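(* There is a polynomial-time constant-factor approximation algorithm for the a priori traveling repairman problem under independent (possibly non-uniform) activation probabilities.
   Context: An instance of the a priori traveling repairman problem (TRP) consists of a finite metric space $(V,d)$ ($d$ symmetric, nonnegative, satisfying the triangle inequality), a root $r\in V$, and activation probabilities $p_v\in[0,1]$ for $v\in V$. A random active set $A\subseteq V$ contains each $v$ independently with probability $p_v$. A solution is a master tour $\tau$: a tour starting at $r$ visiting all vertices of $V$. Given $A$, the tour $\tau_A$ visits the vertices of $A$ starting from $r$ in the order given by $\tau$ (shortcutting over $V\setminus A$). For $v\in A$, the latency $\mathsf{LAT}^A_\tau(v)$ is the length of the path from $r$ to $v$ along $\tau_A$, and $\mathsf{LAT}^A_\tau=\sum_{v\in A}\mathsf{LAT}^A_\tau(v)$. The objective is to find a master tour minimizing the expected latency $\mathbb{E}_A[\mathsf{LAT}^A_\tau]$. A constant-factor approximation algorithm outputs a master tour whose expected latency is at most a fixed constant times the optimum, for every instance. *)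

theory Defs
  imports Complex_Main
begin

text \<open>Instances: vertex set V = {0..<n}, root r < n, rational distances d i j and
rational activation probabilities p i (rational so that instances are finite inputs
to an algorithm).\<close>

definition valid_instance :: "nat \<Rightarrow> nat \<Rightarrow> (nat \<Rightarrow> nat \<Rightarrow> rat) \<Rightarrow> (nat \<Rightarrow> rat) \<Rightarrow> bool" where
  "valid_instance n r d p \<longleftrightarrow>
     r < n \<and>
     (\<forall>i<n. \<forall>j<n. 0 \<le> d i j \<and> d i j = d j i) \<and>
     (\<forall>i<n. d i i = 0) \<and>
     (\<forall>i<n. \<forall>j<n. \<forall>k<n. d i k \<le> d i j + d j k) \<and>
     (\<forall>i<n. 0 \<le> p i \<and> p i \<le> 1)"

definition master_tour :: "nat \<Rightarrow> nat \<Rightarrow> nat list \<Rightarrow> bool" where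
  "master_tour n r \<tau> \<longleftrightarrow> distinct \<tau> \<and> set \<tau> = {..<n} \<and> \<tau> \<noteq> [] \<and> hd \<tau> = r"

definition path_len :: "(nat \<Rightarrow> nat \<Rightarrow> rat) \<Rightarrow> nat list \<Rightarrow> real" where
  "path_len d xs = (\<Sum>i < length xs - 1. real_of_rat (d (xs ! i) (xs ! Suc i)))"

definition shortcut :: "nat list \<Rightarrow> nat set \<Rightarrow> nat list" where
  "shortcut \<tau> A = hd \<tau> # filter (\<lambda>v. v \<in> A) (tl \<tau>)"

text \<open>Total latency LAT^A_tau: sum over active vertices of the length of the path from r
to them along tau_A (the root, if active, has latency 0).\<close>
definition latency :: "(nat \<Rightarrow> nat \<Rightarrow> rat) \<Rightarrow> nat list \<Rightarrow> nat set \<Rightarrow> real" where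
  "latency d \<tau> A = (let L = shortcut \<tau> A in
      (\<Sum>k \<in> {1..<length L}. path_len d (take (Suc k) L)))"

definition exp_latency :: "nat \<Rightarrow> (nat \<Rightarrow> nat \<Rightarrow> rat) \<Rightarrow> (nat \<Rightarrow> rat) \<Rightarrow> nat list \<Rightarrow> real" where
  "exp_latency n d p \<tau> =
     (\<Sum>A \<in> Pow {..<n}.
        (\<Prod>v\<in>A. real_of_rat (p v)) * (\<Prod>v\<in>{..<n} - A. 1 - real_of_rat (p v)) * latency d \<tau> A)"

definition opt_latency :: "nat \<Rightarrow> nat \<Rightarrow> (nat \<Rightarrow> nat \<Rightarrow> rat) \<Rightarrow> (nat \<Rightarrow> rat) \<Rightarrow> real" where
  "opt_latency n r d p = Min (exp_latency n d p ` {\<tau>. master_tour n r \<tau>})"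

section \<open>Encodings (tape symbols: 0 blank, 1 bit 0, 2 bit 1, 3,4,5 separators)\<close>

fun bits :: "nat \<Rightarrow> bool list" where
  "bits 0 = []"
| "bits (Suc n) = odd (Suc n) # bits (Suc n div 2)"

definition nat_enc :: "nat \<Rightarrow> nat list" where
  "nat_enc m = map (\<lambda>b. if b then 2 else 1) (bits m)"

definition rat_enc :: "rat \<Rightarrow> nat list" where
  "rat_enc q = (case quotient_of q of (a, b) \<Rightarrow>
      nat_enc (nat a) @ [3] @ nat_enc (nat b) @ [4])"

definition inst_enc :: "nat \<Rightarrow> nat \<Rightarrow> (nat \<Rightarrow> nat \<Rightarrow> rat) \<Rightarrow> (nat \<Rightarrow> rat) \<Rightarrow> nat list" where
  "inst_enc n r d p =
     nat_enc n @ [5] @ nat_enc r @ [5] @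
     concat (map (\<lambda>i. concat (map (\<lambda>j. rat_enc (d i j)) [0..<n])) [0..<n]) @ [5] @
     concat (map (\<lambda>i. rat_enc (p i)) [0..<n])"

definition tour_enc :: "nat list \<Rightarrow> nat list" where
  "tour_enc \<tau> = concat (map (\<lambda>v. nat_enc v @ [3]) \<tau>)"

text \<open>A machine is (Q, S, delta): states {0..<Q} (0 = start, 1 = halt),
tape alphabet {0..<S} (0 = blank), and a transition table delta q a = (q', a', move)
with move in {-1,0,1}. Only the finite part of delta on states < Q and symbols < S matters.\<close>
type_synonym tm = "nat \<times> nat \<times> (nat \<Rightarrow> nat \<Rightarrow> nat \<times> nat \<times> int)"
type_synonym config = "nat \<times> (int \<Rightarrow> nat) \<times> int"

definition wf_tm :: "tm \<Rightarrow> bool" where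
  "wf_tm M = (case M of (Q, S, \<delta>) \<Rightarrow> 2 \<le> Q \<and> 6 \<le> S \<and>
     (\<forall>q<Q. \<forall>a<S. case \<delta> q a of (q', a', m) \<Rightarrow> q' < Q \<and> a' < S \<and> m \<in> {-1, 0, 1}))"

definition tm_step :: "tm \<Rightarrow> config \<Rightarrow> config" where
  "tm_step M c = (case M of (Q, S, \<delta>) \<Rightarrow> case c of (q, tp, h) \<Rightarrow>
     if q = 1 then c else
       (case \<delta> q (tp h) of (q', a', m) \<Rightarrow> (q', tp(h := a'), h + m)))"

definition init_config :: "nat list \<Rightarrow> config" where
  "init_config w = (0, (\<lambda>i. if 0 \<le> i \<and> nat i < length w then w ! nat i else 0), 0)"

definition tm_run :: "tm \<Rightarrow> nat list \<Rightarrow> nat \<Rightarrow> config" where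
  "tm_run M w t = (tm_step M ^^ t) (init_config w)"

definition computes_within :: "tm \<Rightarrow> nat list \<Rightarrow> nat \<Rightarrow> nat list \<Rightarrow> bool" where
  "computes_within M w T ys \<longleftrightarrow>
     (\<exists>t\<le>T. case tm_run M w t of (q, tp, h) \<Rightarrow>
        q = 1 \<and> (\<forall>i<length ys. tp (int i) = ys ! i) \<and> tp (int (length ys)) = 0)"

end

theory Submission
  imports Defs "HOL-Library.Sublist"
begin

text \<open>Give every vertex the radius \<open>R v\<close> of the smallest ball around it of activation mass at least 1/2,
  the root counting as always active.  An active vertex is isolated at this radius with probability at
  least 1/2, so serving it costs the optimum of the order of \<open>R v\<close>, and one may move the vertices
  greedily to centres whose cells have mass at least 1/2.  For every scale \<open>t = 16^j\<close> the Goemans-Williamson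
  primal-dual algorithm solves the prize-collecting tree problem on the centres, the prize of a cell being
  the sum of \<open>p v * (t - d v c)\<close>.  Its dual moats bound every prefix of the optimal tour from below: a moat
  around cells half of whose mass lies in the prefix is crossed with probability at least 1/5, and the
  prizes of the other cells are paid for by the unserved mass.  Traversing the trees scale by scale gives
  the master tour; its expected latency is a sum over scales which is compared with the area below the
  staircase of (expected length of a prefix, remaining mass) of the optimum.

  For the running time, functions on binary trees that are closed under composition, case distinction and
  iteration of polynomially bounded length and size are implemented by programs on four stacks, which a
  one-tape machine with four tracks simulates.\<close>

section \<open>Stack programs and their simulation on a single tape\<close>

text \<open>The obstacle is non-uniformity: a vertex may be active so rarely that a moat around it
  is hardly ever crossed, and counting vertices says nothing about latency. Cells of mass at least
  1/2 make every moat matter with constant probability. Prizes of slope \<open>t\<close> per unit of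
  mass replace the search for a quota: if \<open>B t\<close> is the value at which the length of a
  prefix of the optimum and \<open>t\<close> times its remaining mass balance, then the tour of
  scale \<open>t\<close> and \<open>t\<close> times the mass that it leaves unserved are both
  O(\<open>B t\<close>). Stage \<open>j\<close> delays only the mass left over by stage
  \<open>j - 1\<close>, so it contributes O(\<open>B t\<close> squared over \<open>t\<close>) with
  \<open>t = 16 ^ (j - 1)\<close>, an area in the corner below the staircase. These areas overlap;
  the ratio 16 repairs this, because whenever \<open>B\<close> does not double from one scale to the
  next, the contribution falls to a quarter. The computation stays in the natural numbers. Halving
  gaps with rounding makes edges tight only up to a factor 2, whence 4 instead of 2 in the
  primal-dual bound.\<close>

type_synonym store = "nat \<Rightarrow> nat list"

definition top :: "nat \<Rightarrow> store \<Rightarrow> nat" where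
  "top i s = (case s i of [] \<Rightarrow> 0 | x # _ \<Rightarrow> x)"

datatype instr = IPush nat nat | IPop nat | ITest nat nat nat nat

fun istep :: "instr list \<Rightarrow> nat \<times> store \<Rightarrow> nat \<times> store" where
  "istep P (pc, s) = (if pc < length P then
     (case P ! pc of
        IPush i a \<Rightarrow> (Suc pc, s(i := a # s i))
      | IPop i \<Rightarrow> (Suc pc, s(i := tl (s i)))
      | ITest i a l1 l2 \<Rightarrow> (if top i s = a then l1 else l2, s))
     else (pc, s))"

definition trk :: "nat \<Rightarrow> nat \<Rightarrow> nat" where
  "trk i x = (x div 6 ^ i) mod 6"

definition upd :: "nat \<Rightarrow> nat \<Rightarrow> nat \<Rightarrow> nat" where
  "upd i a x = x - trk i x * 6 ^ i + a * 6 ^ i"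

lemma less4_cases: "(i::nat) < 4 \<Longrightarrow> i = 0 \<or> i = 1 \<or> i = 2 \<or> i = 3"
  by arith

lemma digit_div_mod: "a < 6 \<Longrightarrow> (a + 6 * k) div 6 = (k::nat)" "a < 6 \<Longrightarrow> (a + 6 * k) mod 6 = (a::nat)"
  by simp_all

lemma trk_simps: "trk 0 x = x mod 6" "trk (Suc i) x = trk i (x div 6)"
  by (simp_all add: trk_def div_mult2_eq)

lemma trk_horner:
  assumes "b0 < 6" "b1 < 6" "b2 < 6" "b3 < 6"
  shows "trk 0 (b0 + 6 * (b1 + 6 * (b2 + 6 * b3))) = b0" "trk 1 (b0 + 6 * (b1 + 6 * (b2 + 6 * b3))) = b1"
    "trk 2 (b0 + 6 * (b1 + 6 * (b2 + 6 * b3))) = b2" "trk 3 (b0 + 6 * (b1 + 6 * (b2 + 6 * b3))) = b3"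
  using assms by (simp_all only: trk_simps digit_div_mod numeral_2_eq_2 numeral_3_eq_3 One_nat_def) simp

lemma trk_upd_decomposed:
  assumes "i < 4" "j < 4" "a < 6" "a0 < 6" "a1 < 6" "a2 < 6" "a3 < (6::nat)"
    and x: "x = a0 + 6 * (a1 + 6 * (a2 + 6 * a3))"
  shows "upd i a x < 1296" "trk j (upd i a x) = (if j = i then a else trk j x)"
proof -
  note t = trk_horner[OF assms(4-7), folded x]
  have u: "upd 0 a x = a + 6 * (a1 + 6 * (a2 + 6 * a3))" "upd 1 a x = a0 + 6 * (a + 6 * (a2 + 6 * a3))"
    "upd 2 a x = a0 + 6 * (a1 + 6 * (a + 6 * a3))" "upd 3 a x = a0 + 6 * (a1 + 6 * (a2 + 6 * a))"
    unfolding upd_def t by (simp_all add: x)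
  show "upd i a x < 1296" using less4_cases[OF assms(1)] assms u by auto
  show "trk j (upd i a x) = (if j = i then a else trk j x)"
    using less4_cases[OF assms(1)] less4_cases[OF assms(2)] t u assms(3-7)
      trk_horner[OF assms(3) assms(5-7)] trk_horner[OF assms(4) assms(3) assms(6,7)]
      trk_horner[OF assms(4,5,3,7)] trk_horner[OF assms(4-6) assms(3)]
    by (elim disjE) simp_all
qed

lemma decompose_symbol:
  assumes "(x::nat) < 1296"
  obtains a0 a1 a2 a3 where "a0 < 6" "a1 < 6" "a2 < 6" "a3 < 6" "x = a0 + 6 * (a1 + 6 * (a2 + 6 * a3))"
proof
  show "x mod 6 < 6" "x div 6 mod 6 < 6" "x div 6 div 6 mod 6 < 6" by auto
  show "x div 6 div 6 div 6 < 6" using assms by (simp add: div_mult2_eq[symmetric])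
  show "x = x mod 6 + 6 * (x div 6 mod 6 + 6 * (x div 6 div 6 mod 6 + 6 * (x div 6 div 6 div 6)))"
    by (simp only: mod_mult_div_eq)
qed

lemma upd_less: "i < 4 \<Longrightarrow> a < 6 \<Longrightarrow> x < 1296 \<Longrightarrow> upd i a x < 1296"
  by (rule decompose_symbol[of x], assumption, rule trk_upd_decomposed(1)[of i 0]) auto

lemma trk_upd: "i < 4 \<Longrightarrow> j < 4 \<Longrightarrow> a < 6 \<Longrightarrow> x < 1296 \<Longrightarrow> trk j (upd i a x) = (if j = i then a else trk j x)"
  by (rule decompose_symbol[of x], assumption, rule trk_upd_decomposed(2)) auto

text \<open>Tape symbols are base-6 numbers with one digit per stack; stack \<open>i\<close> lies with its bottom in
  cell 0 on track \<open>i\<close>.  All cells left of 0 stay blank and stop the return walk to cell 0.\<close>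

definition rep :: "store \<Rightarrow> (int \<Rightarrow> nat) \<Rightarrow> bool" where
  "rep s tp \<longleftrightarrow> (\<forall>h. tp h < 1296 \<and>
     (\<forall>i<4. trk i (tp h) = (if 0 \<le> h \<and> nat h < length (s i) then rev (s i) ! nat h else 0)))"

definition wf_store :: "store \<Rightarrow> bool" where
  "wf_store s \<longleftrightarrow> (\<forall>i<4. \<forall>a\<in>set (s i). 0 < a \<and> a < 6)"

fun wf_instr :: "instr \<Rightarrow> bool" where
  "wf_instr (IPush i a) \<longleftrightarrow> i < 4 \<and> 0 < a \<and> a < 6"
| "wf_instr (IPop i) \<longleftrightarrow> i < 4"
| "wf_instr (ITest i a l1 l2) \<longleftrightarrow> i < 4"

text \<open>States 0 and 1 are the prescribed start and halt states, so the four phases of each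
  instruction are numbered from 2 on.\<close>

definition tm_state :: "instr list \<Rightarrow> nat \<Rightarrow> nat \<Rightarrow> nat" where
  "tm_state P pc ph = (if length P \<le> pc then 1 else 2 + 4 * pc + ph)"

definition tm_return :: "instr list \<Rightarrow> nat \<Rightarrow> nat \<Rightarrow> nat \<Rightarrow> nat \<Rightarrow> nat \<Rightarrow> nat \<times> nat \<times> int" where
  "tm_return P pc ph i l x = (if trk i x \<noteq> 0 then (tm_state P pc ph, x, -1) else (tm_state P l 0, x, 1))"

text \<open>Phase 0 walks right to the first blank of the track, phase 2 acts on the top cell, phases 1 and 3
  walk back to cell 0; the latter two remember the outcome of a test.\<close>

definition tm_trans :: "instr list \<Rightarrow> nat \<Rightarrow> nat \<Rightarrow> nat \<Rightarrow> nat \<times> nat \<times> int" where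
  "tm_trans P pc ph x = (case P ! pc of
     IPush i a \<Rightarrow>
       if ph = 0 then (if trk i x \<noteq> 0 then (tm_state P pc 0, x, 1) else (tm_state P pc 1, upd i a x, 0))
       else tm_return P pc 1 i (Suc pc) x
   | IPop i \<Rightarrow>
       if ph = 0 then (if trk i x \<noteq> 0 then (tm_state P pc 0, x, 1) else (tm_state P pc 2, x, -1))
       else if ph = 2 then (if trk i x = 0 then (tm_state P (Suc pc) 0, x, 1) else (tm_state P pc 1, upd i 0 x, -1))
       else tm_return P pc 1 i (Suc pc) x
   | ITest i a l1 l2 \<Rightarrow>
       if ph = 0 then (if trk i x \<noteq> 0 then (tm_state P pc 0, x, 1) else (tm_state P pc 2, x, -1))
       else if ph = 2 then (if trk i x = a then (tm_state P pc 1, x, 0) else (tm_state P pc 3, x, 0))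
       else if ph = 1 then tm_return P pc 1 i l1 x
       else tm_return P pc 3 i l2 x)"

definition tm_of :: "instr list \<Rightarrow> tm" where
  "tm_of P = (2 + 4 * length P, 1296,
     \<lambda>q x. tm_trans P ((q - 2) div 4) ((q - 2) mod 4) x)"

lemma tm_state_less: "ph < 4 \<Longrightarrow> tm_state P pc ph < Suc (Suc (4 * length P))"
  by (auto simp: tm_state_def)

lemma wf_tm_of:
  assumes "P \<noteq> []" "\<forall>c\<in>set P. wf_instr c"
  shows "wf_tm (tm_of P)"
proof -
  have "case tm_trans P ((q - 2) div 4) ((q - 2) mod 4) x of (q', a', m) \<Rightarrow>
      q' < 2 + 4 * length P \<and> a' < 1296 \<and> m \<in> {-1, 0, 1}" if q: "q < 2 + 4 * length P" "x < 1296" for q x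
  proof -
    have l: "(q - 2) div 4 < length P" using q assms(1) by (cases P) auto
    then have "wf_instr (P ! ((q - 2) div 4))" using assms(2) nth_mem by blast
    then show ?thesis using q(2)
      by (auto simp: tm_trans_def tm_return_def tm_state_less upd_less split: instr.split)
  qed
  then show ?thesis using assms(1) by (auto simp: wf_tm_def tm_of_def)
qed

lemma tm_step_of: 
  assumes "pc < length P" "ph < 4"
  shows "tm_step (tm_of P) (tm_state P pc ph, tp, h) =
     (case tm_trans P pc ph (tp h) of (q', a', m) \<Rightarrow> (q', tp(h := a'), h + m))"
proof -
  have "tm_state P pc ph \<noteq> 1" "(tm_state P pc ph - 2) div 4 = pc" "(tm_state P pc ph - 2) mod 4 = ph"
    using assms by (auto simp: tm_state_def)
  then show ?thesis by (simp add: tm_step_def tm_of_def)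
qed

text \<open>Truncated subtraction makes \<open>0 - 2\<close> equal to 0, so the start state behaves
  like phase 0 of the first instruction.\<close>

lemma tm_step_start: "P \<noteq> [] \<Longrightarrow> tm_step (tm_of P) (0, tp, h) = tm_step (tm_of P) (tm_state P 0 0, tp, h)"
  by (simp add: tm_step_def tm_of_def tm_state_def)

lemma rep_trk:
  "rep s tp \<Longrightarrow> i < 4 \<Longrightarrow> trk i (tp h) = (if 0 \<le> h \<and> nat h < length (s i) then rev (s i) ! nat h else 0)"
  by (auto simp: rep_def)

lemma rep_trk_nonzero:
  assumes "rep s tp" "wf_store s" "i < 4"
  shows "trk i (tp h) \<noteq> 0 \<longleftrightarrow> 0 \<le> h \<and> nat h < length (s i)"
proof -
  have "rev (s i) ! k \<noteq> 0" if "k < length (s i)" for k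
  proof -
    have "rev (s i) ! k \<in> set (s i)" using that by (metis length_rev nth_mem set_rev)
    then show ?thesis using assms by (auto simp: wf_store_def)
  qed
  then show ?thesis using rep_trk[OF assms(1,3)] by auto
qed

fun istack :: "instr \<Rightarrow> nat" where
  "istack (IPush i a) = i" | "istack (IPop i) = i" | "istack (ITest i a l1 l2) = i"

lemma tm_walk_right:
  assumes "rep s tp" "wf_store s" "pc < length P" "istack (P ! pc) < 4" "k \<le> length (s (istack (P ! pc)))"
  shows "(tm_step (tm_of P) ^^ k) (tm_state P pc 0, tp, 0) = (tm_state P pc 0, tp, int k)"
  using assms(5)
proof (induction k)
  case (Suc k)
  have "trk (istack (P ! pc)) (tp (int k)) \<noteq> 0" using rep_trk_nonzero[OF assms(1,2,4)] Suc by auto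
  then have "tm_trans P pc 0 (tp (int k)) = (tm_state P pc 0, tp (int k), 1)"
    by (cases "P ! pc") (auto simp: tm_trans_def)
  then show ?case using Suc by (simp add: tm_step_of[OF assms(3)])
qed simp

text \<open>After \<open>m\<close> steps from cell \<open>m - 1\<close> the head is on cell -1,
  where the blank sends it one step back to cell 0; hence \<open>Suc m\<close> steps. A start on
  cell -1 itself is the case \<open>m = 0\<close>.\<close>

lemma tm_walk_left:
  assumes "rep s tp" "wf_store s" "pc < length P" "ph < 4" "i < 4" "m \<le> length (s i)"
    and tr: "\<And>x. tm_trans P pc ph x = tm_return P pc ph i l x"
  shows "(tm_step (tm_of P) ^^ (Suc m)) (tm_state P pc ph, tp, int m - 1) = (tm_state P l 0, tp, 0)"
  using assms(6)
proof (induction m)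
  case 0
  have "trk i (tp (-1)) = 0" using rep_trk[OF assms(1,5), of "-1"] by simp
  then show ?case by (simp add: tm_step_of[OF assms(3,4)] tr tm_return_def)
next
  case (Suc m)
  have "trk i (tp (int m)) \<noteq> 0" using rep_trk_nonzero[OF assms(1,2,5)] Suc by auto
  then have "tm_step (tm_of P) (tm_state P pc ph, tp, int (Suc m) - 1) = (tm_state P pc ph, tp, int m - 1)"
    by (simp add: tm_step_of[OF assms(3,4)] tr tm_return_def)
  then have "(tm_step (tm_of P) ^^ (Suc (Suc m))) (tm_state P pc ph, tp, int (Suc m) - 1) =
    (tm_step (tm_of P) ^^ (Suc m)) (tm_state P pc ph, tp, int m - 1)" by (simp only: funpow_Suc_right o_apply)
  then show ?case using Suc by simp
qed

lemma rep_push: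
  assumes "rep s tp" "i < 4" "a < 6"
  shows "rep (s(i := a # s i)) (tp(int (length (s i)) := upd i a (tp (int (length (s i))))))"
  using assms unfolding rep_def by (auto simp: upd_less trk_upd nth_append)

lemma rep_pop:
  assumes "rep s tp" "i < 4" "s i = a # xs"
  shows "rep (s(i := xs)) (tp(int (length xs) := upd i 0 (tp (int (length xs)))))"
  using assms unfolding rep_def by (auto simp: upd_less trk_upd nth_append)

lemma funpow_add_apply: "(f ^^ a) x = y \<Longrightarrow> (f ^^ b) y = z \<Longrightarrow> (f ^^ (b + a)) x = z"
  by (simp add: funpow_add)

lemma wf_store_istep: "wf_store s \<Longrightarrow> \<forall>c\<in>set P. wf_instr c \<Longrightarrow> istep P (pc, s) = (pc', s') \<Longrightarrow> wf_store s'"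
proof -
  assume a: "wf_store s" "\<forall>c\<in>set P. wf_instr c" "istep P (pc, s) = (pc', s')"
  show ?thesis
  proof (cases "pc < length P")
    case True
    then have "wf_instr (P ! pc)" using a(2) by simp
    moreover have "a \<in> set (tl xs) \<Longrightarrow> a \<in> set xs" for a :: nat and xs by (cases xs) auto
    ultimately show ?thesis using a(1,3) True
      by (auto simp: wf_store_def split: instr.splits if_splits)
  qed (use a in auto)
qed

text \<open>Every instruction starts and ends with the head on cell 0, so its cost is one trip to
  the top of its stack and back plus a constant number of moves.\<close>

lemma tm_simulates_istep:
  assumes "rep s tp" "wf_store s" "pc < length P" "wf_instr (P ! pc)" and ist: "istep P (pc, s) = (pc', s')"
  shows "\<exists>t tp'. 1 \<le> t \<and> t \<le> 2 * length (s (istack (P ! pc))) + 5 \<and> rep s' tp' \<and>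
           (tm_step (tm_of P) ^^ t) (tm_state P pc 0, tp, 0) = (tm_state P pc' 0, tp', 0)"
proof -
  let ?i = "istack (P ! pc)"
  let ?h = "length (s ?i)"
  let ?S = "tm_step (tm_of P)"
  have i4: "?i < 4" using assms(4) by (cases "P ! pc") auto
  have w: "(?S ^^ ?h) (tm_state P pc 0, tp, 0) = (tm_state P pc 0, tp, int ?h)"
    by (rule tm_walk_right) (use assms i4 in auto)
  have blank: "trk ?i (tp (int ?h)) = 0" using rep_trk[OF assms(1) i4] by simp
  show ?thesis
  proof (cases "P ! pc")
    case (IPush i a)
    then have ii: "?i = i" "i < 4" "0 < a" "a < 6" using assms(4) by auto
    let ?tp = "tp(int ?h := upd i a (tp (int ?h)))"
    have s': "pc' = Suc pc" "s' = s(i := a # s i)" using ist assms(3) IPush by auto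
    have r: "rep s' ?tp" using rep_push[OF assms(1) ii(2,4)] ii s' by simp
    have wf: "wf_store s'" using assms(2) ii unfolding s' wf_store_def by auto
    have 1: "(?S ^^ 1) (tm_state P pc 0, tp, int ?h) = (tm_state P pc 1, ?tp, int (Suc ?h) - 1)"
      using blank by (simp add: tm_step_of[OF assms(3)] tm_trans_def IPush)
    have 2: "(?S ^^ (Suc (Suc ?h))) (tm_state P pc 1, ?tp, int (Suc ?h) - 1) = (tm_state P pc' 0, ?tp, 0)"
      by (rule tm_walk_left[OF r wf assms(3)]) (use ii s' in \<open>auto simp: tm_trans_def IPush\<close>)
    show ?thesis
      by (rule exI[of _ "Suc (Suc ?h) + (1 + ?h)"], rule exI[of _ ?tp])
        (use funpow_add_apply[OF funpow_add_apply[OF w 1] 2] r in auto)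
  next
    case (IPop i)
    then have ii: "?i = i" "i < 4" using assms(4) by auto
    have s': "pc' = Suc pc" "s' = s(i := tl (s i))" using ist assms(3) IPop by auto
    have 1: "(?S ^^ 1) (tm_state P pc 0, tp, int ?h) = (tm_state P pc 2, tp, int ?h - 1)"
      using blank by (simp add: tm_step_of[OF assms(3)] tm_trans_def IPop)
    show ?thesis
    proof (cases "s i")
      \<comment> \<open>Popping an empty stack: phase 2 finds the blank of cell -1 and proceeds
        without writing.\<close>
      case Nil
      then have "trk i (tp (-1)) = 0" using rep_trk[OF assms(1) ii(2)] by simp
      then have 2: "(?S ^^ 1) (tm_state P pc 2, tp, int ?h - 1) = (tm_state P pc' 0, tp, 0)"
        using Nil ii s' by (simp add: tm_step_of[OF assms(3)] tm_trans_def IPop)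
      have "s' = s" using Nil s' by auto
      then show ?thesis
        by (intro exI[of _ "1 + (1 + ?h)"] exI[of _ tp])
          (use funpow_add_apply[OF funpow_add_apply[OF w 1] 2] assms(1) in auto)
    next
      case (Cons a xs)
      let ?tp = "tp(int (length xs) := upd i 0 (tp (int (length xs))))"
      have r: "rep s' ?tp" using rep_pop[OF assms(1) ii(2) Cons] s' Cons by simp
      have wf: "wf_store s'" using assms(2) Cons ii unfolding s' wf_store_def by auto
      have "trk i (tp (int (length xs))) \<noteq> 0" using rep_trk_nonzero[OF assms(1,2) ii(2)] Cons by simp
      then have 2: "(?S ^^ 1) (tm_state P pc 2, tp, int ?h - 1) = (tm_state P pc 1, ?tp, int (length xs) - 1)"
        using Cons ii by (simp add: tm_step_of[OF assms(3)] tm_trans_def IPop)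
      have 3: "(?S ^^ (Suc (length xs))) (tm_state P pc 1, ?tp, int (length xs) - 1) = (tm_state P pc' 0, ?tp, 0)"
        by (rule tm_walk_left[OF r wf assms(3)]) (use ii s' Cons in \<open>auto simp: tm_trans_def IPop\<close>)
      show ?thesis
        by (intro exI[of _ "Suc (length xs) + (1 + (1 + ?h))"] exI[of _ ?tp])
          (use funpow_add_apply[OF funpow_add_apply[OF funpow_add_apply[OF w 1] 2] 3] r Cons ii in auto)
    qed
  next
    case (ITest i a l1 l2)
    then have ii: "?i = i" "i < 4" using assms(4) by auto
    have s': "pc' = (if top i s = a then l1 else l2)" "s' = s" using ist assms(3) ITest by auto
    have 1: "(?S ^^ 1) (tm_state P pc 0, tp, int ?h) = (tm_state P pc 2, tp, int ?h - 1)"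
      using blank by (simp add: tm_step_of[OF assms(3)] tm_trans_def ITest)
    let ?ph = "if top i s = a then 1 else 3 :: nat"
    have "trk i (tp (int ?h - 1)) = top i s"
      using rep_trk[OF assms(1) ii(2), of "int ?h - 1"] ii by (auto simp: top_def nth_append split: list.split)
    then have 2: "(?S ^^ 1) (tm_state P pc 2, tp, int ?h - 1) = (tm_state P pc ?ph, tp, int ?h - 1)"
      by (simp add: tm_step_of[OF assms(3)] tm_trans_def ITest)
    have 3: "(?S ^^ (Suc ?h)) (tm_state P pc ?ph, tp, int ?h - 1) = (tm_state P pc' 0, tp, 0)"
      by (rule tm_walk_left[OF assms(1,2,3)]) (use ii s' in \<open>auto simp: tm_trans_def ITest\<close>)
    show ?thesis
      by (intro exI[of _ "Suc ?h + (1 + (1 + ?h))"] exI[of _ tp])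
        (use funpow_add_apply[OF funpow_add_apply[OF funpow_add_apply[OF w 1] 2] 3] assms(1) s' in auto)
  qed
qed

definition height :: "store \<Rightarrow> nat" where "height s = (\<Sum>i<4. length (s i))"

lemma height_istep:
  assumes "istep P (pc, s) = (pc', s')" "\<forall>c\<in>set P. wf_instr c"
  shows "height s' \<le> Suc (height s)"
proof -
  have *: "length (s' i) \<le> length (s i) + (if i = istack (P ! pc) then 1 else 0)" for i
    using assms by (auto split: if_splits instr.splits)
  have "height s' \<le> (\<Sum>i<4. length (s i) + (if i = istack (P ! pc) then 1 else 0))"
    unfolding height_def by (rule sum_mono) (use * in auto)
  also have "\<dots> \<le> Suc (height s)" by (simp add: height_def sum.distrib sum.delta)
  finally show ?thesis .
qed

lemma height_member: "i < 4 \<Longrightarrow> length (s i) \<le> height s"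
  unfolding height_def by (rule member_le_sum[where f = "\<lambda>i. length (s i)"]) auto

text \<open>Each instruction raises the total height by at most one, so \<open>height s + k\<close>
  bounds every trip during \<open>k\<close> steps and the overhead stays quadratic. A halted program
  is a fixed point and needs no step of the machine.\<close>

lemma tm_simulates_steps:
  assumes "rep s tp" "wf_store s" "\<forall>c\<in>set P. wf_instr c" "(istep P ^^ k) (pc, s) = (pc', s')"
  shows "\<exists>t tp'. t \<le> k * (2 * (height s + k) + 5) \<and> rep s' tp' \<and>
           (tm_step (tm_of P) ^^ t) (tm_state P pc 0, tp, 0) = (tm_state P pc' 0, tp', 0)"
  using assms(1,2,4)
proof (induction k arbitrary: s pc tp)
  case 0
  then show ?case by (intro exI[of _ 0] exI[of _ tp]) auto
next
  case (Suc k)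
  show ?case
  proof (cases "pc < length P")
    case False
    then have "(istep P ^^ j) (pc, s) = (pc, s)" for j by (induction j) auto
    then have "(pc', s') = (pc, s)" using Suc.prems(3) by metis
    then show ?thesis using Suc.prems by (intro exI[of _ 0] exI[of _ tp]) auto
  next
    case True
    obtain pc1 s1 where i: "istep P (pc, s) = (pc1, s1)" by (metis surj_pair)
    have wi: "wf_instr (P ! pc)" using True assms(3) by simp
    obtain t tp1 where t: "t \<le> 2 * length (s (istack (P ! pc))) + 5" "rep s1 tp1"
      "(tm_step (tm_of P) ^^ t) (tm_state P pc 0, tp, 0) = (tm_state P pc1 0, tp1, 0)"
      using tm_simulates_istep[OF Suc.prems(1,2) True wi i] by blast
    have "istack (P ! pc) < 4" using wi by (cases "P ! pc") auto
    then have tb: "t \<le> 2 * height s + 5" using t(1) height_member[of _ s] by (meson add_le_mono1 dual_order.trans mult_le_mono2)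
    have k: "(istep P ^^ k) (pc1, s1) = (pc', s')" using Suc.prems(3) i by (simp only: funpow_Suc_right o_apply)
    obtain t' tp' where t': "t' \<le> k * (2 * (height s1 + k) + 5)" "rep s' tp'"
      "(tm_step (tm_of P) ^^ t') (tm_state P pc1 0, tp1, 0) = (tm_state P pc' 0, tp', 0)"
      using Suc.IH[OF t(2) wf_store_istep[OF Suc.prems(2) assms(3) i] k] by blast
    have "height s1 + k \<le> height s + Suc k" using height_istep[OF i assms(3)] by simp
    then have "k * (2 * (height s1 + k) + 5) \<le> k * (2 * (height s + Suc k) + 5)"
      by (intro mult_le_mono2 add_le_mono1) simp
    moreover have "t \<le> 2 * (height s + Suc k) + 5" using tb by simp
    ultimately have "t' + t \<le> Suc k * (2 * (height s + Suc k) + 5)" using t'(1) unfolding mult_Suc by linarith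
    then show ?thesis using funpow_add_apply[OF t(3) t'(3)] t'(2) by blast
  qed
qed

section \<open>A structured language and its compilation to stack programs\<close>

datatype com = Push nat nat | Pop nat | Seq com com (infixr ";;" 60)
  | If nat nat com com | While nat nat com

text \<open>\<open>While i a c\<close> iterates \<open>c\<close> as long as the top of stack \<open>i\<close> differs from \<open>a\<close>; the top of an
  empty stack is 0.\<close>

inductive exec :: "com \<Rightarrow> store \<Rightarrow> nat \<Rightarrow> store \<Rightarrow> bool" where
  Push: "exec (Push i a) s 1 (s(i := a # s i))"
| Pop: "exec (Pop i) s 1 (s(i := tl (s i)))"
| Seq: "exec c1 s t1 s1 \<Longrightarrow> exec c2 s1 t2 s2 \<Longrightarrow> exec (c1 ;; c2) s (t1 + t2) s2"
| IfT: "top i s = a \<Longrightarrow> exec c1 s t s' \<Longrightarrow> exec (If i a c1 c2) s (t + 2) s'"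
| IfF: "top i s \<noteq> a \<Longrightarrow> exec c2 s t s' \<Longrightarrow> exec (If i a c1 c2) s (t + 2) s'"
| WhileF: "top i s = a \<Longrightarrow> exec (While i a c) s 1 s"
| WhileT: "top i s \<noteq> a \<Longrightarrow> exec c s t s1 \<Longrightarrow> exec (While i a c) s1 t' s2 \<Longrightarrow> exec (While i a c) s (t + t' + 2) s2"

fun clen :: "com \<Rightarrow> nat" where
  "clen (Push i a) = 1" | "clen (Pop i) = 1" | "clen (c1 ;; c2) = clen c1 + clen c2"
| "clen (If i a c1 c2) = clen c1 + clen c2 + 2" | "clen (While i a c) = clen c + 2"

text \<open>Jumps are absolute, so the code depends on its address \<open>p\<close>. A test
  \<open>ITest 0 0 l l\<close> with equal targets is an unconditional jump.\<close>

fun comp :: "nat \<Rightarrow> com \<Rightarrow> instr list" where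
  "comp p (Push i a) = [IPush i a]"
| "comp p (Pop i) = [IPop i]"
| "comp p (c1 ;; c2) = comp p c1 @ comp (p + clen c1) c2"
| "comp p (If i a c1 c2) = ITest i a (p + 1) (p + clen c1 + 2) # comp (p + 1) c1 @
     [ITest 0 0 (p + clen c1 + clen c2 + 2) (p + clen c1 + clen c2 + 2)] @ comp (p + clen c1 + 2) c2"
| "comp p (While i a c) = ITest i a (p + clen c + 2) (p + 1) # comp (p + 1) c @ [ITest 0 0 p p]"

fun wf_com :: "com \<Rightarrow> bool" where
  "wf_com (Push i a) \<longleftrightarrow> i < 4 \<and> 0 < a \<and> a < 6"
| "wf_com (Pop i) \<longleftrightarrow> i < 4"
| "wf_com (c1 ;; c2) \<longleftrightarrow> wf_com c1 \<and> wf_com c2"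
| "wf_com (If i a c1 c2) \<longleftrightarrow> i < 4 \<and> wf_com c1 \<and> wf_com c2"
| "wf_com (While i a c) \<longleftrightarrow> i < 4 \<and> wf_com c"

lemma length_comp [simp]: "length (comp p c) = clen c"
  by (induction c arbitrary: p) auto

lemma wf_comp: "wf_com c \<Longrightarrow> x \<in> set (comp p c) \<Longrightarrow> wf_instr x"
  by (induction c arbitrary: p) auto

text \<open>The surrounding code is arbitrary, so that each subcommand can be regarded as sitting at
  its own address inside the same \<open>P\<close>. The costs in \<open>exec\<close> already count
  tests and jumps, whence \<open>k\<close> is at most \<open>t\<close>.\<close>

lemma comp_correct:
  assumes "exec c s t s'" "P = pre @ comp (length pre) c @ post"
  shows "\<exists>k\<le>t. (istep P ^^ k) (length pre, s) = (length pre + clen c, s')"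
  using assms
proof (induction arbitrary: pre post)
  case (Push i a s)
  then show ?case by (intro exI[of _ 1]) (auto simp: nth_append)
next
  case (Pop i s)
  then show ?case by (intro exI[of _ 1]) (auto simp: nth_append)
next
  case (Seq c1 s t1 s1 c2 t2 s2)
  obtain k1 where k1: "k1 \<le> t1" "(istep P ^^ k1) (length pre, s) = (length pre + clen c1, s1)"
    using Seq.IH(1)[of pre] Seq.prems by fastforce
  obtain k2 where k2: "k2 \<le> t2" "(istep P ^^ k2) (length pre + clen c1, s1) = (length pre + clen c1 + clen c2, s2)"
    using Seq.IH(2)[of "pre @ comp (length pre) c1"] Seq.prems by fastforce
  show ?case using funpow_add_apply[OF k1(2) k2(2)] k1 k2 by (intro exI[of _ "k2 + k1"]) (auto simp: add.assoc)
next
  case (IfT i s a c1 t s' c2)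
  obtain k where k: "k \<le> t" "(istep P ^^ k) (length pre + 1, s) = (length pre + 1 + clen c1, s')"
    using IfT.IH[of "pre @ [ITest i a (length pre + 1) (length pre + clen c1 + 2)]"] IfT.prems by fastforce
  have 1: "(istep P ^^ 1) (length pre, s) = (length pre + 1, s)" using IfT by (simp add: nth_append)
  have 2: "(istep P ^^ 1) (length pre + 1 + clen c1, s') = (length pre + clen (If i a c1 c2), s')"
    using IfT by (simp add: nth_append)
  show ?case using funpow_add_apply[OF funpow_add_apply[OF 1 k(2)] 2] k(1) by (intro exI[of _ "1 + (k + 1)"]) auto
next
  case (IfF i s a c2 t s' c1)
  obtain k where k: "k \<le> t" "(istep P ^^ k) (length pre + clen c1 + 2, s) = (length pre + clen c1 + 2 + clen c2, s')"
    using IfF.IH[of "pre @ ITest i a (length pre + 1) (length pre + clen c1 + 2) # comp (length pre + 1) c1 @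
     [ITest 0 0 (length pre + clen c1 + clen c2 + 2) (length pre + clen c1 + clen c2 + 2)]"] IfF.prems by fastforce
  have 1: "(istep P ^^ 1) (length pre, s) = (length pre + clen c1 + 2, s)" using IfF by (simp add: nth_append)
  show ?case using funpow_add_apply[OF 1 k(2)] k(1) by (intro exI[of _ "k + 1"]) (auto simp: algebra_simps)
next
  case (WhileF i s a c)
  then show ?case by (intro exI[of _ 1]) (auto simp: nth_append)
next
  case (WhileT i s a c t s1 t' s2)
  have 1: "(istep P ^^ 1) (length pre, s) = (length pre + 1, s)" using WhileT by (simp add: nth_append)
  obtain k where k: "k \<le> t" "(istep P ^^ k) (length pre + 1, s) = (length pre + 1 + clen c, s1)"
    using WhileT.IH(1)[of "pre @ [ITest i a (length pre + clen c + 2) (length pre + 1)]"] WhileT.prems by fastforce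
  have 2: "(istep P ^^ 1) (length pre + 1 + clen c, s1) = (length pre, s1)" using WhileT by (simp add: nth_append)
  obtain k' where k': "k' \<le> t'" "(istep P ^^ k') (length pre, s1) = (length pre + clen (While i a c), s2)"
    using WhileT.IH(2)[of pre] WhileT.prems by blast
  show ?case using funpow_add_apply[OF funpow_add_apply[OF funpow_add_apply[OF 1 k(2)] 2] k'(2)] k(1) k'(1)
    by (intro exI[of _ "k' + (1 + (k + 1))"]) auto
qed

section \<open>From commands to computations of the machine\<close>

definition stk :: "nat list \<Rightarrow> nat list \<Rightarrow> nat list \<Rightarrow> nat list \<Rightarrow> store" where
  "stk a m b e = (\<lambda>i. if i = 0 then a else if i = 1 then m else if i = 2 then b else if i = 3 then e else [])"

lemma trk_raw: "a < 6 \<Longrightarrow> i < 4 \<Longrightarrow> trk i a = (if i = 0 then a else 0)"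
  by (auto simp: trk_def dest!: less4_cases)

lemma trk_eq_raw:
  assumes "x < 1296" "\<forall>i<4. trk i x = (if i = 0 then a else 0)" shows "x = a"
proof -
  obtain a0 a1 a2 a3 where x: "a0 < 6" "a1 < 6" "a2 < 6" "a3 < 6" "x = a0 + 6 * (a1 + 6 * (a2 + 6 * a3))"
    using decompose_symbol[OF assms(1)] .
  show ?thesis using trk_horner[OF x(1-4)] assms(2) x(5) by force
qed

text \<open>A tape with symbols below 6 already represents a store whose only nonempty stack is 0,
  because the other three digits vanish. Cell 0 holds the bottom of that stack, so input and output
  lie on it in reverse order and neither needs a conversion.\<close>

theorem exec_computes_within:
  assumes c: "wf_com c" and w: "\<forall>a\<in>set w. 0 < a \<and> a < 6"
    and ex: "exec c (stk (rev w) [] [] []) t (stk (rev ys) [] [] [])"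
  shows "wf_tm (tm_of (comp 0 c))" "computes_within (tm_of (comp 0 c)) w (t * (2 * (length w + t) + 5)) ys"
proof -
  let ?P = "comp 0 c"
  have cl: "clen c > 0" using c by (induction c) auto
  then have ne: "?P \<noteq> []" by (metis length_comp length_greater_0_conv)
  have wf: "\<forall>x\<in>set ?P. wf_instr x" using wf_comp[OF c] by blast
  show "wf_tm (tm_of ?P)" by (rule wf_tm_of[OF ne wf])
  define tp0 where "tp0 = (\<lambda>i::int. if 0 \<le> i \<and> nat i < length w then w ! nat i else 0)"
  have r: "rep (stk (rev w) [] [] []) tp0"
    unfolding rep_def
  proof (intro allI conjI impI)
    fix h
    have "tp0 h < 6" using w nth_mem by (auto simp: tp0_def)
    then show "tp0 h < 1296" by simp
    fix i :: nat assume "i < 4"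
    then show "trk i (tp0 h) = (if 0 \<le> h \<and> nat h < length (stk (rev w) [] [] [] i) then rev (stk (rev w) [] [] [] i) ! nat h else 0)"
      using trk_raw[OF \<open>tp0 h < 6\<close>] by (auto simp: tp0_def stk_def)
  qed
  have ws: "wf_store (stk (rev w) [] [] [])" using w by (auto simp: wf_store_def stk_def)
  obtain k where k: "k \<le> t" "(istep ?P ^^ k) (0, stk (rev w) [] [] []) = (clen c, stk (rev ys) [] [] [])"
    using comp_correct[OF ex, of ?P "[]" "[]"] by auto
  have h: "height (stk (rev w) [] [] []) = length w" by (simp add: height_def stk_def eval_nat_numeral)
  obtain t' tp' where t': "t' \<le> k * (2 * (length w + k) + 5)" "rep (stk (rev ys) [] [] []) tp'"
    "(tm_step (tm_of ?P) ^^ t') (tm_state ?P 0 0, tp0, 0) = (tm_state ?P (clen c) 0, tp', 0)"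
    using tm_simulates_steps[OF r ws wf k(2)] h by auto
  \<comment> \<open>The machine starts in state 0 instead of \<open>tm_state ?P 0 0\<close>; the two
    runs agree from the first step on, so there must be a first step.\<close>
  have "t' \<noteq> 0" using t'(3) cl by (cases t') (auto simp: tm_state_def)
  then obtain m where m: "t' = Suc m" by (cases t') auto
  have "tm_run (tm_of ?P) w t' = (tm_state ?P (clen c) 0, tp', 0)"
    unfolding tm_run_def init_config_def tp0_def[symmetric]
    using t'(3) tm_step_start[OF ne] by (simp add: m funpow_swap1)
  moreover have "tm_state ?P (clen c) 0 = 1" by (simp add: tm_state_def)
  moreover have y: "tp' (int i) = (if i < length ys then ys ! i else 0)" for i
    by (rule trk_eq_raw) (use t'(2) in \<open>auto simp: rep_def stk_def\<close>)
  moreover have "k * (2 * (length w + k) + 5) \<le> t * (2 * (length w + t) + 5)" using k(1) by (intro mult_le_mono) auto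
  ultimately show "computes_within (tm_of ?P) w (t * (2 * (length w + t) + 5)) ys"
    unfolding computes_within_def using t'(1) by (intro exI[of _ t']) auto
qed

declare One_nat_def [simp del] add_2_eq_Suc [simp del] add_2_eq_Suc' [simp del]

section \<open>Polynomially bounded functions of a size\<close>

text \<open>The base \<open>n + 2\<close> is at least 2, so the exponent alone absorbs constants:
  \<open>c\<close> is at most \<open>2 ^ c\<close>, and a sum costs one more power.\<close>

definition pb :: "(nat \<Rightarrow> nat) \<Rightarrow> bool" where
  "pb T \<longleftrightarrow> (\<exists>k. \<forall>n. T n \<le> (n + 2) ^ k)"

lemma pb_id: "pb (\<lambda>n. n)" unfolding pb_def by (rule exI[of _ 1]) simp

lemma pb_const: "pb (\<lambda>n. c)"
proof -
  have "c \<le> (n + 2) ^ c" for n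
  proof -
    have "c \<le> 2 ^ c" by (simp add: less_imp_le)
    also have "\<dots> \<le> (n + 2) ^ c" by (rule power_mono) auto
    finally show ?thesis .
  qed
  then show ?thesis unfolding pb_def by blast
qed

lemma pb_mult: assumes "pb S" "pb T" shows "pb (\<lambda>n. S n * T n)"
proof -
  obtain a b where "\<And>n. S n \<le> (n + 2) ^ a" "\<And>n. T n \<le> (n + 2) ^ b" using assms unfolding pb_def by blast
  then have "S n * T n \<le> (n + 2) ^ (a + b)" for n by (simp add: power_add mult_le_mono)
  then show ?thesis unfolding pb_def by blast
qed

lemma pb_add: assumes "pb S" "pb T" shows "pb (\<lambda>n. S n + T n)"
proof -
  obtain a b where ab: "\<And>n. S n \<le> (n + 2) ^ a" "\<And>n. T n \<le> (n + 2) ^ b" using assms unfolding pb_def by blast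
  have "S n + T n \<le> (n + 2) ^ Suc (a + b)" for n
  proof -
    have "(n + 2) ^ a \<le> (n + 2) ^ (a + b)" "(n + 2) ^ b \<le> (n + 2) ^ (a + b)" by (rule power_increasing; simp)+
    then have "S n + T n \<le> 2 * (n + 2) ^ (a + b)" using ab[of n] by linarith
    also have "\<dots> \<le> (n + 2) * (n + 2) ^ (a + b)" by (rule mult_le_mono1) simp
    finally show ?thesis by simp
  qed
  then show ?thesis unfolding pb_def by blast
qed

lemma pb_power: "pb S \<Longrightarrow> pb (\<lambda>n. S n ^ k)"
  by (induction k) (simp_all add: pb_const pb_mult)

lemmas pb_intros = pb_id pb_const pb_mult pb_add pb_power

section \<open>Binary trees on a stack\<close>

datatype tree = L | N tree tree

text \<open>Preorder makes the code self-delimiting: the topmost tree of a stack can be split off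
  without an end marker, and its first symbol tells a leaf from a node.\<close>

fun code :: "tree \<Rightarrow> nat list" where
  "code L = [1]" | "code (N a b) = 2 # code a @ code b"

definition tsize :: "tree \<Rightarrow> nat" where "tsize x = length (code x)"

lemma tsize_simps [simp]: "tsize L = 1" "tsize (N a b) = 1 + tsize a + tsize b"
  by (simp_all add: tsize_def)

lemma tsize_pos: "tsize x > 0" by (cases x) auto

lemma code_symbols: "set (code x) \<subseteq> {1, 2}" by (induction x) auto

definition runs :: "com \<Rightarrow> store \<Rightarrow> nat \<Rightarrow> store \<Rightarrow> bool" where
  "runs c s T s' \<longleftrightarrow> (\<exists>t\<le>T. exec c s t s')"

lemma runs_mono: "runs c s T s' \<Longrightarrow> T \<le> T' \<Longrightarrow> runs c s T' s'"
  unfolding runs_def using order_trans by blast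

lemma runs_Push: "runs (Push i a) s 1 (s(i := a # s i))" unfolding runs_def using exec.Push by blast
lemma runs_Pop: "runs (Pop i) s 1 (s(i := tl (s i)))" unfolding runs_def using exec.Pop by blast
lemma runs_Seq: "runs c1 s T1 s1 \<Longrightarrow> runs c2 s1 T2 s2 \<Longrightarrow> runs (c1 ;; c2) s (T1 + T2) s2"
  unfolding runs_def using exec.Seq add_mono by blast
lemma runs_IfT: "top i s = a \<Longrightarrow> runs c1 s T s' \<Longrightarrow> runs (If i a c1 c2) s (T + 2) s'"
  unfolding runs_def using exec.IfT by (meson add_mono order_refl)
lemma runs_IfF: "top i s \<noteq> a \<Longrightarrow> runs c2 s T s' \<Longrightarrow> runs (If i a c1 c2) s (T + 2) s'"
  unfolding runs_def using exec.IfF by (meson add_mono order_refl)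
lemma runs_WhileF: "top i s = a \<Longrightarrow> runs (While i a c) s 1 s" unfolding runs_def using exec.WhileF by blast
lemma runs_WhileT: "top i s \<noteq> a \<Longrightarrow> runs c s T s1 \<Longrightarrow> runs (While i a c) s1 T' s2 \<Longrightarrow> runs (While i a c) s (T + T' + 2) s2"
  unfolding runs_def using exec.WhileT by (meson add_mono order_refl)

lemma runs_IfT': "top i s = a \<Longrightarrow> runs c1 s T s' \<Longrightarrow> T + 2 \<le> T' \<Longrightarrow> runs (If i a c1 c2) s T' s'"
  using runs_IfT runs_mono by blast
lemma runs_IfF': "top i s \<noteq> a \<Longrightarrow> runs c2 s T s' \<Longrightarrow> T + 2 \<le> T' \<Longrightarrow> runs (If i a c1 c2) s T' s'"
  using runs_IfF runs_mono by blast

lemma runs_Pop_Push: "i \<noteq> j \<Longrightarrow> s i = x # xs \<Longrightarrow> runs (Pop i ;; Push j a) s 2 (s(i := xs, j := a # s j))"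
  using runs_Seq[OF runs_Pop[of i s] runs_Push[of j a "s(i := tl (s i))"]] by (simp add: numeral_2_eq_2)

definition move1 :: "nat \<Rightarrow> nat \<Rightarrow> com" where
  "move1 i j = If i 2 (Pop i ;; Push j 2) (Pop i ;; Push j 1)"

definition pour :: "nat \<Rightarrow> nat \<Rightarrow> com" where
  "pour i j = While i 0 (move1 i j)"

lemma runs_move1:
  assumes "i \<noteq> j" "s i = x # xs" "x \<in> {1, 2}"
  shows "runs (move1 i j) s 4 (s(i := xs, j := x # s j))"
proof (cases "x = 2")
  case True
  then show ?thesis unfolding move1_def
    using runs_IfT[OF _ runs_Pop_Push[of i j s x xs 2], of i 2] assms by (simp add: top_def)
next
  case False
  then show ?thesis unfolding move1_def
    using runs_IfF[OF _ runs_Pop_Push[of i j s x xs 1], of i 2] assms by (simp add: top_def)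
qed

lemma runs_pour:
  assumes "i \<noteq> j" "set (s i) \<subseteq> {1, 2}"
  shows "runs (pour i j) s (6 * length (s i) + 1) (s(i := [], j := rev (s i) @ s j))"
  using assms(2)
proof (induction "s i" arbitrary: s)
  case Nil
  then have e: "s(i := [], j := rev (s i) @ s j) = s" using assms(1) by (auto simp: fun_eq_iff)
  have "runs (While i 0 (move1 i j)) s (6 * length (s i) + 1) s"
    using runs_WhileF[of i s 0] Nil(1)[symmetric] by (simp add: top_def)
  then show ?case unfolding pour_def e .
next
  case (Cons x xs)
  let ?s = "s(i := xs, j := x # s j)"
  have x: "x \<in> {1, 2}" "set xs \<subseteq> {1, 2}" using Cons.prems unfolding Cons.hyps(2)[symmetric] by auto
  have 1: "runs (move1 i j) s 4 ?s" by (rule runs_move1) (use Cons x assms in auto)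
  have 2: "runs (pour i j) ?s (6 * length xs + 1) (?s(i := [], j := rev xs @ x # s j))"
    using Cons.hyps(1)[of ?s] x assms(1) by (auto simp: fun_upd_twist)
  have t: "top i s \<noteq> 0" using x Cons.hyps(2)[symmetric] by (auto simp: top_def)
  have "?s(i := [], j := rev xs @ x # s j) = s(i := [], j := rev (s i) @ s j)"
    using Cons assms(1) by (auto simp: fun_eq_iff simp flip: Cons.hyps(2))
  moreover have "6 * length (s i) + 1 = 4 + (6 * length xs + 1) + 2" using Cons.hyps(2)[symmetric] by simp
  ultimately show ?case using runs_WhileT[OF t 1 2[unfolded pour_def]] unfolding pour_def by metis
qed

definition move_tree :: "nat \<Rightarrow> com" where
  "move_tree j = Push 3 1 ;; While 3 0 (If 1 2 (Pop 1 ;; Push j 2 ;; Push 3 1) (Pop 1 ;; Push j 1 ;; Pop 3))"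

text \<open>Stack 3 counts in unary the subtrees that are still to be moved.\<close>

lemma runs_move_loop:
  assumes "j = 0 \<or> j = 2" "s 1 = code t @ rest" "s 3 = 1 # cs"
    and "runs (While 3 0 (If 1 2 (Pop 1 ;; Push j 2 ;; Push 3 1) (Pop 1 ;; Push j 1 ;; Pop 3)))
      (s(1 := rest, 3 := cs, j := rev (code t) @ s j)) T s'"
  shows "runs (While 3 0 (If 1 2 (Pop 1 ;; Push j 2 ;; Push 3 1) (Pop 1 ;; Push j 1 ;; Pop 3))) s (T + 7 * tsize t) s'"
  using assms(2-4)
proof (induction t arbitrary: s rest cs T)
  case L
  let ?s = "s(1 := rest, 3 := cs, j := 1 # s j)"
  have "runs (Pop 1 ;; Push j 1 ;; Pop 3) s (1 + (1 + 1)) ?s"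
    using runs_Seq[OF runs_Pop[of 1 s] runs_Seq[OF runs_Push[of j 1 "s(1 := tl (s 1))"] runs_Pop[of 3]]] L assms(1)
    by (auto simp: fun_upd_twist)
  then have 1: "runs (If 1 2 (Pop 1 ;; Push j 2 ;; Push 3 1) (Pop 1 ;; Push j 1 ;; Pop 3)) s 5 ?s"
    by (intro runs_IfF') (use L in \<open>auto simp: top_def\<close>)
  have "runs (While 3 0 (If 1 2 (Pop 1 ;; Push j 2 ;; Push 3 1) (Pop 1 ;; Push j 1 ;; Pop 3))) ?s T s'"
    using L(3) by (simp only: code.simps rev.simps append.simps)
  with runs_WhileT[OF _ 1, of 3 0 T s'] L(2) show ?case by (simp only: top_def tsize_simps) (simp add: add.commute)
next
  case (N l r)
  let ?s = "s(1 := code l @ code r @ rest, 3 := 1 # 1 # cs, j := 2 # s j)"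
  have "runs (Pop 1 ;; Push j 2 ;; Push 3 1) s (1 + (1 + 1)) ?s"
    using runs_Seq[OF runs_Pop[of 1 s] runs_Seq[OF runs_Push[of j 2 "s(1 := tl (s 1))"] runs_Push[of 3 1]]] N.prems assms(1)
    by (auto simp: fun_upd_twist)
  then have 1: "runs (If 1 2 (Pop 1 ;; Push j 2 ;; Push 3 1) (Pop 1 ;; Push j 1 ;; Pop 3)) s 5 ?s"
    by (intro runs_IfT') (use N.prems in \<open>auto simp: top_def\<close>)
  let ?s1 = "s(1 := code r @ rest, 3 := 1 # cs, j := rev (code l) @ 2 # s j)"
  have a: "?s1 1 = code r @ rest" "?s1 3 = 1 # cs" "?s 1 = code l @ code r @ rest" "?s 3 = 1 # 1 # cs"
    using assms(1) by auto
  have "?s1(1 := rest, 3 := cs, j := rev (code r) @ ?s1 j) = s(1 := rest, 3 := cs, j := rev (code (N l r)) @ s j)"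
    (is "?e1 = ?e2") using assms(1) by (auto simp: fun_eq_iff)
  then have "runs (While 3 0 (If 1 2 (Pop 1 ;; Push j 2 ;; Push 3 1) (Pop 1 ;; Push j 1 ;; Pop 3))) ?e1 T s'"
    using N.prems(3) by (simp only:)
  then have 2: "runs (While 3 0 (If 1 2 (Pop 1 ;; Push j 2 ;; Push 3 1) (Pop 1 ;; Push j 1 ;; Pop 3))) ?s1 (T + 7 * tsize r) s'"
    by (rule N.IH(2)[OF a(1,2)])
  have "?s(1 := code r @ rest, 3 := 1 # cs, j := rev (code l) @ ?s j) = ?s1"
    (is "?e3 = _") using assms(1) by (auto simp: fun_eq_iff)
  then have "runs (While 3 0 (If 1 2 (Pop 1 ;; Push j 2 ;; Push 3 1) (Pop 1 ;; Push j 1 ;; Pop 3))) ?e3 (T + 7 * tsize r) s'"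
    using 2 by (simp only:)
  then have 3: "runs (While 3 0 (If 1 2 (Pop 1 ;; Push j 2 ;; Push 3 1) (Pop 1 ;; Push j 1 ;; Pop 3))) ?s (T + 7 * tsize r + 7 * tsize l) s'"
    by (rule N.IH(1)[OF a(3,4)])
  have "top 3 s \<noteq> 0" using N.prems by (simp add: top_def)
  from runs_WhileT[OF this 1 3] show ?case by (rule runs_mono) simp
qed

lemma stk_upd [simp]:
  "(stk a m b e)(0 := x) = stk x m b e" "(stk a m b e)(1 := x) = stk a x b e" "(stk a m b e)(Suc 0 := x) = stk a x b e"
  "(stk a m b e)(2 := x) = stk a m x e" "(stk a m b e)(3 := x) = stk a m b x"
  "stk a m b e 0 = a" "stk a m b e 1 = m" "stk a m b e (Suc 0) = m" "stk a m b e 2 = b" "stk a m b e 3 = e"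
  by (auto simp: stk_def fun_eq_iff)

lemma runs_move_tree:
  "runs (move_tree 0) (stk a (code t @ rest) b []) (7 * tsize t + 2) (stk (rev (code t) @ a) rest b [])"
  "runs (move_tree 2) (stk a (code t @ rest) b []) (7 * tsize t + 2) (stk a rest (rev (code t) @ b) [])"
proof -
  let ?W = "\<lambda>j. While 3 0 (If 1 2 (Pop 1 ;; Push j 2 ;; Push 3 1) (Pop 1 ;; Push j 1 ;; Pop 3))"
  have w: "runs (?W j) (stk a' m' b' []) 1 (stk a' m' b' [])" for a' m' b' j
    using runs_WhileF[of 3 "stk a' m' b' []" 0] by (simp add: top_def)
  have "runs (?W 0) (stk a (code t @ rest) b [1]) (1 + 7 * tsize t) (stk (rev (code t) @ a) rest b [])"
    by (rule runs_move_loop) (use w in \<open>auto simp del: One_nat_def\<close>)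
  then show "runs (move_tree 0) (stk a (code t @ rest) b []) (7 * tsize t + 2) (stk (rev (code t) @ a) rest b [])"
    unfolding move_tree_def
    using runs_mono[OF runs_Seq[OF runs_Push[of 3 1 "stk a (code t @ rest) b []", simplified]], of _ _ _ "7 * tsize t + 2"] by simp
  have "runs (?W 2) (stk a (code t @ rest) b [1]) (1 + 7 * tsize t) (stk a rest (rev (code t) @ b) [])"
    by (rule runs_move_loop) (use w in \<open>auto simp del: One_nat_def\<close>)
  then show "runs (move_tree 2) (stk a (code t @ rest) b []) (7 * tsize t + 2) (stk a rest (rev (code t) @ b) [])"
    unfolding move_tree_def
    using runs_mono[OF runs_Seq[OF runs_Push[of 3 1 "stk a (code t @ rest) b []", simplified]], of _ _ _ "7 * tsize t + 2"] by simp
qed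

definition clear0 :: com where "clear0 = While 0 0 (Pop 0)"

lemma runs_clear0: "0 \<notin> set a \<Longrightarrow> runs clear0 (stk a m b e) (3 * length a + 1) (stk [] m b e)"
proof (induction a)
  case Nil
  show ?case unfolding clear0_def using runs_WhileF[of 0 "stk [] m b e" 0] by (simp add: top_def)
next
  case (Cons x a)
  have "top 0 (stk (x # a) m b e) \<noteq> 0" using Cons by (auto simp: top_def)
  from runs_WhileT[OF this, of "Pop 0" 1 "stk a m b e" "3 * length a + 1" "stk [] m b e"]
  have "runs clear0 (stk (x # a) m b e) (1 + (3 * length a + 1) + 2) (stk [] m b e)"
    using Cons runs_Pop[of 0 "stk (x # a) m b e"] unfolding clear0_def by simp
  then show ?case by (rule runs_mono) simp
qed

definition drop_tree :: com where "drop_tree = move_tree 0 ;; clear0"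
text \<open>The copy on stack 2 is already in the right order and would arrive reversed if it were
  poured directly; hence the detour over stack 0.\<close>

definition dup_tree :: com where
  "dup_tree = move_tree 0 ;; While 0 0 (If 0 2 (Pop 0 ;; Push 1 2 ;; Push 2 2) (Pop 0 ;; Push 1 1 ;; Push 2 1)) ;; pour 2 0 ;; pour 0 1"
definition swap_trees :: com where "swap_trees = move_tree 0 ;; move_tree 2 ;; pour 0 1 ;; pour 2 1"

lemma zero_notin_code: "0 \<notin> set (code t)" "0 \<notin> set (rev (code t))" using code_symbols[of t] by auto

lemma runs_drop_tree: "runs drop_tree (stk [] (code t @ rest) [] []) (10 * tsize t + 3) (stk [] rest [] [])"
  unfolding drop_tree_def
  using runs_Seq[OF runs_move_tree(1)[of "[]" t rest "[]", simplified] runs_clear0[OF zero_notin_code(2)]]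
  by (rule runs_mono) (simp add: tsize_def)

lemma runs_double_pour:
  assumes "set a \<subseteq> {1, 2}"
  shows "runs (While 0 0 (If 0 2 (Pop 0 ;; Push 1 2 ;; Push 2 2) (Pop 0 ;; Push 1 1 ;; Push 2 1))) (stk a m b [])
    (7 * length a + 1) (stk [] (rev a @ m) (rev a @ b) [])"
  using assms
proof (induction a arbitrary: m b)
  case Nil
  then show ?case using runs_WhileF[of 0 "stk [] m b []" 0] by (simp add: top_def)
next
  case (Cons x a)
  have 1: "runs (If 0 2 (Pop 0 ;; Push 1 2 ;; Push 2 2) (Pop 0 ;; Push 1 1 ;; Push 2 1)) (stk (x # a) m b []) (3 + 2) (stk a (x # m) (x # b) [])"
  proof (cases "x = 2")
    case True
    show ?thesis by (rule runs_IfT)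
      (use True runs_Seq[OF runs_Pop[of 0 "stk (x # a) m b []"] runs_Seq[OF runs_Push[of 1 2] runs_Push[of 2 2]]] in \<open>auto simp: top_def numeral_3_eq_3\<close>)
  next
    case False
    then have "x = 1" using Cons by auto
    show ?thesis by (rule runs_IfF)
      (use \<open>x = 1\<close> runs_Seq[OF runs_Pop[of 0 "stk (x # a) m b []"] runs_Seq[OF runs_Push[of 1 1] runs_Push[of 2 1]]] in \<open>auto simp: top_def numeral_3_eq_3\<close>)
  qed
  have "top 0 (stk (x # a) m b []) \<noteq> 0" using Cons by (auto simp: top_def)
  from runs_WhileT[OF this 1 Cons.IH] Cons.prems show ?case by (simp add: algebra_simps)
qed

lemma runs_pour_stk:
  assumes "set a \<subseteq> {1, 2}"
  shows "runs (pour 0 1) (stk a m b e) (6 * length a + 1) (stk [] (rev a @ m) b e)"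
  "runs (pour 2 1) (stk a' m a e) (6 * length a + 1) (stk a' (rev a @ m) [] e)"
  "runs (pour 2 0) (stk a' m a e) (6 * length a + 1) (stk (rev a @ a') m [] e)"
  using runs_pour[of 0 1 "stk a m b e"] runs_pour[of 2 1 "stk a' m a e"] runs_pour[of 2 0 "stk a' m a e"] assms by simp_all

lemma runs_dup_tree: "runs dup_tree (stk [] (code t @ rest) [] []) (26 * tsize t + 5) (stk [] (code t @ code t @ rest) [] [])"
proof -
  have c: "set (rev (code t)) \<subseteq> {1, 2}" "set (code t) \<subseteq> {1, 2}" using code_symbols by auto
  show ?thesis unfolding dup_tree_def
    using runs_Seq[OF runs_move_tree(1)[of "[]" t rest "[]", simplified] runs_Seq[OF runs_double_pour[OF c(1), of rest "[]", simplified]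
      runs_Seq[OF runs_pour_stk(3)[OF c(2), of "[]" "code t @ rest" "[]", simplified] runs_pour_stk(1)[OF c(1), of "code t @ rest" "[]" "[]", simplified]]]]
    by (rule runs_mono) (simp add: tsize_def)
qed

lemma runs_swap_trees:
  "runs swap_trees (stk [] (code x @ code y @ rest) [] []) (13 * tsize x + 13 * tsize y + 6) (stk [] (code y @ code x @ rest) [] [])"
proof -
  have c: "set (rev (code t)) \<subseteq> {1, 2}" for t using code_symbols by auto
  show ?thesis unfolding swap_trees_def
    using runs_Seq[OF runs_move_tree(1)[of "[]" x "code y @ rest" "[]", simplified]
      runs_Seq[OF runs_move_tree(2)[of "rev (code x)" y rest "[]", simplified]
        runs_Seq[OF runs_pour_stk(1)[OF c, of x rest "rev (code y)" "[]", simplified]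
          runs_pour_stk(2)[OF c, of "[]" "code x @ rest" y "[]", simplified]]]]
    by (rule runs_mono) (simp add: tsize_def)
qed

section \<open>Polynomial-time functions on trees\<close>

text \<open>The contract that makes programs composable: the argument on top of stack 1 is replaced
  by the result, whatever lies below it, and the other stacks are empty before and after.
  \<open>X\<close> is the domain on which this is demanded; later it consists of valid
  encodings.\<close>

definition FP :: "tree set \<Rightarrow> (tree \<Rightarrow> tree) \<Rightarrow> bool" where
  "FP X f \<longleftrightarrow> (\<exists>c T. wf_com c \<and> pb T \<and>
     (\<forall>x\<in>X. \<forall>rest. runs c (stk [] (code x @ rest) [] []) (T (tsize x)) (stk [] (code (f x) @ rest) [] [])))"

lemma FPI: "wf_com c \<Longrightarrow> pb T \<Longrightarrow>
   (\<And>x rest. x \<in> X \<Longrightarrow> runs c (stk [] (code x @ rest) [] []) (T (tsize x)) (stk [] (code (f x) @ rest) [] [])) \<Longrightarrow> FP X f"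
  unfolding FP_def by blast

definition FP_by :: "tree set \<Rightarrow> (tree \<Rightarrow> tree) \<Rightarrow> com \<Rightarrow> nat \<Rightarrow> bool" where
  "FP_by X f c k \<longleftrightarrow> wf_com c \<and> (\<forall>x\<in>X. \<forall>rest n. tsize x \<le> n \<longrightarrow>
     runs c (stk [] (code x @ rest) [] []) ((n + 2) ^ k) (stk [] (code (f x) @ rest) [] []))"

lemma FP_byD: "FP_by X f c k \<Longrightarrow> x \<in> X \<Longrightarrow> tsize x \<le> n \<Longrightarrow>
    runs c (stk [] (code x @ rest) [] []) ((n + 2) ^ k) (stk [] (code (f x) @ rest) [] [])"
  "FP_by X f c k \<Longrightarrow> wf_com c"
  by (auto simp: FP_by_def)

lemma FP_imp_FP_by:
  assumes "FP X f" shows "\<exists>c k. FP_by X f c k"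
proof -
  obtain c T k where c: "wf_com c" "\<And>n. T n \<le> (n + 2) ^ k"
    "\<And>x rest. x \<in> X \<Longrightarrow> runs c (stk [] (code x @ rest) [] []) (T (tsize x)) (stk [] (code (f x) @ rest) [] [])"
    using assms unfolding FP_def pb_def by blast
  have "runs c (stk [] (code x @ rest) [] []) ((n + 2) ^ k) (stk [] (code (f x) @ rest) [] [])" if "x \<in> X" "tsize x \<le> n" for x rest n
  proof (rule runs_mono[OF c(3)[OF that(1)]])
    have "T (tsize x) \<le> (tsize x + 2) ^ k" by (rule c(2))
    also have "\<dots> \<le> (n + 2) ^ k" using that by (intro power_mono) auto
    finally show "T (tsize x) \<le> (n + 2) ^ k" .
  qed
  then show ?thesis using c(1) unfolding FP_by_def by blast
qed

lemma exec_length: "exec c s t s' \<Longrightarrow> length (s' i) \<le> length (s i) + t"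
  by (induction rule: exec.induct) auto

text \<open>A step pushes at most one symbol, so the running time bounds the growth in size.
  Composition needs this to bound the time of the second program.\<close>

lemma FP_size:
  assumes "FP X f" shows "\<exists>k. \<forall>x\<in>X. \<forall>n. tsize x \<le> n \<longrightarrow> tsize (f x) \<le> (n + 2) ^ k"
proof -
  obtain c k where c: "FP_by X f c k" using FP_imp_FP_by[OF assms] by blast
  have "pb (\<lambda>n. n + (n + 2) ^ k)" by (intro pb_intros)
  then obtain k' where k': "\<And>n::nat. n + (n + 2) ^ k \<le> (n + 2) ^ k'" unfolding pb_def by blast
  have "tsize (f x) \<le> (n + 2) ^ k'" if x: "x \<in> X" and n: "tsize x \<le> n" for x n
  proof -
    obtain t where t: "t \<le> (n + 2) ^ k" "exec c (stk [] (code x @ []) [] []) t (stk [] (code (f x) @ []) [] [])"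
      using FP_byD(1)[OF c x n, of "[]"] unfolding runs_def by blast
    have "tsize (f x) \<le> tsize x + t" using exec_length[OF t(2), of 1] by (simp add: tsize_def)
    then show ?thesis using k'[of n] t(1) n by linarith
  qed
  then show ?thesis by blast
qed

lemma wf_macros [simp]: "wf_com (move_tree 0)" "wf_com (move_tree 2)" "wf_com drop_tree" "wf_com dup_tree" "wf_com swap_trees"
  by (auto simp: move_tree_def drop_tree_def dup_tree_def swap_trees_def pour_def move1_def clear0_def)

definition skip :: com where "skip = Push 0 1 ;; Pop 0"

lemma runs_skip: "runs skip (stk a m b e) 2 (stk a m b e)"
  unfolding skip_def using runs_Seq[OF runs_Push[of 0 1 "stk a m b e"] runs_Pop[of 0]] by (simp add: numeral_2_eq_2)

lemma wf_skip [simp]: "wf_com skip" by (simp add: skip_def)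

lemma FP_id: "FP X (\<lambda>x. x)"
  by (rule FPI[of skip "\<lambda>_. 2"]) (auto simp: pb_intros runs_skip)

lemma FP_subset: "FP Y f \<Longrightarrow> X \<subseteq> Y \<Longrightarrow> FP X f"
  unfolding FP_def by blast

lemma FP_comp: assumes "FP Y f" "FP X g" "\<And>x. x \<in> X \<Longrightarrow> g x \<in> Y" shows "FP X (\<lambda>x. f (g x))"
proof -
  obtain c k where c: "FP_by Y f c k" using FP_imp_FP_by[OF assms(1)] by blast
  obtain c' k' where c': "FP_by X g c' k'" using FP_imp_FP_by[OF assms(2)] by blast
  obtain m where m: "\<And>x n. x \<in> X \<Longrightarrow> tsize x \<le> n \<Longrightarrow> tsize (g x) \<le> (n + 2) ^ m" using FP_size[OF assms(2)] by blast
  show ?thesis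
    by (rule FPI[of "c' ;; c" "\<lambda>n. (n + 2) ^ k' + ((n + 2) ^ m + 2) ^ k"])
      (use FP_byD(2)[OF c] FP_byD(2)[OF c'] in \<open>auto intro!: pb_intros runs_Seq FP_byD(1)[OF c'] FP_byD(1)[OF c] m assms(3)\<close>)
qed

fun pushes :: "nat list \<Rightarrow> com" where
  "pushes [] = skip" | "pushes (a # as) = pushes as ;; Push 1 a"

lemma runs_pushes: "runs (pushes as) (stk a m b e) (length as + 2) (stk a (as @ m) b e)"
proof (induction as)
  case Nil
  show ?case using runs_skip by (auto elim: runs_mono)
next
  case (Cons x as)
  have "runs (pushes (x # as)) (stk a m b e) (length as + 2 + 1) (stk a ((x # as) @ m) b e)"
    using runs_Seq[OF Cons runs_Push[of 1 x "stk a (as @ m) b e"]] by simp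
  then show ?case by (rule runs_mono) simp
qed

lemma wf_pushes: "set as \<subseteq> {1, 2} \<Longrightarrow> wf_com (pushes as)"
  by (induction as) auto

lemma FP_const: "FP X (\<lambda>x. t)"
proof (rule FPI[of "drop_tree ;; pushes (code t)" "\<lambda>n. (10 * n + 3) + (length (code t) + 2)"])
  show "wf_com (drop_tree ;; pushes (code t))" using wf_pushes code_symbols by simp
  fix x rest
  show "runs (drop_tree ;; pushes (code t)) (stk [] (code x @ rest) [] []) (10 * tsize x + 3 + (length (code t) + 2)) (stk [] (code t @ rest) [] [])"
    by (rule runs_Seq[OF runs_drop_tree runs_pushes])
qed (intro pb_intros)

text \<open>In preorder, a node is formed by pushing the symbol 2 in front of the two codes;
  therefore the component that comes second is computed first and ends up below.\<close>

lemma FP_pair: assumes "FP X f" "FP X g" shows "FP X (\<lambda>x. N (f x) (g x))"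
proof -
  obtain c k where c: "FP_by X f c k" using FP_imp_FP_by[OF assms(1)] by blast
  obtain c' k' where c': "FP_by X g c' k'" using FP_imp_FP_by[OF assms(2)] by blast
  obtain m where m: "\<And>x n. x \<in> X \<Longrightarrow> tsize x \<le> n \<Longrightarrow> tsize (g x) \<le> (n + 2) ^ m" using FP_size[OF assms(2)] by blast
  let ?T = "\<lambda>n. (26 * n + 5) + ((n + 2) ^ k' + ((13 * (n + 2) ^ m + 13 * n + 6) + ((n + 2) ^ k + 1)))"
  show ?thesis
  proof (rule FPI[of "dup_tree ;; c' ;; swap_trees ;; c ;; Push 1 2" ?T])
    show "wf_com (dup_tree ;; c' ;; swap_trees ;; c ;; Push 1 2)" using FP_byD(2)[OF c] FP_byD(2)[OF c'] by simp
    show "pb ?T" by (intro pb_intros)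
    fix x rest assume x: "x \<in> X"
    have sw: "runs swap_trees (stk [] (code (g x) @ code x @ rest) [] []) (13 * (tsize x + 2) ^ m + 13 * tsize x + 6) (stk [] (code x @ code (g x) @ rest) [] [])"
      using runs_mono[OF runs_swap_trees] m[of x "tsize x"] x by simp
    show "runs (dup_tree ;; c' ;; swap_trees ;; c ;; Push 1 2) (stk [] (code x @ rest) [] []) (?T (tsize x)) (stk [] (code (N (f x) (g x)) @ rest) [] [])"
      by (rule runs_Seq[OF runs_dup_tree runs_Seq[OF FP_byD(1)[OF c' x order_refl] runs_Seq[OF sw runs_Seq[OF FP_byD(1)[OF c x order_refl]]]]])
        (use runs_Push[of 1 2 "stk [] (code (f x) @ code (g x) @ rest) [] []"] in simp)
  qed
qed

fun car :: "tree \<Rightarrow> tree" where "car L = L" | "car (N a b) = a"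
fun cdr :: "tree \<Rightarrow> tree" where "cdr L = L" | "cdr (N a b) = b"
fun tlen :: "tree \<Rightarrow> nat" where "tlen L = 0" | "tlen (N a b) = Suc (tlen b)"

lemma runs_Pop_N: "runs (Pop 1) (stk [] (2 # m) [] []) 1 (stk [] m [] [])"
  using runs_Pop[of 1 "stk [] (2 # m) [] []"] by simp

lemma FP_car: "FP X car"
proof (rule FPI[of "If 1 2 (Pop 1 ;; swap_trees ;; drop_tree) skip" "\<lambda>n. 30 * n + 30"])
  fix x rest
  show "runs (If 1 2 (Pop 1 ;; swap_trees ;; drop_tree) skip) (stk [] (code x @ rest) [] []) (30 * tsize x + 30) (stk [] (code (car x) @ rest) [] [])"
  proof (cases x)
    case L
    have "runs (If 1 2 (Pop 1 ;; swap_trees ;; drop_tree) skip) (stk [] (code L @ rest) [] []) (2 + 2) (stk [] (code L @ rest) [] [])"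
      by (rule runs_IfF[OF _ runs_skip]) (simp add: top_def)
    then show ?thesis using L by (auto elim!: runs_mono)
  next
    case (N l r)
    have "runs (Pop 1 ;; swap_trees ;; drop_tree) (stk [] (2 # code l @ code r @ rest) [] [])
      (1 + ((13 * tsize l + 13 * tsize r + 6) + (10 * tsize r + 3))) (stk [] (code l @ rest) [] [])"
      by (rule runs_Seq[OF runs_Pop_N runs_Seq[OF runs_swap_trees runs_drop_tree]])
    then show ?thesis unfolding N by (simp, intro runs_IfT') (auto simp: top_def)
  qed
qed (auto intro!: pb_intros)

lemma FP_cdr: "FP X cdr"
proof (rule FPI[of "If 1 2 (Pop 1 ;; drop_tree) skip" "\<lambda>n. 30 * n + 30"])
  fix x rest
  show "runs (If 1 2 (Pop 1 ;; drop_tree) skip) (stk [] (code x @ rest) [] []) (30 * tsize x + 30) (stk [] (code (cdr x) @ rest) [] [])"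
  proof (cases x)
    case L
    have "runs (If 1 2 (Pop 1 ;; drop_tree) skip) (stk [] (code L @ rest) [] []) (2 + 2) (stk [] (code L @ rest) [] [])"
      by (rule runs_IfF[OF _ runs_skip]) (simp add: top_def)
    then show ?thesis using L by (auto elim!: runs_mono)
  next
    case (N l r)
    have "runs (Pop 1 ;; drop_tree) (stk [] (2 # code l @ code r @ rest) [] []) (1 + (10 * tsize l + 3)) (stk [] (code r @ rest) [] [])"
      by (rule runs_Seq[OF runs_Pop_N runs_drop_tree])
    then show ?thesis unfolding N by (simp, intro runs_IfT') (auto simp: top_def)
  qed
qed (auto intro!: pb_intros)

lemma FP_if: assumes "FP X f" "FP X g" "FP X h" shows "FP X (\<lambda>x. if f x = L then g x else h x)"
proof -
  obtain c k where c: "FP_by X f c k" using FP_imp_FP_by[OF assms(1)] by blast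
  obtain c1 k1 where c1: "FP_by X g c1 k1" using FP_imp_FP_by[OF assms(2)] by blast
  obtain c2 k2 where c2: "FP_by X h c2 k2" using FP_imp_FP_by[OF assms(3)] by blast
  obtain m where m: "\<And>x n. x \<in> X \<Longrightarrow> tsize x \<le> n \<Longrightarrow> tsize (f x) \<le> (n + 2) ^ m" using FP_size[OF assms(1)] by blast
  let ?T = "\<lambda>n. (26 * n + 5) + ((n + 2) ^ k + ((10 * (n + 2) ^ m + 3 + ((n + 2) ^ k1 + (n + 2) ^ k2)) + 2))"
  let ?i = "If 1 1 (Pop 1 ;; c1) (drop_tree ;; c2)"
  show ?thesis
  proof (rule FPI[of "dup_tree ;; c ;; ?i" ?T])
    show "wf_com (dup_tree ;; c ;; ?i)" using FP_byD(2)[OF c] FP_byD(2)[OF c1] FP_byD(2)[OF c2] by simp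
    show "pb ?T" by (intro pb_intros)
    fix x rest assume x: "x \<in> X"
    let ?n = "tsize x"
    have "runs ?i (stk [] (code (f x) @ code x @ rest) [] []) ((10 * (?n + 2) ^ m + 3 + ((?n + 2) ^ k1 + (?n + 2) ^ k2)) + 2)
        (stk [] (code (if f x = L then g x else h x) @ rest) [] [])"
    proof (cases "f x")
      case L
      have "runs (Pop 1 ;; c1) (stk [] (1 # code x @ rest) [] []) (1 + (?n + 2) ^ k1) (stk [] (code (g x) @ rest) [] [])"
        by (rule runs_Seq[OF _ FP_byD(1)[OF c1 x order_refl]]) (use runs_Pop[of 1 "stk [] (1 # code x @ rest) [] []"] in simp)
      then show ?thesis using L by (simp, intro runs_IfT') (auto simp: top_def)
    next
      case (N l r)
      have "runs (drop_tree ;; c2) (stk [] (code (f x) @ code x @ rest) [] []) (10 * tsize (f x) + 3 + (?n + 2) ^ k2) (stk [] (code (h x) @ rest) [] [])"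
        by (rule runs_Seq[OF runs_drop_tree FP_byD(1)[OF c2 x order_refl]])
      then have "runs (drop_tree ;; c2) (stk [] (code (f x) @ code x @ rest) [] []) (10 * (?n + 2) ^ m + 3 + ((?n + 2) ^ k1 + (?n + 2) ^ k2)) (stk [] (code (h x) @ rest) [] [])"
        by (rule runs_mono) (use m[of x ?n] x in simp)
      then show ?thesis using N by (simp, intro runs_IfF') (auto simp: top_def)
    qed
    then show "runs (dup_tree ;; c ;; ?i) (stk [] (code x @ rest) [] []) (?T ?n) (stk [] (code (if f x = L then g x else h x) @ rest) [] [])"
      by (rule runs_Seq[OF runs_dup_tree runs_Seq[OF FP_byD(1)[OF c x order_refl]]])
  qed
qed

lemma tlen_le_tsize: "tlen x \<le> tsize x" by (induction x rule: tlen.induct) auto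

text \<open>Repeated squaring of the size shows that iteration needs the bound \<open>B\<close> on
  all intermediate values. The counter is the right spine of \<open>car z\<close>; its length is at
  most the size of \<open>z\<close>, so the number of rounds is polynomial as well.\<close>

lemma FP_iter:
  assumes f: "FP Y f" and B: "pb B"
    and dom: "\<And>z i. z \<in> X \<Longrightarrow> i < tlen (car z) \<Longrightarrow> (f ^^ i) (cdr z) \<in> Y"
    and bd: "\<And>z i. z \<in> X \<Longrightarrow> i \<le> tlen (car z) \<Longrightarrow> tsize ((f ^^ i) (cdr z)) \<le> B (tsize z)"
  shows "FP X (\<lambda>z. (f ^^ tlen (car z)) (cdr z))"
proof -
  obtain c k where c: "FP_by Y f c k" using FP_imp_FP_by[OF f] by blast
  let ?b = "Pop 1 ;; drop_tree ;; swap_trees ;; c ;; swap_trees"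
  let ?C = "\<lambda>n. 36 * n + 26 * B n + 16 + (B n + 2) ^ k + 2"
  let ?p = "If 1 2 (Pop 1 ;; While 1 1 ?b ;; Pop 1) skip"
  have loop: "runs (While 1 1 ?b) (stk [] (code t @ code x @ rest) [] []) (tlen t * ?C n + 1) (stk [] (code L @ code ((f ^^ tlen t) x) @ rest) [] [])"
    if "tsize t \<le> n" "\<And>i. i \<le> tlen t \<Longrightarrow> tsize ((f ^^ i) x) \<le> B n" "\<And>i. i < tlen t \<Longrightarrow> (f ^^ i) x \<in> Y" for t x rest n
    using that
  proof (induction t arbitrary: x)
    case L
    then show ?case using runs_WhileF[of 1 "stk [] (code L @ code x @ rest) [] []" 1] by (simp add: top_def)
  next
    case (N l r)
    have b0: "tsize x \<le> B n" "x \<in> Y" using N.prems(2,3)[of 0] by simp_all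
    have b1: "tsize (f x) \<le> B n" using N.prems(2)[of "Suc 0"] by simp
    have sz: "tsize l \<le> n" "tsize r \<le> n" using N.prems(1) by auto
    have "runs ?b (stk [] (2 # code l @ code r @ code x @ rest) [] []) (1 + ((10 * tsize l + 3) + ((13 * tsize r + 13 * tsize x + 6) +
        ((B n + 2) ^ k + (13 * tsize (f x) + 13 * tsize r + 6))))) (stk [] (code r @ code (f x) @ rest) [] [])"
      by (rule runs_Seq[OF runs_Pop_N runs_Seq[OF runs_drop_tree runs_Seq[OF runs_swap_trees runs_Seq[OF FP_byD(1)[OF c b0(2,1)] runs_swap_trees]]]])
    then have 1: "runs ?b (stk [] (code (N l r) @ code x @ rest) [] []) (36 * n + 26 * B n + 16 + (B n + 2) ^ k) (stk [] (code r @ code (f x) @ rest) [] [])"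
      using b0 b1 sz by (auto elim!: runs_mono)
    have "tsize ((f ^^ i) (f x)) \<le> B n" if "i \<le> tlen r" for i
      using N.prems(2)[of "Suc i"] that by (simp add: funpow_swap1)
    moreover have "(f ^^ i) (f x) \<in> Y" if "i < tlen r" for i
      using N.prems(3)[of "Suc i"] that by (simp add: funpow_swap1)
    ultimately have 2: "runs (While 1 1 ?b) (stk [] (code r @ code (f x) @ rest) [] []) (tlen r * ?C n + 1) (stk [] (code L @ code ((f ^^ tlen r) (f x)) @ rest) [] [])"
      using N.IH(2)[of "f x"] sz by blast
    have "top 1 (stk [] (code (N l r) @ code x @ rest) [] []) \<noteq> 1" by (simp add: top_def)
    from runs_WhileT[OF this 1 2] have "runs (While 1 1 ?b) (stk [] (code (N l r) @ code x @ rest) [] []) (tlen (N l r) * ?C n + 1)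
      (stk [] (code L @ code ((f ^^ tlen r) (f x)) @ rest) [] [])" by (rule runs_mono) simp
    then show ?case by (simp add: funpow_swap1)
  qed
  let ?T = "\<lambda>n. (1 + ((n * ?C n + 1) + 1)) + 2"
  show ?thesis
  proof (rule FPI[of ?p ?T])
    show "wf_com ?p" using FP_byD(2)[OF c] by simp
    show "pb ?T" by (intro pb_intros B)
    fix z rest assume z: "z \<in> X"
    show "runs ?p (stk [] (code z @ rest) [] []) (?T (tsize z)) (stk [] (code ((f ^^ tlen (car z)) (cdr z)) @ rest) [] [])"
    proof (cases z)
      case L
      have "runs ?p (stk [] (code L @ rest) [] []) (2 + 2) (stk [] (code L @ rest) [] [])"
        by (rule runs_IfF[OF _ runs_skip]) (simp add: top_def)
      then show ?thesis using L by (auto elim!: runs_mono)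
    next
      case (N t x)
      let ?n = "tsize z"
      have "runs (While 1 1 ?b) (stk [] (code t @ code x @ rest) [] []) (tlen t * ?C ?n + 1) (stk [] (code L @ code ((f ^^ tlen t) x) @ rest) [] [])"
        by (rule loop) (use N bd[OF z] dom[OF z] in auto)
      then have "runs (While 1 1 ?b) (stk [] (code t @ code x @ rest) [] []) (?n * ?C ?n + 1) (stk [] (1 # code ((f ^^ tlen t) x) @ rest) [] [])"
        using N tlen_le_tsize[of t] by (auto elim!: runs_mono intro!: mult_le_mono1 simp del: mult_Suc)
      moreover have "runs (Pop 1) (stk [] (1 # m) [] []) 1 (stk [] m [] [])" for m
        using runs_Pop[of 1 "stk [] (1 # m) [] []"] by simp
      ultimately have "runs (Pop 1 ;; While 1 1 ?b ;; Pop 1) (stk [] (2 # code t @ code x @ rest) [] []) (1 + ((?n * ?C ?n + 1) + 1)) (stk [] (code ((f ^^ tlen t) x) @ rest) [] [])"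
        by (intro runs_Seq[OF runs_Pop_N] runs_Seq)
      then show ?thesis using N by (simp, intro runs_IfT') (auto simp: top_def)
    qed
  qed
qed

section \<open>Polynomial-time functions on encodable types\<close>

class enc = fixes enc :: "'a \<Rightarrow> tree"

instantiation unit :: enc begin
definition enc_unit :: "unit \<Rightarrow> tree" where "enc_unit x = L"
instance ..
end

instantiation bool :: enc begin
definition enc_bool :: "bool \<Rightarrow> tree" where "enc_bool b = (if b then N L L else L)"
instance ..
end

instantiation prod :: (enc, enc) enc begin
definition enc_prod :: "'a \<times> 'b \<Rightarrow> tree" where "enc_prod p = N (enc (fst p)) (enc (snd p))"
instance ..
end

instantiation list :: (enc) enc begin
primrec enc_list :: "'a list \<Rightarrow> tree" where
  "enc_list [] = L" | "enc_list (x # xs) = N (enc x) (enc_list xs)"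
instance ..
end

instantiation nat :: enc begin
definition enc_nat :: "nat \<Rightarrow> tree" where "enc_nat n = enc (bits n)"
instance ..
end

definition esize :: "'a::enc \<Rightarrow> nat" where "esize x = tsize (enc x)"

lemma esize_simps [simp]:
  "esize () = 1" "esize False = 1" "esize True = 3" "esize (x, y) = 1 + esize x + esize y"
  "esize ([]::'b::enc list) = 1" "esize (z # zs) = 1 + esize z + esize zs"
  by (simp_all add: esize_def enc_unit_def enc_bool_def enc_prod_def)

lemma esize_pos: "esize x > 0" by (simp add: esize_def tsize_pos)

lemma esize_bool: "esize (b::bool) \<le> 3" by (cases b) auto

lemma esize_list: "esize xs = 1 + (\<Sum>x\<leftarrow>xs. 1 + esize x)"
  by (induction xs) auto

lemma esize_append: "esize (xs @ ys) + 1 = esize xs + esize ys" by (induction xs) auto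

lemma esize_rev: "esize (rev xs) = esize xs" using esize_append by (induction xs) (auto simp: esize_list)

lemma esize_take: "esize (take i xs) \<le> esize xs"
  using esize_append[of "take i xs" "drop i xs"] esize_pos[of "drop i xs"] by simp

lemma esize_mem: "x \<in> set xs \<Longrightarrow> esize x \<le> esize xs" by (induction xs) auto

lemma length_le_esize: "length xs \<le> esize xs" by (induction xs) auto

lemma esize_list_le: "(\<And>x. x \<in> set xs \<Longrightarrow> esize x \<le> b) \<Longrightarrow> esize xs \<le> 1 + length xs * (1 + b)"
proof (induction xs)
  case (Cons a xs)
  have "esize a \<le> b" "esize xs \<le> 1 + length xs * (1 + b)" using Cons by auto
  then show ?case by simp
qed simp

definition PB :: "('a::enc \<Rightarrow> nat) \<Rightarrow> bool" where
  "PB g \<longleftrightarrow> (\<exists>k. \<forall>x. g x \<le> (esize x + 2) ^ k)"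

lemma PBI: "pb T \<Longrightarrow> (\<And>x. g x \<le> T (esize x)) \<Longrightarrow> PB g"
  unfolding PB_def pb_def by (meson order_trans)

lemma PB_const: "PB (\<lambda>x. c)" by (rule PBI[OF pb_const]) auto
lemma PB_esize: "PB esize" by (rule PBI[OF pb_id]) auto

lemma PB_combine:
  assumes "PB f" "PB g" and op: "\<And>S T. pb S \<Longrightarrow> pb T \<Longrightarrow> pb (\<lambda>n. opr (S n) (T n))"
    and mono: "\<And>a b c d. a \<le> c \<Longrightarrow> b \<le> d \<Longrightarrow> opr a b \<le> opr c (d::nat)"
  shows "PB (\<lambda>x. opr (f x) (g x))"
proof -
  obtain a b where a: "\<And>x. f x \<le> (esize x + 2) ^ a" "\<And>x. g x \<le> (esize x + 2) ^ b"
    using assms(1,2) unfolding PB_def by blast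
  show ?thesis
    by (rule PBI[OF op[of "\<lambda>n. (n + 2) ^ a" "\<lambda>n. (n + 2) ^ b"]]) (auto intro!: pb_intros mono a)
qed

lemma PB_add: "PB f \<Longrightarrow> PB g \<Longrightarrow> PB (\<lambda>x. f x + g x)" by (rule PB_combine) (auto intro: pb_intros)
lemma PB_mult: "PB f \<Longrightarrow> PB g \<Longrightarrow> PB (\<lambda>x. f x * g x)" by (rule PB_combine) (auto intro: pb_intros mult_le_mono)
lemma PB_power: "PB f \<Longrightarrow> PB (\<lambda>x. f x ^ k)" by (induction k) (simp_all add: PB_const PB_mult)

definition implements :: "(tree \<Rightarrow> tree) \<Rightarrow> ('a::enc \<Rightarrow> 'b::enc) \<Rightarrow> bool" where
  "implements F f \<longleftrightarrow> FP (range (enc :: 'a \<Rightarrow> tree)) F \<and> (\<forall>x. F (enc x) = enc (f x))"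

definition PT :: "('a::enc \<Rightarrow> 'b::enc) \<Rightarrow> bool" where
  "PT f \<longleftrightarrow> (\<exists>F. implements F f)"

lemma implementsD:
  fixes f :: "'a::enc \<Rightarrow> 'b::enc"
  shows "implements F f \<Longrightarrow> FP (range (enc :: 'a \<Rightarrow> tree)) F" "implements F f \<Longrightarrow> F (enc x) = enc (f x)"
  by (auto simp: implements_def)

lemma PTI: "FP (range (enc :: 'a::enc \<Rightarrow> tree)) F \<Longrightarrow> (\<And>x. F (enc x) = enc (f x)) \<Longrightarrow> PT (f :: 'a \<Rightarrow> 'b::enc)"
  unfolding PT_def implements_def by blast

lemma PT_size:
  assumes "PT f" shows "\<exists>k. \<forall>x n. esize x \<le> n \<longrightarrow> esize (f x) \<le> (n + 2) ^ k"
proof -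
  obtain F where "implements F f" using assms unfolding PT_def by blast
  note F = implementsD[OF this]
  show ?thesis using FP_size[OF F(1)] F(2) unfolding esize_def by (metis rangeI)
qed

lemma PB_esize_PT: "PT f \<Longrightarrow> PB (\<lambda>x. esize (f x))"
  using PT_size[of f] unfolding PB_def by blast

lemmas PB_intros = PB_const PB_esize PB_add PB_mult PB_power PB_esize_PT

lemma PT_id: "PT (\<lambda>x. x)" by (rule PTI[OF FP_id]) simp

lemma PT_comp: assumes "PT f" "PT g" shows "PT (\<lambda>x. f (g x))"
proof -
  obtain F where "implements F f" using assms(1) unfolding PT_def by blast
  note F = implementsD[OF this]
  obtain G where "implements G g" using assms(2) unfolding PT_def by blast
  note G = implementsD[OF this]
  show ?thesis by (rule PTI[OF FP_comp[OF F(1) G(1)]]) (auto simp: F G)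
qed

lemma PT_const: "PT (\<lambda>x. c)" by (rule PTI[OF FP_const[of _ "enc c"]]) simp

lemma PT_Pair: assumes "PT f" "PT g" shows "PT (\<lambda>x. (f x, g x))"
proof -
  obtain F where "implements F f" using assms(1) unfolding PT_def by blast
  note F = implementsD[OF this]
  obtain G where "implements G g" using assms(2) unfolding PT_def by blast
  note G = implementsD[OF this]
  show ?thesis by (rule PTI[OF FP_pair[OF F(1) G(1)]]) (auto simp: F G enc_prod_def)
qed

lemma PT_Cons: assumes "PT f" "PT g" shows "PT (\<lambda>x. f x # g x)"
proof -
  have "PT (\<lambda>p. fst p # snd p :: 'b list)" by (rule PTI[OF FP_id]) (simp add: enc_prod_def)
  from PT_comp[OF this PT_Pair[OF assms]] show ?thesis by simp
qed

lemma PT_fst: "PT f \<Longrightarrow> PT (\<lambda>x. fst (f x))"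
  by (rule PT_comp[of fst]) (rule PTI[OF FP_car], simp add: enc_prod_def)
lemma PT_snd: "PT f \<Longrightarrow> PT (\<lambda>x. snd (f x))"
  by (rule PT_comp[of snd]) (rule PTI[OF FP_cdr], simp add: enc_prod_def)
lemma PT_tl: "PT f \<Longrightarrow> PT (\<lambda>x. tl (f x))"
proof (rule PT_comp[of tl])
  show "PT (tl :: 'b list \<Rightarrow> 'b list)" by (rule PTI[OF FP_cdr]) (case_tac x; simp)
qed

lemma PT_if: assumes "PT b" "PT f" "PT g" shows "PT (\<lambda>x. if b x then f x else g x)"
proof -
  obtain F where "implements F f" using assms(2) unfolding PT_def by blast
  note F = implementsD[OF this]
  obtain G where "implements G g" using assms(3) unfolding PT_def by blast
  note G = implementsD[OF this]
  obtain H where "implements H b" using assms(1) unfolding PT_def by blast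
  note H = implementsD[OF this]
  show ?thesis by (rule PTI[OF FP_if[OF H(1) G(1) F(1)]]) (auto simp: F G H enc_bool_def)
qed

lemma PT_null: "PT f \<Longrightarrow> PT (\<lambda>x. f x = [])"
proof (rule PT_comp[of "\<lambda>xs. xs = []"])
  show "PT (\<lambda>xs::'b list. xs = [])"
    by (rule PTI[OF FP_if[OF FP_id FP_const[of _ "N L L"] FP_const[of _ L]]]) (case_tac x; simp add: enc_bool_def)
qed

definition hdd :: "'a \<Rightarrow> 'a list \<Rightarrow> 'a" where "hdd d xs = (case xs of [] \<Rightarrow> d | x # _ \<Rightarrow> x)"

lemma PT_hdd: "PT f \<Longrightarrow> PT (\<lambda>x. hdd d (f x))"
proof (rule PT_comp[of "hdd d"])
  show "PT (hdd d)"
    by (rule PTI[OF FP_if[OF FP_id FP_const[of _ "enc d"] FP_car]]) (case_tac x; simp add: hdd_def)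
qed

lemma bool_if: "(if p then False else True) = (\<not> p)" "(if p then q else False) = (p \<and> q)"
  "(if p then True else q) = (p \<or> q)" "(if p then q else \<not> q) = (p = q)"
  by auto

lemma PT_not: "PT b \<Longrightarrow> PT (\<lambda>x. \<not> b x)"
  using PT_if[OF _ PT_const[of False] PT_const[of True], of b] by (simp only: bool_if)
lemma PT_conj: "PT a \<Longrightarrow> PT b \<Longrightarrow> PT (\<lambda>x. a x \<and> b x)"
  using PT_if[OF _ _ PT_const[of False], of a b] by (simp only: bool_if)
lemma PT_disj: "PT a \<Longrightarrow> PT b \<Longrightarrow> PT (\<lambda>x. a x \<or> b x)"
  using PT_if[OF _ PT_const[of True], of a b] by (simp only: bool_if)
lemma PT_iff: "PT a \<Longrightarrow> PT b \<Longrightarrow> PT (\<lambda>x. a x = (b x :: bool))"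
  using PT_if[OF _ _ PT_not, of a b b] by (simp only: bool_if)

lemma tlen_enc_list [simp]: "tlen (enc xs) = length xs" by (induction xs) auto

text \<open>Bounded recursion along a list, the form in which iteration is used from here on: the
  list limits the rounds and \<open>bd\<close> limits the accumulator.\<close>

lemma PT_foldl:
  fixes f :: "'e::enc \<Rightarrow> 's::enc \<Rightarrow> 'a::enc \<Rightarrow> 's"
  assumes f: "PT (\<lambda>z. f (fst z) (fst (snd z)) (snd (snd z)))" and a: "PT a" and xs: "PT xs"
    and b: "PB b" and bd: "\<And>x i. i \<le> length (xs x) \<Longrightarrow> esize (foldl (f x) (a x) (take i (xs x))) \<le> b x"
  shows "PT (\<lambda>x. foldl (f x) (a x) (xs x))"
proof -
  obtain F where "implements F (\<lambda>z. f (fst z) (fst (snd z)) (snd (snd z)))" using f unfolding PT_def by blast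
  note F = implementsD[OF this]
  obtain A where "implements A a" using a unfolding PT_def by blast
  note A = implementsD[OF this]
  obtain X where "implements X xs" using xs unfolding PT_def by blast
  note X = implementsD[OF this]
  obtain kb where kb: "\<And>x. b x \<le> (esize x + 2) ^ kb" using b unfolding PB_def by blast
  \<comment> \<open>The remaining list is nonempty whenever a step is made, so \<open>F\<close> is
    applied to encodings only; elsewhere nothing is known about it. The context \<open>x\<close>
    travels along because the step function depends on it.\<close>
  define Y where "Y = {N (enc ys) (N (enc x) (enc s)) | (ys::'a list) (x::'e) (s::'s). ys \<noteq> []}"
  define G' where "G' t = N (cdr (car t)) (N (car (cdr t)) (F (N (car (cdr t)) (N (cdr (cdr t)) (car (car t))))))" for t
  have enc3: "N (enc x) (N (enc s) (enc y)) = enc (x, s, y)" for x :: 'e and s :: 's and y :: 'a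
    by (simp add: enc_prod_def)
  have GF: "FP Y G'"
    unfolding G'_def
  proof (intro FP_pair)
    show "FP Y (\<lambda>t. cdr (car t))" "FP Y (\<lambda>t. car (cdr t))"
      by (rule FP_comp[OF FP_cdr[of UNIV] FP_car] FP_comp[OF FP_car[of UNIV] FP_cdr]; simp)+
    show "FP Y (\<lambda>t. F (N (car (cdr t)) (N (cdr (cdr t)) (car (car t)))))"
    proof (rule FP_comp[OF F(1)])
      show "FP Y (\<lambda>t. N (car (cdr t)) (N (cdr (cdr t)) (car (car t))))"
        by (intro FP_pair FP_comp[OF FP_cdr[of UNIV] FP_cdr] FP_comp[OF FP_car[of UNIV] FP_cdr] FP_comp[OF FP_car[of UNIV] FP_car]) auto
      fix t assume "t \<in> Y"
      then obtain ys :: "'a list" and x :: 'e and s :: 's where t: "t = N (enc ys) (N (enc x) (enc s))" "ys \<noteq> []"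
        unfolding Y_def by blast
      obtain y ys' where "ys = y # ys'" using t(2) by (cases ys) auto
      then have "N (car (cdr t)) (N (cdr (cdr t)) (car (car t))) = enc (x, s, y)" using t(1) by (simp add: enc3)
      then show "N (car (cdr t)) (N (cdr (cdr t)) (car (car t))) \<in> range (enc :: 'e \<times> 's \<times> 'a \<Rightarrow> tree)" by blast
    qed
  qed
  have G': "G' (N (enc (y # ys)) (N (enc x) (enc s))) = N (enc ys) (N (enc x) (enc (f x s y)))" for y ys x s
    by (simp add: G'_def enc3 F(2))
  have it: "(G' ^^ i) (N (enc ys) (N (enc x) (enc s))) = N (enc (drop i ys)) (N (enc x) (enc (foldl (f x) s (take i ys))))"
    if "i \<le> length ys" for i ys x s
    using that
  proof (induction i)
    case (Suc i)
    then have "drop i ys = ys ! i # drop (Suc i) ys" by (simp add: Cons_nth_drop_Suc)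
    then show ?case using Suc G'[simplified] by (simp add: take_Suc_conv_app_nth)
  qed simp
  \<comment> \<open>The list occurs twice: once as the loop counter and once as the data that the
    loop consumes.\<close>
  define Z where "Z t = N (X t) (N (X t) (N t (A t)))" for t
  have ZF: "FP (range (enc :: 'e \<Rightarrow> tree)) Z" unfolding Z_def by (intro FP_pair X A FP_id)
  have IF: "FP (Z ` range (enc :: 'e \<Rightarrow> tree)) (\<lambda>z. (G' ^^ tlen (car z)) (cdr z))"
  proof (rule FP_iter[OF GF, of "\<lambda>n. n + n + (n + 2) ^ kb + 2"])
    show "pb (\<lambda>n. n + n + (n + 2) ^ kb + 2)" by (intro pb_intros)
    fix z i assume "z \<in> Z ` range (enc :: 'e \<Rightarrow> tree)"
    then obtain x :: 'e where z: "z = N (enc (xs x)) (N (enc (xs x)) (N (enc x) (enc (a x))))" by (auto simp: Z_def X A)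
    show "(G' ^^ i) (cdr z) \<in> Y" if "i < tlen (car z)"
    proof -
      have "(G' ^^ i) (cdr z) = N (enc (drop i (xs x))) (N (enc x) (enc (foldl (f x) (a x) (take i (xs x)))))"
        "drop i (xs x) \<noteq> []" using that unfolding z by (simp_all add: it)
      then show ?thesis unfolding Y_def by auto
    qed
    show "tsize ((G' ^^ i) (cdr z)) \<le> tsize z + tsize z + (tsize z + 2) ^ kb + 2" if "i \<le> tlen (car z)"
    proof -
      have i: "i \<le> length (xs x)" using that z by simp
      have 1: "tsize (enc (drop i (xs x))) \<le> tsize (enc (xs x))"
        using esize_append[of "take i (xs x)" "drop i (xs x)"] esize_pos[of "take i (xs x)"] by (simp add: esize_def)
      have "tsize (enc (foldl (f x) (a x) (take i (xs x)))) \<le> (esize x + 2) ^ kb"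
        using bd[OF i] kb[of x] by (simp add: esize_def)
      also have "\<dots> \<le> (tsize z + 2) ^ kb" unfolding z by (intro power_mono) (auto simp: esize_def)
      finally show ?thesis using 1 i unfolding z by (simp add: it)
    qed
  qed
  show ?thesis
  proof (rule PTI[OF FP_comp[OF FP_comp[OF FP_cdr[of UNIV] FP_cdr[of UNIV]] FP_comp[OF IF ZF]]])
    fix x :: 'e
    show "cdr (cdr ((G' ^^ tlen (car (Z (enc x)))) (cdr (Z (enc x))))) = enc (foldl (f x) (a x) (xs x))"
      by (simp add: Z_def X A it)
  qed auto
qed

text \<open>For loops whose size bound needs to know more about the state than its size; the
  invariant may refer to the number of rounds made so far.\<close>

lemma PT_foldl_inv:
  fixes f :: "'e::enc \<Rightarrow> 's::enc \<Rightarrow> 'a::enc \<Rightarrow> 's"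
  assumes "PT (\<lambda>z. f (fst z) (fst (snd z)) (snd (snd z)))" "PT a" "PT xs" "PB b"
    and init: "\<And>x. I x 0 (a x)"
    and step: "\<And>x i s. i < length (xs x) \<Longrightarrow> I x i s \<Longrightarrow> I x (Suc i) (f x s (xs x ! i))"
    and bd: "\<And>x i s. i \<le> length (xs x) \<Longrightarrow> I x i s \<Longrightarrow> esize s \<le> b x"
  shows "PT (\<lambda>x. foldl (f x) (a x) (xs x))"
proof (rule PT_foldl[OF assms(1-4)])
  fix x i assume i: "i \<le> length (xs x)"
  have "I x i (foldl (f x) (a x) (take i (xs x)))" using i
    by (induction i) (auto simp: init take_Suc_conv_app_nth intro!: step)
  then show "esize (foldl (f x) (a x) (take i (xs x))) \<le> b x" using bd i by blast
qed

lemma PT_app2: "PT (\<lambda>z. g (fst z) (snd z)) \<Longrightarrow> PT f \<Longrightarrow> PT h \<Longrightarrow> PT (\<lambda>x. g (f x) (h x))"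
  using PT_comp[of "\<lambda>z. g (fst z) (snd z)" "\<lambda>x. (f x, h x)"] PT_Pair by auto

lemma PT_rev: fixes f :: "'a::enc \<Rightarrow> 'b::enc list" assumes "PT f" shows "PT (\<lambda>x. rev (f x))"
proof -
  have r: "foldl (\<lambda>s a. a # s) ys zs = rev zs @ ys" for ys zs :: "'b list" by (induction zs arbitrary: ys) auto
  have "PT (\<lambda>x. foldl (\<lambda>s a. a # s) [] (f x))"
    by (rule PT_foldl[where b = "\<lambda>x. esize (f x)"])
      (auto intro!: PT_Cons PT_snd PT_fst PT_id PT_const assms PB_intros simp: r esize_rev esize_take)
  then show ?thesis by (simp add: r)
qed

lemma PT_append: fixes f :: "'a::enc \<Rightarrow> 'b::enc list" assumes "PT f" "PT g" shows "PT (\<lambda>x. f x @ g x)"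
proof -
  have r: "foldl (\<lambda>s a. a # s) ys zs = rev zs @ ys" for ys zs :: "'b list" by (induction zs arbitrary: ys) auto
  have "PT (\<lambda>x. foldl (\<lambda>s a. a # s) (g x) (rev (f x)))"
  proof (rule PT_foldl[where b = "\<lambda>x. esize (f x) + esize (g x)"])
    fix x i
    show "esize (foldl (\<lambda>s a. a # s) (g x) (take i (rev (f x)))) \<le> esize (f x) + esize (g x)"
      using esize_append[of "rev (take i (rev (f x)))" "g x"] esize_take[of i "rev (f x)"] by (simp add: r esize_rev)
  qed (auto intro!: PT_Cons PT_snd PT_fst PT_id assms PB_intros PT_rev)
  then show ?thesis by (simp add: r)
qed

lemma PB_PT_over_list:
  assumes f: "PT (\<lambda>z. f (fst z) (snd z))" and xs: "PT xs"
  shows "\<exists>b. PB b \<and> (\<forall>x. \<forall>a\<in>set (xs x). esize (f x a) \<le> b x)"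
proof -
  obtain k where k: "\<And>z n. esize z \<le> n \<Longrightarrow> esize (f (fst z) (snd z)) \<le> (n + 2) ^ k" using PT_size[OF f] by blast
  have "esize (f x a) \<le> (1 + esize x + esize (xs x) + 2) ^ k" if "a \<in> set (xs x)" for x a
    using k[of "(x, a)" "1 + esize x + esize (xs x)"] esize_mem[OF that] by simp
  moreover have "PB (\<lambda>x. (1 + esize x + esize (xs x) + 2) ^ k)" by (intro PB_intros xs)
  ultimately show ?thesis by blast
qed

lemma PT_map:
  fixes f :: "'e::enc \<Rightarrow> 'a::enc \<Rightarrow> 'c::enc"
  assumes f: "PT (\<lambda>z. f (fst z) (snd z))" and xs: "PT xs" shows "PT (\<lambda>x. map (f x) (xs x))"
proof -
  have r: "foldl (\<lambda>s a. g a # s) [] zs = rev (map g zs)" for g :: "'a \<Rightarrow> 'c" and zs by (induction zs rule: rev_induct) auto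
  obtain b where b: "PB b" "\<And>x a. a \<in> set (xs x) \<Longrightarrow> esize (f x a) \<le> b x" using PB_PT_over_list[OF f xs] by blast
  have "PT (\<lambda>x. foldl (\<lambda>s a. f x a # s) [] (xs x))"
  proof (rule PT_foldl[where b = "\<lambda>x. 1 + esize (xs x) * (1 + b x)"])
    show "PT (\<lambda>z. f (fst z) (snd (snd z)) # fst (snd z))"
      by (intro PT_Cons PT_app2[OF f] PT_fst PT_snd PT_id)
    fix x i
    have "esize (rev (map (f x) (take i (xs x)))) \<le> 1 + length (take i (xs x)) * (1 + b x)"
      unfolding esize_rev using b(2) set_take_subset by (intro order_trans[OF esize_list_le[of _ "b x"]]) fastforce+
    also have "\<dots> \<le> 1 + esize (xs x) * (1 + b x)" using length_le_esize[of "xs x"] by (intro add_mono mult_le_mono) auto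
    finally show "esize (foldl (\<lambda>s a. f x a # s) [] (take i (xs x))) \<le> 1 + esize (xs x) * (1 + b x)" by (simp only: r)
  qed (auto intro!: PT_const xs PB_intros b)
  then show ?thesis using PT_rev[of "\<lambda>x. foldl (\<lambda>s a. f x a # s) [] (xs x)"] by (simp add: r)
qed

lemma PT_filter:
  fixes f :: "'e::enc \<Rightarrow> 'a::enc \<Rightarrow> bool"
  assumes f: "PT (\<lambda>z. f (fst z) (snd z))" and xs: "PT xs" shows "PT (\<lambda>x. filter (f x) (xs x))"
proof -
  have r: "foldl (\<lambda>s a. if g a then a # s else s) [] zs = rev (filter g zs)" for g :: "'a \<Rightarrow> bool" and zs by (induction zs rule: rev_induct) auto
  have e: "esize (filter g zs) \<le> esize zs" for g :: "'a \<Rightarrow> bool" and zs by (induction zs) auto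
  have "PT (\<lambda>x. foldl (\<lambda>s a. if f x a then a # s else s) [] (xs x))"
  proof (rule PT_foldl[where b = "\<lambda>x. esize (xs x)"])
    show "PT (\<lambda>z. if f (fst z) (snd (snd z)) then snd (snd z) # fst (snd z) else fst (snd z))"
      by (intro PT_if PT_Cons PT_app2[OF f] PT_fst PT_snd PT_id)
    show "esize (foldl (\<lambda>s a. if f x a then a # s else s) [] (take i (xs x))) \<le> esize (xs x)" for x i
      unfolding r esize_rev using e esize_take order_trans by blast
  qed (auto intro!: PT_const xs PB_intros)
  then show ?thesis using PT_rev[of "\<lambda>x. foldl (\<lambda>s a. if f x a then a # s else s) [] (xs x)"] by (simp add: r)
qed

lemma PT_concat: fixes xss :: "'a::enc \<Rightarrow> 'b::enc list list" assumes "PT xss" shows "PT (\<lambda>x. concat (xss x))"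
proof -
  have r: "foldl (\<lambda>s a. s @ a) [] zs = concat zs" for zs :: "'b list list" by (induction zs rule: rev_induct) auto
  have e: "esize (concat zs) \<le> esize zs" for zs :: "'b list list"
  proof (induction zs)
    case (Cons z zs) then show ?case using esize_append[of z "concat zs"] by simp
  qed simp
  have "PT (\<lambda>x. foldl (\<lambda>s a. s @ a) [] (xss x))"
    by (rule PT_foldl[where b = "\<lambda>x. esize (xss x)"])
      (auto simp: r intro!: PT_append PT_snd PT_fst PT_id PT_const assms PB_intros order_trans[OF e] esize_take)
  then show ?thesis by (simp add: r)
qed

lemma PT_list_ex: assumes f: "PT (\<lambda>z. f (fst z) (snd z))" and xs: "PT xs" shows "PT (\<lambda>x. \<exists>a\<in>set (xs x). f x a)"
proof -
  have "(\<exists>a\<in>set (xs x). f x a) \<longleftrightarrow> \<not> filter (f x) (xs x) = []" for x by (auto simp: filter_empty_conv)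
  then show ?thesis using PT_not[OF PT_null[OF PT_filter[OF f xs]]] by simp
qed

section \<open>Arithmetic on binary numbers\<close>

lemma bits_pos: "n > 0 \<Longrightarrow> bits n = odd n # bits (n div 2)"
  by (cases n) auto

lemma bits_eq_Nil: "bits n = [] \<longleftrightarrow> n = 0" by (cases n) auto

lemma length_bits_le: "length (bits n) \<le> k \<longleftrightarrow> n < 2 ^ k"
proof (induction k arbitrary: n)
  case 0
  then show ?case by (auto simp: bits_eq_Nil)
next
  case (Suc k)
  show ?case
  proof (cases "n = 0")
    case False
    then have "length (bits n) \<le> Suc k \<longleftrightarrow> n div 2 < 2 ^ k" using Suc by (simp add: bits_pos)
    then show ?thesis by auto
  qed auto
qed

lemma less_power_length_bits: "n < 2 ^ length (bits n)" using length_bits_le by blast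

lemma length_bits_mono: "m \<le> n \<Longrightarrow> length (bits m) \<le> length (bits n)"
  using length_bits_le less_power_length_bits le_less_trans by blast

lemma length_bits_mult: "length (bits (a * b)) \<le> length (bits a) + length (bits b)"
  unfolding length_bits_le power_add by (intro mult_strict_mono' less_power_length_bits) auto

lemma length_bits_add: "length (bits (a + b)) \<le> length (bits a) + length (bits b)"
proof (cases "a = 0 \<or> b = 0")
  case False
  then have "1 \<le> length (bits a)" "1 \<le> length (bits b)" by (auto simp: bits_eq_Nil One_nat_def Suc_le_eq)
  then have "(2::nat) ^ length (bits a) \<ge> 2 ^ 1" "(2::nat) ^ length (bits b) \<ge> 2 ^ 1" by (simp_all only: power_increasing one_le_numeral)
  then have "(2::nat) ^ length (bits a) + 2 ^ length (bits b) \<le> 2 ^ length (bits a) * 2 ^ length (bits b)"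
    by (auto simp: algebra_simps dest!: le_Suc_ex)
  then show ?thesis
    unfolding length_bits_le power_add using less_power_length_bits[of a] less_power_length_bits[of b] by linarith
qed auto

lemma esize_nat_le: "esize (n::nat) \<le> 4 * length (bits n) + 1"
proof -
  have "esize (bits n) \<le> 1 + length (bits n) * (1 + 3)" by (rule esize_list_le) (rule esize_bool)
  then show ?thesis by (simp add: esize_def enc_nat_def)
qed

lemma length_bits_le_esize: "length (bits n) \<le> esize n"
  using length_le_esize[of "bits n"] by (simp add: esize_def enc_nat_def)

lemma esize_nat_mono: "m \<le> n \<Longrightarrow> esize m \<le> 4 * esize (n::nat) + 1"
  using esize_nat_le[of m] length_bits_mono[of m n] length_bits_le_esize[of n] by linarith

definition nat_cons :: "nat \<Rightarrow> bool \<Rightarrow> nat" where "nat_cons n b = of_bool b + 2 * n"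

lemma bits_nat_cons: "bits (nat_cons n b) = (if \<not> b \<and> n = 0 then [] else b # bits n)"
  by (cases b) (auto simp: nat_cons_def bits_pos)

lemma PT_bits: "PT f \<Longrightarrow> PT (\<lambda>x. bits (f x))"
  by (rule PT_comp[of bits]) (rule PTI[OF FP_id], simp add: enc_nat_def)

lemma PT_eq_0: "PT f \<Longrightarrow> PT (\<lambda>x. f x = (0::nat))"
  using PT_null[OF PT_bits, of f] by (simp add: bits_eq_Nil)

lemma PT_odd: "PT f \<Longrightarrow> PT (\<lambda>x. odd (f x :: nat))"
proof -
  assume "PT f"
  have "odd n = hdd False (bits n)" for n by (cases n) (auto simp: hdd_def)
  then show ?thesis using PT_hdd[OF PT_bits[OF \<open>PT f\<close>]] by simp
qed

lemma PT_div2: "PT f \<Longrightarrow> PT (\<lambda>x. f x div (2::nat))"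
proof (rule PT_comp[of "\<lambda>n. n div 2"])
  have "tl (bits n) = bits (n div 2)" for n by (cases n) auto
  then have "cdr (enc n) = enc (n div 2)" for n :: nat
    unfolding enc_nat_def by (metis cdr.simps enc_list.simps list.collapse list.sel(2))
  then show "PT (\<lambda>n::nat. n div 2)" by (intro PTI[OF FP_cdr])
qed

lemma PT_nat_cons: assumes "PT f" "PT b" shows "PT (\<lambda>x. nat_cons (f x) (b x))"
proof -
  \<comment> \<open>\<open>?c\<close> is a leaf exactly if the bit is \<open>False\<close> and the
    number is 0. Then the result must be the empty list, since encodings of numbers have no leading
    zero bit.\<close>
  let ?c = "\<lambda>t. if car t = L then cdr t else N L L"
  have c: "FP UNIV ?c" by (intro FP_if FP_car FP_cdr FP_const)
  have z: "enc n = L \<longleftrightarrow> n = 0" for n :: nat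
    unfolding enc_nat_def by (cases n) auto
  have "PT (\<lambda>p. nat_cons (snd p) (fst p))"
  proof (rule PTI[OF FP_if[OF FP_subset[OF c] FP_const[of _ L] FP_id]])
    fix p :: "bool \<times> nat"
    show "(if ?c (enc p) = L then L else enc p) = enc (nat_cons (snd p) (fst p))"
      using z[of "snd p"] by (cases p) (auto simp: enc_prod_def enc_nat_def bits_nat_cons enc_bool_def)
  qed simp
  from PT_comp[OF this PT_Pair[OF assms(2,1)]] show ?thesis by simp
qed

lemma half_bit: "2 * (m div 2) + of_bool (odd m) = (m::nat)"
  by (cases "odd m") (auto elim!: oddE evenE)

text \<open>The most significant bit comes first, which is the order in which bits pile up when they
  are produced from the lowest on.\<close>

definition rval :: "bool list \<Rightarrow> nat" where "rval out = foldl nat_cons 0 out"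

lemma rval_Cons: "rval (b # out) = of_bool b * 2 ^ length out + rval out"
proof -
  have "foldl nat_cons n out = n * 2 ^ length out + foldl nat_cons 0 out" for n
  proof (induction out arbitrary: n)
    case (Cons a out)
    show ?case using Cons[of "nat_cons n a"] Cons[of "nat_cons 0 a"] by (simp add: nat_cons_def algebra_simps)
  qed simp
  from this[of "of_bool b"] show ?thesis by (simp add: rval_def nat_cons_def)
qed

lemma rval_less: "rval out < 2 ^ length out"
  by (induction out) (auto simp: rval_Cons, simp add: rval_def)

lemma PT_rval: assumes "PT f" shows "PT (\<lambda>x. rval (f x))"
  unfolding rval_def
proof (rule PT_foldl[where b = "\<lambda>x. 4 * esize (f x) + 1"])
  fix x i
  have "length (bits (rval (take i (f x)))) \<le> length (take i (f x))" unfolding length_bits_le by (rule rval_less)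
  then show "esize (foldl nat_cons 0 (take i (f x))) \<le> 4 * esize (f x) + 1"
    using esize_nat_le[of "rval (take i (f x))"] length_le_esize[of "f x"] unfolding rval_def by simp
qed (intro PT_nat_cons PT_fst PT_snd PT_id PT_const assms PB_intros)+

text \<open>Ripple-carry addition and subtraction; \<open>t\<close> distinguishes the borrow from the carry.\<close>

definition ripple :: "bool \<Rightarrow> nat \<times> nat \<times> bool \<times> bool list \<Rightarrow> nat \<times> nat \<times> bool \<times> bool list" where
  "ripple t s = (fst s div 2, fst (snd s) div 2,
     (if odd (fst s) = t then odd (fst (snd s)) \<and> fst (snd (snd s)) else odd (fst (snd s)) \<or> fst (snd (snd s))),
     ((odd (fst s) = odd (fst (snd s))) = fst (snd (snd s))) # snd (snd (snd s)))"

text \<open>The list serves as a counter. It is longer than both operands together, so the extra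
  round absorbs the last carry.\<close>

definition ripples :: "bool \<Rightarrow> nat \<Rightarrow> nat \<Rightarrow> nat \<times> nat \<times> bool \<times> bool list" where
  "ripples t a b = foldl (\<lambda>s u. ripple t s) (a, b, False, []) (bits a @ bits b @ [True])"

lemma digit_shift: "X = e + 2 * Y \<Longrightarrow> r + w * X = D \<Longrightarrow> e * w + r + 2 * w * Y = (D :: 'a::comm_semiring_1)"
  by (auto simp: algebra_simps)

text \<open>Loop invariant: the bits produced so far plus a power of two times what remains of the
  operands and the carry give the result. For subtraction it is stated over the integers, where it
  also covers negative differences.\<close>

lemma foldl_ripple_inv:
  fixes xs :: "bool list" and a b :: nat and t :: bool
  defines "s \<equiv> foldl (\<lambda>s u. ripple t s) (a, b, False, []) xs"
  shows "fst s = a div 2 ^ length xs" "fst (snd s) = b div 2 ^ length xs" "length (snd (snd (snd s))) = length xs"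
    "\<not> t \<Longrightarrow> rval (snd (snd (snd s))) + 2 ^ length xs * (fst s + fst (snd s) + of_bool (fst (snd (snd s)))) = a + b"
    "t \<Longrightarrow> int (rval (snd (snd (snd s)))) + 2 ^ length xs * (int (fst s) - int (fst (snd s)) - of_bool (fst (snd (snd s)))) = int a - int b"
proof -
  have "fst s = a div 2 ^ length xs \<and> fst (snd s) = b div 2 ^ length xs \<and> length (snd (snd (snd s))) = length xs \<and>
    (\<not> t \<longrightarrow> rval (snd (snd (snd s))) + 2 ^ length xs * (fst s + fst (snd s) + of_bool (fst (snd (snd s)))) = a + b) \<and>
    (t \<longrightarrow> int (rval (snd (snd (snd s)))) + 2 ^ length xs * (int (fst s) - int (fst (snd s)) - of_bool (fst (snd (snd s)))) = int a - int b)"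
    unfolding s_def
  proof (induction xs rule: rev_induct)
    case Nil
    show ?case by (simp add: rval_def)
  next
    case (snoc x xs)
    obtain a1 b1 c1 o1 where s1: "foldl (\<lambda>s u. ripple t s) (a, b, False, []) xs = (a1, b1, c1, o1)" by (metis surj_pair)
    have IH: "a1 = a div 2 ^ length xs" "b1 = b div 2 ^ length xs" "length o1 = length xs"
      "\<not> t \<Longrightarrow> rval o1 + 2 ^ length xs * (a1 + b1 + of_bool c1) = a + b"
      "t \<Longrightarrow> int (rval o1) + 2 ^ length xs * (int a1 - int b1 - of_bool c1) = int a - int b"
      using snoc unfolding s1 by auto
    have ab: "a1 = 2 * (a1 div 2) + of_bool (odd a1)" "b1 = 2 * (b1 div 2) + of_bool (odd b1)" using half_bit by metis+
    have s1a: "\<not> t \<Longrightarrow> a1 + b1 + of_bool c1 = of_bool ((odd a1 = odd b1) = c1) +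
        2 * (a1 div 2 + b1 div 2 + of_bool (if odd a1 = t then odd b1 \<and> c1 else odd b1 \<or> c1))"
      by (subst (1) ab(1), subst (1) ab(2)) (cases "odd a1"; cases "odd b1"; cases c1; simp)
    have 1: "\<not> t \<Longrightarrow> of_bool ((odd a1 = odd b1) = c1) * 2 ^ length xs + rval o1 + 2 * 2 ^ length xs *
        (a1 div 2 + b1 div 2 + of_bool (if odd a1 = t then odd b1 \<and> c1 else odd b1 \<or> c1)) = a + b"
      by (rule digit_shift[OF s1a IH(4)])
    have iab: "int a1 = 2 * int (a1 div 2) + of_bool (odd a1)" "int b1 = 2 * int (b1 div 2) + of_bool (odd b1)"
      using ab by (metis of_nat_add of_nat_mult of_nat_numeral of_nat_of_bool)+
    have s2a: "t \<Longrightarrow> int a1 - int b1 - of_bool c1 = of_bool ((odd a1 = odd b1) = c1) +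
        2 * (int (a1 div 2) - int (b1 div 2) - of_bool (if odd a1 = t then odd b1 \<and> c1 else odd b1 \<or> c1))"
      by (subst (1) iab(1), subst (1) iab(2)) (cases "odd a1"; cases "odd b1"; cases c1; simp)
    have 2: "t \<Longrightarrow> of_bool ((odd a1 = odd b1) = c1) * 2 ^ length xs + int (rval o1) + 2 * 2 ^ length xs *
        (int (a1 div 2) - int (b1 div 2) - of_bool (if odd a1 = t then odd b1 \<and> c1 else odd b1 \<or> c1)) = int a - int b"
      by (rule digit_shift[OF s2a IH(5)])
    have 3: "a1 div 2 = a div 2 ^ length (xs @ [x])" "b1 div 2 = b div 2 ^ length (xs @ [x])"
      unfolding IH(1,2) by (simp_all add: div_mult2_eq[symmetric] mult.commute)
    define e c2 where "e = ((odd a1 = odd b1) = c1)" and "c2 = (if odd a1 = t then odd b1 \<and> c1 else odd b1 \<or> c1)"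
    have fl: "foldl (\<lambda>s u. ripple t s) (a, b, False, []) (xs @ [x]) = (a1 div 2, b1 div 2, c2, e # o1)"
      unfolding foldl_append s1 by (simp add: ripple_def e_def c2_def)
    show ?case unfolding fl fst_conv snd_conv using 1[folded e_def c2_def] 2[folded e_def c2_def] 3 IH(3) by (simp add: rval_Cons)
  qed
  then show "fst s = a div 2 ^ length xs" "fst (snd s) = b div 2 ^ length xs" "length (snd (snd (snd s))) = length xs"
    "\<not> t \<Longrightarrow> rval (snd (snd (snd s))) + 2 ^ length xs * (fst s + fst (snd s) + of_bool (fst (snd (snd s)))) = a + b"
    "t \<Longrightarrow> int (rval (snd (snd (snd s)))) + 2 ^ length xs * (int (fst s) - int (fst (snd s)) - of_bool (fst (snd (snd s)))) = int a - int b"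
    by auto
qed

text \<open>After more rounds than either operand has bits, only the last carry or borrow is in
  doubt. A carry would make the sum at least \<open>2 ^ ?k\<close>; a borrow means
  \<open>a < b\<close>, where truncated subtraction gives 0.\<close>

lemma ripples_add: "rval (snd (snd (snd (ripples False a b)))) = a + b"
  and ripples_sub: "(if fst (snd (snd (ripples True a b))) then 0 else rval (snd (snd (snd (ripples True a b))))) = a - b"
proof -
  let ?xs = "bits a @ bits b @ [True]"
  let ?k = "length ?xs"
  have "a < 2 ^ length (bits a)" "b < 2 ^ length (bits b)" by (rule less_power_length_bits)+
  moreover have "(2::nat) ^ length (bits a) \<le> 2 ^ (?k - 1)" "(2::nat) ^ length (bits b) \<le> 2 ^ (?k - 1)" by (rule power_increasing; simp)+
  moreover have "(2::nat) ^ ?k = 2 ^ (?k - 1) + 2 ^ (?k - 1)" by simp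
  ultimately have k: "a < 2 ^ ?k" "b < 2 ^ ?k" "a + b < 2 ^ ?k" by linarith+
  note F = foldl_ripple_inv[where xs = ?xs and a = a and b = b, folded ripples_def]
  show "rval (snd (snd (snd (ripples False a b)))) = a + b"
  proof (cases "fst (snd (snd (ripples False a b)))")
    case True
    define X where "X = fst (ripples False a b) + fst (snd (ripples False a b)) + of_bool (fst (snd (snd (ripples False a b))))"
    have "2 ^ ?k * X \<le> a + b" using F(4)[of False] unfolding X_def by (metis le_add2)
    moreover have "2 ^ ?k * 1 \<le> 2 ^ ?k * X" using True unfolding X_def by (intro mult_le_mono2) simp
    ultimately show ?thesis using k by linarith
  next
    case False
    then show ?thesis using F(1,2,4)[of False] k by simp
  qed
  have "int (rval (snd (snd (snd (ripples True a b))))) - 2 ^ ?k * of_bool (fst (snd (snd (ripples True a b)))) = int a - int b"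
    using F(1,2,5)[of True] k by simp
  moreover have "int (rval (snd (snd (snd (ripples True a b))))) < 2 ^ ?k"
    using rval_less[of "snd (snd (snd (ripples True a b)))"] F(3)[of True] by (metis of_nat_less_iff of_nat_numeral of_nat_power)
  ultimately show "(if fst (snd (snd (ripples True a b))) then 0 else rval (snd (snd (snd (ripples True a b))))) = a - b"
    by (auto split: if_splits)
qed

lemma PT_ripples: assumes "PT f" "PT g" shows "PT (\<lambda>x. ripples t (f x) (g x))"
  unfolding ripples_def
proof (rule PT_foldl[where b = "\<lambda>x. 1 + (4 * esize (f x) + 1) + (1 + (4 * esize (g x) + 1) + (1 + 3 + (1 + (esize (f x) + esize (g x) + 1) * (1 + 3))))"])
  show "PT (\<lambda>z. ripple t (fst (snd z)))" unfolding ripple_def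
    by (intro PT_Pair PT_Cons PT_if PT_iff PT_conj PT_disj PT_odd PT_div2 PT_fst PT_snd PT_id PT_const)
  fix x i
  let ?ys = "take i (bits (f x) @ bits (g x) @ [True])"
  note F = foldl_ripple_inv[where xs = ?ys and a = "f x" and b = "g x" and t = t]
  obtain a1 b1 c1 o1 where s1: "foldl (\<lambda>s u. ripple t s) (f x, g x, False, []) ?ys = (a1, b1, c1, o1)" by (metis surj_pair)
  have "a1 \<le> f x" "b1 \<le> g x" "length o1 = length ?ys" using F(1-3) unfolding s1 by auto
  moreover have "length ?ys \<le> length (bits (f x) @ bits (g x) @ [True])" unfolding length_take by (rule min.cobounded1)
  ultimately have "a1 \<le> f x" "b1 \<le> g x" "length o1 \<le> esize (f x) + esize (g x) + 1"
    using length_bits_le_esize[of "f x"] length_bits_le_esize[of "g x"] by (simp_all add: One_nat_def)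
  moreover have "esize o1 \<le> 1 + length o1 * (1 + 3)" by (rule esize_list_le) (rule esize_bool)
  ultimately show "esize (foldl (\<lambda>s u. ripple t s) (f x, g x, False, []) ?ys) \<le>
    1 + (4 * esize (f x) + 1) + (1 + (4 * esize (g x) + 1) + (1 + 3 + (1 + (esize (f x) + esize (g x) + 1) * (1 + 3))))"
    unfolding s1 using esize_nat_mono[of a1 "f x"] esize_nat_mono[of b1 "g x"] esize_bool[of c1] by simp
qed (intro PT_Pair PT_append PT_bits PT_const assms PB_intros)+

lemma PT_add: "PT f \<Longrightarrow> PT g \<Longrightarrow> PT (\<lambda>x. f x + g x :: nat)"
  using PT_rval[OF PT_snd[OF PT_snd[OF PT_snd[OF PT_ripples[of f g False]]]]] by (simp only: ripples_add)

lemma PT_sub: assumes "PT f" "PT g" shows "PT (\<lambda>x. f x - g x :: nat)"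
proof -
  have r: "PT (\<lambda>x. ripples True (f x) (g x))" by (rule PT_ripples[OF assms])
  show ?thesis
    using PT_if[OF PT_fst[OF PT_snd[OF PT_snd[OF r]]] PT_const[of 0] PT_rval[OF PT_snd[OF PT_snd[OF PT_snd[OF r]]]]]
    by (simp only: ripples_sub)
qed

lemma PT_le: "PT f \<Longrightarrow> PT g \<Longrightarrow> PT (\<lambda>x. f x \<le> (g x :: nat))"
  using PT_eq_0[OF PT_sub, of f g] by simp
lemma PT_less: "PT f \<Longrightarrow> PT g \<Longrightarrow> PT (\<lambda>x. f x < (g x :: nat))"
  using PT_not[OF PT_le[of g f]] by (simp only: not_le)
lemma PT_eq: "PT f \<Longrightarrow> PT g \<Longrightarrow> PT (\<lambda>x. f x = (g x :: nat))"
  using PT_conj[OF PT_le[of f g] PT_le[of g f]] by (simp only: order_eq_iff)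
lemma PT_min: "PT f \<Longrightarrow> PT g \<Longrightarrow> PT (\<lambda>x. min (f x) (g x :: nat))"
  unfolding min_def by (intro PT_if PT_le)

lemma PT_mult: assumes "PT f" "PT g" shows "PT (\<lambda>x. f x * g x :: nat)"
proof -
  have m: "foldl (\<lambda>s b. s + s + (if b then c else 0)) 0 (rev (bits n)) = n * c" for n c :: nat
  proof -
    have "foldr (\<lambda>b s. s + s + (if b then c else 0)) (bits n) 0 = n * c"
    proof (induction n rule: bits.induct)
      case (2 n)
      have "2 * (Suc n div 2) + of_bool (odd (Suc n)) = Suc n" by (rule half_bit)
      then have "(2 * (Suc n div 2) + of_bool (odd (Suc n))) * c = Suc n * c" by presburger
      moreover have "k * c + k * c + (if b then c else 0) = (2 * k + of_bool b) * c" for k b by (auto simp: algebra_simps)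
      ultimately show ?case unfolding bits.simps foldr.simps o_apply 2 by metis
    qed simp
    then show ?thesis by (simp add: foldr_conv_foldl)
  qed
  have "PT (\<lambda>x. foldl (\<lambda>s b. s + s + (if b then g x else 0)) 0 (rev (bits (f x))))"
  \<comment> \<open>Horner's scheme maps \<open>s\<close> to at most \<open>2 * s + g x\<close>. The
    added \<open>g x\<close> makes the bound exactly double in each round and hence
    inductive.\<close>
  proof (rule PT_foldl_inv[where I = "\<lambda>x i s. s + g x \<le> 2 ^ i * g x" and b = "\<lambda>x. 4 * (esize (f x) + esize (g x)) + 1"])
    fix x i s assume i: "i \<le> length (rev (bits (f x)))" "s + g x \<le> 2 ^ i * g x"
    have "s < 2 ^ (i + length (bits (g x)))"
    proof (cases "g x = 0")
      case False
      have "2 ^ i * g x < 2 ^ i * 2 ^ length (bits (g x))" using less_power_length_bits by simp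
      moreover have "s \<le> 2 ^ i * g x" using i(2) by linarith
      ultimately show ?thesis unfolding power_add by linarith
    qed (use i in simp)
    then have "length (bits s) \<le> i + length (bits (g x))" by (simp add: length_bits_le)
    then show "esize s \<le> 4 * (esize (f x) + esize (g x)) + 1"
      using esize_nat_le[of s] length_bits_le_esize[of "f x"] length_bits_le_esize[of "g x"] i(1) by simp
  qed (intro PT_add PT_if PT_fst PT_snd PT_id PT_const PT_comp[OF assms(2)] PT_rev PT_bits assms PB_intros | simp)+
  then show ?thesis by (simp only: m)
qed

lemma PT_sum_list: assumes "PT f" shows "PT (\<lambda>x. sum_list (f x :: nat list))"
proof -
  have b: "length (bits (sum_list xs)) \<le> esize xs" for xs :: "nat list"
  proof (induction xs)
    case (Cons a xs)
    then show ?case using length_bits_add[of a "sum_list xs"] length_bits_le_esize[of a] by simp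
  qed simp
  have s: "foldl (+) 0 xs = sum_list xs" for xs :: "nat list" by (induction xs rule: rev_induct) auto
  have "PT (\<lambda>x. foldl (+) 0 (f x))"
  proof (rule PT_foldl[where b = "\<lambda>x. 4 * esize (f x) + 1"])
    show "esize (foldl (+) 0 (take i (f x))) \<le> 4 * esize (f x) + 1" for x i
      using esize_nat_le[of "sum_list (take i (f x))"] b[of "take i (f x)"] esize_take[of i "f x"] unfolding s by simp
  qed (intro PT_add PT_fst PT_snd PT_id PT_const assms PB_intros)+
  then show ?thesis by (simp only: s)
qed

definition nthd :: "'a \<Rightarrow> 'a list \<Rightarrow> nat \<Rightarrow> 'a" where "nthd d xs i = (if i < length xs then xs ! i else d)"

lemma PT_nthd:
  fixes f :: "'e::enc \<Rightarrow> 'a::enc list"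
  assumes "PT f" "PT g" shows "PT (\<lambda>x. nthd d (f x) (g x))"
proof -
  let ?h = "\<lambda>j (s::nat\<times>'a) a. (fst s + 1, if fst s = j then a else snd s)"
  have f: "foldl (?h j) (0, d) xs = (length xs, nthd d xs j)" for xs j
    by (induction xs rule: rev_induct) (auto simp: nthd_def nth_append)
  have "PT (\<lambda>x. foldl (?h (g x)) (0, d) (f x))"
  proof (rule PT_foldl[where b = "\<lambda>x. 1 + (4 * esize (f x) + 1) + (esize d + esize (f x))"])
    show "PT (\<lambda>z. ?h (g (fst z)) (fst (snd z)) (snd (snd z)))"
      by (intro PT_Pair PT_add PT_if PT_eq PT_comp[OF assms(2)] PT_fst PT_snd PT_id PT_const)
    fix x i
    have "esize (nthd d (take i (f x)) (g x)) \<le> esize d + esize (f x)"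
      unfolding nthd_def using esize_mem[of _ "f x"] by (auto intro: trans_le_add2)
    moreover have "length (bits (length (take i (f x)))) \<le> esize (f x)"
      using length_le_esize[of "f x"] by (simp add: length_bits_le less_exp le_less_trans[OF _ less_exp] min.coboundedI1)
    ultimately show "esize (foldl (?h (g x)) (0, d) (take i (f x))) \<le> 1 + (4 * esize (f x) + 1) + (esize d + esize (f x))"
      unfolding f using esize_nat_le[of "length (take i (f x))"] by (simp only: esize_simps)
  qed (intro PT_const assms PB_intros)+
  then show ?thesis using PT_snd[of "\<lambda>x. foldl (?h (g x)) (0, d) (f x)"] by (simp add: f)
qed

text \<open>A range up to a number given in binary would be exponentially long; ranges are therefore
  formed only up to the length of a list that is already present.\<close>

lemma PT_upt: fixes f :: "'e::enc \<Rightarrow> 'a::enc list" assumes "PT f" shows "PT (\<lambda>x. [0..<length (f x)])"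
proof -
  let ?h = "\<lambda>(s::nat\<times>nat list) a. (fst s + 1, snd s @ [fst s])"
  have f: "foldl ?h (0, []) xs = (length xs, [0..<length xs])" for xs :: "'a list"
    by (induction xs rule: rev_induct) auto
  have k: "esize k \<le> 4 * b + 1" if "k \<le> b" for k b :: nat
    using esize_nat_le[of k] that le_less_trans[OF that less_exp[of b]] length_bits_le[of k b] by linarith
  have "PT (\<lambda>x. foldl ?h (0, []) (f x))"
  proof (rule PT_foldl[where b = "\<lambda>x. 1 + (4 * esize (f x) + 1) + (1 + esize (f x) * (1 + (4 * esize (f x) + 1)))"])
    fix x i
    have l: "length (take i (f x)) \<le> esize (f x)" using length_le_esize[of "f x"] by simp
    have "esize [0..<length (take i (f x))] \<le> 1 + length [0..<length (take i (f x))] * (1 + (4 * esize (f x) + 1))"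
      by (rule esize_list_le) (use l in \<open>auto intro!: k\<close>)
    also have "\<dots> \<le> 1 + esize (f x) * (1 + (4 * esize (f x) + 1))" using l by (intro add_mono mult_le_mono) auto
    finally show "esize (foldl ?h (0, []) (take i (f x))) \<le> 1 + (4 * esize (f x) + 1) + (1 + esize (f x) * (1 + (4 * esize (f x) + 1)))"
      unfolding f using k[OF l] by (simp only: esize_simps)
  qed (intro PT_Pair PT_append PT_Cons PT_add PT_fst PT_snd PT_id PT_const assms PB_intros)+
  then show ?thesis using PT_snd[of "\<lambda>x. foldl ?h (0, []) (f x)"] by (simp add: f)
qed

definition argmin :: "'a \<Rightarrow> ('a \<Rightarrow> nat) \<Rightarrow> 'a list \<Rightarrow> 'a" where
  "argmin d k xs = foldl (\<lambda>s a. if k a < k s then a else s) (hdd d xs) xs"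

lemma argmin_foldl:
  "foldl (\<lambda>s a. if k a < k s then a else s) s xs \<in> insert s (set xs) \<and>
   (\<forall>a\<in>insert s (set xs). k (foldl (\<lambda>s a. if k a < k s then a else s) s xs) \<le> (k a :: nat))"
  by (induction xs arbitrary: s) (auto split: if_splits, (meson order_trans not_le less_imp_le)+)

lemma argmin_in: "xs \<noteq> [] \<Longrightarrow> argmin d k xs \<in> set xs"
  and argmin_le: "a \<in> set xs \<Longrightarrow> k (argmin d k xs) \<le> k a"
  using argmin_foldl[of k "hdd d xs" xs] unfolding argmin_def by (auto simp: hdd_def split: list.splits)

lemma PT_argmin:
  fixes f :: "'e::enc \<Rightarrow> 'a::enc list"
  assumes k: "PT (\<lambda>z. k (fst z) (snd z))" and f: "PT f" shows "PT (\<lambda>x. argmin d (k x) (f x))"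
  unfolding argmin_def
proof (rule PT_foldl[where b = "\<lambda>x. esize d + esize (f x)"])
  show "PT (\<lambda>z. if k (fst z) (snd (snd z)) < k (fst z) (fst (snd z)) then snd (snd z) else fst (snd z))"
    by (intro PT_if PT_less PT_app2[OF k] PT_fst PT_snd PT_id)
  fix x i
  have "foldl (\<lambda>s a. if k x a < k x s then a else s) (hdd d (f x)) (take i (f x)) \<in> insert d (set (f x))"
    using argmin_foldl[of "k x" "hdd d (f x)" "take i (f x)"] set_take_subset[of i "f x"]
    by (auto simp: hdd_def split: list.splits)
  then show "esize (foldl (\<lambda>s a. if k x a < k x s then a else s) (hdd d (f x)) (take i (f x))) \<le> esize d + esize (f x)"
    using esize_mem[of _ "f x"] by (auto intro: trans_le_add2)
qed (intro PT_hdd f PB_intros)+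

section \<open>Input and output\<close>

text \<open>There are only a handful of tape symbols, so unary is affordable, and a constant number
  of pops decodes one symbol.\<close>

definition uns :: "nat \<Rightarrow> unit list" where "uns a = replicate a ()"

lemma enc_uns: "enc (uns 0) = L" "enc (uns (Suc a)) = N L (enc (uns a))"
  by (simp_all add: uns_def enc_unit_def)

definition read_sym :: "nat \<Rightarrow> com" where
  "read_sym a = Pop 0 ;; pushes (2 # code (enc (uns a)))"

definition read_input :: com where
  "read_input = Push 1 1 ;; While 0 0 (If 0 1 (read_sym 1) (If 0 2 (read_sym 2) (If 0 3 (read_sym 3) (If 0 4 (read_sym 4) (read_sym 5)))))"

lemma runs_read_sym: "a \<le> 5 \<Longrightarrow> runs (read_sym a) (stk (a # as) m [] []) 20 (stk as ((2 # code (enc (uns a))) @ m) [] [])"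
proof -
  assume a: "a \<le> 5"
  have l: "length (code (enc (uns a))) = 2 * a + 1" by (induction a) (auto simp: enc_uns)
  have "runs (Pop 0) (stk (a # as) m [] []) 1 (stk as m [] [])" using runs_Pop[of 0 "stk (a # as) m [] []"] by simp
  from runs_Seq[OF this runs_pushes] show ?thesis unfolding read_sym_def
    by (rule runs_mono) (use a in \<open>simp add: l\<close>)
qed

text \<open>The last input symbol is on top of stack 0, so consing symbol by symbol builds the list
  in the original order.\<close>

lemma runs_read_loop:
  assumes "\<forall>a\<in>set w. 0 < a \<and> a < 6"
  shows "runs (While 0 0 (If 0 1 (read_sym 1) (If 0 2 (read_sym 2) (If 0 3 (read_sym 3) (If 0 4 (read_sym 4) (read_sym 5))))))
    (stk (rev w) (code (enc (map uns v))) [] []) (30 * length w + 1) (stk [] (code (enc (map uns (w @ v)))) [] [])"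
  using assms
proof (induction w arbitrary: v rule: rev_induct)
  case Nil
  then show ?case using runs_WhileF[of 0 "stk [] (code (enc (map uns v))) [] []" 0] by (simp add: top_def)
next
  case (snoc a w)
  let ?s = "stk (rev (w @ [a])) (code (enc (map uns v))) [] []"
  let ?s' = "stk (rev w) (code (enc (map uns (a # v)))) [] []"
  have a: "0 < a" "a < 6" using snoc.prems by auto
  have r: "runs (read_sym a) ?s 20 ?s'" using runs_read_sym[of a "rev w"] a by simp
  have t: "top 0 ?s = a" by (simp add: top_def)
  have "runs (If 0 1 (read_sym 1) (If 0 2 (read_sym 2) (If 0 3 (read_sym 3) (If 0 4 (read_sym 4) (read_sym 5))))) ?s 28 ?s'"
  proof -
    have choice: "runs (If 0 b (read_sym b) c) ?s (T + 2) ?s'" if "20 \<le> T" "a \<noteq> b \<Longrightarrow> runs c ?s T ?s'" for b c T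
    proof (cases "a = b")
      case True
      then show ?thesis using runs_IfT'[OF t] r that(1) by simp
    next
      case False
      then show ?thesis using runs_IfF[of 0 ?s b] t that(2) by simp
    qed
    have "a \<in> {1, 2, 3, 4, 5}" using a by auto
    then have "runs (If 0 1 (read_sym 1) (If 0 2 (read_sym 2) (If 0 3 (read_sym 3) (If 0 4 (read_sym 4) (read_sym 5))))) ?s (20 + 2 + 2 + 2 + 2) ?s'"
      by (intro choice) (use r in auto)
    then show ?thesis by simp
  qed
  from runs_WhileT[OF _ this snoc.IH[of "a # v"]] show ?case
    using a t snoc.prems by (auto elim!: runs_mono)
qed

text \<open>The output uses the symbols 1, 2 and 3 only. Three pops remove the list cell, the first
  cell of the unary number and its unit; at most two tests then decide the symbol. The first symbol
  ends up at the bottom of stack 0, that is in cell 0.\<close>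

definition write_output :: com where
  "write_output = While 1 1 (Pop 1 ;; Pop 1 ;; Pop 1 ;; If 1 1 (Pop 1 ;; Push 0 1)
     (Pop 1 ;; Pop 1 ;; If 1 1 (Pop 1 ;; Push 0 2) (Pop 1 ;; Pop 1 ;; Pop 1 ;; Push 0 3))) ;; Pop 1"

lemma runs_Pop1: "runs (Pop 1) (stk a (x # m) b e) 1 (stk a m b e)" using runs_Pop[of 1 "stk a (x # m) b e"] by simp
lemma runs_Push0: "runs (Push 0 x) (stk a m b e) 1 (stk (x # a) m b e)" using runs_Push[of 0 x "stk a m b e"] by simp

lemma runs_write_output:
  assumes "set ys \<subseteq> {1, 2, 3}"
  shows "runs write_output (stk out (code (enc (map uns ys))) [] []) (30 * length ys + 2) (stk (rev ys @ out) [] [] [])"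
proof -
  let ?b = "Pop 1 ;; Pop 1 ;; Pop 1 ;; If 1 1 (Pop 1 ;; Push 0 1)
     (Pop 1 ;; Pop 1 ;; If 1 1 (Pop 1 ;; Push 0 2) (Pop 1 ;; Pop 1 ;; Pop 1 ;; Push 0 3))"
  have body: "runs ?b (stk out (2 # code (enc (uns y)) @ m) [] []) 20 (stk (y # out) m [] [])" if y: "y \<in> {1, 2, 3}" for y out m
  proof -
    have c: "code (enc (uns 1)) = [2, 1, 1]" "code (enc (uns 2)) = [2, 1, 2, 1, 1]" "code (enc (uns 3)) = [2, 1, 2, 1, 2, 1, 1]"
      by (simp_all add: enc_uns numeral_2_eq_2 numeral_3_eq_3 One_nat_def)
    have t: "top 1 (stk a (x # m) b e) = x" for a b e x and m :: "nat list" by (simp add: top_def)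
    from y consider "y = 1" | "y = 2" | "y = 3" by blast
    then show ?thesis
    proof cases
      case 1
      then show ?thesis unfolding 1 c append.simps
        by (intro runs_mono[OF runs_Seq[OF runs_Pop1 runs_Seq[OF runs_Pop1 runs_Seq[OF runs_Pop1
          runs_IfT[OF t runs_Seq[OF runs_Pop1 runs_Push0]]]]]]) simp
    next
      case 2
      have n: "top 1 (stk out (2 # m') [] []) \<noteq> 1" for m' by (simp add: t)
      show ?thesis unfolding 2 c append.simps
        by (intro runs_mono[OF runs_Seq[OF runs_Pop1 runs_Seq[OF runs_Pop1 runs_Seq[OF runs_Pop1
          runs_IfF[OF n runs_Seq[OF runs_Pop1 runs_Seq[OF runs_Pop1 runs_IfT[OF t runs_Seq[OF runs_Pop1 runs_Push0]]]]]]]]]) simp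
    next
      case 3
      have n: "top 1 (stk out (2 # m') [] []) \<noteq> 1" for m' by (simp add: t)
      show ?thesis unfolding 3 c append.simps
        by (intro runs_mono[OF runs_Seq[OF runs_Pop1 runs_Seq[OF runs_Pop1 runs_Seq[OF runs_Pop1
          runs_IfF[OF n runs_Seq[OF runs_Pop1 runs_Seq[OF runs_Pop1 runs_IfF[OF n
          runs_Seq[OF runs_Pop1 runs_Seq[OF runs_Pop1 runs_Seq[OF runs_Pop1 runs_Push0]]]]]]]]]]]) simp
    qed
  qed
  have loop: "runs (While 1 1 ?b) (stk out (code (enc (map uns ys))) [] []) (30 * length ys + 1) (stk (rev ys @ out) (code L) [] [])"
    using assms
  proof (induction ys arbitrary: out)
    case Nil
    then show ?case using runs_WhileF[of 1 "stk out (code L) [] []" 1] by (simp add: top_def)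
  next
    case (Cons y ys)
    have "top 1 (stk out (code (enc (map uns (y # ys)))) [] []) \<noteq> 1" by (simp add: top_def)
    from runs_WhileT[OF this _ Cons.IH[of "y # out"], of 20] body[of y out "code (enc (map uns ys))"] Cons.prems
    show ?case by (auto elim!: runs_mono)
  qed
  show ?thesis unfolding write_output_def
    by (rule runs_mono[OF runs_Seq[OF loop, unfolded code.simps, OF runs_Pop1]]) simp
qed

theorem PT_computes_within:
  fixes f :: "unit list list \<Rightarrow> unit list list"
  assumes "PT f"
  shows "\<exists>M c k. wf_tm M \<and> (\<forall>w ys. (\<forall>a\<in>set w. 0 < a \<and> a < 6) \<longrightarrow> f (map uns w) = map uns ys \<longrightarrow> set ys \<subseteq> {1, 2, 3} \<longrightarrow>
     computes_within M w (c * (length w + 2) ^ k) ys)"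
proof -
  obtain F where "implements F f" using assms unfolding PT_def by blast
  note F = implementsD[OF this]
  obtain p k where p: "FP_by (range (enc :: unit list list \<Rightarrow> tree)) F p k" using FP_imp_FP_by[OF F(1)] by blast
  define prog where "prog = (Push 1 1 ;; While 0 0 (If 0 1 (read_sym 1) (If 0 2 (read_sym 2) (If 0 3 (read_sym 3) (If 0 4 (read_sym 4) (read_sym 5)))))) ;; p ;; write_output"
  have ws: "wf_com (read_sym a)" for a
    unfolding read_sym_def using wf_pushes[of "2 # code (enc (uns a))"] code_symbols[of "enc (uns a)"] by simp
  have wf: "wf_com prog" unfolding prog_def write_output_def using FP_byD(2)[OF p] ws by simp
  obtain m where m: "\<And>x n. x \<in> range (enc :: unit list list \<Rightarrow> tree) \<Longrightarrow> tsize x \<le> n \<Longrightarrow> tsize (F x) \<le> (n + 2) ^ m"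
    using FP_size[OF F(1)] by blast
  let ?T = "\<lambda>l. (1 + (30 * l + 1)) + ((20 * l + 1 + 2) ^ k + (30 * (20 * l + 1 + 2) ^ m + 2))"
  have "pb (\<lambda>l. ?T l * (2 * (l + ?T l) + 5))" by (intro pb_intros)
  then obtain K where K: "\<And>l::nat. ?T l * (2 * (l + ?T l) + 5) \<le> (l + 2) ^ K" unfolding pb_def by blast
  have "computes_within (tm_of (comp 0 prog)) w (1 * (length w + 2) ^ K) ys"
    if w: "\<forall>a\<in>set w. 0 < a \<and> a < 6" and f: "f (map uns w) = map uns ys" and ys: "set ys \<subseteq> {1, 2, 3}" for w ys
  proof -
    let ?l = "length w"
    have su: "esize (uns a) = 2 * a + 1" for a by (induction a) (auto simp: esize_def enc_uns)
    have sz: "tsize (enc (map uns w)) \<le> 20 * ?l + 1"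
    proof -
      \<comment> \<open>A symbol is at most 5, and \<open>uns 5\<close> has size 11; together with
        its list cell it stays below the 20 claimed per symbol.\<close>
      have "esize (map uns w) \<le> 1 + length (map uns w) * (1 + 11)"
        by (rule esize_list_le) (use w in \<open>auto simp: su\<close>)
      then show ?thesis by (simp add: esize_def)
    qed
    have 1: "runs (Push 1 1) (stk (rev w) [] [] []) 1 (stk (rev w) (code (enc (map uns []))) [] [])"
      using runs_Push[of 1 1 "stk (rev w) [] [] []"] by simp
    have 2: "runs p (stk [] (code (enc (map uns w))) [] []) ((20 * ?l + 1 + 2) ^ k) (stk [] (code (enc (map uns ys))) [] [])"
      using FP_byD(1)[OF p _ sz, of "[]"] by (simp add: F(2) f)
    have "length ys \<le> esize (map uns ys)" using length_le_esize[of "map uns ys"] by simp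
    also have "\<dots> \<le> (20 * ?l + 1 + 2) ^ m" using m[OF _ sz] by (simp add: F(2) f esize_def)
    finally have ly: "length ys \<le> (20 * ?l + 1 + 2) ^ m" .
    have 3: "runs write_output (stk [] (code (enc (map uns ys))) [] []) (30 * (20 * ?l + 1 + 2) ^ m + 2) (stk (rev ys) [] [] [])"
      using runs_mono[OF runs_write_output[OF ys, of "[]"]] ly by simp
    have "runs prog (stk (rev w) [] [] []) (?T ?l) (stk (rev ys) [] [] [])"
      unfolding prog_def
      by (rule runs_Seq[OF runs_Seq[OF 1 runs_read_loop[OF w, of "[]", simplified append_Nil2]] runs_Seq[OF 2 3]])
    then obtain t where t: "t \<le> ?T ?l" "exec prog (stk (rev w) [] [] []) t (stk (rev ys) [] [] [])" unfolding runs_def by blast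
    have "t * (2 * (?l + t) + 5) \<le> ?T ?l * (2 * (?l + ?T ?l) + 5)" using t(1) by (intro mult_le_mono add_mono) auto
    also have "\<dots> \<le> (?l + 2) ^ K" by (rule K)
    finally have "t * (2 * (?l + t) + 5) \<le> (?l + 2) ^ K" .
    then show ?thesis using exec_computes_within(2)[OF wf w t(2)] unfolding computes_within_def
      by (metis (no_types, lifting) mult_1 order_trans)
  qed
  moreover have "wf_tm (tm_of (comp 0 prog))"
  proof -
    have "comp 0 prog \<noteq> []" by (simp add: prog_def)
    then show ?thesis using wf_tm_of wf_comp[OF wf] by blast
  qed
  ultimately show ?thesis by blast
qed

declare One_nat_def [simp] add_2_eq_Suc [simp] add_2_eq_Suc' [simp]

section \<open>Expectation over a random active set\<close>

definition Ex :: "nat set \<Rightarrow> (nat \<Rightarrow> real) \<Rightarrow> (nat set \<Rightarrow> real) \<Rightarrow> real" where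
  "Ex V p f = (\<Sum>A\<in>Pow V. (\<Prod>v\<in>A. p v) * (\<Prod>v\<in>V - A. 1 - p v) * f A)"

lemma Ex_insert:
  assumes "finite V" "v \<notin> V"
  shows "Ex (insert v V) p f = p v * Ex V p (\<lambda>A. f (insert v A)) + (1 - p v) * Ex V p f"
proof -
  have inj: "inj_on (insert v) (Pow V)" using assms(2) by (auto simp: inj_on_def)
  have disj: "Pow V \<inter> insert v ` Pow V = {}" using assms(2) by auto
  have "Ex (insert v V) p f = (\<Sum>A\<in>Pow V. (\<Prod>u\<in>A. p u) * (\<Prod>u\<in>insert v V - A. 1 - p u) * f A) +
      (\<Sum>A\<in>Pow V. (\<Prod>u\<in>insert v A. p u) * (\<Prod>u\<in>insert v V - insert v A. 1 - p u) * f (insert v A))"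
    unfolding Ex_def Pow_insert using assms disj by (simp add: sum.union_disjoint sum.reindex[OF inj])
  also have "(\<Sum>A\<in>Pow V. (\<Prod>u\<in>A. p u) * (\<Prod>u\<in>insert v V - A. 1 - p u) * f A) = (1 - p v) * Ex V p f"
    unfolding Ex_def sum_distrib_left
  proof (rule sum.cong[OF refl])
    fix A assume "A \<in> Pow V"
    then have "insert v V - A = insert v (V - A)" "v \<notin> V - A" "finite (V - A)" using assms by auto
    then show "(\<Prod>u\<in>A. p u) * (\<Prod>u\<in>insert v V - A. 1 - p u) * f A = (1 - p v) * ((\<Prod>u\<in>A. p u) * (\<Prod>u\<in>V - A. 1 - p u) * f A)" by simp
  qed
  also have "(\<Sum>A\<in>Pow V. (\<Prod>u\<in>insert v A. p u) * (\<Prod>u\<in>insert v V - insert v A. 1 - p u) * f (insert v A)) = p v * Ex V p (\<lambda>A. f (insert v A))"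
    unfolding Ex_def sum_distrib_left
  proof (rule sum.cong[OF refl])
    fix A assume "A \<in> Pow V"
    then have "insert v V - insert v A = V - A" "v \<notin> A" "finite A" using assms finite_subset by auto
    then show "(\<Prod>u\<in>insert v A. p u) * (\<Prod>u\<in>insert v V - insert v A. 1 - p u) * f (insert v A) = p v * ((\<Prod>u\<in>A. p u) * (\<Prod>u\<in>V - A. 1 - p u) * f (insert v A))" by simp
  qed
  finally show ?thesis by simp
qed

lemma Ex_add: "Ex V p (\<lambda>A. f A + g A) = Ex V p f + Ex V p g"
  by (simp add: Ex_def sum.distrib algebra_simps)

lemma Ex_cmult: "Ex V p (\<lambda>A. c * f A) = c * Ex V p f"
  by (simp add: Ex_def sum_distrib_left algebra_simps)

lemma Ex_diff: "Ex V p (\<lambda>A. f A - g A) = Ex V p f - Ex V p g"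
  using Ex_add[of V p f "\<lambda>A. -1 * g A"] Ex_cmult[of V p "-1" g] by simp

lemma Ex_const: "finite V \<Longrightarrow> Ex V p (\<lambda>A. c) = c"
proof (induction V rule: finite_induct)
  case empty
  show ?case by (simp add: Ex_def)
next
  case (insert v V)
  then show ?case by (simp add: Ex_insert algebra_simps)
qed

lemma Ex_sum: "finite V \<Longrightarrow> Ex V p (\<lambda>A. \<Sum>i\<in>I. f i A) = (\<Sum>i\<in>I. Ex V p (f i))"
  by (induction I rule: infinite_finite_induct) (auto simp: Ex_add Ex_const)

lemma Ex_mono:
  assumes "\<And>v. v \<in> V \<Longrightarrow> 0 \<le> p v \<and> p v \<le> 1" "\<And>A. A \<subseteq> V \<Longrightarrow> f A \<le> g A"
  shows "Ex V p f \<le> Ex V p g"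
  unfolding Ex_def
proof (intro sum_mono mult_left_mono)
  fix A assume "A \<in> Pow V"
  then show "f A \<le> g A" using assms by auto
  show "0 \<le> (\<Prod>v\<in>A. p v) * (\<Prod>v\<in>V - A. 1 - p v)"
    using assms(1) \<open>A \<in> Pow V\<close> by (intro mult_nonneg_nonneg prod_nonneg) auto
qed

text \<open>Independence: conditioning on \<open>v\<close> being active leaves the rest of
  \<open>A\<close> unchanged, so it amounts to inserting \<open>v\<close>.\<close>

lemma Ex_indicator:
  assumes "finite V" "v \<in> V"
  shows "Ex V p (\<lambda>A. of_bool (v \<in> A) * f A) = p v * Ex V p (\<lambda>A. f (insert v A))"
proof -
  have V: "V = insert v (V - {v})" using assms by auto
  have fin: "finite (V - {v})" "v \<notin> V - {v}" using assms by auto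
  have "Ex (V - {v}) p (\<lambda>A. of_bool (v \<in> A) * f A) = Ex (V - {v}) p (\<lambda>A. 0)"
    unfolding Ex_def by (rule sum.cong) auto
  then have "Ex (insert v (V - {v})) p (\<lambda>A. of_bool (v \<in> A) * f A) = p v * Ex (V - {v}) p (\<lambda>A. f (insert v A))"
    unfolding Ex_insert[OF fin] by (simp add: Ex_const[OF fin(1)])
  moreover have "Ex (insert v (V - {v})) p (\<lambda>A. f (insert v A)) = Ex (V - {v}) p (\<lambda>A. f (insert v A))"
    unfolding Ex_insert[OF fin] by (simp add: algebra_simps)
  ultimately show ?thesis using V by metis
qed

section \<open>Lengths of paths\<close>

fun plen :: "(nat \<Rightarrow> nat \<Rightarrow> real) \<Rightarrow> nat list \<Rightarrow> real" where
  "plen d (x # y # zs) = d x y + plen d (y # zs)"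
| "plen d _ = 0"

lemma plen_append: "plen d (xs @ a # ys) = plen d (xs @ [a]) + plen d (a # ys)"
  by (induction d xs rule: plen.induct) auto

lemma path_len_eq_plen: "path_len d xs = plen (\<lambda>i j. real_of_rat (d i j)) xs"
proof (induction "\<lambda>i j. real_of_rat (d i j)" xs rule: plen.induct)
  case (1 x y zs)
  then show ?case by (simp add: path_len_def sum.lessThan_Suc_shift del: sum.lessThan_Suc)
qed (auto simp: path_len_def)

lemma plen_scale: "plen (\<lambda>i j. c * d i j) xs = c * plen d xs"
  by (induction d xs rule: plen.induct) (auto simp: algebra_simps)

lemma plen_cong: "(\<And>x y. x \<in> set xs \<Longrightarrow> y \<in> set xs \<Longrightarrow> d x y = d' x y) \<Longrightarrow> plen d xs = plen d' xs"
  by (induction d xs rule: plen.induct) auto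

text \<open>The expected latency of the tour \<open>r # xs\<close>, split by served vertex, each
  contribution being conditioned on the activity of that vertex; \<open>exp_latency_eq\<close> is
  the bridge.\<close>

definition elat :: "nat \<Rightarrow> nat \<Rightarrow> (nat \<Rightarrow> nat \<Rightarrow> real) \<Rightarrow> (nat \<Rightarrow> real) \<Rightarrow> nat list \<Rightarrow> real" where
  "elat n r d p xs = (\<Sum>i<length xs. p (xs ! i) *
     Ex {..<n} p (\<lambda>A. plen d (r # filter (\<lambda>v. v \<in> insert (xs ! i) A) (take (Suc i) xs))))"

lemma latency_eq:
  "latency d (r # xs) A = (\<Sum>i<length xs. of_bool (xs ! i \<in> A) * path_len d (r # filter (\<lambda>v. v \<in> A) (take (Suc i) xs)))"
proof (induction xs rule: rev_induct)
  case Nil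
  show ?case by (simp add: latency_def shortcut_def)
next
  case (snoc x xs)
  let ?L = "filter (\<lambda>v. v \<in> A) xs"
  have "(\<Sum>i<length (xs @ [x]). of_bool ((xs @ [x]) ! i \<in> A) * path_len d (r # filter (\<lambda>v. v \<in> A) (take (Suc i) (xs @ [x])))) =
    (\<Sum>i<length xs. of_bool (xs ! i \<in> A) * path_len d (r # filter (\<lambda>v. v \<in> A) (take (Suc i) xs))) +
     of_bool (x \<in> A) * path_len d (r # filter (\<lambda>v. v \<in> A) (xs @ [x]))"
    by (simp add: nth_append)
  also have "\<dots> = latency d (r # (xs @ [x])) A"
  proof (cases "x \<in> A")
    case True
    have "{1..<length (r # ?L @ [x])} = insert (Suc (length ?L)) {1..<length (r # ?L)}" by auto
    then have "latency d (r # (xs @ [x])) A = path_len d (r # ?L @ [x]) + (\<Sum>k\<in>{1..<length (r # ?L)}. path_len d (take (Suc k) (r # ?L @ [x])))"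
      using True by (simp add: latency_def shortcut_def)
    also have "(\<Sum>k\<in>{1..<length (r # ?L)}. path_len d (take (Suc k) (r # ?L @ [x]))) = latency d (r # xs) A"
      unfolding latency_def shortcut_def Let_def by (intro sum.cong) auto
    finally show ?thesis using True snoc by simp
  qed (use snoc in \<open>simp add: latency_def shortcut_def\<close>)
  finally show ?case by simp
qed

lemma exp_latency_eq:
  assumes "set xs \<subseteq> {..<n}"
  shows "exp_latency n d p (r # xs) = elat n r (\<lambda>i j. real_of_rat (d i j)) (\<lambda>v. real_of_rat (p v)) xs"
proof -
  have "exp_latency n d p (r # xs) = Ex {..<n} (\<lambda>v. real_of_rat (p v)) (\<lambda>A. \<Sum>i<length xs. of_bool (xs ! i \<in> A) *
      plen (\<lambda>i j. real_of_rat (d i j)) (r # filter (\<lambda>v. v \<in> A) (take (Suc i) xs)))"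
    by (simp add: exp_latency_def Ex_def latency_eq path_len_eq_plen)
  also have "\<dots> = elat n r (\<lambda>i j. real_of_rat (d i j)) (\<lambda>v. real_of_rat (p v)) xs"
    unfolding elat_def by (subst Ex_sum, simp, intro sum.cong refl, subst Ex_indicator) (use assms nth_mem in auto)
  finally show ?thesis .
qed

text \<open>Homogeneity in the distances allows the comparison with the optimum to be made after
  denominators have been cleared.\<close>

lemma elat_scale:
  assumes "set xs \<subseteq> {..<n}" "r < n" "\<And>i j. i < n \<Longrightarrow> j < n \<Longrightarrow> d' i j = c * d i j" "\<And>i. i < n \<Longrightarrow> p' i = p i"
  shows "elat n r d' p' xs = c * elat n r d p xs"
proof -
  have P: "plen d' (r # filter Q (take k xs)) = c * plen d (r # filter Q (take k xs))" for Q k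
  proof -
    have "set (r # filter Q (take k xs)) \<subseteq> {..<n}" using assms set_take_subset[of k xs] by auto
    then show ?thesis unfolding plen_scale[symmetric] by (intro plen_cong assms(3)) auto
  qed
  have "Ex {..<n} p' f = Ex {..<n} p f" for f
    unfolding Ex_def using assms(4) by (intro sum.cong refl) (auto intro!: prod.cong arg_cong2[where f = "(*)"])
  moreover have "p' (xs ! i) = p (xs ! i)" if "i < length xs" for i
    using assms(1,4) nth_mem[OF that] by blast
  ultimately show ?thesis unfolding elat_def sum_distrib_left P Ex_cmult
    by (intro sum.cong) (auto simp: algebra_simps)
qed

section \<open>Lower bounds for the expected length of a prefix\<close>

locale apriori =
  fixes n r :: nat and d :: "nat \<Rightarrow> nat \<Rightarrow> real" and p :: "nat \<Rightarrow> real"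
  assumes r: "r < n"
    and nonneg: "\<And>i j. i < n \<Longrightarrow> j < n \<Longrightarrow> 0 \<le> d i j"
    and sym: "\<And>i j. i < n \<Longrightarrow> j < n \<Longrightarrow> d i j = d j i"
    and refl: "\<And>i. i < n \<Longrightarrow> d i i = 0"
    and tri: "\<And>i j k. i < n \<Longrightarrow> j < n \<Longrightarrow> k < n \<Longrightarrow> d i k \<le> d i j + d j k"
    and prob: "\<And>i. i < n \<Longrightarrow> 0 \<le> p i \<and> p i \<le> 1"
begin

abbreviation "E \<equiv> Ex {..<n} p"

lemma E_mono: "(\<And>A. A \<subseteq> {..<n} \<Longrightarrow> f A \<le> g A) \<Longrightarrow> E f \<le> E g"
  by (rule Ex_mono) (auto simp: prob)

lemma plen_nonneg: "set xs \<subseteq> {..<n} \<Longrightarrow> 0 \<le> plen d xs"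
  by (induction xs rule: induct_list012) (auto simp: nonneg)

lemma plen_drop_second: "set (x # y # xs) \<subseteq> {..<n} \<Longrightarrow> plen d (x # xs) \<le> plen d (x # y # xs)"
  by (cases xs) (auto simp: nonneg, smt (verit) tri)

lemma plen_subseq_Cons: "subseq xs ys \<Longrightarrow> set ys \<subseteq> {..<n} \<Longrightarrow> x < n \<Longrightarrow> plen d (x # xs) \<le> plen d (x # ys)"
proof (induction xs ys arbitrary: x rule: list_emb.induct)
  case (list_emb_Nil ys)
  then show ?case using plen_nonneg[of "x # ys"] by simp
next
  case (list_emb_Cons xs ys y)
  then show ?case using plen_drop_second[of x y ys] by fastforce
next
  case (list_emb_Cons2 a b xs ys)
  then show ?case by auto
qed

lemma subseq_filter_mono: "(\<And>v. v \<in> set xs \<Longrightarrow> P v \<Longrightarrow> Q v) \<Longrightarrow> subseq (filter P xs) (filter Q xs)"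
  by (induction xs) auto

text \<open>A lower bound for the expected latency of the \<open>k\<close>-th vertex, and later the
  coordinate \<open>l\<close> of the staircase.\<close>

definition ell :: "nat list \<Rightarrow> nat \<Rightarrow> real" where
  "ell xs k = E (\<lambda>A. plen d (r # filter (\<lambda>v. v \<in> A) (take k xs)))"

lemma subset_take: "set xs \<subseteq> {..<n} \<Longrightarrow> set (take k xs) \<subseteq> {..<n}"
  using set_take_subset by fast

lemma ell_0: "ell xs 0 = 0" by (simp add: ell_def Ex_const)

lemma ell_mono: assumes "set xs \<subseteq> {..<n}" "k \<le> l" shows "ell xs k \<le> ell xs l"
  unfolding ell_def
proof (rule E_mono)
  fix A
  have "prefix (take k xs) (take l xs)" using assms(2) by (metis min.absorb1 take_is_prefix take_take)
  then show "plen d (r # filter (\<lambda>v. v \<in> A) (take k xs)) \<le> plen d (r # filter (\<lambda>v. v \<in> A) (take l xs))"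
    using subset_take[OF assms(1), of l] r by (intro plen_subseq_Cons) (auto intro: subseq_filter prefix_imp_subseq)
qed

text \<open>By the triangle inequality, forcing the served vertex to be active can only lengthen the
  path.\<close>

lemma elat_ge_ell:
  assumes "set xs \<subseteq> {..<n}"
  shows "(\<Sum>i<length xs. p (xs ! i) * ell xs (Suc i)) \<le> elat n r d p xs"
  unfolding elat_def ell_def
proof (intro sum_mono mult_left_mono E_mono)
  fix i A assume "i \<in> {..<length xs}"
  then show "0 \<le> p (xs ! i)" using assms prob nth_mem by blast
  show "plen d (r # filter (\<lambda>v. v \<in> A) (take (Suc i) xs)) \<le> plen d (r # filter (\<lambda>v. v \<in> insert (xs ! i) A) (take (Suc i) xs))"
    using subset_take[OF assms, of "Suc i"] r by (intro plen_subseq_Cons subseq_filter_mono) auto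
qed

lemma elat_ge_dist:
  assumes "set xs \<subseteq> {..<n}"
  shows "(\<Sum>i<length xs. p (xs ! i) * d r (xs ! i)) \<le> elat n r d p xs"
  unfolding elat_def
proof (intro sum_mono mult_left_mono)
  fix i assume i: "i \<in> {..<length xs}"
  then show "0 \<le> p (xs ! i)" using assms prob nth_mem by blast
  have "d r (xs ! i) = E (\<lambda>A. plen d [r, xs ! i])" by (simp add: Ex_const)
  also have "\<dots> \<le> E (\<lambda>A. plen d (r # filter (\<lambda>v. v \<in> insert (xs ! i) A) (take (Suc i) xs)))"
  proof (rule E_mono, rule plen_subseq_Cons)
    fix A
    have "xs ! i \<in> set (filter (\<lambda>v. v \<in> insert (xs ! i) A) (take (Suc i) xs))"
      using i by (simp add: take_Suc_conv_app_nth)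
    then show "subseq [xs ! i] (filter (\<lambda>v. v \<in> insert (xs ! i) A) (take (Suc i) xs))"
      by (simp add: subseq_singleton_left)
  qed (use r subset_take[OF assms, of "Suc i"] in auto)
  finally show "d r (xs ! i) \<le> E (\<lambda>A. plen d (r # filter (\<lambda>v. v \<in> insert (xs ! i) A) (take (Suc i) xs)))" .
qed

lemma E_indicator: "v < n \<Longrightarrow> E (\<lambda>A. of_bool (v \<in> A)) = p v"
  using Ex_indicator[of "{..<n}" v p "\<lambda>_. 1"] by (simp add: Ex_const)

lemma E_indicator2: "v < n \<Longrightarrow> u < n \<Longrightarrow> u \<noteq> v \<Longrightarrow> E (\<lambda>A. of_bool (v \<in> A) * of_bool (u \<in> A)) = p v * p u"
  using Ex_indicator[of "{..<n}" v p "\<lambda>A. of_bool (u \<in> A)"] by (simp add: E_indicator)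

text \<open>Every vertex pays for the edge on which the path enters it, and that edge comes from
  another vertex of the path.\<close>

lemma plen_ge_isolation:
  assumes "distinct (x # zs)" "set (x # zs) \<subseteq> {..<n}"
    and g: "\<And>v u. v \<in> set zs \<Longrightarrow> u \<in> set (x # zs) \<Longrightarrow> u \<noteq> v \<Longrightarrow> g v \<le> d u v"
  shows "(\<Sum>v\<in>set zs. g v) \<le> plen d (x # zs)"
  using assms
proof (induction zs arbitrary: x)
  case (Cons y zs)
  have "(\<Sum>v\<in>set zs. g v) \<le> plen d (y # zs)" by (rule Cons.IH) (use Cons.prems in auto)
  moreover have "g y \<le> d x y" using Cons.prems by auto
  ultimately show ?case using Cons.prems by (simp add: add_mono)
qed simp

text \<open>An active vertex \<open>v\<close> pays at least \<open>R v\<close> unless some other vertex of its open ball is active.\<close>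

lemma ell_ge_radius:
  assumes xs: "set xs \<subseteq> {..<n} - {r}" "distinct xs"
    and R: "\<And>v. v < n \<Longrightarrow> 0 \<le> R v" "\<And>v. v < n \<Longrightarrow> R v \<le> d r v"
    and mass: "\<And>v. v < n \<Longrightarrow> v \<noteq> r \<Longrightarrow> (\<Sum>u\<in>{u. u < n \<and> u \<noteq> v \<and> d u v < R v}. p u) \<le> 1 / 2"
  shows "(\<Sum>v\<in>set (take k xs). p v * R v) \<le> 2 * ell xs k"
proof -
  let ?S = "set (take k xs)"
  define B where "B v = {u. u < n \<and> u \<noteq> v \<and> d u v < R v}" for v
  have S: "?S \<subseteq> {..<n} - {r}" using xs set_take_subset by fast
  have point: "(\<Sum>v\<in>?S. of_bool (v \<in> A) * (1 - (\<Sum>u\<in>B v. of_bool (u \<in> A))) * R v) \<le> plen d (r # filter (\<lambda>v. v \<in> A) (take k xs))"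
    if A: "A \<subseteq> {..<n}" for A
  proof -
    \<comment> \<open>A bound for the distance to the nearest vertex of the path: at most 0 as soon
      as another vertex of the ball is active, and never more than \<open>R v\<close>. Being linear
      in indicators, it has an expectation that only needs independence of pairs.\<close>
    define g where "g v = (1 - (\<Sum>u\<in>B v. of_bool (u \<in> A))) * R v" for v
    have "(\<Sum>v\<in>?S. of_bool (v \<in> A) * (1 - (\<Sum>u\<in>B v. of_bool (u \<in> A))) * R v) = (\<Sum>v\<in>?S. if v \<in> A then g v else 0)"
      by (intro sum.cong) (auto simp: g_def)
    also have "\<dots> = (\<Sum>v\<in>set (filter (\<lambda>v. v \<in> A) (take k xs)). g v)"
      by (simp add: sum.If_cases Int_def Collect_conj_eq[symmetric])
    also have "\<dots> \<le> plen d (r # filter (\<lambda>v. v \<in> A) (take k xs))"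
    proof (rule plen_ge_isolation)
      fix v u assume vu: "v \<in> set (filter (\<lambda>v. v \<in> A) (take k xs))" "u \<in> set (r # filter (\<lambda>v. v \<in> A) (take k xs))" "u \<noteq> v"
      then have v: "v < n" "u < n" "v \<noteq> r" using S r by auto
      have nn: "0 \<le> (\<Sum>u\<in>B v. of_bool (u \<in> A) :: real)" by (rule sum_nonneg) auto
      show "g v \<le> d u v"
      proof (cases "d u v < R v")
        case True
        \<comment> \<open>The root starts every path without having to be active, so it must lie
          outside the open ball; this is why radii do not exceed the distance to the root.\<close>
        then have "u \<noteq> r" using R(2)[OF v(1)] by auto
        then have "u \<in> B v" "u \<in> A" using True vu v by (auto simp: B_def)
        then have "1 \<le> (\<Sum>u\<in>B v. of_bool (u \<in> A) :: real)"
          using member_le_sum[of u "B v" "\<lambda>u. of_bool (u \<in> A) :: real"] by (simp add: B_def)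
        then have "g v \<le> 0" unfolding g_def using R(1)[OF v(1)] by (intro mult_nonpos_nonneg) auto
        then show ?thesis using nonneg[OF v(2,1)] by linarith
      next
        case False
        have "g v \<le> 1 * R v" unfolding g_def using R(1)[OF v(1)] nn by (intro mult_right_mono) auto
        then show ?thesis using False by simp
      qed
    qed (use xs S r set_take_subset in \<open>auto\<close>)
    finally show ?thesis .
  qed
  have "(\<Sum>v\<in>?S. p v * R v * (1 / 2)) \<le> (\<Sum>v\<in>?S. p v * R v * (1 - (\<Sum>u\<in>B v. p u)))"
  proof (intro sum_mono mult_left_mono)
    fix v assume "v \<in> ?S"
    then have v: "v < n" "v \<noteq> r" using S by auto
    show "1 / 2 \<le> 1 - (\<Sum>u\<in>B v. p u)" using mass[OF v] unfolding B_def by simp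
    show "0 \<le> p v * R v" using prob R(1) v by simp
  qed
  also have "\<dots> = (\<Sum>v\<in>?S. E (\<lambda>A. of_bool (v \<in> A) * (1 - (\<Sum>u\<in>B v. of_bool (u \<in> A))) * R v))"
  proof (rule sum.cong)
    fix v assume "v \<in> ?S"
    then have v: "v < n" using S by auto
    have "E (\<lambda>A. of_bool (v \<in> A) * (1 - (\<Sum>u\<in>B v. of_bool (u \<in> A))) * R v)
        = E (\<lambda>A. R v * (of_bool (v \<in> A) - (\<Sum>u\<in>B v. of_bool (v \<in> A) * of_bool (u \<in> A))))"
      by (simp add: algebra_simps sum_distrib_left)
    also have "\<dots> = R v * (p v - (\<Sum>u\<in>B v. p v * p u))"
      unfolding Ex_cmult Ex_diff by (subst Ex_sum) (use v in \<open>auto simp: E_indicator B_def intro!: sum.cong E_indicator2\<close>)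
    finally show "p v * R v * (1 - (\<Sum>u\<in>B v. p u)) = E (\<lambda>A. of_bool (v \<in> A) * (1 - (\<Sum>u\<in>B v. of_bool (u \<in> A))) * R v)"
      by (simp add: algebra_simps sum_distrib_left)
  qed simp
  also have "\<dots> = E (\<lambda>A. \<Sum>v\<in>?S. of_bool (v \<in> A) * (1 - (\<Sum>u\<in>B v. of_bool (u \<in> A))) * R v)" by (simp add: Ex_sum)
  also have "\<dots> \<le> ell xs k" unfolding ell_def by (rule E_mono) (rule point)
  finally show ?thesis by (simp add: sum_divide_distrib[symmetric])
qed

text \<open>Second moment bound \<open>P(X > 0) \<ge> s / (1 + s)\<close> from \<open>1[X > 0] \<ge> 2X/m - X\<^sup>2/m\<^sup>2\<close> with \<open>m = 1 + s\<close>.\<close>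

lemma hit_probability:
  assumes Z: "Z \<subseteq> {..<n}" and s: "1 / 4 \<le> (\<Sum>u\<in>Z. p u)"
  shows "1 / 5 \<le> E (\<lambda>A. of_bool (A \<inter> Z \<noteq> {}))"
proof -
  define s where "s = (\<Sum>u\<in>Z. p u)"
  define m where "m = 1 + s"
  have fin: "finite Z" using Z finite_subset by blast
  have m: "m > 0" "s \<ge> 1 / 4" using s unfolding m_def s_def by auto
  let ?X = "\<lambda>A. \<Sum>u\<in>Z. of_bool (u \<in> A) :: real"
  have EX: "E ?X = s" unfolding s_def by (subst Ex_sum) (use Z in \<open>auto intro!: sum.cong E_indicator\<close>)
  have "E (\<lambda>A. ?X A * ?X A) = (\<Sum>u\<in>Z. \<Sum>v\<in>Z. E (\<lambda>A. of_bool (u \<in> A) * of_bool (v \<in> A)))"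
    by (simp add: sum_product Ex_sum)
  also have "\<dots> \<le> (\<Sum>u\<in>Z. p u + p u * s)"
  proof (rule sum_mono)
    fix u assume u: "u \<in> Z"
    have "(\<Sum>v\<in>Z. E (\<lambda>A. of_bool (u \<in> A) * of_bool (v \<in> A))) = (\<Sum>v\<in>Z. if v = u then p u else p u * p v)"
    proof (rule sum.cong)
      fix v assume "v \<in> Z"
      then show "E (\<lambda>A. of_bool (u \<in> A) * of_bool (v \<in> A)) = (if v = u then p u else p u * p v)"
        using Z u E_indicator2[of u v] Ex_indicator[of "{..<n}" u p "\<lambda>A. of_bool (u \<in> A)"] by (auto simp: Ex_const)
    qed simp
    also have "\<dots> \<le> (\<Sum>v\<in>Z. (if v = u then p u else 0) + p u * p v)"
      by (intro sum_mono) (use Z u prob in \<open>auto intro!: mult_nonneg_nonneg\<close>)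
    also have "\<dots> = p u + p u * s" using u fin by (simp add: sum.distrib s_def sum_distrib_left)
    finally show "(\<Sum>v\<in>Z. E (\<lambda>A. of_bool (u \<in> A) * of_bool (v \<in> A))) \<le> p u + p u * s" .
  qed
  also have "\<dots> = s * m" by (simp add: sum.distrib s_def m_def sum_distrib_right algebra_simps)
  finally have EX2: "E (\<lambda>A. ?X A * ?X A) \<le> s * m" .
  have "1 / 5 \<le> s / m" using m unfolding m_def by (simp add: field_simps)
  also have "\<dots> = 2 / m * s - 1 / m\<^sup>2 * (s * m)" using m by (simp add: field_simps power2_eq_square)
  also have "\<dots> \<le> 2 / m * E ?X - 1 / m\<^sup>2 * E (\<lambda>A. ?X A * ?X A)"
    unfolding EX using EX2 m by (intro diff_left_mono mult_left_mono) auto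
  also have "\<dots> = E (\<lambda>A. 2 / m * ?X A - 1 / m\<^sup>2 * (?X A * ?X A))" by (simp only: Ex_diff Ex_cmult)
  also have "\<dots> \<le> E (\<lambda>A. of_bool (A \<inter> Z \<noteq> {}))"
  proof (rule E_mono)
    fix A
    show "2 / m * ?X A - 1 / m\<^sup>2 * (?X A * ?X A) \<le> of_bool (A \<inter> Z \<noteq> {})"
    proof (cases "A \<inter> Z = {}")
      case True
      then have "?X A = 0" by (auto intro!: sum.neutral)
      then show ?thesis by simp
    next
      case False
      have "2 / m * x - 1 / m\<^sup>2 * (x * x) = 1 - (1 - x / m)\<^sup>2" for x using m by (simp add: field_simps power2_eq_square)
      then show ?thesis using False by (simp only:) simp
    qed
  qed
  finally show ?thesis .
qed

text \<open>Each moved vertex touches two edges, whence the factor 2. The induction carries a first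
  vertex that may move as well and touches only one edge; for the fixed start that term
  vanishes.\<close>

lemma plen_map_le:
  assumes "set (x # zs) \<subseteq> {..<n}" "\<And>v. v \<in> set (x # zs) \<Longrightarrow> c v < n" "c x = x"
  shows "plen d (x # map c zs) \<le> plen d (x # zs) + 2 * (\<Sum>v\<leftarrow>zs. d v (c v))"
    "plen d (x # zs) \<le> plen d (x # map c zs) + 2 * (\<Sum>v\<leftarrow>zs. d v (c v))"
proof -
  have *: "plen d (map c (y # zs)) \<le> plen d (y # zs) + 2 * (\<Sum>v\<leftarrow>zs. d v (c v)) + d y (c y) \<and>
      plen d (y # zs) \<le> plen d (map c (y # zs)) + 2 * (\<Sum>v\<leftarrow>zs. d v (c v)) + d y (c y)"
    if "set (y # zs) \<subseteq> {..<n}" "\<And>v. v \<in> set (y # zs) \<Longrightarrow> c v < n" for y zs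
    using that
  proof (induction zs arbitrary: y)
    case Nil
    then show ?case using nonneg by simp
  next
    case (Cons z zs)
    have b: "y < n" "z < n" "c y < n" "c z < n" using Cons.prems by auto
    have IH: "plen d (map c (z # zs)) \<le> plen d (z # zs) + 2 * (\<Sum>v\<leftarrow>zs. d v (c v)) + d z (c z)"
      "plen d (z # zs) \<le> plen d (map c (z # zs)) + 2 * (\<Sum>v\<leftarrow>zs. d v (c v)) + d z (c z)"
      using Cons.IH[of z] Cons.prems by auto
    have "d (c y) (c z) \<le> d y (c y) + d y z + d z (c z)"
      using tri[OF b(3,1,4)] tri[OF b(1,2,4)] sym[OF b(3,1)] by linarith
    moreover have "d y z \<le> d y (c y) + d (c y) (c z) + d z (c z)"
      using tri[OF b(1,3,2)] tri[OF b(3,4,2)] sym[OF b(4,2)] by linarith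
    ultimately show ?case using IH by simp
  qed
  show "plen d (x # map c zs) \<le> plen d (x # zs) + 2 * (\<Sum>v\<leftarrow>zs. d v (c v))"
    "plen d (x # zs) \<le> plen d (x # map c zs) + 2 * (\<Sum>v\<leftarrow>zs. d v (c v))"
    using *[of x zs] assms refl[of x] by auto
qed

text \<open>Weak duality: a path from outside a moat to a vertex inside crosses it at least once,
  and the widths of the moats crossed by an edge add up to at most its length.\<close>

lemma plen_ge_moats:
  assumes "finite I" "\<And>i. i \<in> I \<Longrightarrow> 0 \<le> e i"
    and moat: "\<And>a b. a < n \<Longrightarrow> b < n \<Longrightarrow> (\<Sum>i\<in>I. of_bool ((a \<in> X i) \<noteq> (b \<in> X i)) * e i) \<le> d a b"
    and "set (x # zs) \<subseteq> {..<n}"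
  shows "(\<Sum>i\<in>I. of_bool (x \<notin> X i \<and> (\<exists>v\<in>set zs. v \<in> X i)) * e i) \<le> plen d (x # zs)"
  using assms(4)
proof (induction zs arbitrary: x)
  case (Cons y zs)
  have "(\<Sum>i\<in>I. of_bool (x \<notin> X i \<and> (\<exists>v\<in>set (y # zs). v \<in> X i)) * e i) \<le>
      (\<Sum>i\<in>I. of_bool ((x \<in> X i) \<noteq> (y \<in> X i)) * e i + of_bool (y \<notin> X i \<and> (\<exists>v\<in>set zs. v \<in> X i)) * e i)"
    by (intro sum_mono) (use assms(2) in \<open>auto simp: of_bool_def\<close>)
  also have "\<dots> \<le> d x y + plen d (y # zs)"
    unfolding sum.distrib using moat[of x y] Cons.IH[of y] Cons.prems by (intro add_mono) auto
  finally show ?case by simp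
qed simp

text \<open>Moats are made of centres, so the path is first moved there, at the cost of the
  displacement term. Weak duality then applies to each outcome \<open>A\<close>, and a moat of
  \<open>H\<close> is hit with probability at least 1/5.\<close>

lemma ell_ge_moats:
  assumes I: "finite I" "\<And>i. i \<in> I \<Longrightarrow> 0 \<le> e i" "\<And>i. i \<in> I \<Longrightarrow> r \<notin> X i"
    and moat: "\<And>a b. a < n \<Longrightarrow> b < n \<Longrightarrow> (\<Sum>i\<in>I. of_bool ((a \<in> X i) \<noteq> (b \<in> X i)) * e i) \<le> d a b"
    and xs: "set xs \<subseteq> {..<n}" "distinct xs" and c: "\<And>v. v < n \<Longrightarrow> c v < n" "c r = r"
    and H: "\<And>i. i \<in> H \<Longrightarrow> i \<in> I \<and> 1 / 4 \<le> (\<Sum>u\<in>{u\<in>set (take k xs). c u \<in> X i}. p u)"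
  shows "(\<Sum>i\<in>H. e i) \<le> 5 * (ell xs k + 2 * (\<Sum>v\<in>set (take k xs). p v * d v (c v)))"
proof -
  let ?S = "set (take k xs)"
  have S: "?S \<subseteq> {..<n}" using xs(1) subset_take by blast
  have HI: "H \<subseteq> I" "finite H" using H I(1) finite_subset[of H I] by auto
  have "(\<Sum>i\<in>H. e i) / 5 = (\<Sum>i\<in>H. e i * (1 / 5))" by (simp add: sum_divide_distrib)
  also have "\<dots> \<le> (\<Sum>i\<in>H. e i * E (\<lambda>A. of_bool (A \<inter> {u\<in>?S. c u \<in> X i} \<noteq> {})))"
    by (intro sum_mono mult_left_mono hit_probability) (use S H I(2) in auto)
  also have "\<dots> = E (\<lambda>A. \<Sum>i\<in>H. e i * of_bool (A \<inter> {u\<in>?S. c u \<in> X i} \<noteq> {}))"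
    by (simp add: Ex_sum Ex_cmult)
  also have "\<dots> \<le> E (\<lambda>A. plen d (r # filter (\<lambda>v. v \<in> A) (take k xs)) + 2 * (\<Sum>v\<in>?S. of_bool (v \<in> A) * d v (c v)))"
  proof (rule E_mono)
    fix A assume "A \<subseteq> {..<n}"
    let ?zs = "filter (\<lambda>v. v \<in> A) (take k xs)"
    have "(\<Sum>i\<in>H. e i * of_bool (A \<inter> {u\<in>?S. c u \<in> X i} \<noteq> {})) \<le> (\<Sum>i\<in>H. of_bool (r \<notin> X i \<and> (\<exists>v\<in>set (map c ?zs). v \<in> X i)) * e i)"
      by (intro sum_mono) (use HI I in \<open>auto simp: of_bool_def\<close>)
    also have "\<dots> \<le> (\<Sum>i\<in>I. of_bool (r \<notin> X i \<and> (\<exists>v\<in>set (map c ?zs). v \<in> X i)) * e i)"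
      by (rule sum_mono2) (use HI I in auto)
    also have "\<dots> \<le> plen d (r # map c ?zs)"
      by (rule plen_ge_moats[OF I(1,2) moat]) (use S c r in auto)
    also have "\<dots> \<le> plen d (r # ?zs) + 2 * (\<Sum>v\<leftarrow>?zs. d v (c v))"
      by (rule plen_map_le(1)) (use S c r in auto)
    also have "(\<Sum>v\<leftarrow>?zs. d v (c v)) = (\<Sum>v\<in>set ?zs. d v (c v))"
      using xs(2) by (simp add: sum_list_distinct_conv_sum_set)
    also have "\<dots> = (\<Sum>v\<in>?S. of_bool (v \<in> A) * d v (c v))"
      by (simp add: of_bool_def if_distrib[of "\<lambda>x. x * _"] sum.If_cases Int_def cong: if_cong)
    finally show "(\<Sum>i\<in>H. e i * of_bool (A \<inter> {u\<in>?S. c u \<in> X i} \<noteq> {})) \<le> plen d (r # ?zs) + 2 * (\<Sum>v\<in>?S. of_bool (v \<in> A) * d v (c v))" by simp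
  qed
  also have "\<dots> = ell xs k + 2 * (\<Sum>v\<in>?S. p v * d v (c v))"
  proof -
    have "E (\<lambda>A. \<Sum>v\<in>?S. of_bool (v \<in> A) * d v (c v)) = (\<Sum>v\<in>?S. E (\<lambda>A. of_bool (v \<in> A) * d v (c v)))"
      by (rule Ex_sum) simp
    also have "\<dots> = (\<Sum>v\<in>?S. p v * d v (c v))"
      by (intro sum.cong) (use S in \<open>auto simp: Ex_indicator Ex_const\<close>)
    finally show ?thesis by (simp add: Ex_add Ex_cmult ell_def)
  qed
  finally show ?thesis by simp
qed

end

section \<open>Primal-dual algorithm for the prize-collecting tree problem\<close>

definition dm :: "nat list list \<Rightarrow> nat \<Rightarrow> nat \<Rightarrow> nat" where
  "dm ds u v = nthd 0 (nthd [] ds u) v"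

text \<open>An environment consists of the vertex list, the root, the distance matrix and a cap on all numbers;
  a state consists of component labels, the total moat width around each vertex, and the residual prize of
  each label.  The cap is never reached and only serves to bound the size of the state.\<close>

type_synonym genv = "nat list \<times> nat \<times> nat list list \<times> nat"
type_synonym gstate = "nat list \<times> nat list \<times> nat list"
type_synonym gevent = "nat list \<times> (nat \<times> nat) \<times> bool"

abbreviation lb :: "gstate \<Rightarrow> nat \<Rightarrow> nat" where "lb s v \<equiv> nthd 0 (fst s) v"
abbreviation Dv :: "gstate \<Rightarrow> nat \<Rightarrow> nat" where "Dv s v \<equiv> nthd 0 (fst (snd s)) v"
abbreviation ph :: "gstate \<Rightarrow> nat \<Rightarrow> nat" where "ph s l \<equiv> nthd 0 (snd (snd s)) l"

definition g_act :: "gstate \<Rightarrow> nat \<Rightarrow> bool" where "g_act s v \<longleftrightarrow> 0 < ph s (lb s v)"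

definition g_pairs :: "nat list \<Rightarrow> (nat \<times> nat) list" where
  "g_pairs vs = concat (map (\<lambda>u. map (\<lambda>v. (u, v)) vs) vs)"

definition g_cross :: "genv \<Rightarrow> gstate \<Rightarrow> (nat \<times> nat) list" where
  "g_cross g s = filter (\<lambda>q. lb s (fst q) \<noteq> lb s (snd q) \<and> g_act s (fst q)) (g_pairs (fst g))"

text \<open>Half of the gap is safe whether one or both ends grow. Rounding keeps the numbers
  integral; the price is that \<open>g_tight\<close> must accept an edge as soon as twice the moats
  cover it, which doubles the usual factor of the primal-dual bound.\<close>

definition g_eps :: "genv \<Rightarrow> gstate \<Rightarrow> nat" where
  "g_eps g s = argmin 0 (\<lambda>x. x)
     (map (\<lambda>q. (dm (fst (snd (snd g))) (fst q) (snd q) - (Dv s (fst q) + Dv s (snd q))) div 2) (g_cross g s)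
      @ filter (\<lambda>a. 0 < a) (map (\<lambda>l. ph s l) (fst g)))"

definition g_grow :: "genv \<Rightarrow> gstate \<Rightarrow> gstate" where
  "g_grow g s = (fst s,
     map (\<lambda>v. min (snd (snd (snd g))) (Dv s v + (if g_act s v then g_eps g s else 0))) (fst g),
     map (\<lambda>l. ph s l - g_eps g s) (fst g))"

definition g_tight :: "genv \<Rightarrow> gstate \<Rightarrow> gstate \<Rightarrow> (nat \<times> nat) list" where
  "g_tight g s t = filter (\<lambda>q. g_act t (fst q) \<and>
     dm (fst (snd (snd g))) (fst q) (snd q) \<le> 2 * (Dv t (fst q) + Dv t (snd q))) (g_cross g s)"

text \<open>In a tight pair the first component is active, so only the second one can contain the
  root. A merge with the root's component ends the growth, hence the prize 0.\<close>

definition g_merge :: "genv \<Rightarrow> gstate \<Rightarrow> nat \<times> nat \<Rightarrow> gstate" where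
  "g_merge g t q = (map (\<lambda>v. if lb t v = lb t (snd q) then lb t (fst q) else lb t v) (fst g),
     fst (snd t),
     map (\<lambda>l. if l = lb t (fst q)
       then (if lb t (snd q) = lb t (fst (snd g)) then 0 else min (snd (snd (snd g))) (ph t (lb t (fst q)) + ph t (lb t (snd q))))
       else if l = lb t (snd q) then 0 else ph t l) (fst g))"

definition g_next :: "genv \<Rightarrow> gstate \<Rightarrow> (nat \<times> nat) list \<Rightarrow> gstate" where
  "g_next g t Q = (if Q = [] then t else g_merge g t (hdd (0, 0) Q))"

definition g_step :: "genv \<Rightarrow> gstate \<Rightarrow> gstate" where
  "g_step g s = g_next g (g_grow g s) (g_tight g s (g_grow g s))"

definition g_ev :: "gstate \<Rightarrow> (nat \<times> nat) list \<Rightarrow> gevent list" where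
  "g_ev t Q = (if Q = [] then [] else [(fst t, hdd (0, 0) Q, g_act t (snd (hdd (0, 0) Q)))])"

definition g_event :: "genv \<Rightarrow> gstate \<Rightarrow> gevent list" where
  "g_event g s = g_ev (g_grow g s) (g_tight g s (g_grow g s))"

definition g_verts :: "nat \<Rightarrow> (nat \<times> nat) list \<Rightarrow> nat list" where
  "g_verts r T = r # map fst T @ map snd T"

definition g_touch :: "nat list \<Rightarrow> nat list \<Rightarrow> nat \<Rightarrow> bool" where
  "g_touch lab tv x \<longleftrightarrow> (\<exists>t\<in>set tv. nthd 0 lab t = nthd 0 lab x)"

text \<open>Undoing a merge: the merging edge is kept if the merged component is used and the second
  component is either used or was active; the first one is always active.\<close>

definition g_sel :: "nat \<Rightarrow> (nat \<times> nat) list \<Rightarrow> gevent \<Rightarrow> (nat \<times> nat) list" where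
  "g_sel r T ev =
     (if (g_touch (fst ev) (g_verts r T) (fst (fst (snd ev))) \<or> g_touch (fst ev) (g_verts r T) (snd (fst (snd ev)))) \<and>
         (g_touch (fst ev) (g_verts r T) (snd (fst (snd ev))) \<or> snd (snd ev))
      then fst (snd ev) # T else T)"

definition g_init :: "genv \<Rightarrow> nat list \<Rightarrow> gstate" where
  "g_init g pz = (fst g, map (\<lambda>v. 0) (fst g), map (\<lambda>v. nthd 0 pz v) (fst g))"

text \<open>The latest event comes first, so the later fold undoes the merges in reverse order. Two
  rounds per vertex suffice, because a round lowers the number of components plus the number of
  active ones.\<close>

definition g_hist :: "genv \<Rightarrow> gstate \<Rightarrow> nat list \<Rightarrow> gstate \<times> gevent list" where
  "g_hist g s cs = foldl (\<lambda>z _. (g_step g (fst z), g_event g (fst z) @ snd z)) (s, []) cs"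

definition g_edges :: "genv \<Rightarrow> nat list \<Rightarrow> (nat \<times> nat) list" where
  "g_edges g pz = foldl (g_sel (fst (snd g))) [] (snd (g_hist g (g_init g pz) (fst g @ fst g)))"

definition ins_after :: "nat \<Rightarrow> nat \<Rightarrow> nat list \<Rightarrow> nat list" where
  "ins_after x y zs = concat (map (\<lambda>z. if z = x then [x, y] else [z]) zs)"

definition memb :: "nat \<Rightarrow> nat list \<Rightarrow> bool" where "memb x zs \<longleftrightarrow> (\<exists>z\<in>set zs. z = x)"

definition g_attach :: "nat list \<Rightarrow> nat \<times> nat \<Rightarrow> nat list" where
  "g_attach zs e = (if memb (fst e) zs \<and> \<not> memb (snd e) zs then ins_after (fst e) (snd e) zs
     else if memb (snd e) zs \<and> \<not> memb (fst e) zs then ins_after (snd e) (fst e) zs else zs)"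

text \<open>The edges come in no useful order, so all of them are tried once per vertex; a pass that
  attaches nothing shows that the tree is exhausted.\<close>

definition g_tour :: "nat list \<Rightarrow> nat \<Rightarrow> (nat \<times> nat) list \<Rightarrow> nat list" where
  "g_tour vs r T = foldl g_attach [r] (concat (map (\<lambda>_. T) vs))"

text \<open>The reverse pass as a recursion over the forward steps, the form that suits
  induction.\<close>

fun g_sol :: "genv \<Rightarrow> nat \<Rightarrow> gstate \<Rightarrow> (nat \<times> nat) list" where
  "g_sol g 0 s = []"
| "g_sol g (Suc k) s = foldl (g_sel (fst (snd g))) (g_sol g k (g_step g s)) (g_event g s)"

lemma g_hist_sol:
  "\<exists>H. snd (foldl (\<lambda>z _. (g_step g (fst z), g_event g (fst z) @ snd z)) (s, h) cs) = H @ h \<and>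
     foldl (g_sel (fst (snd g))) [] H = g_sol g (length cs) s"
proof (induction cs arbitrary: s h)
  case (Cons c cs)
  obtain H where "snd (foldl (\<lambda>z _. (g_step g (fst z), g_event g (fst z) @ snd z)) (g_step g s, g_event g s @ h) cs) = H @ g_event g s @ h"
    "foldl (g_sel (fst (snd g))) [] H = g_sol g (length cs) (g_step g s)"
    using Cons[of "g_step g s" "g_event g s @ h"] by blast
  then show ?case by (intro exI[of _ "H @ g_event g s"]) simp
qed simp

lemma g_edges_sol: "g_edges g pz = g_sol g (2 * length (fst g)) (g_init g pz)"
  using g_hist_sol[of g "g_init g pz" "[]" "fst g @ fst g"] unfolding g_edges_def g_hist_def by (auto simp: mult_2)

lemma nthd_map_upt [simp]: "v < n \<Longrightarrow> nthd d (map f [0..<n]) v = f v"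
  by (simp add: nthd_def)

lemma set_g_pairs: "set (g_pairs vs) = set vs \<times> set vs"
  by (auto simp: g_pairs_def)

section \<open>The forward pass: growth and merging of moats\<close>

locale moats =
  fixes n r :: nat and dd :: "nat \<Rightarrow> nat \<Rightarrow> nat" and pz :: "nat \<Rightarrow> nat" and ds :: "nat list list" and M :: nat
  assumes r: "r < n" and dm: "\<And>u v. u < n \<Longrightarrow> v < n \<Longrightarrow> dm ds u v = dd u v"
    and sym: "\<And>u v. u < n \<Longrightarrow> v < n \<Longrightarrow> dd u v = dd v u"
    and even: "\<And>u v. u < n \<Longrightarrow> v < n \<Longrightarrow> even (dd u v)"
    and pz_r: "pz r = 0" and M: "M = (\<Sum>v<n. pz v)"
begin

definition g :: genv where "g = ([0..<n], r, ds, M)"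

lemma g_simps: "fst g = [0..<n]" "fst (snd g) = r" "fst (snd (snd g)) = ds" "snd (snd (snd g)) = M"
  by (simp_all add: g_def)

definition cls :: "gstate \<Rightarrow> nat \<Rightarrow> nat set" where "cls s l = {v. v < n \<and> lb s v = l}"
definition Act :: "gstate \<Rightarrow> nat set" where "Act s = {l. l < n \<and> 0 < ph s l}"
definition wsum :: "(nat set \<Rightarrow> nat) \<Rightarrow> (nat set \<Rightarrow> nat) \<Rightarrow> nat" where "wsum h y = (\<Sum>X\<in>Pow {..<n}. h X * y X)"

text \<open>The dual solution \<open>y\<close> exists only in the proof; the algorithm stores its
  sums \<open>Dv\<close>. The inequality over all \<open>U\<close> is the packing constraint with
  the residual prizes added on the left: growth shifts an amount from the residual prizes into
  \<open>y\<close>, and merging regroups them.\<close>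

definition ginv :: "gstate \<Rightarrow> (nat set \<Rightarrow> nat) \<Rightarrow> bool" where
  "ginv s y \<longleftrightarrow> (\<forall>v<n. lb s v < n) \<and>
     (\<forall>v<n. Dv s v = wsum (\<lambda>X. of_bool (v \<in> X)) y) \<and>
     (\<forall>a<n. \<forall>b<n. lb s a \<noteq> lb s b \<longrightarrow> Dv s a + Dv s b \<le> dd a b) \<and>
     (\<forall>a<n. \<forall>b<n. wsum (\<lambda>X. of_bool ((a \<in> X) \<noteq> (b \<in> X))) y \<le> dd a b) \<and>
     (\<forall>X. 0 < y X \<longrightarrow> X \<subseteq> {..<n} - {r} \<and> (\<forall>a\<in>X. \<forall>b\<in>X. lb s a = lb s b)) \<and>
     (\<forall>U\<subseteq>{..<n}. wsum (\<lambda>X. of_bool (X \<subseteq> U)) y + (\<Sum>l<n. of_bool (cls s l \<subseteq> U) * ph s l) \<le> (\<Sum>u\<in>U. pz u)) \<and>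
     (\<forall>l<n. 0 < ph s l \<longrightarrow> cls s l \<noteq> {}) \<and> ph s (lb s r) = 0"

lemma invD:
  assumes "ginv s y"
  shows "v < n \<Longrightarrow> lb s v < n" "v < n \<Longrightarrow> Dv s v = wsum (\<lambda>X. of_bool (v \<in> X)) y"
    "a < n \<Longrightarrow> b < n \<Longrightarrow> lb s a \<noteq> lb s b \<Longrightarrow> Dv s a + Dv s b \<le> dd a b"
    "a < n \<Longrightarrow> b < n \<Longrightarrow> wsum (\<lambda>X. of_bool ((a \<in> X) \<noteq> (b \<in> X))) y \<le> dd a b"
    "0 < y X \<Longrightarrow> X \<subseteq> {..<n} - {r}" "0 < y X \<Longrightarrow> a \<in> X \<Longrightarrow> b \<in> X \<Longrightarrow> lb s a = lb s b"
    "U \<subseteq> {..<n} \<Longrightarrow> wsum (\<lambda>X. of_bool (X \<subseteq> U)) y + (\<Sum>l<n. of_bool (cls s l \<subseteq> U) * ph s l) \<le> (\<Sum>u\<in>U. pz u)"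
    "l < n \<Longrightarrow> 0 < ph s l \<Longrightarrow> cls s l \<noteq> {}" "ph s (lb s r) = 0"
proof -
  note c = assms[unfolded ginv_def]
  note c1 = c[THEN conjunct1] and c = c[THEN conjunct2]
  note c2 = c[THEN conjunct1] and c = c[THEN conjunct2]
  note c3 = c[THEN conjunct1] and c = c[THEN conjunct2]
  note c4 = c[THEN conjunct1] and c = c[THEN conjunct2]
  note c5 = c[THEN conjunct1] and c = c[THEN conjunct2]
  note c6 = c[THEN conjunct1] and c = c[THEN conjunct2]
  note c7 = c[THEN conjunct1] and c8 = c[THEN conjunct2]
  show "v < n \<Longrightarrow> lb s v < n" "v < n \<Longrightarrow> Dv s v = wsum (\<lambda>X. of_bool (v \<in> X)) y" using c1 c2 by simp_all
  show "a < n \<Longrightarrow> b < n \<Longrightarrow> lb s a \<noteq> lb s b \<Longrightarrow> Dv s a + Dv s b \<le> dd a b" using c3 by simp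
  show "a < n \<Longrightarrow> b < n \<Longrightarrow> wsum (\<lambda>X. of_bool ((a \<in> X) \<noteq> (b \<in> X))) y \<le> dd a b" using c4 by simp
  show "0 < y X \<Longrightarrow> X \<subseteq> {..<n} - {r}" "0 < y X \<Longrightarrow> a \<in> X \<Longrightarrow> b \<in> X \<Longrightarrow> lb s a = lb s b" using c5 by blast+
  show "U \<subseteq> {..<n} \<Longrightarrow> wsum (\<lambda>X. of_bool (X \<subseteq> U)) y + (\<Sum>l<n. of_bool (cls s l \<subseteq> U) * ph s l) \<le> (\<Sum>u\<in>U. pz u)" using c6 by blast
  show "l < n \<Longrightarrow> 0 < ph s l \<Longrightarrow> cls s l \<noteq> {}" "ph s (lb s r) = 0" using c7 c8 by simp_all
qed

text \<open>The packing constraint for the set of all vertices; it shows that the cap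
  \<open>M\<close> never takes effect.\<close>

lemma inv_total:
  assumes "ginv s y"
  shows "wsum (\<lambda>_. 1) y + (\<Sum>l<n. ph s l) \<le> M"
proof -
  have "wsum (\<lambda>X. of_bool (X \<subseteq> {..<n})) y = wsum (\<lambda>_. 1) y" unfolding wsum_def by (rule sum.cong) auto
  moreover have "(\<Sum>l<n. of_bool (cls s l \<subseteq> {..<n}) * ph s l) = (\<Sum>l<n. ph s l)" by (rule sum.cong) (auto simp: cls_def)
  ultimately show ?thesis using invD(7)[OF assms, of "{..<n}"] M by simp
qed

lemma wsum_mono: "(\<And>X. h X \<le> h' X) \<Longrightarrow> wsum h y \<le> wsum h' y"
  unfolding wsum_def by (intro sum_mono mult_le_mono1) auto

lemma inv_init:
  assumes "length ps = n" "\<And>v. v < n \<Longrightarrow> ps ! v = pz v"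
  shows "ginv (g_init g ps) (\<lambda>_. 0)"
proof -
  have s: "\<And>v. v < n \<Longrightarrow> lb (g_init g ps) v = v" "\<And>v. v < n \<Longrightarrow> Dv (g_init g ps) v = 0" "\<And>v. v < n \<Longrightarrow> ph (g_init g ps) v = pz v"
    using assms by (auto simp: g_init_def g_def nthd_def)
  then have c: "v < n \<Longrightarrow> cls (g_init g ps) v = {v}" for v by (auto simp: cls_def)
  have "(\<Sum>l<n. of_bool (cls (g_init g ps) l \<subseteq> U) * ph (g_init g ps) l) \<le> (\<Sum>u\<in>U. pz u)" if U: "U \<subseteq> {..<n}" for U
  proof -
    have "(\<Sum>l<n. of_bool (cls (g_init g ps) l \<subseteq> U) * ph (g_init g ps) l) = (\<Sum>l<n. if l \<in> U then pz l else 0)"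
      by (rule sum.cong) (auto simp: s c)
    also have "\<dots> = (\<Sum>u\<in>U. pz u)" using U by (simp add: sum.If_cases Int_absorb1)
    finally show ?thesis by simp
  qed
  then show ?thesis unfolding ginv_def using s c r pz_r by (auto simp: wsum_def)
qed

definition grown :: "gstate \<Rightarrow> (nat set \<Rightarrow> nat) \<Rightarrow> nat set \<Rightarrow> nat" where
  "grown s y X = y X + (if X \<in> cls s ` Act s then g_eps g s else 0)"

lemma cross_iff: "(u, v) \<in> set (g_cross g s) \<longleftrightarrow> u < n \<and> v < n \<and> lb s u \<noteq> lb s v \<and> g_act s u"
  by (auto simp: g_cross_def set_g_pairs g_def)

lemma act_iff: "ginv s y \<Longrightarrow> v < n \<Longrightarrow> g_act s v \<longleftrightarrow> lb s v \<in> Act s"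
  by (auto simp: g_act_def Act_def dest: invD(1))

lemma eps_le_ph: "l \<in> Act s \<Longrightarrow> g_eps g s \<le> ph s l"
  unfolding g_eps_def by (rule argmin_le[where k = "\<lambda>x. x"]) (auto simp: Act_def g_def)

lemma eps_le_gap: "(u, v) \<in> set (g_cross g s) \<Longrightarrow> g_eps g s \<le> (dd u v - (Dv s u + Dv s v)) div 2"
proof -
  assume uv: "(u, v) \<in> set (g_cross g s)"
  then have "dm ds u v = dd u v" using dm by (simp add: cross_iff)
  then show ?thesis unfolding g_eps_def
    by (intro argmin_le[where k = "\<lambda>x. x"]) (use uv in \<open>force simp: g_def\<close>)
qed

lemma eps_attained:
  assumes "Act s \<noteq> {}"
  shows "(\<exists>l\<in>Act s. g_eps g s = ph s l) \<or> (\<exists>u v. (u, v) \<in> set (g_cross g s) \<and> g_eps g s = (dd u v - (Dv s u + Dv s v)) div 2)"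
proof -
  let ?xs = "map (\<lambda>q. (dm (fst (snd (snd g))) (fst q) (snd q) - (Dv s (fst q) + Dv s (snd q))) div 2) (g_cross g s)
      @ filter (\<lambda>a. 0 < a) (map (\<lambda>l. ph s l) (fst g))"
  have "?xs \<noteq> []" using assms by (auto simp: Act_def g_def filter_empty_conv)
  then have "g_eps g s \<in> set ?xs" unfolding g_eps_def by (rule argmin_in)
  then show ?thesis
  proof (simp only: set_append, elim UnE)
    assume "g_eps g s \<in> set (map (\<lambda>q. (dm (fst (snd (snd g))) (fst q) (snd q) - (Dv s (fst q) + Dv s (snd q))) div 2) (g_cross g s))"
    then obtain u v where "(u, v) \<in> set (g_cross g s)" "g_eps g s = (dm ds u v - (Dv s u + Dv s v)) div 2"
      by (auto simp: g_def)
    moreover from this(1) have "dm ds u v = dd u v" using dm by (simp add: cross_iff)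
    ultimately show ?thesis by auto
  qed (auto simp: g_def Act_def)
qed

text \<open>Active labels have nonempty classes, so distinct labels grow distinct moats; otherwise
  \<open>grown\<close> would count a common moat once only.\<close>

lemma inj_cls: "ginv s y \<Longrightarrow> inj_on (cls s) (Act s)"
  by (rule inj_onI) (use invD(8) in \<open>fastforce simp: Act_def cls_def\<close>)

lemma wsum_grown:
  assumes "ginv s y"
  shows "wsum h (grown s y) = wsum h y + g_eps g s * (\<Sum>l\<in>Act s. h (cls s l))"
proof -
  have sub: "cls s ` Act s \<subseteq> Pow {..<n}" by (auto simp: cls_def)
  have "wsum h (grown s y) = wsum h y + (\<Sum>X\<in>Pow {..<n}. if X \<in> cls s ` Act s then h X * g_eps g s else 0)"
    unfolding wsum_def grown_def sum.distrib[symmetric] by (rule sum.cong) (auto simp: algebra_simps)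
  also have "(\<Sum>X\<in>Pow {..<n}. if X \<in> cls s ` Act s then h X * g_eps g s else 0) = (\<Sum>X\<in>cls s ` Act s. h X * g_eps g s)"
    by (subst sum.If_cases) (use sub in \<open>auto simp: Int_absorb1\<close>)
  also have "\<dots> = g_eps g s * (\<Sum>l\<in>Act s. h (cls s l))"
    by (simp add: sum.reindex[OF inj_cls[OF assms]] sum_distrib_left mult.commute)
  finally show ?thesis .
qed

lemma fin_Act: "finite (Act s)" by (simp add: Act_def)

lemma sum_act_mem: "v < n \<Longrightarrow> (\<Sum>l\<in>Act s. of_bool (v \<in> cls s l)) = (of_bool (lb s v \<in> Act s) :: nat)"
proof -
  assume "v < n"
  then have "(\<Sum>l\<in>Act s. of_bool (v \<in> cls s l)) = (\<Sum>l\<in>Act s. if l = lb s v then 1 else 0 :: nat)"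
    by (intro sum.cong) (auto simp: cls_def)
  then show ?thesis using fin_Act by simp
qed

lemma grow_lb: "lb (g_grow g s) v = lb s v" by (simp add: g_grow_def)

lemma grow_ph: "l < n \<Longrightarrow> ph (g_grow g s) l = ph s l - g_eps g s" by (simp add: g_grow_def g_def)

lemma eps_sum_le:
  assumes "ginv s y" shows "g_eps g s * card (Act s) \<le> (\<Sum>l<n. ph s l)"
proof -
  have "g_eps g s * card (Act s) = (\<Sum>l\<in>Act s. g_eps g s)" by simp
  also have "\<dots> \<le> (\<Sum>l\<in>Act s. ph s l)" by (intro sum_mono eps_le_ph)
  also have "\<dots> \<le> (\<Sum>l<n. ph s l)" by (rule sum_mono2) (auto simp: Act_def)
  finally show ?thesis .
qed

text \<open>The cap does not bite: the width is at most the value of \<open>y\<close>, the step at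
  most the total residual prize, and together these are at most \<open>M\<close>.\<close>

lemma grow_Dv:
  assumes "ginv s y" "v < n"
  shows "Dv (g_grow g s) v = Dv s v + (if lb s v \<in> Act s then g_eps g s else 0)"
proof -
  have "Dv s v + (if lb s v \<in> Act s then g_eps g s else 0) \<le> M"
  proof -
    have "Dv s v \<le> wsum (\<lambda>_. 1) y" unfolding invD(2)[OF assms] by (rule wsum_mono) simp
    moreover have "(if lb s v \<in> Act s then g_eps g s else 0) \<le> (\<Sum>l<n. ph s l)"
    proof (cases "lb s v \<in> Act s")
      case True
      then have "card (Act s) \<ge> 1" using fin_Act by (metis One_nat_def Suc_leI card_gt_0_iff empty_iff)
      then have "g_eps g s * 1 \<le> g_eps g s * card (Act s)" by (rule mult_le_mono2)
      then have "g_eps g s \<le> (\<Sum>l<n. ph s l)" using eps_sum_le[OF assms(1)] by linarith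
      then show ?thesis using True by simp
    qed simp
    ultimately show ?thesis using inv_total[OF assms(1)] by linarith
  qed
  then show ?thesis using assms act_iff[OF assms] by (simp add: g_grow_def g_simps min_absorb2)
qed

lemma cls_grow: "cls (g_grow g s) l = cls s l" by (simp add: cls_def grow_lb)

text \<open>A new moat is a whole component, so it separates only vertices of different components,
  and for these the sum of their widths is a bound. What \<open>y\<close> gains inside
  \<open>U\<close>, the residual prizes inside \<open>U\<close> lose.\<close>

lemma inv_grow: assumes i: "ginv s y" shows "ginv (g_grow g s) (grown s y)"
proof -
  let ?t = "g_grow g s" and ?e = "g_eps g s"
  have 2: "Dv ?t v = wsum (\<lambda>X. of_bool (v \<in> X)) (grown s y)" if "v < n" for v
    using that by (simp add: grow_Dv[OF i] wsum_grown[OF i] sum_act_mem invD(2)[OF i])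
  have 3: "Dv ?t a + Dv ?t b \<le> dd a b" if ab: "a < n" "b < n" "lb s a \<noteq> lb s b" for a b
  proof -
    have base: "Dv s a + Dv s b \<le> dd a b" using invD(3)[OF i ab] .
    consider "lb s a \<in> Act s" | "lb s b \<in> Act s" "lb s a \<notin> Act s" | "lb s a \<notin> Act s" "lb s b \<notin> Act s" by blast
    then show ?thesis
    proof cases
      case 1
      then have "(a, b) \<in> set (g_cross g s)" using ab act_iff[OF i] by (simp add: cross_iff)
      from eps_le_gap[OF this] have "Dv s a + Dv s b + ?e + ?e \<le> dd a b" using base by linarith
      then show ?thesis using base ab by (simp add: grow_Dv[OF i])
    next
      case 2
      then have "(b, a) \<in> set (g_cross g s)" using ab act_iff[OF i] by (auto simp: cross_iff)
      from eps_le_gap[OF this] have "Dv s a + Dv s b + ?e + ?e \<le> dd a b" using base sym[OF ab(1,2)] by linarith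
      then show ?thesis using base ab by (simp add: grow_Dv[OF i])
    next
      case 3
      then show ?thesis using base ab by (simp add: grow_Dv[OF i])
    qed
  qed
  have 4: "wsum (\<lambda>X. of_bool ((a \<in> X) \<noteq> (b \<in> X))) (grown s y) \<le> dd a b" if ab: "a < n" "b < n" for a b
  proof (cases "lb s a = lb s b")
    case True
    then have "(\<Sum>l\<in>Act s. of_bool ((a \<in> cls s l) \<noteq> (b \<in> cls s l))) = (0::nat)" using ab by (auto simp: cls_def)
    then show ?thesis using invD(4)[OF i ab] by (simp add: wsum_grown[OF i])
  next
    case False
    have "wsum (\<lambda>X. of_bool ((a \<in> X) \<noteq> (b \<in> X))) (grown s y) \<le> wsum (\<lambda>X. of_bool (a \<in> X) + of_bool (b \<in> X)) (grown s y)"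
      by (rule wsum_mono) auto
    also have "\<dots> = Dv ?t a + Dv ?t b" using ab by (simp add: 2) (simp add: wsum_def sum.distrib distrib_right)
    also have "\<dots> \<le> dd a b" using 3 ab False by simp
    finally show ?thesis .
  qed
  have 5: "X \<subseteq> {..<n} - {r} \<and> (\<forall>a\<in>X. \<forall>b\<in>X. lb s a = lb s b)" if pos: "0 < grown s y X" for X
  proof (cases "0 < y X")
    case True
    then show ?thesis using invD(5,6)[OF i] by blast
  next
    case False
    then obtain l where l: "l \<in> Act s" "X = cls s l" using pos False by (auto simp: grown_def split: if_splits)
    moreover have "l \<noteq> lb s r" using l(1) invD(9)[OF i] by (auto simp: Act_def)
    ultimately show ?thesis by (auto simp: cls_def)
  qed
  have 6: "wsum (\<lambda>X. of_bool (X \<subseteq> U)) (grown s y) + (\<Sum>l<n. of_bool (cls s l \<subseteq> U) * ph ?t l) \<le> (\<Sum>u\<in>U. pz u)"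
    if U: "U \<subseteq> {..<n}" for U
  proof -
    have "?e * (\<Sum>l\<in>Act s. of_bool (cls s l \<subseteq> U)) = (\<Sum>l\<in>Act s. of_bool (cls s l \<subseteq> U) * ?e)"
      by (simp add: sum_distrib_left mult.commute)
    also have "\<dots> = (\<Sum>l<n. if l \<in> Act s then of_bool (cls s l \<subseteq> U) * ?e else 0)"
      by (subst sum.If_cases) (auto simp: Act_def Int_def intro: sum.cong)
    finally have "?e * (\<Sum>l\<in>Act s. of_bool (cls s l \<subseteq> U)) + (\<Sum>l<n. of_bool (cls s l \<subseteq> U) * ph ?t l) =
        (\<Sum>l<n. (if l \<in> Act s then of_bool (cls s l \<subseteq> U) * ?e else 0) + of_bool (cls s l \<subseteq> U) * ph ?t l)"
      by (simp add: sum.distrib)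
    also have "\<dots> \<le> (\<Sum>l<n. of_bool (cls s l \<subseteq> U) * ph s l)"
    proof (rule sum_mono)
      fix l assume "l \<in> {..<n}"
      then show "(if l \<in> Act s then of_bool (cls s l \<subseteq> U) * ?e else 0) + of_bool (cls s l \<subseteq> U) * ph ?t l \<le> of_bool (cls s l \<subseteq> U) * ph s l"
        using eps_le_ph[of l s] by (auto simp: grow_ph Act_def)
    qed
    finally show ?thesis using invD(7)[OF i U] by (simp add: wsum_grown[OF i])
  qed
  have 7: "cls s l \<noteq> {}" if "l < n" "0 < ph ?t l" for l
    using that invD(8)[OF i, of l] by (auto simp: grow_ph)
  have 8: "ph ?t (lb s r) = 0" using invD(9)[OF i] invD(1)[OF i r] by (simp add: grow_ph)
  show ?thesis unfolding ginv_def cls_grow grow_lb using invD(1)[OF i] 2 3 4 5 6 7 8 by blast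
qed

lemma merge_simps:
  assumes "v < n" "l < n"
  shows "lb (g_merge g t q) v = (if lb t v = lb t (snd q) then lb t (fst q) else lb t v)"
    "Dv (g_merge g t q) v = Dv t v"
    "ph (g_merge g t q) l = (if l = lb t (fst q)
       then (if lb t (snd q) = lb t r then 0 else min M (ph t (lb t (fst q)) + ph t (lb t (snd q))))
       else if l = lb t (snd q) then 0 else ph t l)"
  using assms by (simp_all add: g_merge_def g_def)

lemma merge_ph:
  assumes i: "ginv t y" and xy: "x < n" "y' < n" "lb t x \<noteq> lb t y'" and l: "l < n"
  shows "ph (g_merge g t (x, y')) l = (if l = lb t x
       then (if lb t y' = lb t r then 0 else ph t (lb t x) + ph t (lb t y'))
       else if l = lb t y' then 0 else ph t l)"
proof -
  have "ph t (lb t x) + ph t (lb t y') = (\<Sum>l\<in>{lb t x, lb t y'}. ph t l)" using xy by simp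
  also have "\<dots> \<le> (\<Sum>l<n. ph t l)" by (rule sum_mono2) (use xy invD(1)[OF i] in auto)
  also have "\<dots> \<le> M" using inv_total[OF i] by simp
  finally show ?thesis using l by (simp add: merge_simps)
qed

text \<open>The merged component lies in \<open>U\<close> only if both parts do, so the left side of
  the packing constraint can only shrink.\<close>

lemma inv_merge:
  assumes i: "ginv t y" and xy: "x < n" "x' < n" "lb t x \<noteq> lb t x'" and act: "lb t x \<in> Act t"
  shows "ginv (g_merge g t (x, x')) y"
proof -
  let ?m = "g_merge g t (x, x')" and ?a = "lb t x" and ?b = "lb t x'"
  have ab: "?a < n" "?b < n" using invD(1)[OF i] xy by auto
  have ar: "?a \<noteq> lb t r" using act invD(9)[OF i] by (auto simp: Act_def)
  have l: "lb ?m v = (if lb t v = ?b then ?a else lb t v)" if "v < n" for v using that by (simp add: merge_simps[where l = v])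
  have D: "Dv ?m v = Dv t v" if "v < n" for v using that by (simp add: merge_simps[where l = v])
  note P = merge_ph[OF i xy]
  have c: "cls ?m l = (if l = ?a then cls t ?a \<union> cls t ?b else if l = ?b then {} else cls t l)" for l
    using l xy(3) by (auto simp: cls_def)
  have 5: "\<forall>a\<in>X. \<forall>b\<in>X. lb ?m a = lb ?m b" if "0 < y X" for X
  proof (intro ballI)
    fix a b assume ab: "a \<in> X" "b \<in> X"
    then have "a < n" "b < n" using invD(5)[OF i that] by auto
    then show "lb ?m a = lb ?m b" using l[of a] l[of b] invD(6)[OF i that ab] by presburger
  qed
  have 6: "wsum (\<lambda>X. of_bool (X \<subseteq> U)) y + (\<Sum>l<n. of_bool (cls ?m l \<subseteq> U) * ph ?m l) \<le> (\<Sum>u\<in>U. pz u)"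
    if U: "U \<subseteq> {..<n}" for U
  proof -
    have split: "(\<Sum>l<n. f l) = f ?a + f ?b + (\<Sum>l\<in>{..<n} - {?a, ?b}. f l)" for f :: "nat \<Rightarrow> nat"
    proof -
      have "(\<Sum>l<n. f l) = (\<Sum>l\<in>{?a, ?b}. f l) + (\<Sum>l\<in>{..<n} - {?a, ?b}. f l)"
        using sum.subset_diff[of "{?a, ?b}" "{..<n}" f] ab by (simp only: add.commute) auto
      also have "(\<Sum>l\<in>{?a, ?b}. f l) = f ?a + f ?b" using xy(3) by (subst sum.insert) auto
      finally show ?thesis .
    qed
    have "(\<Sum>l\<in>{..<n} - {?a, ?b}. of_bool (cls ?m l \<subseteq> U) * ph ?m l) = (\<Sum>l\<in>{..<n} - {?a, ?b}. of_bool (cls t l \<subseteq> U) * ph t l)"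
      by (rule sum.cong) (auto simp: c P)
    moreover have "of_bool (cls ?m ?a \<subseteq> U) * ph ?m ?a + of_bool (cls ?m ?b \<subseteq> U) * ph ?m ?b \<le>
        of_bool (cls t ?a \<subseteq> U) * ph t ?a + of_bool (cls t ?b \<subseteq> U) * ph t ?b"
      using xy(3) ab by (auto simp: c P)
    ultimately have "(\<Sum>l<n. of_bool (cls ?m l \<subseteq> U) * ph ?m l) \<le> (\<Sum>l<n. of_bool (cls t l \<subseteq> U) * ph t l)"
      unfolding split by linarith
    then show ?thesis using invD(7)[OF i U] by linarith
  qed
  have 7: "cls ?m l \<noteq> {}" if "l < n" "0 < ph ?m l" for l
    using that P[OF that(1)] c[of l] invD(8)[OF i, of l] xy(1) by (auto simp: cls_def split: if_splits)
  have 8: "ph ?m (lb ?m r) = 0" using l[OF r] P[of "lb ?m r"] invD(1)[OF i r] invD(9)[OF i] ar ab by auto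
  show ?thesis unfolding ginv_def
  proof (intro conjI allI impI)
    fix v assume "v < n" then show "lb ?m v < n" using l invD(1)[OF i] ab by simp
  next
    fix v assume "v < n" then show "Dv ?m v = wsum (\<lambda>X. of_bool (v \<in> X)) y" using D invD(2)[OF i] by simp
  next
    fix a b assume "a < n" "b < n" "lb ?m a \<noteq> lb ?m b"
    then show "Dv ?m a + Dv ?m b \<le> dd a b" using D l invD(3)[OF i, of a b] by metis
  next
    fix a b assume "a < n" "b < n"
    then show "wsum (\<lambda>X. of_bool ((a \<in> X) \<noteq> (b \<in> X))) y \<le> dd a b" using invD(4)[OF i] by blast
  qed (use invD(5)[OF i] 5 6 7 8 in blast)+
qed

lemma tight_hd:
  assumes "ginv s y" "g_tight g s (g_grow g s) \<noteq> []"
  obtains x x' where "hdd (0, 0) (g_tight g s (g_grow g s)) = (x, x')" "x < n" "x' < n" "lb s x \<noteq> lb s x'"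
    "lb s x \<in> Act (g_grow g s)" "dd x x' \<le> 2 * (Dv (g_grow g s) x + Dv (g_grow g s) x')"
proof -
  obtain x x' where h: "hdd (0, 0) (g_tight g s (g_grow g s)) = (x, x')" by fastforce
  have "(x, x') \<in> set (g_tight g s (g_grow g s))" using assms(2) h by (cases "g_tight g s (g_grow g s)") (auto simp: hdd_def)
  then have *: "(x, x') \<in> set (g_cross g s)" "g_act (g_grow g s) x" "dm ds x x' \<le> 2 * (Dv (g_grow g s) x + Dv (g_grow g s) x')"
    by (auto simp: g_tight_def g_def)
  then have xx: "x < n" "x' < n" "lb s x \<noteq> lb s x'" by (auto simp: cross_iff)
  have "lb s x \<in> Act (g_grow g s)" using act_iff[OF inv_grow[OF assms(1)] xx(1)] *(2) grow_lb by simp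
  then show ?thesis using that[OF h xx] *(3) dm[OF xx(1,2)] by simp
qed

lemma inv_step: assumes "ginv s y" shows "ginv (g_step g s) (grown s y)"
proof (cases "g_tight g s (g_grow g s) = []")
  case True
  then show ?thesis using inv_grow[OF assms] by (simp add: g_step_def g_next_def)
next
  case False
  obtain x x' where x: "hdd (0, 0) (g_tight g s (g_grow g s)) = (x, x')" "x < n" "x' < n" "lb s x \<noteq> lb s x'" "lb s x \<in> Act (g_grow g s)"
    using tight_hd[OF assms False] by metis
  then show ?thesis using inv_merge[OF inv_grow[OF assms], of x x'] False by (simp add: g_step_def g_next_def grow_lb)
qed

definition labels :: "gstate \<Rightarrow> nat set" where "labels s = lb s ` {..<n}"

text \<open>A merge removes a label and activates nothing. Without a merge, the step length came
  from an exhausted prize, or from a gap whose growing end has just run out of prize, since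
  otherwise the pair would be tight; either way an active component is lost.\<close>

lemma step_decreases:
  assumes i: "ginv s y" and A: "Act s \<noteq> {}"
  shows "card (labels (g_step g s)) + card (Act (g_step g s)) < card (labels s) + card (Act s)"
proof -
  let ?t = "g_grow g s"
  have lt: "labels ?t = labels s" by (simp add: labels_def grow_lb)
  have At: "Act ?t \<subseteq> Act s" by (auto simp: Act_def grow_ph)
  show ?thesis
  proof (cases "g_tight g s ?t = []")
    case True
    have "Act ?t \<noteq> Act s"
      using eps_attained[OF A]
    proof
      assume "\<exists>l\<in>Act s. g_eps g s = ph s l"
      then obtain l where "l \<in> Act s" "g_eps g s = ph s l" by blast
      then have "l \<notin> Act ?t" by (auto simp: Act_def grow_ph)
      then show ?thesis using \<open>l \<in> Act s\<close> by blast
    next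
      assume "\<exists>u v. (u, v) \<in> set (g_cross g s) \<and> g_eps g s = (dd u v - (Dv s u + Dv s v)) div 2"
      then obtain u v where uv: "(u, v) \<in> set (g_cross g s)" and e: "g_eps g s = (dd u v - (Dv s u + Dv s v)) div 2" by blast
      have u: "u < n" "v < n" "lb s u \<noteq> lb s v" "lb s u \<in> Act s" using uv act_iff[OF i] by (auto simp: cross_iff)
      have "Dv ?t u + Dv ?t v \<ge> Dv s u + Dv s v + g_eps g s" using u by (simp add: grow_Dv[OF i])
      \<comment> \<open>Rounding loses at most 1. A moat of width at least 1 at one of the ends
        makes up for it; if there is none, the gap is \<open>dd u v\<close> itself, which is
        even.\<close>
      moreover have "dd u v \<le> 2 * (Dv s u + Dv s v + g_eps g s)"
      proof (cases "Dv s u + Dv s v = 0")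
        case True
        then show ?thesis using e even[OF u(1,2)] by auto
      next
        case False
        then have "1 \<le> Dv s u + Dv s v" by arith
        moreover have "m \<le> 2 * (m div 2) + 1" for m :: nat by presburger
        from this[of "dd u v - (Dv s u + Dv s v)"] have "dd u v - (Dv s u + Dv s v) \<le> 2 * g_eps g s + 1" using e by simp
        then have "dd u v \<le> 2 * g_eps g s + 1 + (Dv s u + Dv s v)" by (simp only: le_diff_conv)
        ultimately show ?thesis by arith
      qed
      ultimately have "dm ds u v \<le> 2 * (Dv ?t u + Dv ?t v)" using dm[OF u(1,2)] by arith
      then have "\<not> g_act ?t u" using True uv by (auto simp: g_tight_def filter_empty_conv g_def)
      then have "lb s u \<notin> Act ?t" using act_iff[OF inv_grow[OF i] u(1)] grow_lb by simp
      then show ?thesis using u(4) by blast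
    qed
    then have "card (Act ?t) < card (Act s)" using At by (intro psubset_card_mono[OF fin_Act]) auto
    then show ?thesis using True lt by (simp add: g_step_def g_next_def)
  next
    case False
    obtain x x' where x: "hdd (0, 0) (g_tight g s ?t) = (x, x')" "x < n" "x' < n" "lb s x \<noteq> lb s x'" "lb s x \<in> Act ?t"
      using tight_hd[OF i False] by metis
    let ?m = "g_merge g ?t (x, x')"
    have st: "g_step g s = ?m" using False x by (simp add: g_step_def g_next_def)
    have lm: "lb ?m v = (if lb s v = lb s x' then lb s x else lb s v)" if "v < n" for v
      using that by (simp add: merge_simps[where l = v] grow_lb)
    have "labels ?m \<subseteq> labels s - {lb s x'}" using lm x by (auto simp: labels_def)
    moreover have "lb s x' \<in> labels s" using x by (auto simp: labels_def)
    ultimately have "labels ?m \<subset> labels s" by blast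
    then have "card (labels ?m) < card (labels s)" by (intro psubset_card_mono) (auto simp: labels_def)
    moreover have "Act ?m \<subseteq> Act ?t"
    proof
      fix l assume "l \<in> Act ?m"
      then have "l < n" "0 < ph ?m l" by (auto simp: Act_def)
      then show "l \<in> Act ?t"
        using merge_ph[OF inv_grow[OF i], of x x' l] x by (auto simp: grow_lb Act_def split: if_splits)
    qed
    then have "card (Act ?m) \<le> card (Act s)" using At fin_Act card_mono[of "Act s" "Act ?m"] by blast
    ultimately show ?thesis unfolding st by linarith
  qed
qed

lemma no_active_stable: assumes "ginv s y" "Act s = {}" shows "Act (g_step g s) = {}"
proof -
  have "g_cross g s = []"
    using act_iff[OF assms(1)] assms(2) cross_iff[of _ _ s] by (metis empty_iff list.set_intros(1) neq_Nil_conv surj_pair)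
  then have "g_tight g s (g_grow g s) = []" by (simp add: g_tight_def)
  then show ?thesis using assms(2) by (auto simp: g_step_def g_next_def Act_def grow_ph)
qed

lemma terminates:
  "ginv s y \<Longrightarrow> card (labels s) + card (Act s) \<le> k \<Longrightarrow> Act ((g_step g ^^ k) s) = {}"
proof (induction k arbitrary: s y)
  case 0
  then show ?case using fin_Act by simp
next
  case (Suc k)
  show ?case
  proof (cases "Act s = {}")
    case True
    have "\<exists>y. ginv ((g_step g ^^ j) s) y \<and> Act ((g_step g ^^ j) s) = {}" for j
    proof (induction j)
      case 0 then show ?case using Suc.prems True by auto
    next
      case (Suc j) then show ?case using inv_step no_active_stable by (metis funpow.simps(2) o_apply)
    qed
    then show ?thesis by blast
  next
    case False
    have "card (labels (g_step g s)) + card (Act (g_step g s)) \<le> k" using step_decreases[OF Suc.prems(1) False] Suc.prems(2) by linarith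
    from Suc.IH[OF inv_step[OF Suc.prems(1)] this] show ?thesis by (simp add: funpow_swap1)
  qed
qed

end

section \<open>The reverse pass: pruning and the balance of costs\<close>

context moats
begin

definition verts :: "(nat \<times> nat) list \<Rightarrow> nat set" where "verts T = insert r (fst ` set T \<union> snd ` set T)"
definition tch :: "gstate \<Rightarrow> (nat \<times> nat) list \<Rightarrow> nat set" where "tch s T = lb s ` verts T"
definition deg :: "gstate \<Rightarrow> (nat \<times> nat) list \<Rightarrow> nat \<Rightarrow> nat" where
  "deg s T l = (\<Sum>e\<leftarrow>T. of_bool (lb s (fst e) = l) + of_bool (lb s (snd e) = l))"

lemma set_g_verts: "set (g_verts r T) = verts T" by (auto simp: g_verts_def verts_def)

lemma verts_Cons: "verts (e # T) = insert (fst e) (insert (snd e) (verts T))" by (auto simp: verts_def)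

definition edges_ok :: "gstate \<Rightarrow> (nat \<times> nat) list \<Rightarrow> bool" where
  "edges_ok s T \<longleftrightarrow> (\<forall>e\<in>set T. fst e < n \<and> snd e < n \<and> lb s (fst e) \<noteq> lb s (snd e))"

text \<open>Connectivity as a closure property avoids any talk of paths; the tour construction will
  apply it to the set of vertices reached so far.\<close>

definition conn :: "gstate \<Rightarrow> (nat \<times> nat) list \<Rightarrow> bool" where
  "conn s T \<longleftrightarrow> (\<forall>P. P \<subseteq> {..<n} \<longrightarrow> r \<in> P \<longrightarrow> (\<forall>a\<in>P. cls s (lb s a) \<subseteq> P) \<longrightarrow>
      (\<forall>e\<in>set T. fst e \<in> P \<longleftrightarrow> snd e \<in> P) \<longrightarrow> verts T \<subseteq> P)"

lemma connD: "conn s T \<Longrightarrow> P \<subseteq> {..<n} \<Longrightarrow> r \<in> P \<Longrightarrow> (\<And>a. a \<in> P \<Longrightarrow> cls s (lb s a) \<subseteq> P) \<Longrightarrow>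
    (\<And>e. e \<in> set T \<Longrightarrow> (fst e \<in> P) = (snd e \<in> P)) \<Longrightarrow> verts T \<subseteq> P"
  by (simp add: conn_def)

definition cost_ok :: "gstate \<Rightarrow> (nat \<times> nat) list \<Rightarrow> nat \<Rightarrow> bool" where
  "cost_ok s T Y \<longleftrightarrow> (\<Sum>e\<leftarrow>T. int (dd (fst e) (snd e)) - 2 * int (Dv s (fst e)) - 2 * int (Dv s (snd e)))
      + 2 * (\<Sum>l\<in>{..<n} - tch s T. int (ph s l)) \<le> 4 * int Y"

text \<open>Invariant of the reverse pass: at every level the kept edges form a tree on the used
  components in which inactive components other than the root's are not leaves.\<close>

definition bwd :: "gstate \<Rightarrow> (nat \<times> nat) list \<Rightarrow> nat \<Rightarrow> bool" where
  "bwd s T Y \<longleftrightarrow> edges_ok s T \<and> card (tch s T) = Suc (length T) \<and>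
     (\<forall>l\<in>tch s T. l \<noteq> lb s r \<longrightarrow> ph s l = 0 \<longrightarrow> 2 \<le> deg s T l) \<and> conn s T \<and> cost_ok s T Y"

lemma verts_less: "edges_ok s T \<Longrightarrow> v \<in> verts T \<Longrightarrow> v < n"
  using r by (auto simp: verts_def edges_ok_def)

lemma back_end: assumes "ginv s y" "Act s = {}" shows "bwd s [] 0"
proof -
  have "ph s l = 0" if "l < n" for l using that assms(2) by (auto simp: Act_def)
  then show ?thesis using r by (auto simp: bwd_def edges_ok_def tch_def verts_def conn_def cost_ok_def)
qed

lemma sum_deg: assumes "finite S" shows "(\<Sum>l\<in>S. deg s T l) = (\<Sum>e\<leftarrow>T. of_bool (lb s (fst e) \<in> S) + of_bool (lb s (snd e) \<in> S))"
proof (induction T)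
  case (Cons e T)
  have "(\<Sum>l\<in>S. of_bool (lb s v = l)) = (of_bool (lb s v \<in> S) :: nat)" for v
    using assms by (simp add: of_bool_def)
  then show ?case using Cons by (simp add: deg_def sum.distrib)
qed (simp add: deg_def)

text \<open>The degrees in a tree with \<open>m\<close> nodes sum to \<open>2 * (m - 1)\<close>.
  Inactive nodes other than the root's have degree at least 2 and use up their share, and the -1
  pays for the root; so active nodes have average degree at most 2.\<close>

lemma active_degree:
  assumes i: "ginv s y" and ok: "edges_ok s T" and c: "card (tch s T) = Suc (length T)"
    and d2: "\<And>l. l \<in> tch s T \<Longrightarrow> l \<noteq> lb s r \<Longrightarrow> ph s l = 0 \<Longrightarrow> 2 \<le> deg s T l"
  shows "(\<Sum>e\<leftarrow>T. of_bool (lb s (fst e) \<in> Act s) + of_bool (lb s (snd e) \<in> Act s)) \<le> 2 * card (Act s \<inter> tch s T)"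
proof -
  define Z where "Z = tch s T - Act s - {lb s r}"
  have fin: "finite (tch s T)" by (simp add: tch_def verts_def)
  have rt: "lb s r \<in> tch s T" "lb s r \<notin> Act s" using invD(9)[OF i] by (auto simp: tch_def verts_def Act_def)
  have all: "(\<Sum>l\<in>tch s T. deg s T l) = 2 * length T"
  proof -
    have "(\<Sum>l\<in>tch s T. deg s T l) = (\<Sum>e\<leftarrow>T. 2)"
      unfolding sum_deg[OF fin] by (rule arg_cong[where f = sum_list], rule map_cong) (auto simp: tch_def verts_def)
    then show ?thesis by (simp add: sum_list_const_mult[of 2 "\<lambda>_. 1", simplified] sum_list_triv)
  qed
  have part: "tch s T = (Act s \<inter> tch s T) \<union> Z \<union> {lb s r}" using rt by (auto simp: Z_def)
  have finp: "finite (Act s \<inter> tch s T)" "finite Z" using fin by (auto simp: Z_def)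
  have "card (tch s T) = card (Act s \<inter> tch s T) + card Z + 1"
  proof -
    have "card (tch s T) = card ((Act s \<inter> tch s T) \<union> Z \<union> {lb s r})" using part by simp
    also have "\<dots> = card ((Act s \<inter> tch s T) \<union> Z) + 1"
      by (subst card_Un_disjoint) (use finp rt in \<open>auto simp: Z_def\<close>)
    also have "card ((Act s \<inter> tch s T) \<union> Z) = card (Act s \<inter> tch s T) + card Z"
      by (rule card_Un_disjoint) (use finp in \<open>auto simp: Z_def\<close>)
    finally show ?thesis .
  qed
  moreover have "(\<Sum>l\<in>tch s T. deg s T l) = (\<Sum>l\<in>Act s \<inter> tch s T. deg s T l) + (\<Sum>l\<in>Z. deg s T l) + deg s T (lb s r)"
  proof -
    have "(\<Sum>l\<in>tch s T. deg s T l) = (\<Sum>l\<in>(Act s \<inter> tch s T) \<union> Z \<union> {lb s r}. deg s T l)" using part by simp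
    also have "\<dots> = (\<Sum>l\<in>(Act s \<inter> tch s T) \<union> Z. deg s T l) + deg s T (lb s r)"
      by (subst sum.union_disjoint) (use finp rt in \<open>auto simp: Z_def\<close>)
    also have "(\<Sum>l\<in>(Act s \<inter> tch s T) \<union> Z. deg s T l) = (\<Sum>l\<in>Act s \<inter> tch s T. deg s T l) + (\<Sum>l\<in>Z. deg s T l)"
      by (rule sum.union_disjoint) (use finp in \<open>auto simp: Z_def\<close>)
    finally show ?thesis .
  qed
  moreover have "2 * card Z \<le> (\<Sum>l\<in>Z. deg s T l)"
  proof -
    have "(\<Sum>l\<in>Z. 2) \<le> (\<Sum>l\<in>Z. deg s T l)"
    proof (rule sum_mono)
      fix l assume l: "l \<in> Z"
      then have "l < n" using invD(1)[OF i] verts_less[OF ok] by (auto simp: Z_def tch_def)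
      then show "2 \<le> deg s T l" using l by (intro d2) (auto simp: Z_def Act_def)
    qed
    then show ?thesis by (simp add: mult.commute)
  qed
  moreover have "(\<Sum>e\<leftarrow>T. of_bool (lb s (fst e) \<in> Act s) + of_bool (lb s (snd e) \<in> Act s)) = (\<Sum>l\<in>Act s \<inter> tch s T. deg s T l)"
    unfolding sum_deg[OF finp(1)] by (rule arg_cong[where f = sum_list], rule map_cong) (auto simp: tch_def verts_def)
  ultimately show ?thesis using all c by linarith
qed

lemma back_grow:
  assumes i: "ginv s y" and b: "bwd (g_grow g s) T Y"
  shows "bwd s T (g_eps g s * card (Act s) + Y)"
proof -
  let ?t = "g_grow g s" and ?e = "g_eps g s"
  have tch: "tch ?t T = tch s T" by (simp add: tch_def grow_lb)
  have ok: "edges_ok s T" and c: "card (tch s T) = Suc (length T)" and cn: "conn s T"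
    using b tch by (auto simp: bwd_def edges_ok_def grow_lb conn_def cls_grow)
  have lt: "l \<in> tch s T \<Longrightarrow> l < n" for l using invD(1)[OF i] verts_less[OF ok] by (auto simp: tch_def)
  have d2: "2 \<le> deg s T l" if "l \<in> tch s T" "l \<noteq> lb s r" "ph s l = 0" for l
    using b that tch lt[OF that(1)] by (auto simp: bwd_def grow_lb deg_def grow_ph)
  let ?k = "\<lambda>e. of_bool (lb s (fst e) \<in> Act s) + of_bool (lb s (snd e) \<in> Act s) :: nat"
  have "(\<Sum>e\<leftarrow>T. int (dd (fst e) (snd e)) - 2 * int (Dv s (fst e)) - 2 * int (Dv s (snd e)))
      = (\<Sum>e\<leftarrow>T. int (dd (fst e) (snd e)) - 2 * int (Dv ?t (fst e)) - 2 * int (Dv ?t (snd e))) + 2 * int ?e * int (\<Sum>e\<leftarrow>T. ?k e)"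
    using ok
  proof (induction T)
    case (Cons e T)
    have "fst e < n" "snd e < n" using Cons.prems by (auto simp: edges_ok_def)
    then have "Dv ?t (fst e) = Dv s (fst e) + ?e * of_bool (lb s (fst e) \<in> Act s)"
      "Dv ?t (snd e) = Dv s (snd e) + ?e * of_bool (lb s (snd e) \<in> Act s)" by (simp_all add: grow_Dv[OF i])
    then show ?case using Cons by (simp add: edges_ok_def algebra_simps)
  qed simp
  moreover have "(\<Sum>l\<in>{..<n} - tch s T. int (ph s l)) = (\<Sum>l\<in>{..<n} - tch s T. int (ph ?t l)) + int ?e * int (card (Act s - tch s T))"
  proof -
    have "(\<Sum>l\<in>{..<n} - tch s T. int (ph s l)) = (\<Sum>l\<in>{..<n} - tch s T. int (ph ?t l) + (if l \<in> Act s then int ?e else 0))"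
    proof (rule sum.cong)
      fix l assume "l \<in> {..<n} - tch s T"
      then show "int (ph s l) = int (ph ?t l) + (if l \<in> Act s then int ?e else 0)"
        using eps_le_ph[of l s] by (auto simp: grow_ph Act_def of_nat_diff)
    qed simp
    also have "(\<Sum>l\<in>{..<n} - tch s T. (if l \<in> Act s then int ?e else 0)) = int ?e * int (card (Act s - tch s T))"
    proof -
      have "({..<n} - tch s T) \<inter> Act s = Act s - tch s T" by (auto simp: Act_def)
      then show ?thesis by (simp add: sum.If_cases mult.commute)
    qed
    then have "(\<Sum>l\<in>{..<n} - tch s T. int (ph ?t l) + (if l \<in> Act s then int ?e else 0)) = (\<Sum>l\<in>{..<n} - tch s T. int (ph ?t l)) + int ?e * int (card (Act s - tch s T))"
      by (simp add: sum.distrib)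
    finally show ?thesis .
  qed
  moreover have "(\<Sum>e\<leftarrow>T. int (dd (fst e) (snd e)) - 2 * int (Dv ?t (fst e)) - 2 * int (Dv ?t (snd e)))
      + 2 * (\<Sum>l\<in>{..<n} - tch s T. int (ph ?t l)) \<le> 4 * int Y"
    using b tch by (simp add: bwd_def cost_ok_def)
  moreover have "2 * int ?e * int (\<Sum>e\<leftarrow>T. ?k e) + 2 * (int ?e * int (card (Act s - tch s T))) \<le> 4 * (int ?e * int (card (Act s)))"
  proof -
    have "card (Act s) = card (Act s \<inter> tch s T) + card (Act s - tch s T)"
      using card_Int_Diff[OF fin_Act] by blast
    moreover have "(\<Sum>e\<leftarrow>T. ?k e) \<le> 2 * card (Act s \<inter> tch s T)" by (rule active_degree[OF i ok c d2])
    ultimately have "2 * (\<Sum>e\<leftarrow>T. ?k e) + 2 * card (Act s - tch s T) \<le> 4 * card (Act s)" by linarith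
    then have "int ?e * int (2 * (\<Sum>e\<leftarrow>T. ?k e) + 2 * card (Act s - tch s T)) \<le> int ?e * int (4 * card (Act s))"
      by (intro mult_left_mono) (simp_all only: of_nat_le_iff of_nat_0_le_iff)
    then show ?thesis by (simp add: algebra_simps)
  qed
  ultimately have "cost_ok s T (?e * card (Act s) + Y)" unfolding cost_ok_def by simp
  then show ?thesis using ok c d2 cn by (auto simp: bwd_def)
qed

lemma back_merge:
  assumes i: "ginv t y" and x: "x < n" "x' < n" "lb t x \<noteq> lb t x'" and act: "lb t x \<in> Act t"
    and tight: "dd x x' \<le> 2 * (Dv t x + Dv t x')" and b: "bwd (g_merge g t (x, x')) T Y"
  shows "bwd t (g_sel r T (fst t, (x, x'), g_act t x')) Y"
proof -
  let ?m = "g_merge g t (x, x')" and ?a = "lb t x" and ?b = "lb t x'"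
  have ab: "?a < n" "?b < n" "?a \<noteq> ?b" using invD(1)[OF i] x by auto
  have l: "lb ?m v = (if lb t v = ?b then ?a else lb t v)" if "v < n" for v using that by (simp add: merge_simps[where l = v])
  have D: "Dv ?m v = Dv t v" if "v < n" for v using that by (simp add: merge_simps[where l = v])
  note P = merge_ph[OF i x]
  have okm: "edges_ok ?m T" and cm: "card (tch ?m T) = Suc (length T)" and conm: "conn ?m T" and costm: "cost_ok ?m T Y"
    and d2m: "\<And>l. l \<in> tch ?m T \<Longrightarrow> l \<noteq> lb ?m r \<Longrightarrow> ph ?m l = 0 \<Longrightarrow> 2 \<le> deg ?m T l"
    using b by (auto simp: bwd_def)
  have vn: "v \<in> verts T \<Longrightarrow> v < n" for v using verts_less[OF okm] .
  have okT: "edges_ok t T" using okm l unfolding edges_ok_def by metis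
  have c: "cls ?m l = (if l = ?a then cls t ?a \<union> cls t ?b else if l = ?b then {} else cls t l)" for l
    using l x(3) by (auto simp: cls_def)
  have pa: "0 < ph t ?a" using act by (auto simp: Act_def)
  have degm: "deg t T l = deg ?m T l" if "l \<noteq> ?a" "l \<noteq> ?b" for l
    unfolding deg_def by (rule arg_cong[where f = sum_list], rule map_cong) (use okm l that in \<open>auto simp: edges_ok_def\<close>)
  have lr: "lb ?m r \<noteq> l" if "l \<noteq> ?a" "l \<noteq> lb t r" for l using l[OF r] that by auto
  have costT: "(\<Sum>e\<leftarrow>T. int (dd (fst e) (snd e)) - 2 * int (Dv t (fst e)) - 2 * int (Dv t (snd e))) =
      (\<Sum>e\<leftarrow>T. int (dd (fst e) (snd e)) - 2 * int (Dv ?m (fst e)) - 2 * int (Dv ?m (snd e)))"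
    by (rule arg_cong[where f = sum_list], rule map_cong) (use okm D in \<open>auto simp: edges_ok_def\<close>)
  have tx: "g_touch (fst t) (g_verts r T) v \<longleftrightarrow> lb t v \<in> tch t T" for v
    unfolding g_touch_def set_g_verts tch_def image_iff by metis
  have ay: "g_act t x' \<longleftrightarrow> 0 < ph t ?b" by (simp add: g_act_def)
  have tm: "tch ?m T = (if ?b \<in> tch t T then insert ?a (tch t T - {?b}) else tch t T)"
  proof -
    have "tch ?m T = (\<lambda>u. if u = ?b then ?a else u) ` tch t T"
      unfolding tch_def image_image by (rule image_cong) (use l vn in auto)
    then show ?thesis by (auto simp: image_iff)
  qed
  have fint: "finite (tch t T)" by (simp add: tch_def verts_def)
  have msplit: "(\<Sum>l\<in>S. int (ph ?m l)) = (\<Sum>l\<in>S. int (ph t l))" if "S \<subseteq> {..<n} - {?a, ?b}" for S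
  proof (rule sum.cong)
    fix l assume "l \<in> S"
    then have "l < n" "l \<noteq> ?a" "l \<noteq> ?b" using that by auto
    then show "int (ph ?m l) = int (ph t l)" by (simp add: P)
  qed simp
  show ?thesis
  proof (cases "(?a \<in> tch t T \<or> ?b \<in> tch t T) \<and> (?b \<in> tch t T \<or> 0 < ph t ?b)")
    case True
    let ?T = "(x, x') # T"
    have sel: "g_sel r T (fst t, (x, x'), g_act t x') = ?T" using True by (simp add: g_sel_def tx ay)
    have tt: "tch t ?T = insert ?b (tch ?m T)" "?b \<notin> tch ?m T" "?a \<in> tch ?m T"
      using True ab by (auto simp: tm) (auto simp: tch_def verts_Cons)
    have "finite (tch ?m T)" by (simp add: tch_def verts_def)
    then have card: "card (tch t ?T) = Suc (length ?T)" using tt cm by simp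
    have ok: "edges_ok t ?T" using okT x by (auto simp: edges_ok_def)
    have d2: "2 \<le> deg t ?T k" if k: "k \<in> tch t ?T" "k \<noteq> lb t r" "ph t k = 0" for k
    proof -
      have ka: "k \<noteq> ?a" using pa k by auto
      show ?thesis
      proof (cases "k = ?b")
        case True
        \<comment> \<open>An inactive second component is joined only if it is already used, so an
          earlier kept edge ends in it; the merging edge is its second one.\<close>
        then have "?b \<in> tch t T" using \<open>(?a \<in> tch t T \<or> ?b \<in> tch t T) \<and> (?b \<in> tch t T \<or> 0 < ph t ?b)\<close> k by auto
        then obtain v where v: "v \<in> verts T" "lb t v = ?b" by (auto simp: tch_def)
        then have "v \<noteq> r" using k True by auto
        then obtain e where e: "e \<in> set T" "v = fst e \<or> v = snd e" using v(1) by (auto simp: verts_def)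
        have "1 \<le> (of_bool (lb t (fst e) = k) + of_bool (lb t (snd e) = k) :: nat)" using e v True by auto
        also have "\<dots> \<le> deg t T k" unfolding deg_def using e(1) by (intro member_le_sum_list) auto
        finally show ?thesis using True x(3) by (simp add: deg_def)
      next
        case False
        have "k \<in> tch ?m T" using tt k False by auto
        moreover have "k < n" using k verts_less[OF ok] invD(1)[OF i] by (auto simp: tch_def)
        moreover have "k \<noteq> lb ?m r" using lr[OF ka k(2)] by auto
        ultimately have "2 \<le> deg ?m T k" using k ka False by (intro d2m) (auto simp: P)
        then have "2 \<le> deg t T k" using degm[OF ka False] by simp
        then show ?thesis by (simp add: deg_def)
      qed
    qed
    have con: "conn t ?T"
      unfolding conn_def
    proof (intro allI impI)
      fix Q assume Q: "Q \<subseteq> {..<n}" "r \<in> Q" "\<forall>a\<in>Q. cls t (lb t a) \<subseteq> Q" "\<forall>e\<in>set ?T. (fst e \<in> Q) = (snd e \<in> Q)"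
      have xx: "x \<in> Q \<longleftrightarrow> x' \<in> Q" using Q(4) by simp
      have in_x: "x \<in> Q" if "v \<in> Q" "lb t v = ?a \<or> lb t v = ?b" for v
      proof -
        have "x \<in> cls t (lb t v) \<or> x' \<in> cls t (lb t v)" using that x by (auto simp: cls_def)
        then show ?thesis using Q(3) that(1) xx by blast
      qed
      have cl: "cls ?m (lb ?m v) \<subseteq> Q" if v: "v \<in> Q" for v
      proof -
        have vn: "v < n" using Q(1) v by auto
        show ?thesis
        proof (cases "lb t v = ?a \<or> lb t v = ?b")
          case True
          have "cls t ?a \<subseteq> Q" "cls t ?b \<subseteq> Q" using Q(3) in_x[OF v True] xx by blast+
          then show ?thesis using l[OF vn] c True by auto
        next
          case False
          then show ?thesis using l[OF vn] c Q(3) v by auto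
        qed
      qed
      have "verts T \<subseteq> Q" by (rule connD[OF conm Q(1,2) cl]) (use Q(4) in auto)
      moreover obtain v where "v \<in> verts T" "lb t v = ?a \<or> lb t v = ?b" using True by (auto simp: tch_def)
      ultimately show "verts ?T \<subseteq> Q" using in_x xx by (auto simp: verts_Cons)
    qed
    have "cost_ok t ?T Y"
    proof -
      have e: "{..<n} - tch ?m T = insert ?b ({..<n} - tch t ?T)" "?b \<notin> {..<n} - tch t ?T" using tt ab by auto
      have "(\<Sum>l\<in>{..<n} - tch ?m T. int (ph ?m l)) = int (ph ?m ?b) + (\<Sum>l\<in>{..<n} - tch t ?T. int (ph ?m l))"
        unfolding e(1) by (rule sum.insert) (use e(2) in simp_all)
      also have "\<dots> = (\<Sum>l\<in>{..<n} - tch t ?T. int (ph t l))"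
        using msplit[of "{..<n} - tch t ?T"] tt P[OF ab(2)] ab(3) by auto
      finally show ?thesis using costm costT tight unfolding cost_ok_def by simp
    qed
    then show ?thesis unfolding sel using ok card d2 con by (auto simp: bwd_def)
  next
    case False
    have sel: "g_sel r T (fst t, (x, x'), g_act t x') = T" using False by (simp add: g_sel_def tx ay)
    have nb: "?b \<notin> tch t T" using False by blast
    have tt: "tch ?m T = tch t T" using tm nb by simp
    have rb: "lb t r \<noteq> ?b" using nb by (auto simp: tch_def verts_def)
    have d2: "2 \<le> deg t T k" if k: "k \<in> tch t T" "k \<noteq> lb t r" "ph t k = 0" for k
    proof -
      have ka: "k \<noteq> ?a" "k \<noteq> ?b" using pa k nb by auto
      have "k < n" using k verts_less[OF okT] invD(1)[OF i] by (auto simp: tch_def)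
      moreover have "k \<noteq> lb ?m r" using lr[OF ka(1) k(2)] by auto
      ultimately have "2 \<le> deg ?m T k" using k ka tt by (intro d2m) (auto simp: P)
      then show ?thesis using degm[OF ka] by simp
    qed
    have vb: "v \<notin> cls t ?b" if "v \<in> verts T" for v
    proof
      assume "v \<in> cls t ?b"
      then have "?b = lb t v" by (simp add: cls_def)
      then show False using nb that unfolding tch_def by blast
    qed
    have con: "conn t T"
      unfolding conn_def
    proof (intro allI impI)
      fix Q assume Q: "Q \<subseteq> {..<n}" "r \<in> Q" "\<forall>a\<in>Q. cls t (lb t a) \<subseteq> Q" "\<forall>e\<in>set T. (fst e \<in> Q) = (snd e \<in> Q)"
      \<comment> \<open>\<open>Q\<close> need not respect the merged component, so the second part
        is moved to the side on which \<open>x\<close> lies. \<open>T\<close> has no vertex in that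
        part, so neither the edges nor the claim notice the change.\<close>
      define Q' where "Q' = (if x \<in> Q then Q \<union> cls t ?b else Q - cls t ?b)"
      have xQ: "x \<in> Q" if "v \<in> Q" "lb t v = ?a" for v
      proof -
        have "x \<in> cls t (lb t v)" using that x(1) by (simp add: cls_def)
        then show ?thesis using Q(3) that(1) by blast
      qed
      have cl: "cls ?m (lb ?m v) \<subseteq> Q'" if v: "v \<in> Q'" for v
      proof -
        have vn: "v < n" using Q(1) v by (auto simp: Q'_def cls_def split: if_splits)
        show ?thesis
        proof (cases "lb t v = ?a \<or> lb t v = ?b")
          case True
          then have xq: "x \<in> Q" using v xQ vn by (auto simp: Q'_def cls_def split: if_splits)
          then have "cls t ?a \<subseteq> Q" using Q(3) by blast
          then show ?thesis using l[OF vn] c True xq by (auto simp: Q'_def)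
        next
          case False
          then have "v \<in> Q" using v by (auto simp: Q'_def cls_def split: if_splits)
          then have "cls t (lb t v) \<subseteq> Q" using Q(3) by blast
          moreover have "cls t (lb t v) \<inter> cls t ?b = {}" using False by (auto simp: cls_def)
          ultimately show ?thesis using l[OF vn] c False by (auto simp: Q'_def)
        qed
      qed
      have sub': "Q' \<subseteq> {..<n}" using Q(1) by (auto simp: Q'_def cls_def)
      have mem: "v \<in> Q' \<longleftrightarrow> v \<in> Q" if "v \<in> verts T" for v using vb[OF that] by (auto simp: Q'_def)
      have rQ: "r \<in> Q'" using mem[of r] Q(2) by (simp add: verts_def)
      have eQ: "(fst e \<in> Q') = (snd e \<in> Q')" if "e \<in> set T" for e
        using Q(4) that mem[of "fst e"] mem[of "snd e"] by (auto simp: verts_def)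
      have "verts T \<subseteq> Q'" by (rule connD[OF conm sub' rQ cl eQ])
      then show "verts T \<subseteq> Q" using mem by blast
    qed
    have "(\<Sum>l\<in>{..<n} - tch ?m T. int (ph ?m l)) = (\<Sum>l\<in>{..<n} - tch t T. int (ph t l))"
    proof (cases "?a \<in> tch t T")
      case True
      then have b0: "ph t ?b = 0" using False by auto
      have "(\<Sum>l\<in>{..<n} - tch t T. int (f l)) = int (f ?b) + (\<Sum>l\<in>{..<n} - tch t T - {?b}. int (f l))" for f
        by (rule sum.remove) (use nb ab in auto)
      moreover have "(\<Sum>l\<in>{..<n} - tch t T - {?b}. int (ph ?m l)) = (\<Sum>l\<in>{..<n} - tch t T - {?b}. int (ph t l))"
        by (rule msplit) (use True in auto)
      moreover have "ph ?m ?b = 0" using P[OF ab(2)] ab(3) by simp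
      ultimately show ?thesis using b0 unfolding tt by presburger
    next
      case False
      have "(\<Sum>l\<in>{..<n} - tch t T. int (f l)) = int (f ?a) + (int (f ?b) + (\<Sum>l\<in>{..<n} - tch t T - {?a} - {?b}. int (f l)))" for f
      proof -
        have "(\<Sum>l\<in>{..<n} - tch t T. int (f l)) = int (f ?a) + (\<Sum>l\<in>{..<n} - tch t T - {?a}. int (f l))"
          by (rule sum.remove) (use False ab in auto)
        also have "(\<Sum>l\<in>{..<n} - tch t T - {?a}. int (f l)) = int (f ?b) + (\<Sum>l\<in>{..<n} - tch t T - {?a} - {?b}. int (f l))"
          by (rule sum.remove) (use nb ab in auto)
        finally show ?thesis .
      qed
      moreover have "(\<Sum>l\<in>{..<n} - tch t T - {?a} - {?b}. int (ph ?m l)) = (\<Sum>l\<in>{..<n} - tch t T - {?a} - {?b}. int (ph t l))"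
        by (rule msplit) auto
      moreover have "ph ?m ?b = 0" "ph ?m ?a = ph t ?a + ph t ?b" using P[OF ab(2)] P[OF ab(1)] ab(3) rb by simp_all
      ultimately show ?thesis unfolding tt by (simp only: of_nat_add)
    qed
    then have "cost_ok t T Y" using costm costT unfolding cost_ok_def by simp
    then show ?thesis unfolding sel using okT cm tt d2 con by (auto simp: bwd_def)
  qed
qed

fun total_growth :: "nat \<Rightarrow> gstate \<Rightarrow> nat" where
  "total_growth 0 s = 0"
| "total_growth (Suc k) s = g_eps g s * card (Act s) + total_growth k (g_step g s)"

lemma back_sol:
  "ginv s y \<Longrightarrow> Act ((g_step g ^^ k) s) = {} \<Longrightarrow> bwd s (g_sol g k s) (total_growth k s)"
proof (induction k arbitrary: s y)
  case 0
  then show ?case using back_end by simp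
next
  case (Suc k)
  have IH: "bwd (g_step g s) (g_sol g k (g_step g s)) (total_growth k (g_step g s))"
    by (rule Suc.IH[OF inv_step[OF Suc.prems(1)]]) (use Suc.prems(2) in \<open>simp add: funpow_swap1\<close>)
  have "bwd (g_grow g s) (g_sol g (Suc k) s) (total_growth k (g_step g s))"
  proof (cases "g_tight g s (g_grow g s) = []")
    case True
    then show ?thesis using IH by (simp add: g_step_def g_next_def g_event_def g_ev_def)
  next
    case False
    obtain x x' where x: "hdd (0, 0) (g_tight g s (g_grow g s)) = (x, x')" "x < n" "x' < n" "lb s x \<noteq> lb s x'"
      "lb s x \<in> Act (g_grow g s)" "dd x x' \<le> 2 * (Dv (g_grow g s) x + Dv (g_grow g s) x')"
      using tight_hd[OF Suc.prems(1) False] by metis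
    have st: "g_step g s = g_merge g (g_grow g s) (x, x')" using False x(1) by (simp add: g_step_def g_next_def)
    have ev: "g_event g s = [(fst (g_grow g s), (x, x'), g_act (g_grow g s) x')]" using False x(1) by (simp add: g_event_def g_ev_def)
    show ?thesis
      using back_merge[OF inv_grow[OF Suc.prems(1)], of x x'] x IH by (simp add: st[symmetric] ev grow_lb g_simps)
  qed
  then show ?case using back_grow[OF Suc.prems(1)] by simp
qed

text \<open>Identifies the growth to which the reverse pass charges its costs with the value of the
  dual solution.\<close>

lemma ghost_total:
  "ginv s y \<Longrightarrow> \<exists>y'. ginv ((g_step g ^^ k) s) y' \<and> wsum (\<lambda>_. 1) y' = wsum (\<lambda>_. 1) y + total_growth k s"
proof (induction k arbitrary: s y)
  case (Suc k)
  obtain y' where y': "ginv ((g_step g ^^ k) (g_step g s)) y'" "wsum (\<lambda>_. 1) y' = wsum (\<lambda>_. 1) (grown s y) + total_growth k (g_step g s)"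
    using Suc.IH[OF inv_step[OF Suc.prems]] by blast
  then show ?case using wsum_grown[OF Suc.prems, of "\<lambda>_. 1"] by (intro exI[of _ y']) (simp add: funpow_swap1)
qed auto

text \<open>At the initial state all widths are 0 and the residual prizes are the original ones, so
  the balance becomes the cost of the tree plus twice the lost prizes.\<close>

theorem primal_dual:
  assumes ps: "length ps = n" "\<And>v. v < n \<Longrightarrow> ps ! v = pz v"
  defines "T \<equiv> g_edges g ps"
  shows "\<exists>y. (\<forall>a<n. \<forall>b<n. wsum (\<lambda>X. of_bool ((a \<in> X) \<noteq> (b \<in> X))) y \<le> dd a b) \<and>
     (\<forall>X. 0 < y X \<longrightarrow> X \<subseteq> {..<n} - {r}) \<and>
     (\<forall>U\<subseteq>{..<n}. wsum (\<lambda>X. of_bool (X \<subseteq> U)) y \<le> (\<Sum>u\<in>U. pz u)) \<and>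
     (\<Sum>e\<leftarrow>T. dd (fst e) (snd e)) + 2 * (\<Sum>v\<in>{..<n} - verts T. pz v) \<le> 4 * wsum (\<lambda>_. 1) y"
    "\<forall>e\<in>set T. fst e < n \<and> snd e < n"
    "\<And>P. P \<subseteq> {..<n} \<Longrightarrow> r \<in> P \<Longrightarrow> (\<And>e. e \<in> set T \<Longrightarrow> fst e \<in> P \<longleftrightarrow> snd e \<in> P) \<Longrightarrow> verts T \<subseteq> P"
proof -
  let ?s = "g_init g ps"
  have i: "ginv ?s (\<lambda>_. 0)" by (rule inv_init[OF ps])
  have s: "\<And>v. v < n \<Longrightarrow> lb ?s v = v" "\<And>v. v < n \<Longrightarrow> Dv ?s v = 0" "\<And>v. v < n \<Longrightarrow> ph ?s v = pz v"
    using ps by (auto simp: g_init_def g_def nthd_def)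
  have T: "T = g_sol g (2 * n) ?s" unfolding T_def g_edges_sol by (simp add: g_def)
  have "card (labels ?s) \<le> n" unfolding labels_def using card_image_le[of "{..<n}" "lb ?s"] by simp
  moreover have "card (Act ?s) \<le> n" using card_mono[of "{..<n}" "Act ?s"] by (auto simp: Act_def)
  ultimately have fin: "Act ((g_step g ^^ (2 * n)) ?s) = {}" by (intro terminates[OF i]) linarith
  have b: "bwd ?s T (total_growth (2 * n) ?s)" unfolding T by (rule back_sol[OF i fin])
  obtain y where y: "ginv ((g_step g ^^ (2 * n)) ?s) y" "wsum (\<lambda>_. 1) y = total_growth (2 * n) ?s"
    using ghost_total[OF i, of "2 * n"] by (auto simp: wsum_def)
  have ok: "edges_ok ?s T" using b by (simp add: bwd_def)
  then show "\<forall>e\<in>set T. fst e < n \<and> snd e < n" by (auto simp: edges_ok_def)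
  have vl: "v \<in> verts T \<Longrightarrow> v < n" for v using verts_less[OF ok] .
  have e1: "tch ?s T = verts T" unfolding tch_def using s vl by force
  have e2: "(\<Sum>e\<leftarrow>T. int (dd (fst e) (snd e)) - 2 * int (Dv ?s (fst e)) - 2 * int (Dv ?s (snd e))) = (\<Sum>e\<leftarrow>T. int (dd (fst e) (snd e)))"
    by (rule arg_cong[where f = sum_list], rule map_cong) (use ok s in \<open>auto simp: edges_ok_def\<close>)
  have e3: "(\<Sum>e\<leftarrow>T. int (dd (fst e) (snd e))) = int (\<Sum>e\<leftarrow>T. dd (fst e) (snd e))" by (induction T) auto
  have e4: "(\<Sum>l\<in>{..<n} - verts T. int (ph ?s l)) = int (\<Sum>v\<in>{..<n} - verts T. pz v)" by (simp add: s)
  have "cost_ok ?s T (total_growth (2 * n) ?s)" using b by (simp add: bwd_def)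
  from this[unfolded cost_ok_def e1 e2 e3 e4]
  have "(\<Sum>e\<leftarrow>T. dd (fst e) (snd e)) + 2 * (\<Sum>v\<in>{..<n} - verts T. pz v) \<le> 4 * wsum (\<lambda>_. 1) y"
    unfolding y(2) by linarith
  moreover have "wsum (\<lambda>X. of_bool (X \<subseteq> U)) y \<le> (\<Sum>u\<in>U. pz u)" if "U \<subseteq> {..<n}" for U
    using invD(7)[OF y(1) that] by linarith
  ultimately show "\<exists>y. (\<forall>a<n. \<forall>b<n. wsum (\<lambda>X. of_bool ((a \<in> X) \<noteq> (b \<in> X))) y \<le> dd a b) \<and>
     (\<forall>X. 0 < y X \<longrightarrow> X \<subseteq> {..<n} - {r}) \<and>
     (\<forall>U\<subseteq>{..<n}. wsum (\<lambda>X. of_bool (X \<subseteq> U)) y \<le> (\<Sum>u\<in>U. pz u)) \<and>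
     (\<Sum>e\<leftarrow>T. dd (fst e) (snd e)) + 2 * (\<Sum>v\<in>{..<n} - verts T. pz v) \<le> 4 * wsum (\<lambda>_. 1) y"
    using invD(4,5)[OF y(1)] by (intro exI[of _ y]) simp
  fix P assume P: "P \<subseteq> {..<n}" "r \<in> P" "\<And>e. e \<in> set T \<Longrightarrow> fst e \<in> P \<longleftrightarrow> snd e \<in> P"
  have "\<forall>a\<in>P. cls ?s (lb ?s a) \<subseteq> P" using P(1) s by (auto simp: cls_def)
  moreover have "conn ?s T" using b by (simp add: bwd_def)
  ultimately show "verts T \<subseteq> P" using P unfolding conn_def by simp
qed

end

section \<open>From a tree to a closed tour\<close>

lemma ins_after_split: "x \<notin> set as \<Longrightarrow> x \<notin> set bs \<Longrightarrow> ins_after x y (as @ x # bs) = as @ x # y # bs"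
proof -
  have id: "x \<notin> set zs \<Longrightarrow> concat (map (\<lambda>z. if z = x then [x, y] else [z]) zs) = zs" for zs by (induction zs) auto
  assume "x \<notin> set as" "x \<notin> set bs"
  then show ?thesis by (simp add: ins_after_def id)
qed

lemma sum_list_strict:
  fixes f g :: "'a \<Rightarrow> real"
  assumes "e \<in> set T" "\<And>x. x \<in> set T \<Longrightarrow> f x \<le> g x" "f e + c \<le> g e"
  shows "(\<Sum>x\<leftarrow>T. f x) + c \<le> (\<Sum>x\<leftarrow>T. g x)"
  using assms
proof (induction T)
  case (Cons a T)
  show ?case
  proof (cases "a = e")
    case True
    have "(\<Sum>x\<leftarrow>T. f x) \<le> (\<Sum>x\<leftarrow>T. g x)" by (rule sum_list_mono) (use Cons.prems(2) in auto)
    then show ?thesis using Cons.prems(3) True by simp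
  next
    case False
    then have "(\<Sum>x\<leftarrow>T. f x) + c \<le> (\<Sum>x\<leftarrow>T. g x)" using Cons by auto
    moreover have "f a \<le> g a" using Cons.prems(2) by simp
    ultimately show ?thesis by simp
  qed
qed simp

context apriori
begin

text \<open>Only edges with both ends in the present tour are charged, so each new vertex brings a
  fresh edge that pays for its detour.\<close>

definition tour_inv :: "(nat \<times> nat) list \<Rightarrow> nat list \<Rightarrow> bool" where
  "tour_inv T zs \<longleftrightarrow> (\<exists>ws. zs = r # ws) \<and> distinct zs \<and> set zs \<subseteq> insert r (fst ` set T \<union> snd ` set T) \<and>
     plen d (zs @ [r]) \<le> 2 * (\<Sum>e\<leftarrow>T. of_bool (fst e \<in> set zs \<and> snd e \<in> set zs) * d (fst e) (snd e))"

text \<open>The detour from \<open>x\<close> to \<open>y\<close> and back costs at most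
  \<open>2 * d x y\<close>, paid by the edge that has just come to lie inside.\<close>

lemma tour_inv_insert:
  assumes T: "\<forall>e\<in>set T. fst e < n \<and> snd e < n" and z: "tour_inv T zs" and e: "e \<in> set T"
    and xy: "e = (x, y) \<or> e = (y, x)" "x \<in> set zs" "y \<notin> set zs"
  shows "tour_inv T (ins_after x y zs)" "set (ins_after x y zs) = insert y (set zs)"
proof -
  obtain as bs where sp: "zs = as @ x # bs" using xy(2) by (meson split_list)
  have x: "x \<notin> set as" "x \<notin> set bs" using z sp by (auto simp: tour_inv_def)
  have ia: "ins_after x y zs = as @ x # y # bs" unfolding sp by (rule ins_after_split[OF x])
  show st: "set (ins_after x y zs) = insert y (set zs)" unfolding ia by (auto simp: sp)
  have sub: "set zs \<subseteq> {..<n}" using z T r unfolding tour_inv_def by fastforce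
  have xyn: "x < n" "y < n" using e xy T by auto
  have dxy: "d (fst e) (snd e) = d x y" using xy(1) sym xyn by auto
  have w: "\<exists>w ws. bs @ [r] = w # ws \<and> w < n" using sub r unfolding sp by (cases bs) auto
  then obtain w ws where w: "bs @ [r] = w # ws" "w < n" by blast
  have "plen d (ins_after x y zs @ [r]) = plen d (as @ [x]) + plen d (x # y # w # ws)"
    unfolding ia using plen_append[of d as x "y # bs @ [r]"] w(1) by simp
  also have "\<dots> \<le> plen d (as @ [x]) + (2 * d x y + plen d (x # w # ws))"
    using tri[OF xyn(2,1) w(2)] sym[OF xyn] by simp
  also have "\<dots> = plen d (zs @ [r]) + 2 * d x y"
    unfolding sp using plen_append[of d as x "bs @ [r]"] w(1) by simp
  also have "\<dots> \<le> 2 * ((\<Sum>e\<leftarrow>T. of_bool (fst e \<in> set zs \<and> snd e \<in> set zs) * d (fst e) (snd e)) + d x y)"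
    using z unfolding tour_inv_def by simp
  also have "\<dots> \<le> 2 * (\<Sum>e\<leftarrow>T. of_bool (fst e \<in> set (ins_after x y zs) \<and> snd e \<in> set (ins_after x y zs)) * d (fst e) (snd e))"
  proof (intro mult_left_mono sum_list_strict[OF e])
    fix e assume "e \<in> set T"
    then have "0 \<le> d (fst e) (snd e)" using T nonneg by auto
    then show "of_bool (fst e \<in> set zs \<and> snd e \<in> set zs) * d (fst e) (snd e) \<le>
        of_bool (fst e \<in> set (ins_after x y zs) \<and> snd e \<in> set (ins_after x y zs)) * d (fst e) (snd e)"
      unfolding st by auto
  next
    have "\<not> (fst e \<in> set zs \<and> snd e \<in> set zs)" "fst e \<in> insert y (set zs) \<and> snd e \<in> insert y (set zs)" using xy by auto
    then show "of_bool (fst e \<in> set zs \<and> snd e \<in> set zs) * d (fst e) (snd e) + d x y \<le>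
        of_bool (fst e \<in> set (ins_after x y zs) \<and> snd e \<in> set (ins_after x y zs)) * d (fst e) (snd e)"
      unfolding st dxy by auto
  qed simp
  finally have "plen d (ins_after x y zs @ [r]) \<le> 2 * (\<Sum>e\<leftarrow>T. of_bool (fst e \<in> set (ins_after x y zs) \<and> snd e \<in> set (ins_after x y zs)) * d (fst e) (snd e))" .
  moreover have "\<exists>ws. ins_after x y zs = r # ws" using z sp unfolding ia tour_inv_def by (cases as) auto
  moreover have "distinct (ins_after x y zs)" using z xy(3) sp unfolding ia tour_inv_def by auto
  moreover have "set (ins_after x y zs) \<subseteq> insert r (fst ` set T \<union> snd ` set T)"
  proof -
    have "set zs \<subseteq> insert r (fst ` set T \<union> snd ` set T)" using z by (simp add: tour_inv_def)
    moreover have "y \<in> fst ` set T \<union> snd ` set T" using e xy(1) by (metis UnI1 UnI2 fst_conv image_eqI snd_conv)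
    ultimately show ?thesis unfolding st by simp
  qed
  ultimately show "tour_inv T (ins_after x y zs)" unfolding tour_inv_def by (intro conjI)
qed

lemma tour_inv_attach:
  assumes T: "\<forall>e\<in>set T. fst e < n \<and> snd e < n" and z: "tour_inv T zs" and e: "e \<in> set T"
  shows "tour_inv T (g_attach zs e)" "set zs \<subseteq> set (g_attach zs e)"
    "(fst e \<in> set zs) \<noteq> (snd e \<in> set zs) \<Longrightarrow> set (g_attach zs e) \<noteq> set zs"
proof -
  have m: "memb x zs \<longleftrightarrow> x \<in> set zs" for x by (auto simp: memb_def)
  note I = tour_inv_insert[OF T z e]
  consider "fst e \<in> set zs \<and> snd e \<notin> set zs" | "snd e \<in> set zs \<and> fst e \<notin> set zs" | "(fst e \<in> set zs) = (snd e \<in> set zs)" by blast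
  then have "tour_inv T (g_attach zs e) \<and> set zs \<subseteq> set (g_attach zs e) \<and>
    ((fst e \<in> set zs) \<noteq> (snd e \<in> set zs) \<longrightarrow> set (g_attach zs e) \<noteq> set zs)"
  proof cases
    case 1
    then have "g_attach zs e = ins_after (fst e) (snd e) zs" by (simp add: g_attach_def m)
    then show ?thesis using I[of "fst e" "snd e"] 1 by auto
  next
    case 2
    then have "g_attach zs e = ins_after (snd e) (fst e) zs" by (simp add: g_attach_def m)
    then show ?thesis using I[of "snd e" "fst e"] 2 by auto
  next
    case 3
    then show ?thesis using z by (auto simp: g_attach_def m)
  qed
  then show "tour_inv T (g_attach zs e)" "set zs \<subseteq> set (g_attach zs e)"
    "(fst e \<in> set zs) \<noteq> (snd e \<in> set zs) \<Longrightarrow> set (g_attach zs e) \<noteq> set zs" by auto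
qed

text \<open>The last conjunct turns a pass without progress into a certificate that the tour is
  closed under the edges.\<close>

lemma tour_inv_pass:
  assumes T: "\<forall>e\<in>set T. fst e < n \<and> snd e < n" and z: "tour_inv T zs" and "set es \<subseteq> set T"
  shows "tour_inv T (foldl g_attach zs es) \<and> set zs \<subseteq> set (foldl g_attach zs es) \<and>
    (set (foldl g_attach zs es) = set zs \<longrightarrow> (\<forall>e\<in>set es. (fst e \<in> set zs) = (snd e \<in> set zs)))"
  using assms(2,3)
proof (induction es arbitrary: zs)
  case (Cons e es)
  note A = tour_inv_attach[OF T Cons.prems(1), of e]
  have e: "e \<in> set T" using Cons.prems by auto
  have IH: "tour_inv T (foldl g_attach (g_attach zs e) es)" "set (g_attach zs e) \<subseteq> set (foldl g_attach (g_attach zs e) es)"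
    "set (foldl g_attach (g_attach zs e) es) = set (g_attach zs e) \<longrightarrow> (\<forall>e'\<in>set es. (fst e' \<in> set (g_attach zs e)) = (snd e' \<in> set (g_attach zs e)))"
    using Cons.IH[OF A(1)[OF e]] Cons.prems by auto
  show ?case
  proof (intro conjI impI)
    show "tour_inv T (foldl g_attach zs (e # es))" "set zs \<subseteq> set (foldl g_attach zs (e # es))"
      using IH A(2)[OF e] by auto
    assume "set (foldl g_attach zs (e # es)) = set zs"
    then have "set (g_attach zs e) = set zs" "set (foldl g_attach (g_attach zs e) es) = set (g_attach zs e)"
      using IH(2) A(2)[OF e] by auto
    then show "\<forall>e'\<in>set (e # es). (fst e' \<in> set zs) = (snd e' \<in> set zs)" using IH(3) A(3)[OF e] by auto
  qed
qed (use z in simp)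

lemma g_tour_correct:
  assumes T: "\<forall>e\<in>set T. fst e < n \<and> snd e < n"
    and conn: "\<And>P. P \<subseteq> {..<n} \<Longrightarrow> r \<in> P \<Longrightarrow> (\<And>e. e \<in> set T \<Longrightarrow> fst e \<in> P \<longleftrightarrow> snd e \<in> P) \<Longrightarrow>
       insert r (fst ` set T \<union> snd ` set T) \<subseteq> P"
  defines "zs \<equiv> g_tour [0..<n] r T"
  shows "\<exists>ws. zs = r # ws" "distinct zs" "set zs = insert r (fst ` set T \<union> snd ` set T)"
    "plen d (zs @ [r]) \<le> 2 * (\<Sum>e\<leftarrow>T. d (fst e) (snd e))"
proof -
  let ?pass = "\<lambda>zs. foldl g_attach zs T"
  have zs: "zs = (?pass ^^ n) [r]"
  proof -
    have "foldl g_attach ws (concat (map (\<lambda>_. T) ks)) = (?pass ^^ length ks) ws" for ws and ks :: "nat list"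
      by (induction ks arbitrary: ws) (simp_all add: funpow_Suc_right del: funpow.simps(2))
    from this[of "[r]" "[0..<n]"] show ?thesis by (simp add: zs_def g_tour_def)
  qed
  have init: "tour_inv T [r]"
  proof -
    have "0 \<le> (\<Sum>e\<leftarrow>T. of_bool (fst e \<in> set [r] \<and> snd e \<in> set [r]) * d (fst e) (snd e))"
      using T nonneg by (intro sum_list_nonneg) auto
    then show ?thesis using refl[OF r] by (simp add: tour_inv_def)
  qed
  have P: "tour_inv T (?pass ws) \<and> set ws \<subseteq> set (?pass ws) \<and> (set (?pass ws) = set ws \<longrightarrow> (\<forall>e\<in>set T. (fst e \<in> set ws) = (snd e \<in> set ws)))"
    if "tour_inv T ws" for ws using tour_inv_pass[OF T that, of T] by auto
  have sub: "set ws \<subseteq> {..<n}" if "tour_inv T ws" for ws using that T r unfolding tour_inv_def by fastforce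
  \<comment> \<open>After \<open>k\<close> passes the tour is closed under the edges or has more
    than \<open>k\<close> vertices; the latter is impossible for \<open>k = n\<close>.\<close>
  have it: "tour_inv T ((?pass ^^ k) [r]) \<and> ((\<forall>e\<in>set T. (fst e \<in> set ((?pass ^^ k) [r])) = (snd e \<in> set ((?pass ^^ k) [r]))) \<or> k < card (set ((?pass ^^ k) [r])))" for k
  proof (induction k)
    case 0
    then show ?case using init by simp
  next
    case (Suc k)
    let ?w = "(?pass ^^ k) [r]"
    have w: "tour_inv T ?w" using Suc by blast
    show ?case
    proof (cases "\<forall>e\<in>set T. (fst e \<in> set ?w) = (snd e \<in> set ?w)")
      case True
      have "foldl g_attach ?w es = ?w" if "set es \<subseteq> set T" for es
        using that by (induction es) (use True in \<open>auto simp: g_attach_def memb_def\<close>)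
      then show ?thesis using w True by simp
    next
      case False
      then have k: "k < card (set ?w)" using Suc by blast
      have "set ?w \<subset> set (?pass ?w)" using P[OF w] False by blast
      then have "card (set ?w) < card (set (?pass ?w))" by (intro psubset_card_mono) auto
      then show ?thesis using P[OF w] k by simp
    qed
  qed
  have zi: "tour_inv T zs" using it[of n] zs by simp
  have "\<not> n < card (set zs)" using card_mono[OF _ sub[OF zi]] by simp
  then have closed: "\<forall>e\<in>set T. (fst e \<in> set zs) = (snd e \<in> set zs)" using it[of n] zs by simp
  show "\<exists>ws. zs = r # ws" "distinct zs" using zi by (auto simp: tour_inv_def)
  have "r \<in> set zs" using zi by (auto simp: tour_inv_def)
  then have "insert r (fst ` set T \<union> snd ` set T) \<subseteq> set zs" using conn[OF sub[OF zi]] closed by blast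
  then show "set zs = insert r (fst ` set T \<union> snd ` set T)" using zi by (auto simp: tour_inv_def)
  have "(\<Sum>e\<leftarrow>T. of_bool (fst e \<in> set zs \<and> snd e \<in> set zs) * d (fst e) (snd e)) \<le> (\<Sum>e\<leftarrow>T. d (fst e) (snd e))"
    using T nonneg by (intro sum_list_mono) auto
  then show "plen d (zs @ [r]) \<le> 2 * (\<Sum>e\<leftarrow>T. d (fst e) (snd e))" using zi unfolding tour_inv_def by linarith
qed

end

section \<open>Summation over geometric scales\<close>

text \<open>By monotonicity the indices with \<open>B j\<close> at most \<open>x\<close> form an
  initial segment, and the increments over it add up to its last value.\<close>

lemma telescope_below:
  fixes B :: "nat \<Rightarrow> real"
  assumes "mono B" "0 \<le> B 0" "0 \<le> x"
  shows "(\<Sum>j\<le>J. (B j - (if j = 0 then 0 else B (j - 1))) * of_bool (B j \<le> x)) \<le> x"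
proof (induction J)
  case 0
  then show ?case using assms by (simp add: of_bool_def)
next
  case (Suc J)
  show ?case
  proof (cases "B (Suc J) \<le> x")
    case True
    have "(\<Sum>j\<le>K. (B j - (if j = 0 then 0 else B (j - 1))) * of_bool (B j \<le> x)) = B K" if "K \<le> Suc J" for K
      using that
    proof (induction K)
      case 0
      then show ?case using True monoD[OF assms(1), of 0 "Suc J"] by auto
    next
      case (Suc K)
      then show ?case using True monoD[OF assms(1), of "Suc K" "Suc J"] by auto
    qed
    from this[of "Suc J"] show ?thesis using True by simp
  next
    case False
    then show ?thesis using Suc by simp
  qed
qed

text \<open>\<open>l k\<close> will be the expected length of the first \<open>k\<close> vertices of
  the optimum and \<open>q k\<close> the probability of the \<open>k\<close>-th; the sum of
  \<open>q k * l k\<close> is the area below the staircase and bounds the optimum from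
  below.\<close>

locale staircase =
  fixes m :: nat and l q :: "nat \<Rightarrow> real"
  assumes l0: "l 0 = 0" and lmono: "\<And>i j. i \<le> j \<Longrightarrow> j \<le> m \<Longrightarrow> l i \<le> l j"
    and q: "\<And>i. 1 \<le> i \<Longrightarrow> i \<le> m \<Longrightarrow> 0 \<le> q i"
begin

definition upper :: "nat \<Rightarrow> real" where "upper k = (\<Sum>i\<in>{k..m}. q i)"

text \<open>The height at which the ray of slope \<open>1/t\<close> meets the boundary of the region below the
  staircase \<open>l \<mapsto> remaining mass\<close>.\<close>

definition B :: "real \<Rightarrow> real" where "B t = Max ((\<lambda>k. if k = 0 then 0 else min (l k) (t * upper k)) ` {..m})"

lemma upper_nonneg: "1 \<le> k \<Longrightarrow> 0 \<le> upper k" unfolding upper_def by (intro sum_nonneg) (use q in auto)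

lemma B_ge: "k \<le> m \<Longrightarrow> k \<noteq> 0 \<Longrightarrow> min (l k) (t * upper k) \<le> B t"
  unfolding B_def by (intro Max_ge) (auto intro!: image_eqI[of _ _ k])

lemma B_nonneg: "0 \<le> B t" unfolding B_def by (rule Max_ge) (auto intro!: image_eqI[of _ _ 0])

lemma B_in: "\<exists>k\<le>m. B t = (if k = 0 then 0 else min (l k) (t * upper k))"
proof -
  have "B t \<in> (\<lambda>k. if k = 0 then 0 else min (l k) (t * upper k)) ` {..m}" unfolding B_def by (rule Max_in) auto
  then show ?thesis by blast
qed

lemma B_mono: assumes "0 \<le> s" "s \<le> t" shows "B s \<le> B t"
proof -
  obtain k where k: "k \<le> m" "B s = (if k = 0 then 0 else min (l k) (s * upper k))" using B_in by blast
  show ?thesis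
  proof (cases "k = 0")
    case False
    have "s * upper k \<le> t * upper k" using assms upper_nonneg[of k] False by (intro mult_right_mono) auto
    then show ?thesis using k B_ge[of k t] False by auto
  qed (use k B_nonneg in simp)
qed

text \<open>Stretching \<open>t\<close> by \<open>c\<close> multiplies one of the two terms of each
  minimum by \<open>c\<close> and leaves the other alone.\<close>

lemma B_scale: assumes "0 \<le> t" "1 \<le> c" shows "B (c * t) \<le> c * B t"
proof -
  obtain k where k: "k \<le> m" "B (c * t) = (if k = 0 then 0 else min (l k) (c * t * upper k))" using B_in by blast
  show ?thesis
  proof (cases "k = 0")
    case False
    have "0 \<le> l k" using lmono[of 0 k] l0 k by simp
    then have "l k \<le> c * l k" using assms(2) mult_right_mono[of 1 c "l k"] by simp
    then have "min (l k) (c * t * upper k) \<le> min (c * l k) (c * (t * upper k))" by (intro min.mono) (auto simp: mult.assoc)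
    also have "\<dots> = c * min (l k) (t * upper k)" using assms by (simp add: min_mult_distrib_left)
    also have "\<dots> \<le> c * B t" using B_ge[OF k(1) False] assms by (intro mult_left_mono) auto
    finally show ?thesis using k False by simp
  qed (use k B_nonneg assms in simp)
qed

text \<open>Take the last prefix of length at most \<open>B t\<close>. The next one is longer, so
  its minimum is the mass term, and that is the mass remaining after the chosen prefix.\<close>

lemma B_crossing: assumes "0 \<le> t" shows "\<exists>k\<le>m. l k \<le> B t \<and> t * (\<Sum>i\<in>{k<..m}. q i) \<le> B t"
proof -
  define k where "k = Max {k. k \<le> m \<and> l k \<le> B t}"
  have fin: "finite {k. k \<le> m \<and> l k \<le> B t}" "{k. k \<le> m \<and> l k \<le> B t} \<noteq> {}" using l0 B_nonneg by (auto intro!: exI[of _ 0])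
  have k: "k \<le> m" "l k \<le> B t" using Max_in[OF fin] unfolding k_def by auto
  show ?thesis
  proof (cases "k = m")
    case True
    then show ?thesis using k B_nonneg by auto
  next
    case False
    then have "\<not> l (Suc k) \<le> B t" using Max_ge[OF fin(1), of "Suc k"] k unfolding k_def[symmetric] by auto
    then have "t * upper (Suc k) \<le> B t" using B_ge[of "Suc k" t] k False by auto
    moreover have "{k<..m} = {Suc k..m}" by auto
    ultimately show ?thesis using k by (auto simp: upper_def)
  qed
qed

text \<open>At height \<open>B t\<close> the region is still at least \<open>B t / t\<close> wide,
  because from the maximising \<open>k\<close> on all lengths are at least
  \<open>B t\<close>.\<close>

lemma B_slope: assumes "0 < t" shows "B t / t \<le> (\<Sum>k\<in>{1..m}. q k * of_bool (B t \<le> l k))"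
proof -
  have nn: "0 \<le> (\<Sum>k\<in>{1..m}. q k * of_bool (B t \<le> l k))" by (intro sum_nonneg) (use q in auto)
  obtain k where k: "k \<le> m" "B t = (if k = 0 then 0 else min (l k) (t * upper k))" using B_in by blast
  show ?thesis
  proof (cases "k = 0")
    case False
    then have "B t \<le> t * upper k" "B t \<le> l k" using k by auto
    then have "B t / t \<le> upper k" using assms by (simp add: field_simps)
    also have "\<dots> = (\<Sum>i\<in>{k..m}. q i * of_bool (B t \<le> l i))"
      unfolding upper_def
    proof (rule sum.cong)
      fix i assume "i \<in> {k..m}"
      then have "l k \<le> l i" by (intro lmono) auto
      then show "q i = q i * of_bool (B t \<le> l i)" using \<open>B t \<le> l k\<close> by simp
    qed simp
    also have "\<dots> \<le> (\<Sum>i\<in>{1..m}. q i * of_bool (B t \<le> l i))" by (rule sum_mono2) (use False q in auto)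
    finally show ?thesis .
  qed (use k nn in simp)
qed

text \<open>The strips between consecutive heights, with the widths of \<open>B_slope\<close>, are
  disjoint and lie below the staircase. If \<open>B\<close> at least doubles, a strip has at least
  half the size of its square term; if not, the ratio 16 makes the term at most a quarter of its
  predecessor up to no further loss. Hence the sum is at most twice the area plus a quarter of
  itself.\<close>

lemma sum_B_squares: "(\<Sum>j\<le>J. (B (16 ^ j))\<^sup>2 / 16 ^ j) \<le> 3 * (\<Sum>k\<in>{1..m}. q k * l k)"
proof -
  let ?B = "\<lambda>j::nat. B (16 ^ j)"
  define a where "a j = (?B j)\<^sup>2 / 16 ^ j" for j :: nat
  define prev where "prev j = (if j = 0 then 0 else ?B (j - 1))" for j :: nat
  define area where "area j = (?B j - prev j) * (?B j / 16 ^ j)" for j :: nat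
  let ?A = "\<Sum>k\<in>{1..m}. q k * l k"
  have mono: "mono ?B" by (rule monoI, rule B_mono) (auto intro: power_increasing)
  have pm: "prev j \<le> ?B j" for j using monoD[OF mono, of "j - 1" j] B_nonneg by (auto simp: prev_def)
  have lk: "0 \<le> l k" if "k \<le> m" for k using lmono[of 0 k] l0 that by simp
  have "(\<Sum>j\<le>J. area j) \<le> (\<Sum>j\<le>J. (?B j - prev j) * (\<Sum>k\<in>{1..m}. q k * of_bool (?B j \<le> l k)))"
    unfolding area_def by (intro sum_mono mult_left_mono B_slope) (use pm in auto)
  also have "\<dots> = (\<Sum>k\<in>{1..m}. q k * (\<Sum>j\<le>J. (?B j - prev j) * of_bool (?B j \<le> l k)))"
  proof -
    have "(\<Sum>j\<le>J. (?B j - prev j) * (\<Sum>k\<in>{1..m}. q k * of_bool (?B j \<le> l k))) =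
        (\<Sum>j\<le>J. \<Sum>k\<in>{1..m}. q k * ((?B j - prev j) * of_bool (?B j \<le> l k)))"
      unfolding sum_distrib_left by (intro sum.cong) (simp_all only: mult.left_commute)
    also have "\<dots> = (\<Sum>k\<in>{1..m}. \<Sum>j\<le>J. q k * ((?B j - prev j) * of_bool (?B j \<le> l k)))" by (rule sum.swap)
    finally show ?thesis unfolding sum_distrib_left .
  qed
  also have "\<dots> \<le> ?A"
  proof (intro sum_mono mult_left_mono)
    fix k assume "k \<in> {1..m}"
    then show "0 \<le> q k" using q by auto
    show "(\<Sum>j\<le>J. (?B j - prev j) * of_bool (?B j \<le> l k)) \<le> l k"
      unfolding prev_def by (rule telescope_below[OF mono]) (use lk B_nonneg \<open>k \<in> {1..m}\<close> in auto)
  qed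
  finally have area: "(\<Sum>j\<le>J. area j) \<le> ?A" .
  have rec: "a j \<le> 2 * area j + (if j = 0 then 0 else a (j - 1) / 4)" for j
  proof (cases "j = 0")
    case True
    have "0 \<le> a 0" by (simp add: a_def)
    moreover have "area 0 = a 0" by (simp add: area_def prev_def a_def power2_eq_square)
    ultimately show ?thesis using True by simp
  next
    case False
    then obtain i where i: "j = Suc i" by (cases j) auto
    have bi: "0 \<le> ?B i" "0 \<le> ?B j" using B_nonneg by auto
    show ?thesis
    proof (cases "2 * ?B i \<le> ?B j")
      case True
      then have "?B j / 2 * (?B j / 16 ^ j) \<le> area j" unfolding area_def
        using bi by (intro mult_right_mono) (auto simp: prev_def i)
      moreover have "0 \<le> a i" by (simp add: a_def)
      moreover have "?B j / 2 * (?B j / 16 ^ j) = a j / 2" by (simp add: a_def power2_eq_square)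
      ultimately have "a j \<le> 2 * area j + a i / 4" by linarith
      then show ?thesis using i by simp
    next
      case False
      then have "(?B j)\<^sup>2 \<le> (2 * ?B i)\<^sup>2" using bi by (intro power_mono) auto
      then have "a j \<le> (2 * ?B i)\<^sup>2 / 16 ^ j" unfolding a_def by (intro divide_right_mono) auto
      also have "\<dots> = a i / 4" by (simp add: a_def i power_mult_distrib field_simps)
      also have "\<dots> \<le> 2 * area j + a i / 4" unfolding area_def using pm[of j] bi by simp
      finally show ?thesis using i by simp
    qed
  qed
  have "(\<Sum>j\<le>J. a j) \<le> (\<Sum>j\<le>J. 2 * area j + (if j = 0 then 0 else a (j - 1) / 4))" by (intro sum_mono rec)
  also have "\<dots> = 2 * (\<Sum>j\<le>J. area j) + (\<Sum>j\<le>J. if j = 0 then 0 else a (j - 1) / 4)"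
    by (simp add: sum.distrib sum_distrib_left)
  also have "(\<Sum>j\<le>J. if j = 0 then 0 else a (j - 1) / 4) \<le> (\<Sum>j\<le>J. a j) / 4"
  proof (induction J)
    case (Suc J)
    have "(\<Sum>j\<le>J'. if j = 0 then 0 else a (j - 1) / 4) = (\<Sum>j<J'. a j / 4)" for J'
      by (induction J') auto
    then have "(\<Sum>j\<le>Suc J. if j = 0 then 0 else a (j - 1) / 4) = (\<Sum>j<Suc J. a j / 4)" by blast
    also have "\<dots> \<le> (\<Sum>j\<le>Suc J. a j / 4)" by (rule sum_mono2) (auto simp: a_def)
    finally show ?case by (simp only: sum_divide_distrib)
  qed (simp add: a_def)
  finally have "(\<Sum>j\<le>J. a j) * 3 \<le> 8 * ?A" using area by linarith
  moreover have "0 \<le> ?A" by (intro sum_nonneg mult_nonneg_nonneg) (use q lk in auto)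
  ultimately show ?thesis unfolding a_def by linarith
qed

end

section \<open>Concatenating stages into one master tour\<close>

definition rd :: "nat list \<Rightarrow> nat \<Rightarrow> nat list" where
  "rd s a = (if \<exists>z\<in>set s. z = a then s else s @ [a])"

lemma foldl_rd_prefix: "\<exists>zs. foldl rd s xs = s @ zs \<and> subseq zs xs"
proof (induction xs arbitrary: s)
  case (Cons a xs)
  obtain zs where zs: "foldl rd (rd s a) xs = rd s a @ zs" "subseq zs xs" using Cons by blast
  show ?case
  proof (cases "\<exists>z\<in>set s. z = a")
    case True
    then have "rd s a = s" by (simp add: rd_def)
    then show ?thesis using zs by (intro exI[of _ zs]) auto
  next
    case False
    then have "rd s a = s @ [a]" by (auto simp: rd_def)
    then show ?thesis using zs by (intro exI[of _ "a # zs"]) auto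
  qed
qed simp

lemma foldl_rd_distinct: "distinct s \<Longrightarrow> distinct (foldl rd s xs)"
  by (induction xs arbitrary: s) (auto simp: rd_def)

lemma foldl_rd_set: "set (foldl rd s xs) = set s \<union> set xs"
  by (induction xs arbitrary: s) (auto simp: rd_def)

definition stage :: "nat list \<Rightarrow> (nat \<Rightarrow> nat \<Rightarrow> bool) \<Rightarrow> nat list \<Rightarrow> nat list" where
  "stage vs Q Tr = concat (map (\<lambda>a. filter (\<lambda>v. Q v a) vs) Tr)"

context apriori
begin

text \<open>Once vertices are moved to their centres, a stage repeats each centre as often as its
  cell has served vertices, possibly never: repetitions are free and omissions are shortcuts. The
  second disjunct stands for a premise on \<open>ws\<close>.\<close>

lemma plen_repeat:
  assumes "set (x # T) \<subseteq> {..<n}" "\<And>a. a \<in> set T \<Longrightarrow> set (f a) \<subseteq> {a}"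
  shows "plen d (x # concat (map f T) @ ws) \<le> plen d (x # T @ ws) \<or> \<not> set ws \<subseteq> {..<n}"
  using assms
proof (induction T arbitrary: x)
  case (Cons a T)
  have rep: "plen d (a # us @ zs) = plen d (a # zs)" if "set us \<subseteq> {a}" for us zs
    using that by (induction us) (use refl Cons.prems in auto)
  show ?case
  proof (cases "set ws \<subseteq> {..<n}")
    case True
    have IH: "plen d (a # concat (map f T) @ ws) \<le> plen d (a # T @ ws)" using Cons.IH[of a] Cons.prems True by auto
    have fa: "set (f a) \<subseteq> {a}" using Cons.prems by auto
    have cs: "set (concat (map f T) @ ws) \<subseteq> {..<n}" using Cons.prems True by fastforce
    have "plen d (x # f a @ concat (map f T) @ ws) \<le> plen d (x # a # f a @ concat (map f T) @ ws)"
      by (rule plen_drop_second) (use Cons.prems fa cs in auto)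
    also have "\<dots> = d x a + plen d (a # concat (map f T) @ ws)" using rep[OF fa] by simp
    also have "\<dots> \<le> d x a + plen d (a # T @ ws)" using IH by simp
    finally show ?thesis by simp
  qed simp
qed simp

text \<open>Returning to the root after every stage only lengthens the walk and makes the stages
  independent of each other.\<close>

lemma plen_stages:
  assumes "\<And>T. T \<in> set Ts \<Longrightarrow> set T \<subseteq> {..<n} \<and> (\<exists>ws. T = r # ws)"
  shows "plen d (r # concat Ts) \<le> (\<Sum>T\<leftarrow>Ts. plen d (T @ [r]))"
  using assms
proof (induction Ts)
  case (Cons T Ts)
  have "set T \<subseteq> {..<n} \<and> (\<exists>ws. T = r # ws)" using Cons.prems by simp
  then obtain ws where T: "T = r # ws" "set T \<subseteq> {..<n}" by blast
  have "U \<in> set Ts \<Longrightarrow> set U \<subseteq> {..<n}" for U using Cons.prems by simp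
  then have sub: "set (concat Ts) \<subseteq> {..<n}" by auto
  have IH: "plen d (r # concat Ts) \<le> (\<Sum>T\<leftarrow>Ts. plen d (T @ [r]))" using Cons by auto
  have "plen d (r # T @ concat Ts) \<le> plen d (r # T @ r # concat Ts)"
    by (rule plen_subseq_Cons) (use T sub r in \<open>auto intro: list_emb_append_mono\<close>)
  also have "\<dots> = plen d (r # T @ [r]) + plen d (r # concat Ts)" using plen_append[of d "r # T" r "concat Ts"] by simp
  also have "plen d (r # T @ [r]) = plen d (T @ [r])" using T refl[OF r] by simp
  finally show ?case using IH by simp
qed simp

text \<open>A vertex waits for all stages up to the first one that serves it, so stage
  \<open>j\<close> may be charged to the vertices outside \<open>W (j - 1)\<close>, and stage 0 to
  all. The sets \<open>W j\<close> need not increase; this may count a stage too often but never too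
  rarely.\<close>

lemma elat_stages:
  fixes Tr :: "nat \<Rightarrow> nat list" and W :: "nat \<Rightarrow> nat set" and ss :: "nat list list"
  assumes Tr: "\<And>j. j \<le> J \<Longrightarrow> set (Tr j) \<subseteq> {..<n} \<and> (\<exists>ws. Tr j = r # ws)"
    and c: "\<And>v. v < n \<Longrightarrow> c v < n" "c r = r"
    and W: "\<And>j. W j = {v. v < n \<and> c v \<in> set (Tr j) \<and> d v (c v) \<le> lam j}"
    and WJ: "W J = {..<n}"
    and ss: "ss = map (\<lambda>j. stage [0..<n] (\<lambda>v a. c v = a \<and> d v a \<le> lam j) (Tr j)) [0..<Suc J]"
    and xs: "r # xs = foldl rd [r] (concat ss @ [0..<n])"
  defines "Ls \<equiv> \<lambda>j. plen d (Tr j @ [r]) + 2 * (\<Sum>u\<in>W j. p u * d u (c u))"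
  shows "set xs = {..<n} - {r}" "distinct xs"
    "elat n r d p xs \<le> (\<Sum>j\<le>J. Ls j * (\<Sum>v\<in>{v. v < n \<and> (j = 0 \<or> v \<notin> W (j - 1))}. p v)) + 2 * (\<Sum>v<n. p v * d v (c v))"
proof -
  have dist: "distinct (r # xs)" unfolding xs by (rule foldl_rd_distinct) simp
  have stW: "set (stage [0..<n] (\<lambda>v a. c v = a \<and> d v a \<le> lam j) (Tr j)) = W j" for j
    unfolding stage_def W by auto
  have "set (r # xs) = {..<n}"
    unfolding xs foldl_rd_set using r stW W by (auto simp: ss)
  then show sx: "set xs = {..<n} - {r}" "distinct xs" using dist by auto
  have Lnn: "0 \<le> Ls j" if "j \<le> J" for j
    unfolding Ls_def using Tr[OF that] r prob nonneg c(1) W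
    by (intro add_nonneg_nonneg plen_nonneg mult_nonneg_nonneg sum_nonneg) auto
  define f where "f v = (\<Sum>j\<le>J. Ls j * of_bool (j = 0 \<or> v \<notin> W (j - 1))) + 2 * d v (c v)" for v
  have main: "E (\<lambda>A. plen d (r # filter (\<lambda>v. v \<in> insert (xs ! i) A) (take (Suc i) xs))) \<le> f (xs ! i)" if i: "i < length xs" for i
  proof -
    define v where "v = xs ! i"
    have v: "v < n" "v \<noteq> r" using sx(1) nth_mem[OF i] by (auto simp: v_def)
    define j where "j = (LEAST j. v \<in> W j)"
    have j: "v \<in> W j" "j \<le> J" unfolding j_def using LeastI[of "\<lambda>j. v \<in> W j" J] Least_le[of "\<lambda>j. v \<in> W j" J] WJ v by auto
    have jmin: "v \<notin> W k" if "k < j" for k using that not_less_Least unfolding j_def by blast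
    let ?pre = "take (Suc j) ss"
    have pre: "?pre = map (\<lambda>j. stage [0..<n] (\<lambda>v a. c v = a \<and> d v a \<le> lam j) (Tr j)) [0..<Suc j]"
      using j(2) unfolding ss by (simp add: take_map take_upt del: upt_Suc)
    have spre: "set (concat ?pre) = (\<Union>k\<le>j. W k)" unfolding pre using stW by (auto simp: less_Suc_eq_le simp del: upt_Suc)
    have "concat ss @ [0..<n] = concat ?pre @ (concat (drop (Suc j) ss) @ [0..<n])"
      by (metis append_assoc append_take_drop_id concat_append)
    then obtain zs where zs: "r # xs = foldl rd [r] (concat ?pre) @ zs"
      unfolding xs using foldl_rd_prefix[of "foldl rd [r] (concat ?pre)"] by (metis foldl_append)
    obtain us where us: "foldl rd [r] (concat ?pre) = r # us" "subseq us (concat ?pre)"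
      using foldl_rd_prefix[of "[r]" "concat ?pre"] by auto
    have "v \<in> set us" using foldl_rd_set[of "[r]" "concat ?pre"] us(1) spre j(1) v(2) by auto
    have xz: "xs = us @ zs" using zs us(1) by simp
    have "i < length us"
    proof (rule ccontr)
      assume "\<not> i < length us"
      then have "v \<in> set zs" using i xz v_def by (simp add: nth_append)
      then show False using \<open>v \<in> set us\<close> sx(2) xz by auto
    qed
    then have tk: "take (Suc i) xs = take (Suc i) us" using xz by simp
    have sub: "subseq (take (Suc i) xs) (concat ?pre)"
      unfolding tk using us(2) subseq_order.order_trans[OF prefix_imp_subseq[OF take_is_prefix]] by blast
    let ?X = "set (take (Suc i) xs)"
    have "?X \<subseteq> set (concat ?pre)" using list_emb_set[OF sub] by blast
    then have X: "?X \<subseteq> (\<Union>k\<le>j. W k)" unfolding spre .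
    moreover have "(\<Union>k\<le>j. W k) \<subseteq> {..<n}" using W by auto
    ultimately have X: "?X \<subseteq> (\<Union>k\<le>j. W k)" "?X \<subseteq> {..<n}" by auto
    have vX: "v \<in> ?X" using i by (simp add: v_def take_Suc_conv_app_nth)
    let ?C = "\<Sum>k\<le>j. plen d (Tr k @ [r])"
    \<comment> \<open>The vertex \<open>v\<close> is active by conditioning and pays its
      displacement in full. The other displacements carry their indicators, and their expectations
      are absorbed in the terms \<open>Ls\<close>.\<close>
    have point: "plen d (r # filter (\<lambda>u. u \<in> insert v A) (take (Suc i) xs)) \<le>
        ?C + 2 * d v (c v) + 2 * (\<Sum>u\<in>?X - {v}. of_bool (u \<in> A) * d u (c u))" for A
    proof -
      let ?zs = "filter (\<lambda>u. u \<in> insert v A) (take (Suc i) xs)"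
      have zn: "set ?zs \<subseteq> {..<n}" using X(2) by auto
      have "plen d (r # ?zs) \<le> plen d (r # map c ?zs) + 2 * (\<Sum>u\<leftarrow>?zs. d u (c u))"
        by (rule plen_map_le(2)) (use zn r c in auto)
      also have "plen d (r # map c ?zs) \<le> plen d (r # map c (concat ?pre))"
      proof (rule plen_subseq_Cons)
        show "subseq (map c ?zs) (map c (concat ?pre))"
          using sub subseq_filter_left subseq_map subseq_order.order_trans by blast
        show "set (map c (concat ?pre)) \<subseteq> {..<n}" using spre W c(1) by auto
      qed (rule r)
      also have "plen d (r # map c (concat ?pre)) \<le> plen d (r # concat (map Tr [0..<Suc j]))"
      proof -
        have gen: "plen d (x # map c (concat (map (\<lambda>j. stage [0..<n] (\<lambda>v a. c v = a \<and> d v a \<le> lam j) (Tr j)) ks))) \<le>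
            plen d (x # concat (map Tr ks))" if "set ks \<subseteq> {..J}" "x < n" for ks x
          using that
        proof (induction ks arbitrary: x)
          case (Cons k ks)
          let ?f = "\<lambda>a. map c (filter (\<lambda>v. c v = a \<and> d v a \<le> lam k) [0..<n])"
          let ?rest = "map c (concat (map (\<lambda>j. stage [0..<n] (\<lambda>v a. c v = a \<and> d v a \<le> lam j) (Tr j)) ks))"
          have kJ: "k \<le> J" "set ks \<subseteq> {..J}" using Cons.prems by auto
          obtain ws where tk: "Tr k = r # ws" "set (Tr k) \<subseteq> {..<n}" using Tr[OF kJ(1)] by blast
          have rn: "set ?rest \<subseteq> {..<n}" using stW W c(1) by auto
          have mc: "map c (stage [0..<n] (\<lambda>v a. c v = a \<and> d v a \<le> lam k) (Tr k)) = concat (map ?f (Tr k))"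
            unfolding stage_def by (simp add: map_concat comp_def)
          have "plen d (x # concat (map ?f (Tr k)) @ ?rest) \<le> plen d (x # Tr k @ ?rest)"
            using plen_repeat[of x "Tr k" ?f ?rest] tk(2) rn Cons.prems by auto
          also have "\<dots> \<le> plen d (x # Tr k @ concat (map Tr ks))"
          proof -
            obtain ys b where yb: "x # Tr k = ys @ [b]" "b < n"
              using Cons.prems tk(2) by (metis append_butlast_last_id last_in_set lessThan_iff list.distinct(1) set_ConsD subsetD)
            have "plen d (b # ?rest) \<le> plen d (b # concat (map Tr ks))" by (rule Cons.IH[OF kJ(2) yb(2)])
            moreover have "plen d (x # Tr k @ zs) = plen d (ys @ [b]) + plen d (b # zs)" for zs
              using plen_append[of d ys b zs] yb(1) by (metis append_Cons append_assoc append_Nil)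
            ultimately show ?thesis by simp
          qed
          finally show ?case using mc by simp
        qed simp
        show ?thesis unfolding pre by (rule gen) (use j(2) r in auto)
      qed
      also have "\<dots> \<le> (\<Sum>T\<leftarrow>map Tr [0..<Suc j]. plen d (T @ [r]))"
      proof (rule plen_stages)
        fix T assume "T \<in> set (map Tr [0..<Suc j])"
        then obtain k where "k \<le> j" "T = Tr k" by (auto simp: less_Suc_eq_le simp del: upt_Suc)
        then show "set T \<subseteq> {..<n} \<and> (\<exists>ws. T = r # ws)" using Tr[of k] j(2) by simp
      qed
      also have "\<dots> = ?C" by (simp add: interv_sum_list_conv_sum_set_nat atLeast0LessThan lessThan_Suc_atMost comp_def del: upt_Suc)
      also have "(\<Sum>u\<leftarrow>?zs. d u (c u)) = (\<Sum>u\<in>set ?zs. d u (c u))"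
        using sx(2) by (simp add: sum_list_distinct_conv_sum_set)
      also have "\<dots> = d v (c v) + (\<Sum>u\<in>set ?zs - {v}. d u (c u))" using vX by (intro sum.remove) auto
      also have "(\<Sum>u\<in>set ?zs - {v}. d u (c u)) = (\<Sum>u\<in>?X - {v}. of_bool (u \<in> A) * d u (c u))"
        by (rule sum.mono_neutral_cong_left) auto
      finally show ?thesis by simp
    qed
    have "E (\<lambda>A. plen d (r # filter (\<lambda>u. u \<in> insert v A) (take (Suc i) xs))) \<le>
        E (\<lambda>A. ?C + 2 * d v (c v) + 2 * (\<Sum>u\<in>?X - {v}. of_bool (u \<in> A) * d u (c u)))"
      by (rule E_mono) (rule point)
    also have "\<dots> = ?C + 2 * d v (c v) + 2 * (\<Sum>u\<in>?X - {v}. p u * d u (c u))"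
    proof -
      have "E (\<lambda>A. \<Sum>u\<in>?X - {v}. of_bool (u \<in> A) * d u (c u)) = (\<Sum>u\<in>?X - {v}. E (\<lambda>A. of_bool (u \<in> A) * d u (c u)))"
        by (rule Ex_sum) simp
      also have "\<dots> = (\<Sum>u\<in>?X - {v}. p u * d u (c u))"
        by (rule sum.cong) (use X(2) in \<open>auto simp: Ex_indicator Ex_const\<close>)
      finally show ?thesis by (simp add: Ex_add Ex_cmult Ex_const)
    qed
    also have "(\<Sum>u\<in>?X - {v}. p u * d u (c u)) \<le> (\<Sum>k\<le>j. \<Sum>u\<in>W k. p u * d u (c u))"
    proof -
      have Wf: "finite (W k)" for k unfolding W by simp
      have nn: "0 \<le> p u * d u (c u)" if "u < n" for u using that prob nonneg c(1) by simp
      have "(\<Sum>u\<in>?X - {v}. p u * d u (c u)) \<le> (\<Sum>u\<in>(\<Union>k\<le>j. W k). p u * d u (c u))"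
        by (rule sum_mono2) (use X Wf W nn in auto)
      also have "\<dots> \<le> (\<Sum>k\<le>j. \<Sum>u\<in>W k. p u * d u (c u))"
      proof -
        have "(\<Sum>u\<in>(\<Union>k\<in>K. W k). p u * d u (c u)) \<le> (\<Sum>k\<in>K. \<Sum>u\<in>W k. p u * d u (c u))" if "finite K" for K
          using that
        proof (induction K rule: finite_induct)
          case (insert k K)
          have "(\<Sum>u\<in>W k \<union> (\<Union>k\<in>K. W k). p u * d u (c u)) \<le> (\<Sum>u\<in>W k. p u * d u (c u)) + (\<Sum>u\<in>(\<Union>k\<in>K. W k). p u * d u (c u))"
            using sum.union_inter[of "W k" "\<Union>k\<in>K. W k" "\<lambda>u. p u * d u (c u)"] Wf insert.hyps
              sum_nonneg[of "W k \<inter> (\<Union>k\<in>K. W k)" "\<lambda>u. p u * d u (c u)"] nn W by fastforce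
          then show ?case using insert by simp
        qed simp
        then show ?thesis by blast
      qed
      finally show ?thesis .
    qed
    also have "?C + 2 * d v (c v) + 2 * (\<Sum>k\<le>j. \<Sum>u\<in>W k. p u * d u (c u)) = (\<Sum>k\<le>j. Ls k) + 2 * d v (c v)"
      by (simp add: Ls_def sum.distrib sum_distrib_left)
    also have "(\<Sum>k\<le>j. Ls k) = (\<Sum>k\<le>j. Ls k * of_bool (k = 0 \<or> v \<notin> W (k - 1)))"
      by (rule sum.cong) (use jmin in auto)
    also have "\<dots> \<le> (\<Sum>k\<le>J. Ls k * of_bool (k = 0 \<or> v \<notin> W (k - 1)))"
      by (rule sum_mono2) (use j(2) Lnn in auto)
    finally show ?thesis unfolding f_def v_def by simp
  qed
  have nnf: "0 \<le> f v" if "v < n" for v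
    unfolding f_def using Lnn nonneg c(1) that by (intro add_nonneg_nonneg sum_nonneg mult_nonneg_nonneg) auto
  have "elat n r d p xs \<le> (\<Sum>i<length xs. p (xs ! i) * f (xs ! i))"
    unfolding elat_def
  proof (intro sum_mono mult_left_mono)
    fix i assume "i \<in> {..<length xs}"
    then have i: "i < length xs" by simp
    then show "E (\<lambda>A. plen d (r # filter (\<lambda>v. v \<in> insert (xs ! i) A) (take (Suc i) xs))) \<le> f (xs ! i)" by (rule main)
    have "xs ! i < n" using sx(1) nth_mem[OF i] by auto
    then show "0 \<le> p (xs ! i)" using prob by blast
  qed
  also have "\<dots> = (\<Sum>v\<leftarrow>xs. p v * f v)" by (simp add: sum_list_sum_nth atLeast0LessThan)
  also have "\<dots> = (\<Sum>v\<in>{..<n} - {r}. p v * f v)" using sx by (simp add: sum_list_distinct_conv_sum_set)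
  also have "\<dots> \<le> (\<Sum>v<n. p v * f v)" by (rule sum_mono2) (use prob nnf in auto)
  also have "\<dots> = (\<Sum>v<n. \<Sum>j\<le>J. p v * (Ls j * of_bool (j = 0 \<or> v \<notin> W (j - 1)))) + 2 * (\<Sum>v<n. p v * d v (c v))"
    by (simp add: f_def algebra_simps sum.distrib sum_distrib_left)
  also have "(\<Sum>v<n. \<Sum>j\<le>J. p v * (Ls j * of_bool (j = 0 \<or> v \<notin> W (j - 1)))) = (\<Sum>j\<le>J. \<Sum>v<n. p v * (Ls j * of_bool (j = 0 \<or> v \<notin> W (j - 1))))"
    by (rule sum.swap)
  also have "\<dots> = (\<Sum>j\<le>J. Ls j * (\<Sum>v\<in>{v. v < n \<and> (j = 0 \<or> v \<notin> W (j - 1))}. p v))"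
  proof (rule sum.cong)
    fix j
    have "(\<Sum>v<n. p v * (Ls j * of_bool (j = 0 \<or> v \<notin> W (j - 1)))) = (\<Sum>v\<in>{v. v < n \<and> (j = 0 \<or> v \<notin> W (j - 1))}. Ls j * p v)"
      by (rule sum.mono_neutral_cong_right) (auto simp: of_bool_def)
    then show "(\<Sum>v<n. p v * (Ls j * of_bool (j = 0 \<or> v \<notin> W (j - 1)))) = Ls j * (\<Sum>v\<in>{v. v < n \<and> (j = 0 \<or> v \<notin> W (j - 1))}. p v)"
      by (simp add: sum_distrib_left)
  qed simp
  finally show "elat n r d p xs \<le> (\<Sum>j\<le>J. Ls j * (\<Sum>v\<in>{v. v < n \<and> (j = 0 \<or> v \<notin> W (j - 1))}. p v)) + 2 * (\<Sum>v<n. p v * d v (c v))" .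
qed

end

section \<open>Comparison of the stages with the optimum\<close>

context apriori
begin

text \<open>A cell is good if at least half of its mass lies in the prefix. A moat with a good cell
  has prefix mass at least 1/4 and is paid for by the prefix. Moats of bad cells only are bounded by
  the prizes of these cells, at most \<open>lam\<close> times a mass of which more than half is
  still to be served. The 45 is \<open>5 * (1 + 2 * 4)\<close>, displacements in the prefix being at
  most \<open>4 * ell xo k\<close> by the radius bound.\<close>

lemma dual_lower_bound:
  fixes y :: "nat set \<Rightarrow> real" and c :: "nat \<Rightarrow> nat" and R z :: "nat \<Rightarrow> real"
  assumes c: "\<And>v. v < n \<Longrightarrow> c v < n" "c r = r"
    and R: "\<And>v. v < n \<Longrightarrow> 0 \<le> R v" "\<And>v. v < n \<Longrightarrow> R v \<le> d r v"
      "\<And>v. v < n \<Longrightarrow> v \<noteq> r \<Longrightarrow> (\<Sum>u\<in>{u. u < n \<and> u \<noteq> v \<and> d u v < R v}. p u) \<le> 1 / 2"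
    and cR: "\<And>v. v < n \<Longrightarrow> d v (c v) \<le> 2 * R v"
    and cell: "\<And>v. v < n \<Longrightarrow> c v \<noteq> r \<Longrightarrow> 1 / 2 \<le> (\<Sum>u\<in>{u. u < n \<and> c u = c v}. p u)"
    and lam: "0 \<le> lam"
    and y: "\<And>X. 0 \<le> y X" "\<And>X. 0 < y X \<Longrightarrow> r \<notin> X"
      "\<And>a b. a < n \<Longrightarrow> b < n \<Longrightarrow> (\<Sum>X\<in>Pow {..<n}. of_bool ((a \<in> X) \<noteq> (b \<in> X)) * y X) \<le> d a b"
      "\<And>U. U \<subseteq> {..<n} \<Longrightarrow> (\<Sum>X\<in>Pow {..<n}. of_bool (X \<subseteq> U) * y X) \<le> (\<Sum>u\<in>U. z u)"
    and z: "\<And>u. z u = (if u = r then 0 else \<Sum>v\<in>{v. v < n \<and> c v = u}. p v * max 0 (lam - d v u))"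
    and xo: "set xo = {..<n} - {r}" "distinct xo" and k: "k \<le> length xo"
  shows "(\<Sum>X\<in>Pow {..<n}. y X) \<le> 45 * ell xo k + 2 * (lam * (\<Sum>v\<in>set (drop k xo). p v))"
    "(\<Sum>v<n. p v * min lam (d v (c v))) \<le> 4 * ell xo k + lam * (\<Sum>v\<in>set (drop k xo). p v)"
proof -
  let ?S = "set (take k xo)" and ?D = "set (drop k xo)"
  have SD: "?S \<union> ?D = {..<n} - {r}" "?S \<inter> ?D = {}"
    using xo by (metis append_take_drop_id set_append, metis append_take_drop_id distinct_append)
  have S: "?S \<subseteq> {..<n} - {r}" "?D \<subseteq> {..<n} - {r}" using SD by auto
  have pn: "v < n \<Longrightarrow> 0 \<le> p v" for v using prob by blast
  have dn: "v < n \<Longrightarrow> 0 \<le> d v (c v)" for v using nonneg c(1) by blast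
  have SR: "(\<Sum>v\<in>?S. p v * R v) \<le> 2 * ell xo k"
    by (rule ell_ge_radius) (use xo R in auto)
  have Sd: "(\<Sum>v\<in>?S. p v * d v (c v)) \<le> 4 * ell xo k"
  proof -
    have "(\<Sum>v\<in>?S. p v * d v (c v)) \<le> (\<Sum>v\<in>?S. 2 * (p v * R v))"
    proof (rule sum_mono)
      fix v assume "v \<in> ?S"
      then have "v < n" using S by auto
      then show "p v * d v (c v) \<le> 2 * (p v * R v)" using mult_left_mono[OF cR pn, of v v] by simp
    qed
    also have "\<dots> \<le> 4 * ell xo k" using SR by (simp add: sum_distrib_left[symmetric])
    finally show ?thesis .
  qed
  have "(\<Sum>v<n. p v * min lam (d v (c v))) = (\<Sum>v\<in>{..<n} - {r}. p v * min lam (d v (c v)))"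
    using refl[OF r] c(2) lam r by (subst sum.remove[of _ r]) auto
  also have "\<dots> = (\<Sum>v\<in>?S. p v * min lam (d v (c v))) + (\<Sum>v\<in>?D. p v * min lam (d v (c v)))"
    unfolding SD(1)[symmetric] by (rule sum.union_disjoint) (use SD in auto)
  also have "\<dots> \<le> (\<Sum>v\<in>?S. p v * d v (c v)) + (\<Sum>v\<in>?D. p v * lam)"
    by (intro add_mono sum_mono mult_left_mono) (use S pn in auto)
  also have "\<dots> \<le> 4 * ell xo k + lam * (\<Sum>v\<in>?D. p v)"
    using Sd by (simp add: sum_distrib_left mult.commute)
  finally show "(\<Sum>v<n. p v * min lam (d v (c v))) \<le> 4 * ell xo k + lam * (\<Sum>v\<in>?D. p v)" .
  define good where "good u \<longleftrightarrow> u \<noteq> r \<and> u \<in> c ` {..<n} \<and>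
      (\<Sum>v\<in>{v. v < n \<and> c v = u}. p v) \<le> 2 * (\<Sum>v\<in>{v\<in>?S. c v = u}. p v)" for u
  define H where "H = {X\<in>Pow {..<n}. 0 < y X \<and> (\<exists>u\<in>X. good u)}"
  have "(\<Sum>X\<in>H. y X) \<le> 5 * (ell xo k + 2 * (\<Sum>v\<in>?S. p v * d v (c v)))"
  proof (rule ell_ge_moats[where I = "{X\<in>Pow {..<n}. 0 < y X}" and X = "\<lambda>X. X"])
    fix a b assume ab: "a < n" "b < n"
    have "(\<Sum>X\<in>{X \<in> Pow {..<n}. 0 < y X}. of_bool ((a \<in> X) \<noteq> (b \<in> X)) * y X) \<le> (\<Sum>X\<in>Pow {..<n}. of_bool ((a \<in> X) \<noteq> (b \<in> X)) * y X)"
      by (rule sum_mono2) (use y(1) in auto)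
    then show "(\<Sum>X\<in>{X \<in> Pow {..<n}. 0 < y X}. of_bool ((a \<in> X) \<noteq> (b \<in> X)) * y X) \<le> d a b" using y(3)[OF ab] by linarith
  next
    fix X assume "X \<in> H"
    then obtain u where u: "X \<in> Pow {..<n}" "0 < y X" "u \<in> X" "good u" unfolding H_def by blast
    obtain w where w: "w < n" "u = c w" using u(4) by (auto simp: good_def)
    have "1 / 2 \<le> (\<Sum>v\<in>{v. v < n \<and> c v = u}. p v)" using cell[OF w(1)] u(4) w(2) by (auto simp: good_def)
    then have "1 / 4 \<le> (\<Sum>v\<in>{v\<in>?S. c v = u}. p v)" using u(4) by (auto simp: good_def)
    also have "\<dots> \<le> (\<Sum>v\<in>{v\<in>?S. c v \<in> X}. p v)" by (rule sum_mono2) (use u(3) S pn in auto)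
    finally show "X \<in> {X \<in> Pow {..<n}. 0 < y X} \<and> 1 / 4 \<le> (\<Sum>v\<in>{v\<in>?S. c v \<in> X}. p v)" using u by blast
  qed (use y(2) xo c in auto)
  then have h: "(\<Sum>X\<in>H. y X) \<le> 45 * ell xo k" using Sd by simp
  define U where "U = {u. u < n \<and> \<not> good u}"
  have "(\<Sum>X\<in>Pow {..<n} - H. y X) \<le> (\<Sum>X\<in>Pow {..<n}. of_bool (X \<subseteq> U) * y X)"
  proof -
    have "(\<Sum>X\<in>Pow {..<n} - H. y X) \<le> (\<Sum>X\<in>Pow {..<n} - H. of_bool (X \<subseteq> U) * y X)"
    proof (rule sum_mono)
      fix X assume X: "X \<in> Pow {..<n} - H"
      show "y X \<le> of_bool (X \<subseteq> U) * y X"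
      proof (cases "0 < y X")
        case True
        then have "X \<subseteq> U" using X unfolding H_def U_def by auto
        then show ?thesis by simp
      next
        case False
        then have "y X = 0" using y(1)[of X] by linarith
        then show ?thesis by simp
      qed
    qed
    also have "\<dots> \<le> (\<Sum>X\<in>Pow {..<n}. of_bool (X \<subseteq> U) * y X)" by (rule sum_mono2) (use y(1) in auto)
    finally show ?thesis .
  qed
  also have "\<dots> \<le> (\<Sum>u\<in>U. z u)" by (rule y(4)) (auto simp: U_def)
  also have "\<dots> \<le> (\<Sum>u\<in>U. 2 * (lam * (\<Sum>v\<in>{v\<in>?D. c v = u}. p v)))"
  proof (rule sum_mono)
    fix u assume u: "u \<in> U"
    let ?c = "{v. v < n \<and> c v = u}"
    have rhs: "0 \<le> 2 * (lam * (\<Sum>v\<in>{v\<in>?D. c v = u}. p v))"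
      using lam S pn by (intro mult_nonneg_nonneg sum_nonneg) auto
    show "z u \<le> 2 * (lam * (\<Sum>v\<in>{v\<in>?D. c v = u}. p v))"
    proof (cases "u = r \<or> u \<notin> c ` {..<n}")
      case True
      then have "z u = 0" unfolding z by (auto intro!: sum.neutral)
      then show ?thesis using rhs by simp
    next
      case False
      have "z u \<le> (\<Sum>v\<in>?c. p v * lam)" unfolding z using False pn lam u
        by (auto simp: U_def intro!: sum_mono mult_left_mono nonneg)
      also have "\<dots> = lam * (\<Sum>v\<in>?c. p v)" by (simp add: sum_distrib_left mult.commute)
      also have "\<dots> \<le> lam * (2 * (\<Sum>v\<in>{v\<in>?D. c v = u}. p v))"
      proof (rule mult_left_mono)
        have "v \<in> ?S \<union> ?D" if "v < n" "c v = u" for v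
          unfolding SD(1) using that False c(2) by auto
        then have "?c = {v\<in>?S. c v = u} \<union> {v\<in>?D. c v = u}" using S by blast
        then have "(\<Sum>v\<in>?c. p v) = (\<Sum>v\<in>{v\<in>?S. c v = u}. p v) + (\<Sum>v\<in>{v\<in>?D. c v = u}. p v)"
          using SD(2) by (simp only:) (rule sum.union_disjoint, auto)
        moreover have "\<not> (\<Sum>v\<in>?c. p v) \<le> 2 * (\<Sum>v\<in>{v\<in>?S. c v = u}. p v)"
          using u False by (auto simp: U_def good_def)
        ultimately show "(\<Sum>v\<in>?c. p v) \<le> 2 * (\<Sum>v\<in>{v\<in>?D. c v = u}. p v)" by linarith
      qed (rule lam)
      finally show ?thesis by simp
    qed
  qed
  also have "\<dots> = 2 * (lam * (\<Sum>u\<in>U. \<Sum>v\<in>{v\<in>?D. c v = u}. p v))" by (simp add: sum_distrib_left)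
  also have "\<dots> \<le> 2 * (lam * (\<Sum>v\<in>?D. p v))"
  proof (intro mult_left_mono)
    have "(\<Sum>u\<in>U. \<Sum>v\<in>{v\<in>?D. c v = u}. p v) \<le> (\<Sum>u\<in>{..<n}. \<Sum>v\<in>{v\<in>?D. c v = u}. p v)"
      by (rule sum_mono2) (use S pn in \<open>auto simp: U_def intro!: sum_nonneg\<close>)
    also have "\<dots> = (\<Sum>v\<in>?D. p v)" by (rule sum.group) (use S c(1) in auto)
    finally show "(\<Sum>u\<in>U. \<Sum>v\<in>{v\<in>?D. c v = u}. p v) \<le> (\<Sum>v\<in>?D. p v)" .
  qed (use lam in auto)
  finally have nh: "(\<Sum>X\<in>Pow {..<n} - H. y X) \<le> 2 * (lam * (\<Sum>v\<in>?D. p v))" .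
  have "(\<Sum>X\<in>Pow {..<n}. y X) = (\<Sum>X\<in>Pow {..<n} - H. y X) + (\<Sum>X\<in>H. y X)"
    by (rule sum.subset_diff) (auto simp: H_def)
  then show "(\<Sum>X\<in>Pow {..<n}. y X) \<le> 45 * ell xo k + 2 * (lam * (\<Sum>v\<in>?D. p v))" using h nh by linarith
qed

text \<open>The length of stage \<open>j\<close> is bounded by \<open>B\<close> at its own scale,
  and the mass waiting for it by \<open>B\<close> over the scale before; the product is a term of
  \<open>sum_B_squares\<close>. Stage 0 has no scale before it and must have length 0, which is what
  the assumptions \<open>first\<close> are for.\<close>

theorem approximation:
  fixes y :: "nat \<Rightarrow> nat set \<Rightarrow> real" and c :: "nat \<Rightarrow> nat" and R :: "nat \<Rightarrow> real" and z :: "nat \<Rightarrow> nat \<Rightarrow> real"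
    and Tr :: "nat \<Rightarrow> nat list"
  assumes c: "\<And>v. v < n \<Longrightarrow> c v < n" "c r = r"
    and R: "\<And>v. v < n \<Longrightarrow> 0 \<le> R v" "\<And>v. v < n \<Longrightarrow> R v \<le> d r v"
      "\<And>v. v < n \<Longrightarrow> v \<noteq> r \<Longrightarrow> (\<Sum>u\<in>{u. u < n \<and> u \<noteq> v \<and> d u v < R v}. p u) \<le> 1 / 2"
    and cR: "\<And>v. v < n \<Longrightarrow> d v (c v) \<le> 2 * R v"
    and cell: "\<And>v. v < n \<Longrightarrow> c v \<noteq> r \<Longrightarrow> 1 / 2 \<le> (\<Sum>u\<in>{u. u < n \<and> c u = c v}. p u)"
    and Tr: "\<And>j. j \<le> J \<Longrightarrow> set (Tr j) \<subseteq> {..<n} \<and> (\<exists>ws. Tr j = r # ws)"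
    and y: "\<And>j X. 0 \<le> y j X" "\<And>j X. j \<le> J \<Longrightarrow> 0 < y j X \<Longrightarrow> r \<notin> X"
      "\<And>j a b. j \<le> J \<Longrightarrow> a < n \<Longrightarrow> b < n \<Longrightarrow> (\<Sum>X\<in>Pow {..<n}. of_bool ((a \<in> X) \<noteq> (b \<in> X)) * y j X) \<le> d a b"
      "\<And>j U. j \<le> J \<Longrightarrow> U \<subseteq> {..<n} \<Longrightarrow> (\<Sum>X\<in>Pow {..<n}. of_bool (X \<subseteq> U) * y j X) \<le> (\<Sum>u\<in>U. z j u)"
    and z: "\<And>j u. z j u = (if u = r then 0 else \<Sum>v\<in>{v. v < n \<and> c v = u}. p v * max 0 (16 ^ j - d v u))"
    and tour: "\<And>j. j \<le> J \<Longrightarrow> plen d (Tr j @ [r]) \<le> 8 * (\<Sum>X\<in>Pow {..<n}. y j X)"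
    and unserved: "\<And>j. j \<le> J \<Longrightarrow> (\<Sum>u\<in>{..<n} - set (Tr j). z j u) \<le> 2 * (\<Sum>X\<in>Pow {..<n}. y j X)"
    and served: "\<And>v. v < n \<Longrightarrow> c v \<in> set (Tr J) \<and> d v (c v) \<le> 16 ^ J"
    and first: "plen d (Tr 0 @ [r]) \<le> 0" "\<And>v. v < n \<Longrightarrow> d v (c v) \<le> 1 \<Longrightarrow> d v (c v) = 0"
    and xs: "r # xs = foldl rd [r] (concat (map (\<lambda>j. stage [0..<n] (\<lambda>v a. c v = a \<and> d v a \<le> 16 ^ j) (Tr j)) [0..<Suc J]) @ [0..<n])"
    and xo: "set xo = {..<n} - {r}" "distinct xo"
  shows "set xs = {..<n} - {r}" "distinct xs" "elat n r d p xs \<le> 30000000 * elat n r d p xo"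
proof -
  define W where "W j = {v. v < n \<and> c v \<in> set (Tr j) \<and> d v (c v) \<le> 16 ^ j}" for j :: nat
  define Ls where "Ls j = plen d (Tr j @ [r]) + 2 * (\<Sum>u\<in>W j. p u * d u (c u))" for j
  have WJ: "W J = {..<n}" using served by (auto simp: W_def)
  note ES = elat_stages[where lam = "\<lambda>j. 16 ^ j" and W = W, OF Tr c W_def WJ HOL.refl xs, folded Ls_def]
  show "set xs = {..<n} - {r}" "distinct xs" using ES(1,2) by auto
  have pn: "v < n \<Longrightarrow> 0 \<le> p v" for v using prob by blast
  have dn: "v < n \<Longrightarrow> 0 \<le> d v (c v)" for v using nonneg c(1) by blast
  let ?m = "length xo"
  define q where "q i = p (xo ! (i - 1))" for i
  have xon: "set xo \<subseteq> {..<n}" using xo by auto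
  interpret st: staircase ?m "ell xo" q
  proof
    show "ell xo 0 = 0" by (rule ell_0)
    show "i \<le> j \<Longrightarrow> j \<le> ?m \<Longrightarrow> ell xo i \<le> ell xo j" for i j using ell_mono[OF xon] by blast
    show "0 \<le> q i" if i: "1 \<le> i" "i \<le> ?m" for i
    proof -
      have "xo ! (i - 1) \<in> set xo" using i by (intro nth_mem) linarith
      then show ?thesis using pn xon by (auto simp: q_def)
    qed
  qed
  have OPT: "(\<Sum>k\<in>{1..?m}. q k * ell xo k) \<le> elat n r d p xo"
  proof -
    have "(\<Sum>k\<in>{1..?m}. q k * ell xo k) = (\<Sum>i<?m. p (xo ! i) * ell xo (Suc i))"
      unfolding q_def by (rule sum.reindex_bij_witness[of _ Suc "\<lambda>k. k - 1"]) auto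
    then show ?thesis using elat_ge_ell[OF xon] by simp
  qed
  have rest: "(\<Sum>i\<in>{k<..?m}. q i) = (\<Sum>v\<in>set (drop k xo). p v)" if "k \<le> ?m" for k
  proof -
    have "(\<Sum>v\<in>set (drop k xo). p v) = (\<Sum>v\<leftarrow>drop k xo. p v)" using xo(2) by (simp add: sum_list_distinct_conv_sum_set)
    also have "\<dots> = (\<Sum>i<?m - k. p (xo ! (k + i)))" using that by (simp add: sum_list_sum_nth atLeast0LessThan)
    also have "\<dots> = (\<Sum>i\<in>{k<..?m}. q i)"
      unfolding q_def by (rule sum.reindex_bij_witness[of _ "\<lambda>i. i - 1 - k" "\<lambda>i. Suc (k + i)"]) auto
    finally show ?thesis by simp
  qed
  define K where "K j = (\<Sum>v<n. p v * min (16 ^ j) (d v (c v)))" for j :: nat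
  define Y where "Y j = (\<Sum>X\<in>Pow {..<n}. y j X)" for j
  have Ynn: "0 \<le> Y j" for j unfolding Y_def by (intro sum_nonneg y(1))
  have Knn: "0 \<le> K j" for j unfolding K_def using pn dn by (intro sum_nonneg mult_nonneg_nonneg) auto
  \<comment> \<open>\<open>B_crossing\<close> yields one prefix at which both terms of
    \<open>dual_lower_bound\<close> are at most \<open>B\<close>. This gives
    \<open>8 * 47 + 2 * 5 = 386\<close>, well below 736.\<close>
  have G: "8 * Y j + 2 * K j \<le> 736 * st.B (16 ^ j)" if j: "j \<le> J" for j
  proof -
    obtain k where k: "k \<le> ?m" "ell xo k \<le> st.B (16 ^ j)" "16 ^ j * (\<Sum>i\<in>{k<..?m}. q i) \<le> st.B (16 ^ j)"
      using st.B_crossing[of "16 ^ j"] by auto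
    have "Y j \<le> 45 * ell xo k + 2 * (16 ^ j * (\<Sum>v\<in>set (drop k xo). p v))"
      "K j \<le> 4 * ell xo k + 16 ^ j * (\<Sum>v\<in>set (drop k xo). p v)"
      unfolding Y_def K_def
      by (rule dual_lower_bound[where z = "z j", OF c R cR cell _ y(1) y(2)[OF j] y(3)[OF j] y(4)[OF j] z xo k(1)]; simp)+
    then show ?thesis using k(2) k(3)[unfolded rest[OF k(1)]] st.B_nonneg[of "16 ^ j"] by linarith
  qed
  have Wd: "(\<Sum>u\<in>W j. p u * d u (c u)) \<le> K j" for j
  proof -
    have "(\<Sum>u\<in>W j. p u * d u (c u)) = (\<Sum>u\<in>W j. p u * min (16 ^ j) (d u (c u)))"
      by (rule sum.cong) (auto simp: W_def)
    also have "\<dots> \<le> K j" unfolding K_def by (rule sum_mono2) (use pn dn in \<open>auto simp: W_def\<close>)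
    finally show ?thesis .
  qed
  have LB: "Ls j \<le> 736 * st.B (16 ^ j)" if j: "j \<le> J" for j
    using tour[OF j] Wd[of j] G[OF j] unfolding Ls_def Y_def by linarith
  \<comment> \<open>A vertex outside \<open>W j\<close> is farther than \<open>16 ^ j\<close> from
    its centre, which \<open>K\<close> pays for, or its centre is missed; then its distance cut off
    at \<open>16 ^ j\<close> and its share of the lost prize add up to
    \<open>16 ^ j\<close>.\<close>
  have UB: "16 ^ j * (\<Sum>v\<in>{v. v < n \<and> v \<notin> W j}. p v) \<le> 736 * st.B (16 ^ j)" if j: "j \<le> J" for j
  proof -
    have rT: "r \<in> set (Tr j)" using Tr[OF j] by auto
    have "16 ^ j * (\<Sum>v\<in>{v. v < n \<and> v \<notin> W j}. p v) = (\<Sum>v<n. if v \<notin> W j then p v * 16 ^ j else 0)"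
      by (simp add: sum.If_cases sum_distrib_left mult.commute Int_def)
    also have "\<dots> \<le> (\<Sum>v<n. p v * min (16 ^ j) (d v (c v)) + (if c v \<notin> set (Tr j) then p v * max 0 (16 ^ j - d v (c v)) else 0))"
    proof (rule sum_mono)
      fix v assume "v \<in> {..<n}"
      then have v: "v < n" "0 \<le> p v" "0 \<le> d v (c v)" using pn dn by auto
      have e: "p v * min (16 ^ j) (d v (c v)) + p v * max 0 (16 ^ j - d v (c v)) = p v * 16 ^ j"
        unfolding distrib_left[symmetric] by (auto simp: min_def max_def)
      show "(if v \<notin> W j then p v * 16 ^ j else 0) \<le> p v * min (16 ^ j) (d v (c v)) + (if c v \<notin> set (Tr j) then p v * max 0 (16 ^ j - d v (c v)) else 0)"
      proof (cases "v \<in> W j")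
        case True
        then show ?thesis using v by (auto simp: W_def)
      next
        case False
        show ?thesis
        proof (cases "c v \<in> set (Tr j)")
          case True
          then have "16 ^ j < d v (c v)" using False v by (auto simp: W_def)
          then show ?thesis using False True by simp
        next
          case c: False
          then show ?thesis using False e by simp
        qed
      qed
    qed
    also have "\<dots> = K j + (\<Sum>v\<in>{v. v < n \<and> c v \<notin> set (Tr j)}. p v * max 0 (16 ^ j - d v (c v)))"
      by (simp add: K_def sum.distrib sum.If_cases Int_def)
    also have "(\<Sum>v\<in>{v. v < n \<and> c v \<notin> set (Tr j)}. p v * max 0 (16 ^ j - d v (c v))) = (\<Sum>u\<in>{..<n} - set (Tr j). z j u)"
    proof -
      have "(\<Sum>v\<in>{v. v < n \<and> c v \<notin> set (Tr j)}. p v * max 0 (16 ^ j - d v (c v))) =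
          (\<Sum>u\<in>{..<n} - set (Tr j). \<Sum>v\<in>{v\<in>{v. v < n \<and> c v \<notin> set (Tr j)}. c v = u}. p v * max 0 (16 ^ j - d v (c v)))"
        by (rule sum.group[symmetric]) (use c(1) in auto)
      also have "\<dots> = (\<Sum>u\<in>{..<n} - set (Tr j). z j u)"
      proof (rule sum.cong)
        fix u assume u: "u \<in> {..<n} - set (Tr j)"
        have "{v\<in>{v. v < n \<and> c v \<notin> set (Tr j)}. c v = u} = {v. v < n \<and> c v = u}" using u by auto
        moreover have "u \<noteq> r" using u rT by auto
        ultimately show "(\<Sum>v\<in>{v\<in>{v. v < n \<and> c v \<notin> set (Tr j)}. c v = u}. p v * max 0 (16 ^ j - d v (c v))) = z j u"
          by (simp add: z)
      qed simp
      finally show ?thesis .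
    qed
    also have "\<dots> \<le> 2 * Y j" using unserved[OF j] by (simp add: Y_def)
    finally show ?thesis using G[OF j] Knn[of j] Ynn[of j] by linarith
  qed
  have L0: "Ls 0 = 0"
  proof -
    have "p u * d u (c u) = 0" if "u \<in> W 0" for u using first(2)[of u] that by (auto simp: W_def)
    then have "(\<Sum>u\<in>W 0. p u * d u (c u)) = 0" by (intro sum.neutral) auto
    moreover have "0 \<le> plen d (Tr 0 @ [r])" using Tr[of 0] r by (intro plen_nonneg) auto
    ultimately show ?thesis using first(1) by (simp add: Ls_def)
  qed
  \<comment> \<open>The constants are \<open>11776 = 16 * 736\<close>, where 16 comes from
    \<open>B_scale\<close>, and \<open>8667136 = 11776 * 736\<close>.\<close>
  have stage_bound: "Ls j * (\<Sum>v\<in>{v. v < n \<and> (j = 0 \<or> v \<notin> W (j - 1))}. p v) \<le> (if j = 0 then 0 else 8667136 * ((st.B (16 ^ (j - 1)))\<^sup>2 / 16 ^ (j - 1)))"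
    if j: "j \<le> J" for j
  proof (cases j)
    case 0
    then show ?thesis using L0 by simp
  next
    case (Suc i)
    let ?B = "st.B (16 ^ i)" and ?u = "\<Sum>v\<in>{v. v < n \<and> v \<notin> W i}. p v"
    have "st.B (16 ^ j) \<le> 16 * ?B" using st.B_scale[of "16 ^ i" 16] by (simp add: Suc)
    then have 1: "Ls j \<le> 11776 * ?B" using LB[OF j] by linarith
    have "16 ^ i * ?u \<le> 736 * ?B" using UB[of i] j Suc by simp
    then have 2: "?u \<le> 736 * ?B / 16 ^ i" by (simp add: field_simps)
    have "Ls j * ?u \<le> 11776 * ?B * (736 * ?B / 16 ^ i)"
      by (rule mult_mono[OF 1 2]) (use st.B_nonneg[of "16 ^ i"] pn in \<open>auto intro!: sum_nonneg\<close>)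
    then show ?thesis using Suc by (simp add: power2_eq_square)
  qed
  have "(\<Sum>j\<le>J. Ls j * (\<Sum>v\<in>{v. v < n \<and> (j = 0 \<or> v \<notin> W (j - 1))}. p v)) \<le>
      (\<Sum>j\<le>J. if j = 0 then 0 else 8667136 * ((st.B (16 ^ (j - 1)))\<^sup>2 / 16 ^ (j - 1)))"
    by (rule sum_mono) (use stage_bound in auto)
  also have "\<dots> = (\<Sum>j<J. 8667136 * ((st.B (16 ^ j))\<^sup>2 / 16 ^ j))"
    by (induction J) auto
  also have "\<dots> \<le> 8667136 * (\<Sum>j\<le>J. (st.B (16 ^ j))\<^sup>2 / 16 ^ j)"
    unfolding sum_distrib_left by (rule sum_mono2) auto
  also have "\<dots> \<le> 8667136 * (3 * elat n r d p xo)" using st.sum_B_squares[of J] OPT by linarith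
  finally have main: "(\<Sum>j\<le>J. Ls j * (\<Sum>v\<in>{v. v < n \<and> (j = 0 \<or> v \<notin> W (j - 1))}. p v)) \<le> 8667136 * (3 * elat n r d p xo)" .
  \<comment> \<open>The displacement of the served vertex is at most twice its radius, hence at most
    twice its distance from the root, which every tour pays. The total factor is
    \<open>3 * 8667136 + 4\<close>, below 30000000.\<close>
  have "(\<Sum>v<n. p v * d v (c v)) \<le> (\<Sum>v<n. 2 * (p v * d r v))"
  proof (rule sum_mono)
    fix v assume "v \<in> {..<n}"
    then have v: "v < n" by simp
    have "d v (c v) \<le> 2 * d r v" using cR[OF v] R(2)[OF v] by linarith
    from mult_left_mono[OF this pn[OF v]] show "p v * d v (c v) \<le> 2 * (p v * d r v)" by simp
  qed
  also have "\<dots> = 2 * (\<Sum>v\<in>{..<n} - {r}. p v * d r v)"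
    using r refl[OF r] by (simp add: sum_distrib_left sum.remove[of _ r])
  also have "(\<Sum>v\<in>{..<n} - {r}. p v * d r v) = (\<Sum>i<?m. p (xo ! i) * d r (xo ! i))"
    using xo by (simp add: sum_list_distinct_conv_sum_set[symmetric, of xo] sum_list_sum_nth atLeast0LessThan flip: xo(1))
  also have "\<dots> \<le> elat n r d p xo" by (rule elat_ge_dist[OF xon])
  finally have det: "(\<Sum>v<n. p v * d v (c v)) \<le> 2 * elat n r d p xo" by simp
  have "0 \<le> (\<Sum>v<n. p v * d v (c v))" using pn dn by (intro sum_nonneg mult_nonneg_nonneg) auto
  then have "0 \<le> elat n r d p xo" using det by linarith
  then show "elat n r d p xs \<le> 30000000 * elat n r d p xo" using ES(3) main det by linarith
qed

end

declare One_nat_def [simp del]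

section \<open>The algorithm and its running time\<close>

lemma PT_dm: "PT ds \<Longrightarrow> PT u \<Longrightarrow> PT v \<Longrightarrow> PT (\<lambda>x. dm (ds x) (u x) (v x))"
  unfolding dm_def by (intro PT_nthd)

lemma PT_g_act: "PT s \<Longrightarrow> PT v \<Longrightarrow> PT (\<lambda>x. g_act (s x) (v x))"
  unfolding g_act_def by (intro PT_less PT_const PT_nthd PT_fst PT_snd)

lemma PT_g_pairs: "PT f \<Longrightarrow> PT (\<lambda>x. g_pairs (f x))"
proof (rule PT_comp[of g_pairs])
  have 1: "PT (\<lambda>z. map (\<lambda>v. (snd z :: nat, v :: nat)) (fst z))" by (intro PT_map PT_Pair PT_fst PT_snd PT_id)
  show "PT g_pairs" unfolding g_pairs_def by (intro PT_concat PT_map PT_id 1)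
qed

lemma PT_g_cross: assumes "PT g" "PT s" shows "PT (\<lambda>x. g_cross (g x) (s x))"
  unfolding g_cross_def
  by (intro PT_filter PT_conj PT_not PT_eq PT_g_act PT_g_pairs PT_nthd PT_fst PT_snd PT_id PT_comp[OF assms(1)] PT_comp[OF assms(2)] assms)

lemma PT_g_eps: assumes "PT g" "PT s" shows "PT (\<lambda>x. g_eps (g x) (s x))"
proof -
  have P: "PT (\<lambda>z. (dm (fst (snd (snd (g (fst z))))) (fst (snd z)) (snd (snd z)) - (Dv (s (fst z)) (fst (snd z)) + Dv (s (fst z)) (snd (snd z)))) div 2)"
    by (intro PT_div2 PT_sub PT_add PT_dm PT_nthd PT_fst PT_snd PT_id PT_comp[OF assms(1)] PT_comp[OF assms(2)])
  have Q: "PT (\<lambda>z. ph (s (fst z)) (snd z))" by (intro PT_nthd PT_fst PT_snd PT_id PT_comp[OF assms(2)])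
  show ?thesis unfolding g_eps_def
    by (intro PT_argmin PT_append PT_map P Q PT_g_cross PT_filter PT_less PT_const PT_fst PT_snd PT_id assms)
qed

lemma PT_g_grow: assumes "PT g" "PT s" shows "PT (\<lambda>x. g_grow (g x) (s x))"
proof -
  have c: "PT (\<lambda>z. g (fst z))" "PT (\<lambda>z. s (fst z))" by (rule PT_comp[OF _ PT_fst[OF PT_id]], rule assms)+
  have P: "PT (\<lambda>z. min (snd (snd (snd (g (fst z))))) (Dv (s (fst z)) (snd z) + (if g_act (s (fst z)) (snd z) then g_eps (g (fst z)) (s (fst z)) else 0)))"
    by (intro PT_min PT_add PT_if PT_g_act PT_g_eps PT_nthd PT_fst PT_snd PT_id PT_const c)
  have Q: "PT (\<lambda>z. ph (s (fst z)) (snd z) - g_eps (g (fst z)) (s (fst z)))"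
    by (intro PT_sub PT_g_eps PT_nthd PT_fst PT_snd PT_id c)
  show ?thesis unfolding g_grow_def by (intro PT_Pair PT_map P Q PT_fst PT_snd assms)
qed

lemma PT_g_tight: assumes "PT g" "PT s" "PT t" shows "PT (\<lambda>x. g_tight (g x) (s x) (t x))"
proof -
  have c: "PT (\<lambda>z. g (fst z))" "PT (\<lambda>z. t (fst z))" by (rule PT_comp[OF _ PT_fst[OF PT_id]], rule assms)+
  have P: "PT (\<lambda>z. g_act (t (fst z)) (fst (snd z)) \<and>
      dm (fst (snd (snd (g (fst z))))) (fst (snd z)) (snd (snd z)) \<le> 2 * (Dv (t (fst z)) (fst (snd z)) + Dv (t (fst z)) (snd (snd z))))"
    by (intro PT_conj PT_le PT_mult PT_add PT_dm PT_g_act PT_nthd PT_fst PT_snd PT_id PT_const c)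
  show ?thesis unfolding g_tight_def by (intro PT_filter P PT_g_cross assms)
qed

lemma PT_g_merge: assumes "PT g" "PT t" "PT q" shows "PT (\<lambda>x. g_merge (g x) (t x) (q x))"
proof -
  have c: "PT (\<lambda>z. g (fst z))" "PT (\<lambda>z. t (fst z))" "PT (\<lambda>z. q (fst z))" by (rule PT_comp[OF _ PT_fst[OF PT_id]], rule assms)+
  have P: "PT (\<lambda>z. if lb (t (fst z)) (snd z) = lb (t (fst z)) (snd (q (fst z))) then lb (t (fst z)) (fst (q (fst z))) else lb (t (fst z)) (snd z))"
    by (intro PT_if PT_eq PT_nthd PT_fst PT_snd PT_id c)
  have Q: "PT (\<lambda>z. if snd z = lb (t (fst z)) (fst (q (fst z)))
       then (if lb (t (fst z)) (snd (q (fst z))) = lb (t (fst z)) (fst (snd (g (fst z)))) then 0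
         else min (snd (snd (snd (g (fst z))))) (ph (t (fst z)) (lb (t (fst z)) (fst (q (fst z)))) + ph (t (fst z)) (lb (t (fst z)) (snd (q (fst z))))))
       else if snd z = lb (t (fst z)) (snd (q (fst z))) then 0 else ph (t (fst z)) (snd z))"
    by (intro PT_if PT_eq PT_min PT_add PT_nthd PT_fst PT_snd PT_id PT_const c)
  show ?thesis unfolding g_merge_def by (intro PT_Pair PT_map P Q PT_fst PT_snd assms)
qed

lemma PT_g_step: assumes "PT g" "PT s" shows "PT (\<lambda>x. g_step (g x) (s x))"
proof -
  have n: "PT (\<lambda>z. g_next (fst z) (fst (snd z)) (snd (snd z)))"
    unfolding g_next_def by (intro PT_if PT_null PT_g_merge PT_hdd PT_fst PT_snd PT_id)
  have "PT (\<lambda>x. (g x, g_grow (g x) (s x), g_tight (g x) (s x) (g_grow (g x) (s x))))"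
    by (intro PT_Pair PT_g_grow PT_g_tight assms)
  from PT_comp[OF n this] show ?thesis by (simp add: g_step_def)
qed

lemma PT_g_event: assumes "PT g" "PT s" shows "PT (\<lambda>x. g_event (g x) (s x))"
proof -
  have n: "PT (\<lambda>z. g_ev (fst z) (snd z))"
    unfolding g_ev_def by (intro PT_if PT_null PT_Cons PT_Pair PT_g_act PT_hdd PT_fst PT_snd PT_id PT_const)
  have "PT (\<lambda>x. (g_grow (g x) (s x), g_tight (g x) (s x) (g_grow (g x) (s x))))"
    by (intro PT_Pair PT_g_grow PT_g_tight assms)
  from PT_comp[OF n this] show ?thesis by (simp add: g_event_def)
qed

definition g_okl :: "nat list \<Rightarrow> nat list \<Rightarrow> bool" where
  "g_okl vs lab \<longleftrightarrow> length lab \<le> length vs \<and> set lab \<subseteq> insert 0 (set vs)"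

definition g_oks :: "genv \<Rightarrow> nat \<Rightarrow> gstate \<Rightarrow> bool" where
  "g_oks g m s \<longleftrightarrow> g_okl (fst g) (fst s) \<and>
     length (fst (snd s)) \<le> length (fst g) \<and> (\<forall>a\<in>set (fst (snd s)). a \<le> m) \<and>
     length (snd (snd s)) \<le> length (fst g) \<and> (\<forall>a\<in>set (snd (snd s)). a \<le> m)"

definition g_oke :: "nat list \<Rightarrow> gevent \<Rightarrow> bool" where
  "g_oke vs ev \<longleftrightarrow> g_okl vs (fst ev) \<and> fst (fst (snd ev)) \<in> insert 0 (set vs) \<and> snd (fst (snd ev)) \<in> insert 0 (set vs)"

lemma nthd_in: "nthd 0 xs i \<in> insert 0 (set xs)" by (auto simp: nthd_def)

lemma nthd_le: "(\<forall>a\<in>set xs. a \<le> m) \<Longrightarrow> nthd 0 xs i \<le> (m::nat)" by (auto simp: nthd_def)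

lemma g_oks_grow: assumes "g_oks g m s" "snd (snd (snd g)) \<le> m" shows "g_oks g m (g_grow g s)"
proof -
  have "ph s l - e \<le> m" for l e using nthd_le[of "snd (snd s)" m l] assms unfolding g_oks_def by (meson diff_le_self order_trans)
  then show ?thesis using assms by (auto simp: g_oks_def g_grow_def)
qed

lemma g_tight_hdd: "fst (hdd (0, 0) (g_tight g s t)) \<in> insert 0 (set (fst g))" "snd (hdd (0, 0) (g_tight g s t)) \<in> insert 0 (set (fst g))"
proof -
  have "set (g_tight g s t) \<subseteq> set (fst g) \<times> set (fst g)" by (auto simp: g_tight_def g_cross_def set_g_pairs)
  then show "fst (hdd (0, 0) (g_tight g s t)) \<in> insert 0 (set (fst g))" "snd (hdd (0, 0) (g_tight g s t)) \<in> insert 0 (set (fst g))"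
    by (auto simp: hdd_def split: list.split)
qed

lemma g_oks_merge: assumes "g_oks g m t" "snd (snd (snd g)) \<le> m" shows "g_oks g m (g_merge g t q)"
proof -
  have 1: "ph t l \<le> m" for l using nthd_le[of "snd (snd t)" m l] assms unfolding g_oks_def by blast
  have 2: "lb t v \<in> insert 0 (set (fst g))" for v using nthd_in[of "fst t" v] assms unfolding g_oks_def g_okl_def by blast
  have "g_okl (fst g) (map (\<lambda>v. if lb t v = lb t (snd q) then lb t (fst q) else lb t v) (fst g))"
    using 2 by (auto simp: g_okl_def)
  then show ?thesis using assms 1 by (auto simp: g_oks_def g_merge_def le_diff_conv min_le_iff_disj)
qed

lemma g_oks_step:
  assumes "g_oks g m s" "snd (snd (snd g)) \<le> m"
  shows "g_oks g m (g_step g s)" "\<forall>ev\<in>set (g_event g s). g_oke (fst g) ev" "length (g_event g s) \<le> 1"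
proof -
  have gr: "g_oks g m (g_grow g s)" by (rule g_oks_grow[OF assms])
  show "g_oks g m (g_step g s)" unfolding g_step_def g_next_def using gr g_oks_merge[OF gr assms(2)] by auto
  show "length (g_event g s) \<le> 1" by (simp add: g_event_def g_ev_def)
  show "\<forall>ev\<in>set (g_event g s). g_oke (fst g) ev"
    using gr g_tight_hdd[of g s "g_grow g s"] by (auto simp: g_event_def g_ev_def g_oke_def g_oks_def)
qed

lemma esize_okl: assumes "g_okl vs lab" shows "esize lab \<le> 1 + esize vs * (1 + (1 + esize vs))"
proof -
  have z: "esize (0::nat) = 1" by (simp add: esize_def enc_nat_def)
  have "esize lab \<le> 1 + length lab * (1 + (1 + esize vs))"
  proof (rule esize_list_le)
    fix x assume "x \<in> set lab"
    then have "x = 0 \<or> x \<in> set vs" using assms by (auto simp: g_okl_def)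
    then show "esize x \<le> 1 + esize vs" using z esize_mem[of x vs] by auto
  qed
  also have "\<dots> \<le> 1 + esize vs * (1 + (1 + esize vs))"
    using assms length_le_esize[of vs] by (intro add_mono mult_le_mono) (auto simp: g_okl_def)
  finally show ?thesis .
qed

lemma esize_nats_le:
  assumes "length (xs::nat list) \<le> length (vs::nat list)" "\<forall>a\<in>set xs. a \<le> m"
  shows "esize xs \<le> 1 + esize vs * (1 + (4 * esize m + 1))"
proof -
  have "esize xs \<le> 1 + length xs * (1 + (4 * esize m + 1))"
    by (rule esize_list_le) (use assms(2) esize_nat_mono in auto)
  also have "\<dots> \<le> 1 + esize vs * (1 + (4 * esize m + 1))"
    using assms(1) length_le_esize[of vs] by (intro add_mono mult_le_mono) auto
  finally show ?thesis .
qed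

lemma esize_fst_snd: "esize (fst z) \<le> esize z" "esize (snd z) \<le> esize z"
  by (cases z; simp)+

lemma esize_0: "esize (0::nat) = 1" by (simp add: esize_def enc_nat_def)

lemma esize_oke: assumes "g_oke vs ev" shows "esize ev \<le> 1 + (1 + esize vs * (1 + (1 + esize vs))) + (1 + (1 + (1 + esize vs) + (1 + esize vs)) + 3)"
proof -
  obtain lab x y b where ev: "ev = (lab, (x, y), b)" by (metis surj_pair)
  have "esize x \<le> 1 + esize vs" "esize y \<le> 1 + esize vs"
    using assms esize_mem[of x vs] esize_mem[of y vs] esize_0 by (auto simp: ev g_oke_def)
  moreover have "esize lab \<le> 1 + esize vs * (1 + (1 + esize vs))" using assms by (intro esize_okl) (auto simp: ev g_oke_def)
  ultimately show ?thesis using esize_bool[of b] unfolding ev esize_simps by linarith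
qed

text \<open>The initial residual prizes are at most the sum of all prizes and later numbers are
  limited by the cap; the sum of both serves as the bound on all entries.\<close>

lemma PT_g_hist: assumes g: "PT g" and ps: "PT ps"
  shows "PT (\<lambda>x. g_hist (g x) (g_init (g x) (ps x)) (fst (g x) @ fst (g x)))"
proof -
  let ?m = "\<lambda>x. snd (snd (snd (g x))) + sum_list (ps x)"
  let ?vs = "\<lambda>x. fst (g x)"
  let ?e = "\<lambda>x. 1 + esize (?vs x) * (1 + (1 + esize (?vs x)))"
  let ?I = "\<lambda>x i z. g_oks (g x) (?m x) (fst z) \<and> length (snd z) \<le> i \<and> (\<forall>ev\<in>set (snd z). g_oke (?vs x) ev)"
  let ?E = "\<lambda>x. 1 + ?e x + (1 + (1 + (1 + esize (?vs x)) + (1 + esize (?vs x))) + 3)"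
  let ?n = "\<lambda>x. 1 + esize (?vs x) * (1 + (4 * esize (?m x) + 1))"
  let ?b = "\<lambda>x. 1 + (1 + ?e x + (1 + ?n x + ?n x)) + (1 + (2 * esize (?vs x)) * (1 + ?E x))"
  have m: "PT ?m" by (intro PT_add PT_snd PT_sum_list g ps)
  have vs: "PT ?vs" by (intro PT_fst g)
  show ?thesis
    unfolding g_hist_def
  proof (rule PT_foldl_inv[where I = ?I and b = ?b])
    show "PT (\<lambda>z. (g_step (g (fst z)) (fst (fst (snd z))), g_event (g (fst z)) (fst (fst (snd z))) @ snd (fst (snd z))))"
      by (intro PT_Pair PT_append PT_g_step PT_g_event PT_fst PT_snd PT_id PT_comp[OF g])
    have "PT (\<lambda>z. nthd 0 (ps (fst z)) (snd z))" by (intro PT_nthd PT_comp[OF ps] PT_fst PT_snd PT_id)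
    then show "PT (\<lambda>x. (g_init (g x) (ps x), []))" unfolding g_init_def by (intro PT_Pair PT_map PT_fst PT_const g)
    show "PT (\<lambda>x. fst (g x) @ fst (g x))" by (intro PT_append PT_fst g)
    show "PB ?b" by (intro PB_intros vs m)
    fix x
    have nn: "nthd 0 (ps x) v \<le> sum_list (ps x)" for v by (auto simp: nthd_def intro!: member_le_sum_list)
    show "?I x 0 (g_init (g x) (ps x), [])" using nn by (auto simp: g_oks_def g_okl_def g_init_def trans_le_add2)
    fix i z
    show "?I x (Suc i) (g_step (g x) (fst z), g_event (g x) (fst z) @ snd z)" if "?I x i z"
      using g_oks_step[of "g x" "?m x" "fst z"] that by auto
    assume i: "i \<le> length (fst (g x) @ fst (g x))" and I: "?I x i z"
    have "esize (fst z) \<le> 1 + ?e x + (1 + ?n x + ?n x)"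
    proof -
      obtain lab D phi where z: "fst z = (lab, D, phi)" by (metis surj_pair)
      have "esize lab \<le> ?e x" by (rule esize_okl) (use I z in \<open>auto simp: g_oks_def\<close>)
      moreover have "esize D \<le> ?n x" by (rule esize_nats_le) (use I z in \<open>auto simp: g_oks_def\<close>)
      moreover have "esize phi \<le> ?n x" by (rule esize_nats_le) (use I z in \<open>auto simp: g_oks_def\<close>)
      ultimately show ?thesis unfolding z esize_simps by linarith
    qed
    moreover have "esize (snd z) \<le> 1 + (2 * esize (?vs x)) * (1 + ?E x)"
    proof -
      have "esize (snd z) \<le> 1 + length (snd z) * (1 + ?E x)" by (rule esize_list_le) (use I esize_oke in blast)
      also have "\<dots> \<le> 1 + (2 * esize (?vs x)) * (1 + ?E x)"
        using I i length_le_esize[of "?vs x"] by (intro add_mono mult_le_mono) auto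
      finally show ?thesis .
    qed
    ultimately show "esize z \<le> ?b x" using esize_simps(4)[of "fst z" "snd z"] by simp
  qed
qed

lemma PT_memb: "PT a \<Longrightarrow> PT zs \<Longrightarrow> PT (\<lambda>x. memb (a x) (zs x))"
  unfolding memb_def by (intro PT_list_ex PT_eq PT_snd PT_id PT_comp[of a fst] PT_fst)

lemma PT_g_touch: assumes "PT lab" "PT tv" "PT v" shows "PT (\<lambda>x. g_touch (lab x) (tv x) (v x))"
proof -
  have c: "PT (\<lambda>z. lab (fst z))" "PT (\<lambda>z. v (fst z))" by (rule PT_comp[OF _ PT_fst[OF PT_id]], rule assms)+
  show ?thesis unfolding g_touch_def by (intro PT_list_ex PT_eq PT_nthd PT_snd PT_id c assms)
qed

lemma PT_map_fst: "PT T \<Longrightarrow> PT (\<lambda>x. map fst (T x))" "PT T \<Longrightarrow> PT (\<lambda>x. map snd (T x))"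
  by (intro PT_map PT_fst PT_snd PT_id; assumption)+

lemma PT_g_sel: assumes "PT r" "PT T" "PT ev" shows "PT (\<lambda>x. g_sel (r x) (T x) (ev x))"
  unfolding g_sel_def g_verts_def
  by (intro PT_if PT_conj PT_disj PT_g_touch PT_Cons PT_append PT_map_fst PT_fst PT_snd assms)

lemma PT_g_edges: assumes g: "PT g" and ps: "PT ps" shows "PT (\<lambda>x. g_edges (g x) (ps x))"
proof -
  define hist where "hist x = snd (g_hist (g x) (g_init (g x) (ps x)) (fst (g x) @ fst (g x)))" for x
  have h: "PT hist" unfolding hist_def by (intro PT_snd PT_g_hist g ps)
  let ?I = "\<lambda>x i T. length T \<le> i \<and> (\<forall>e\<in>set T. \<exists>ev\<in>set (hist x). e = fst (snd ev))"
  have "PT (\<lambda>x. foldl (g_sel (fst (snd (g x)))) [] (hist x))"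
  proof (rule PT_foldl_inv[where I = ?I and b = "\<lambda>x. 1 + esize (hist x) * (1 + esize (hist x))"])
    show "PT (\<lambda>z. g_sel (fst (snd (g (fst z)))) (fst (snd z)) (snd (snd z)))"
      by (intro PT_g_sel PT_fst PT_snd PT_id PT_comp[OF g])
    show "PB (\<lambda>x. 1 + esize (hist x) * (1 + esize (hist x)))" by (intro PB_intros h)
    fix x i T
    show "?I x (Suc i) (g_sel (fst (snd (g x))) T (hist x ! i))" if "i < length (hist x)" "?I x i T"
      using that by (auto simp: g_sel_def)
    assume i: "i \<le> length (hist x)" and I: "?I x i T"
    have "esize T \<le> 1 + length T * (1 + esize (hist x))"
    proof (rule esize_list_le)
      fix e assume "e \<in> set T"
      then obtain ev where ev: "ev \<in> set (hist x)" "e = fst (snd ev)" using I by blast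
      have "esize e \<le> esize ev" unfolding ev(2) using esize_fst_snd(1)[of "snd ev"] esize_fst_snd(2)[of ev] by (rule order_trans)
      then show "esize e \<le> esize (hist x)" using esize_mem[OF ev(1)] by linarith
    qed
    also have "\<dots> \<le> 1 + esize (hist x) * (1 + esize (hist x))"
      using I i length_le_esize[of "hist x"] by (intro add_mono mult_le_mono) auto
    finally show "esize T \<le> 1 + esize (hist x) * (1 + esize (hist x))" .
  qed (auto intro!: PT_const h)
  then show ?thesis by (simp add: g_edges_def hist_def)
qed

text \<open>\<open>ins_after\<close> inserts behind every occurrence, so distinctness is what limits
  the growth to one entry per edge.\<close>

lemma attach_props:
  assumes "distinct zs"
  shows "distinct (g_attach zs e) \<and> length (g_attach zs e) \<le> Suc (length zs) \<and> set (g_attach zs e) \<subseteq> insert (fst e) (insert (snd e) (set zs))"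
proof -
  have *: "distinct (ins_after x y zs) \<and> length (ins_after x y zs) \<le> Suc (length zs) \<and> set (ins_after x y zs) \<subseteq> insert x (insert y (set zs))"
    if xy: "x \<in> set zs" "y \<notin> set zs" for x y
  proof -
    obtain as bs where sp: "zs = as @ x # bs" using split_list[OF xy(1)] by blast
    then have "ins_after x y zs = as @ x # y # bs" using ins_after_split[of x as bs y] assms by auto
    then show ?thesis using sp assms xy by auto
  qed
  show ?thesis using *[of "fst e" "snd e"] *[of "snd e" "fst e"] assms by (auto simp: g_attach_def memb_def)
qed

lemma PT_ins_after: assumes "PT a" "PT b" "PT zs" shows "PT (\<lambda>x. ins_after (a x) (b x) (zs x))"
proof -
  have c: "PT (\<lambda>z. a (fst z))" "PT (\<lambda>z. b (fst z))" by (rule PT_comp[OF _ PT_fst[OF PT_id]], rule assms)+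
  show ?thesis unfolding ins_after_def by (intro PT_concat PT_map PT_if PT_eq PT_Cons PT_snd PT_id PT_const c assms)
qed

lemma PT_g_attach: assumes "PT zs" "PT e" shows "PT (\<lambda>x. g_attach (zs x) (e x))"
  unfolding g_attach_def by (intro PT_if PT_conj PT_not PT_memb PT_ins_after PT_fst PT_snd assms)

lemma PT_g_tour: assumes "PT vs" "PT r" "PT T" shows "PT (\<lambda>x. g_tour (vs x) (r x) (T x))"
proof -
  define es where "es x = concat (map (\<lambda>_. T x) (vs x))" for x
  have cT: "PT (\<lambda>z. T (fst z))" by (rule PT_comp[OF assms(3) PT_fst[OF PT_id]])
  have e: "PT es" unfolding es_def by (intro PT_concat PT_map cT assms)
  let ?I = "\<lambda>x i zs. distinct zs \<and> length zs \<le> 1 + i \<and> set zs \<subseteq> insert (r x) (fst ` set (es x) \<union> snd ` set (es x))"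
  have "PT (\<lambda>x. foldl g_attach [r x] (es x))"
  proof (rule PT_foldl_inv[where I = ?I and b = "\<lambda>x. 1 + (1 + esize (es x)) * (1 + (esize (r x) + esize (es x)))"])
    show "PT (\<lambda>z. g_attach (fst (snd z)) (snd (snd z)))" by (intro PT_g_attach PT_fst PT_snd PT_id)
    show "PB (\<lambda>x. 1 + (1 + esize (es x)) * (1 + (esize (r x) + esize (es x))))" by (intro PB_intros e assms)
    fix x i zs
    show "?I x (Suc i) (g_attach zs (es x ! i))" if i: "i < length (es x)" "?I x i zs"
    proof -
      have "es x ! i \<in> set (es x)" using i by simp
      then have m: "fst (es x ! i) \<in> fst ` set (es x)" "snd (es x ! i) \<in> snd ` set (es x)" by simp_all
      have "set (g_attach zs (es x ! i)) \<subseteq> insert (r x) (fst ` set (es x) \<union> snd ` set (es x))"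
        using attach_props[of zs "es x ! i"] i(2) m by blast
      then show ?thesis using attach_props[of zs "es x ! i"] i(2) by auto
    qed
    assume i: "i \<le> length (es x)" and I: "?I x i zs"
    have "esize zs \<le> 1 + length zs * (1 + (esize (r x) + esize (es x)))"
    proof (rule esize_list_le)
      fix z assume "z \<in> set zs"
      then consider "z = r x" | e where "e \<in> set (es x)" "z = fst e \<or> z = snd e" using I by blast
      then show "esize z \<le> esize (r x) + esize (es x)"
      proof cases
        case 2
        then show ?thesis using esize_mem[OF 2(1)] esize_fst_snd[of e] by fastforce
      qed simp
    qed
    also have "\<dots> \<le> 1 + (1 + esize (es x)) * (1 + (esize (r x) + esize (es x)))"
      using I i length_le_esize[of "es x"] by (intro add_mono mult_le_mono) auto
    finally show "esize zs \<le> 1 + (1 + esize (es x)) * (1 + (esize (r x) + esize (es x)))" .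
  qed (auto intro!: PT_Cons PT_const e assms)
  then show ?thesis by (simp add: g_tour_def es_def)
qed

lemma PT_stage:
  assumes "PT vs" "PT (\<lambda>z. Q (fst z) (fst (snd z)) (snd (snd z)))" "PT T"
  shows "PT (\<lambda>x. stage (vs x) (Q x) (T x))"
proof -
  have "PT (\<lambda>z. (fst (fst z), snd z, snd (fst z)))" by (intro PT_Pair PT_fst PT_snd PT_id)
  from PT_comp[OF assms(2) this] have q: "PT (\<lambda>z. Q (fst (fst z)) (snd z) (snd (fst z)))" by simp
  have cv: "PT (\<lambda>z. vs (fst z))" by (rule PT_comp[OF assms(1) PT_fst[OF PT_id]])
  have "PT (\<lambda>z. filter (\<lambda>v. Q (fst z) v (snd z)) (vs (fst z)))" by (intro PT_filter q cv)
  then show ?thesis unfolding stage_def by (intro PT_concat PT_map assms)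
qed

lemma PT_foldl_rd: assumes "PT a" "PT xs" shows "PT (\<lambda>x. foldl rd (a x) (xs x))"
proof -
  let ?b = "\<lambda>x. esize (a x) + esize (xs x)"
  have one: "1 \<le> esize ys" for ys :: "nat list" using esize_pos[of ys] by linarith
  have sub: "esize zs \<le> esize ys" if "subseq zs ys" for zs ys :: "nat list"
    using that by (induction rule: list_emb.induct) (auto intro: one)
  show ?thesis
  proof (rule PT_foldl[where b = ?b])
    show "PT (\<lambda>z. rd (fst (snd z)) (snd (snd z)))" unfolding rd_def
      by (intro PT_if PT_list_ex PT_eq PT_append PT_Cons PT_fst PT_snd PT_id PT_const)
    fix x i
    obtain zs where zs: "foldl rd (a x) (take i (xs x)) = a x @ zs" "subseq zs (take i (xs x))" using foldl_rd_prefix by blast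
    have "esize (foldl rd (a x) (take i (xs x))) + 1 = esize (a x) + esize zs" unfolding zs(1) by (rule esize_append)
    then show "esize (foldl rd (a x) (take i (xs x))) \<le> ?b x"
      using sub[OF zs(2)] esize_take[of i "xs x"] by linarith
  qed (intro PB_intros assms)+
qed

section \<open>The algorithm on integral instances\<close>

text \<open>The components are the vertices, the root, the distances, the weights \<open>w\<close> and a common denominator
  \<open>Q\<close> of the activation probabilities \<open>p v = w v / Q\<close>.\<close>

type_synonym inst = "nat list \<times> nat \<times> nat list list \<times> nat list \<times> nat"

abbreviation i_vs :: "inst \<Rightarrow> nat list" where "i_vs I \<equiv> fst I"
abbreviation i_r :: "inst \<Rightarrow> nat" where "i_r I \<equiv> fst (snd I)"
abbreviation i_ds :: "inst \<Rightarrow> nat list list" where "i_ds I \<equiv> fst (snd (snd I))"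
abbreviation i_ws :: "inst \<Rightarrow> nat list" where "i_ws I \<equiv> fst (snd (snd (snd I)))"
abbreviation i_Q :: "inst \<Rightarrow> nat" where "i_Q I \<equiv> snd (snd (snd (snd I)))"

text \<open>The root counts as always active, so that no radius exceeds the distance to the root.\<close>

definition mass :: "inst \<Rightarrow> nat \<Rightarrow> nat \<Rightarrow> nat" where
  "mass I v t = sum_list (map (\<lambda>x. if dm (i_ds I) v x \<le> t then (if x = i_r I then i_Q I else nthd 0 (i_ws I) x) else 0) (i_vs I))"

text \<open>Only distances from \<open>v\<close> can be minimal radii, and the distance to the root
  always qualifies, so the list of candidates is not empty on a valid instance.\<close>

definition rad :: "inst \<Rightarrow> nat \<Rightarrow> nat" where
  "rad I v = argmin 0 (\<lambda>t. t) (filter (\<lambda>t. i_Q I \<le> 2 * mass I v t) (map (\<lambda>u. dm (i_ds I) v u) (i_vs I)))"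

definition uncovered :: "inst \<Rightarrow> nat list \<Rightarrow> nat list" where
  "uncovered I C = filter (\<lambda>v. \<not> (\<exists>a\<in>set C. dm (i_ds I) v a \<le> 2 * rad I v)) (i_vs I)"

definition add_centre :: "inst \<Rightarrow> nat list \<Rightarrow> nat list" where
  "add_centre I C = (if uncovered I C = [] then C else argmin 0 (\<lambda>v. rad I v) (uncovered I C) # C)"

definition centres :: "inst \<Rightarrow> nat list" where
  "centres I = foldl (\<lambda>C _. add_centre I C) [i_r I] (i_vs I)"

definition cells :: "inst \<Rightarrow> nat list" where
  "cells I = map (\<lambda>v. argmin 0 (\<lambda>u. dm (i_ds I) v u) (centres I)) (i_vs I)"

text \<open>Weights instead of probabilities multiply the prizes by \<open>Q\<close>, which is
  matched by the factor on the distances in \<open>env_of\<close>. Truncated subtraction drops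
  vertices farther than \<open>t\<close> from their centre.\<close>

definition prizes :: "inst \<Rightarrow> nat list \<Rightarrow> nat \<Rightarrow> nat list" where
  "prizes I cl t = map (\<lambda>u. if u = i_r I then 0
     else sum_list (map (\<lambda>v. if nthd 0 cl v = u then nthd 0 (i_ws I) v * (t - dm (i_ds I) v u) else 0) (i_vs I))) (i_vs I)"

definition env_of :: "inst \<Rightarrow> nat list \<Rightarrow> genv" where
  "env_of I ps = (i_vs I, i_r I, map (\<lambda>row. map (\<lambda>a. i_Q I * a) row) (i_ds I), sum_list ps)"

definition tour_at :: "inst \<Rightarrow> nat list \<Rightarrow> nat \<Rightarrow> nat list" where
  "tour_at I cl t = g_tour (i_vs I) (i_r I) (g_edges (env_of I (prizes I cl t)) (prizes I cl t))"

definition stage_at :: "inst \<Rightarrow> nat list \<Rightarrow> nat \<Rightarrow> nat list" where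
  "stage_at I cl t = stage (i_vs I) (\<lambda>v a. nthd 0 cl v = a \<and> dm (i_ds I) v a \<le> t) (tour_at I cl t)"

text \<open>The number of scales is given in unary by a list, so that even the last power has
  polynomial length.\<close>

definition powers16 :: "bool list \<Rightarrow> nat list" where
  "powers16 cs = foldl (\<lambda>ts _. 1 # map (\<lambda>a. 16 * a) ts) [] cs"

text \<open>At a scale above this bound the prize of any cell exceeds what the dual solution can pay for, so
  the tour of that scale visits all centres.\<close>

definition horizon :: "inst \<Rightarrow> nat" where
  "horizon I = 5 * sum_list (map (\<lambda>_. 1) (i_vs I)) * sum_list (map (\<lambda>row. sum_list row) (i_ds I))"

definition solve :: "inst \<Rightarrow> nat list" where
  "solve I = foldl rd [i_r I]
     (concat (map (\<lambda>t. stage_at I (cells I) t) (powers16 (True # bits (horizon I)))) @ i_vs I)"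

lemma PT_app3: "PT (\<lambda>z. g (fst z) (fst (snd z)) (snd (snd z))) \<Longrightarrow> PT a \<Longrightarrow> PT b \<Longrightarrow> PT c \<Longrightarrow> PT (\<lambda>x. g (a x) (b x) (c x))"
  using PT_comp[of "\<lambda>z. g (fst z) (fst (snd z)) (snd (snd z))" "\<lambda>x. (a x, b x, c x)"] by (simp add: PT_Pair)

lemma PT_mass: "PT a \<Longrightarrow> PT b \<Longrightarrow> PT c \<Longrightarrow> PT (\<lambda>x. mass (a x) (b x) (c x))"
  by (rule PT_app3[of mass]) (unfold mass_def, intro PT_sum_list PT_map PT_if PT_le PT_dm PT_eq PT_nthd PT_fst PT_snd PT_id PT_const)

lemma PT_rad: "PT a \<Longrightarrow> PT b \<Longrightarrow> PT (\<lambda>x. rad (a x) (b x))"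
  by (rule PT_app2[of rad]) (unfold rad_def, intro PT_argmin PT_filter PT_map PT_le PT_mult PT_mass PT_dm PT_fst PT_snd PT_id PT_const)

lemma PT_uncovered: "PT a \<Longrightarrow> PT b \<Longrightarrow> PT (\<lambda>x. uncovered (a x) (b x))"
  by (rule PT_app2[of uncovered]) (unfold uncovered_def, intro PT_filter PT_not PT_list_ex PT_le PT_mult PT_rad PT_dm PT_fst PT_snd PT_id PT_const)

lemma PT_add_centre: "PT a \<Longrightarrow> PT b \<Longrightarrow> PT (\<lambda>x. add_centre (a x) (b x))"
  by (rule PT_app2[of add_centre]) (unfold add_centre_def, intro PT_if PT_null PT_argmin PT_uncovered PT_rad PT_Cons PT_fst PT_snd PT_id PT_const)

lemma uncovered_subset: "set (uncovered I C) \<subseteq> set (i_vs I)" by (auto simp: uncovered_def)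

lemma add_centre_sub: "set (add_centre I C) \<subseteq> set C \<union> set (i_vs I)"
  using argmin_in[of "uncovered I C" 0 "\<lambda>v. rad I v"] uncovered_subset[of I C] by (auto simp: add_centre_def)

lemma PT_centres: "PT a \<Longrightarrow> PT (\<lambda>x. centres (a x))"
proof (rule PT_comp[of centres])
  let ?I = "\<lambda>I i C. length C \<le> 1 + i \<and> set C \<subseteq> insert (i_r I) (set (i_vs I))"
  show "PT centres" unfolding centres_def
  proof (rule PT_foldl_inv[where I = ?I and b = "\<lambda>I. 1 + (1 + esize (i_vs I)) * (1 + (esize (i_r I) + esize (i_vs I)))"])
    show "PT (\<lambda>z. add_centre (fst z) (fst (snd z)))" by (intro PT_add_centre PT_fst PT_snd PT_id)
    show "PB (\<lambda>I::inst. 1 + (1 + esize (i_vs I)) * (1 + (esize (i_r I) + esize (i_vs I))))"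
      by (intro PB_intros PT_fst PT_snd PT_id)
    fix I :: inst and i C
    show "?I I (Suc i) (add_centre I C)" if "?I I i C"
      using that add_centre_sub[of I C] by (auto simp: add_centre_def)
    assume i: "i \<le> length (i_vs I)" and I: "?I I i C"
    have "esize C \<le> 1 + length C * (1 + (esize (i_r I) + esize (i_vs I)))"
    proof (rule esize_list_le)
      fix x assume "x \<in> set C"
      then show "esize x \<le> esize (i_r I) + esize (i_vs I)" using I esize_mem[of x "i_vs I"] by fastforce
    qed
    also have "\<dots> \<le> 1 + (1 + esize (i_vs I)) * (1 + (esize (i_r I) + esize (i_vs I)))"
      using I i length_le_esize[of "i_vs I"] by (intro add_mono mult_le_mono) auto
    finally show "esize C \<le> 1 + (1 + esize (i_vs I)) * (1 + (esize (i_r I) + esize (i_vs I)))" .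
  qed (auto intro!: PT_Cons PT_const PT_fst PT_snd PT_id)
qed

lemma PT_cells: "PT a \<Longrightarrow> PT (\<lambda>x. cells (a x))"
  by (rule PT_comp[of cells]) (unfold cells_def, intro PT_map PT_argmin PT_dm PT_centres PT_fst PT_snd PT_id)

lemma PT_prizes: "PT a \<Longrightarrow> PT b \<Longrightarrow> PT c \<Longrightarrow> PT (\<lambda>x. prizes (a x) (b x) (c x))"
  by (rule PT_app3[of prizes]) (unfold prizes_def, intro PT_sum_list PT_map PT_if PT_mult PT_sub PT_dm PT_eq PT_nthd PT_fst PT_snd PT_id PT_const)

lemma PT_env_of: "PT a \<Longrightarrow> PT b \<Longrightarrow> PT (\<lambda>x. env_of (a x) (b x))"
  by (rule PT_app2[of env_of]) (unfold env_of_def, intro PT_Pair PT_sum_list PT_map PT_mult PT_fst PT_snd PT_id)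

lemma PT_tour_at: "PT a \<Longrightarrow> PT b \<Longrightarrow> PT c \<Longrightarrow> PT (\<lambda>x. tour_at (a x) (b x) (c x))"
  unfolding tour_at_def by (intro PT_g_tour PT_g_edges PT_env_of PT_prizes PT_fst PT_snd)

lemma PT_stage_at: "PT a \<Longrightarrow> PT b \<Longrightarrow> PT c \<Longrightarrow> PT (\<lambda>x. stage_at (a x) (b x) (c x))"
  by (rule PT_app3[of stage_at]) (unfold stage_at_def, intro PT_stage PT_conj PT_eq PT_le PT_nthd PT_dm PT_tour_at PT_fst PT_snd PT_id)

lemma powers16_eq: "powers16 cs = map (\<lambda>j. 16 ^ j) [0..<length cs]"
proof (induction cs rule: rev_induct)
  case (snoc c cs)
  have "map (\<lambda>j. 16 ^ j :: nat) [0..<length (cs @ [c])] = 1 # map (\<lambda>j. 16 ^ Suc j) [0..<length cs]"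
    by (simp add: upt_conv_Cons map_Suc_upt[symmetric] o_def del: upt_Suc)
  then show ?case using snoc by (simp add: powers16_def o_def del: upt_Suc)
qed (simp add: powers16_def)

lemma PT_powers16: "PT a \<Longrightarrow> PT (\<lambda>x. powers16 (a x))"
proof (rule PT_comp[of powers16])
  let ?b = "\<lambda>cs::bool list. 1 + esize cs * (1 + (4 * (4 * esize cs + 1) + 1))"
  show "PT powers16" unfolding powers16_def
  proof (rule PT_foldl[where b = ?b])
    show "PT (\<lambda>z. 1 # map (\<lambda>a. 16 * a :: nat) (fst (snd z)))" by (intro PT_Cons PT_map PT_mult PT_fst PT_snd PT_id PT_const)
    show "PB ?b" by (intro PB_intros)
    fix cs :: "bool list" and i
    let ?p = "powers16 (take i cs)"
    have "esize ?p \<le> 1 + length ?p * (1 + (4 * (4 * esize cs + 1) + 1))"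
    proof (rule esize_list_le)
      fix t assume "t \<in> set ?p"
      then obtain j where j: "t = 16 ^ j" "j < length cs" by (auto simp: powers16_eq)
      have "length (bits t) \<le> 4 * j + 1"
        unfolding length_bits_le j using power_mult[of "2::nat" 4 j] by (simp add: power_add)
      moreover have "length (bits t) \<le> 4 * esize cs + 1" using calculation j(2) length_le_esize[of cs] by linarith
      ultimately show "esize t \<le> 4 * (4 * esize cs + 1) + 1" using esize_nat_le[of t] by arith
    qed
    also have "\<dots> \<le> ?b cs" using length_le_esize[of cs] by (intro add_mono mult_le_mono) (auto simp: powers16_eq)
    finally show "esize (foldl (\<lambda>ts _. 1 # map (\<lambda>a. 16 * a :: nat) ts) [] (take i cs)) \<le> ?b cs" by (simp add: powers16_def)
  qed (intro PT_const PT_id)+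
qed

lemma PT_solve: "PT a \<Longrightarrow> PT (\<lambda>x. solve (a x))"
proof (rule PT_comp[of solve])
  have h: "PT horizon" unfolding horizon_def by (intro PT_mult PT_sum_list PT_map PT_fst PT_snd PT_id PT_const)
  show "PT solve" unfolding solve_def
    by (intro PT_foldl_rd PT_append PT_concat PT_map PT_stage_at PT_cells PT_powers16 PT_bits h PT_Cons PT_fst PT_snd PT_id PT_const)
qed

section \<open>Reading the instance and printing the tour\<close>

definition to_common :: "nat list \<times> nat \<Rightarrow> nat \<times> nat \<Rightarrow> nat list \<times> nat" where
  "to_common s q = (fst q * snd s # map (\<lambda>a. snd q * a) (fst s), snd q * snd s)"

text \<open>The product of the denominators serves as the common one; its bit length is at most the
  sum of theirs. The reversal yields the recursion of \<open>common_den_simps\<close> and preserves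
  the order of the numerators.\<close>

definition common_den :: "(nat \<times> nat) list \<Rightarrow> nat list \<times> nat" where
  "common_den qs = foldl to_common ([], 1) (rev qs)"

lemma common_den_simps: "common_den [] = ([], 1)" "common_den (q # qs) = to_common (common_den qs) q"
  by (simp_all add: common_den_def)

lemma common_den_bits:
  "length (fst (common_den qs)) = length qs \<and> length (bits (snd (common_den qs))) \<le> esize qs \<and>
   (\<forall>a\<in>set (fst (common_den qs)). length (bits a) \<le> esize qs)"
proof (induction qs)
  case (Cons q qs)
  obtain a b where q: "q = (a, b)" by fastforce
  have s: "esize (q # qs) = 2 + (esize a + esize b + esize qs)" by (simp add: q)
  have m: "length (bits (u * v)) \<le> esize (q # qs)" if "length (bits u) \<le> esize a + esize b" "length (bits v) \<le> esize qs" for u v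
    using length_bits_mult[of u v] that unfolding s by linarith
  have ab: "length (bits a) \<le> esize a + esize b" "length (bits b) \<le> esize a + esize b"
    using length_bits_le_esize[of a] length_bits_le_esize[of b] by linarith+
  show ?case using Cons m[OF ab(1)] m[OF ab(2)] by (auto simp: common_den_simps to_common_def q)
qed (simp add: common_den_simps bits_pos)

lemma PT_common_den: "PT a \<Longrightarrow> PT (\<lambda>x. common_den (a x))"
proof (rule PT_comp[of common_den])
  let ?c = "\<lambda>qs::(nat \<times> nat) list. 4 * esize qs + 1"
  let ?b = "\<lambda>qs. 1 + (1 + esize qs * (1 + ?c qs)) + ?c qs"
  show "PT common_den" unfolding common_den_def
  proof (rule PT_foldl[where b = ?b])
    show "PT (\<lambda>z. to_common (fst (snd z)) (snd (snd z)))" unfolding to_common_def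
      by (intro PT_Pair PT_Cons PT_map PT_mult PT_fst PT_snd PT_id)
    show "PB ?b" by (intro PB_intros)
    fix qs :: "(nat \<times> nat) list" and i
    define rs where "rs = rev (take i (rev qs))"
    have e: "esize rs \<le> esize qs" unfolding rs_def esize_rev using esize_take[of i "rev qs"] by (simp add: esize_rev)
    have l: "length rs \<le> esize qs" using length_le_esize[of rs] e by linarith
    note cb = common_den_bits[of rs]
    have "esize (fst (common_den rs)) \<le> 1 + length (fst (common_den rs)) * (1 + ?c qs)"
    proof (rule esize_list_le)
      fix a assume "a \<in> set (fst (common_den rs))"
      then have "length (bits a) \<le> esize qs" using cb e by fastforce
      then show "esize a \<le> ?c qs" using esize_nat_le[of a] by linarith
    qed
    also have "\<dots> \<le> 1 + esize qs * (1 + ?c qs)" using cb l by (intro add_mono mult_le_mono) auto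
    finally have 1: "esize (fst (common_den rs)) \<le> 1 + esize qs * (1 + ?c qs)" .
    have "length (bits (snd (common_den rs))) \<le> esize qs" using cb e by linarith
    then have 2: "esize (snd (common_den rs)) \<le> ?c qs" using esize_nat_le[of "snd (common_den rs)"] by linarith
    have "esize (common_den rs) = 1 + esize (fst (common_den rs)) + esize (snd (common_den rs))"
      using esize_simps(4)[of "fst (common_den rs)" "snd (common_den rs)"] by simp
    then have "esize (common_den rs) \<le> ?b qs" using 1 2 by linarith
    then show "esize (foldl to_common ([], 1) (take i (rev qs))) \<le> ?b qs" by (simp add: common_den_def rs_def)
  qed (intro PT_const PT_rev PT_id)+
qed

text \<open>Every separator ends a number.  The separator in front of the probabilities directly follows
  another one and reads as an additional 0.\<close>

definition tok_step :: "nat list \<times> bool list \<Rightarrow> unit list \<Rightarrow> nat list \<times> bool list" where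
  "tok_step s a = (if tl (tl a) = [] then (fst s, (tl a \<noteq> []) # snd s) else (fst s @ [rval (snd s)], []))"

definition tokens :: "unit list list \<Rightarrow> nat list" where
  "tokens w = fst (foldl tok_step ([], []) w)"

lemma PT_tokens: "PT a \<Longrightarrow> PT (\<lambda>x. tokens (a x))"
proof (rule PT_comp[of tokens])
  let ?I = "\<lambda>w i s. length (fst s) \<le> i \<and> length (snd s) \<le> i \<and> (\<forall>a\<in>set (fst s). length (bits a) \<le> i)"
  let ?c = "\<lambda>w::unit list list. 4 * esize w + 1"
  let ?b = "\<lambda>w. 1 + (1 + esize w * (1 + ?c w)) + (1 + esize w * (1 + 3))"
  have "PT (\<lambda>w. foldl tok_step ([], []) w)"
  proof (rule PT_foldl_inv[where I = ?I and b = ?b])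
    show "PT (\<lambda>z. tok_step (fst (snd z)) (snd (snd z)))" unfolding tok_step_def
      by (intro PT_if PT_null PT_not PT_Pair PT_Cons PT_append PT_rval PT_tl PT_fst PT_snd PT_id PT_const)
    show "PB ?b" by (intro PB_intros)
    fix w i and s :: "nat list \<times> bool list"
    show "?I w (Suc i) (tok_step s (w ! i))" if I: "?I w i s"
    proof -
      have "length (bits (rval (snd s))) \<le> length (snd s)" unfolding length_bits_le by (rule rval_less)
      then show ?thesis using I by (auto simp: tok_step_def)
    qed
    assume i: "i \<le> length w" and I: "?I w i s"
    have iw: "i \<le> esize w" using i length_le_esize[of w] by linarith
    have "esize (fst s) \<le> 1 + length (fst s) * (1 + ?c w)"
    proof (rule esize_list_le)
      fix a assume "a \<in> set (fst s)"
      then have "length (bits a) \<le> esize w" using I iw by fastforce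
      then show "esize a \<le> ?c w" using esize_nat_le[of a] by linarith
    qed
    also have "\<dots> \<le> 1 + esize w * (1 + ?c w)" using I iw by (intro add_mono mult_le_mono) auto
    finally have 1: "esize (fst s) \<le> 1 + esize w * (1 + ?c w)" .
    have "esize (snd s) \<le> 1 + length (snd s) * (1 + 3)" by (rule esize_list_le) (rule esize_bool)
    also have "\<dots> \<le> 1 + esize w * (1 + 3)" using I iw by (intro add_mono mult_le_mono) auto
    finally have 2: "esize (snd s) \<le> 1 + esize w * (1 + 3)" .
    have "esize s = 1 + esize (fst s) + esize (snd s)" using esize_simps(4)[of "fst s" "snd s"] by simp
    then show "esize s \<le> ?b w" using 1 2 by linarith
  qed (auto intro!: PT_const PT_id)
  then show "PT tokens" unfolding tokens_def by (rule PT_fst)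
qed

text \<open>The number of vertices comes in binary, so the range is cut out of the positions of the
  token list, of which an encoded instance has more than enough.\<close>

definition verts_of :: "nat list \<Rightarrow> nat list" where
  "verts_of ts = filter (\<lambda>v. v < nthd 0 ts 0) [0..<length ts]"

definition grid :: "nat list \<Rightarrow> nat list" where
  "grid ts = concat (map (\<lambda>u. map (\<lambda>v. u * nthd 0 ts 0 + v) (verts_of ts)) (verts_of ts))"

text \<open>After scaling by \<open>8n\<close> distances are even, and nonzero ones are so long that the tree built at
  scale 1 has length 0.\<close>

definition matrix_of :: "nat list \<Rightarrow> nat list \<Rightarrow> nat list list" where
  "matrix_of ts ns = map (\<lambda>u. map (\<lambda>v. 8 * nthd 0 ts 0 * nthd 0 ns (u * nthd 0 ts 0 + v)) (verts_of ts)) (verts_of ts)"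

definition dist_fracs :: "nat list \<Rightarrow> nat list \<times> nat" where
  "dist_fracs ts = common_den (map (\<lambda>k. (nthd 0 ts (2 + 2 * k), nthd 0 ts (3 + 2 * k))) (grid ts))"

text \<open>The offset 3 counts the number of vertices, the root and the additional 0.\<close>

definition prob_fracs :: "nat list \<Rightarrow> nat list \<times> nat" where
  "prob_fracs ts = common_den (map (\<lambda>v. (nthd 0 ts (3 + 2 * (nthd 0 ts 0 * nthd 0 ts 0) + 2 * v),
     nthd 0 ts (4 + 2 * (nthd 0 ts 0 * nthd 0 ts 0) + 2 * v))) (verts_of ts))"

definition parse :: "nat list \<Rightarrow> inst" where
  "parse ts = (verts_of ts, nthd 0 ts 1, matrix_of ts (fst (dist_fracs ts)), fst (prob_fracs ts), snd (prob_fracs ts))"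

definition print_tour :: "nat list \<Rightarrow> unit list list" where
  "print_tour xs = concat (map (\<lambda>v. map (\<lambda>b. if b then uns 2 else uns 1) (bits v) @ [uns 3]) xs)"

definition algorithm :: "unit list list \<Rightarrow> unit list list" where
  "algorithm w = print_tour (solve (parse (tokens w)))"

theorem PT_algorithm: "PT algorithm"
proof -
  have v: "PT verts_of" unfolding verts_of_def by (intro PT_filter PT_less PT_nthd PT_upt PT_fst PT_snd PT_id PT_const)
  note vc = PT_comp[OF v]
  have g: "PT grid" unfolding grid_def by (intro PT_concat PT_map PT_add PT_mult PT_nthd vc PT_fst PT_snd PT_id PT_const)
  have d: "PT dist_fracs" unfolding dist_fracs_def
    by (intro PT_common_den PT_map PT_Pair PT_add PT_mult PT_nthd g PT_fst PT_snd PT_id PT_const)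
  have p: "PT prob_fracs" unfolding prob_fracs_def
    by (intro PT_common_den PT_map PT_Pair PT_add PT_mult PT_nthd v PT_fst PT_snd PT_id PT_const)
  have "PT (\<lambda>z. matrix_of (fst z) (snd z))" unfolding matrix_of_def
    by (intro PT_map PT_mult PT_add PT_nthd vc PT_fst PT_snd PT_id PT_const)
  then have m: "PT (\<lambda>ts. matrix_of ts (fst (dist_fracs ts)))" by (rule PT_app2) (intro PT_id PT_fst d)+
  have pa: "PT parse" unfolding parse_def by (intro PT_Pair v m p PT_nthd PT_fst PT_snd PT_id PT_const)
  have "PT print_tour" unfolding print_tour_def
    by (intro PT_concat PT_map PT_append PT_Cons PT_if PT_bits PT_fst PT_snd PT_id PT_const)
  then show ?thesis unfolding algorithm_def by (rule PT_comp) (intro PT_solve PT_comp[OF pa] PT_tokens PT_id)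
qed

declare One_nat_def [simp]

section \<open>Correctness of the algorithm\<close>

lemma sum_list_upt_if: "sum_list (map (\<lambda>x. if P x then f x else 0) [0..<n]) = (\<Sum>x\<in>{x. x < n \<and> P x}. f x :: 'a::comm_monoid_add)"
proof -
  have "sum_list (map (\<lambda>x. if P x then f x else 0) [0..<n]) = (\<Sum>x\<in>{0..<n}. if P x then f x else 0)"
    by (simp add: sum_list_distinct_conv_sum_set)
  also have "\<dots> = (\<Sum>x\<in>{x\<in>{0..<n}. P x}. f x)" by (rule sum.inter_filter[symmetric]) simp
  also have "{x\<in>{0..<n}. P x} = {x. x < n \<and> P x}" by auto
  finally show ?thesis .
qed

lemma dm_map: "dm (map (\<lambda>row. map (\<lambda>a. Q * a) row) ds) u v = Q * dm ds u v"
  by (auto simp: dm_def nthd_def)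

lemma dm_le_sum: "dm ds u v \<le> sum_list (map (\<lambda>row. sum_list row) ds)"
proof -
  have 1: "nthd 0 xs i \<le> sum_list (xs :: nat list)" for xs i by (auto simp: nthd_def intro!: member_le_sum_list)
  have "sum_list (nthd [] ds u) \<le> sum_list (map (\<lambda>row. sum_list row) ds)"
    by (auto simp: nthd_def intro!: member_le_sum_list)
  then show ?thesis unfolding dm_def using 1[of "nthd [] ds u" v] by linarith
qed

section \<open>Properties of radii, centres and cells\<close>

locale integral_instance =
  fixes n r :: nat and ds :: "nat list list" and ws :: "nat list" and Q :: nat
  assumes r: "r < n"
    and dn_sym: "\<And>u v. u < n \<Longrightarrow> v < n \<Longrightarrow> dm ds u v = dm ds v u"
    and dn_zero: "\<And>u. u < n \<Longrightarrow> dm ds u u = 0"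
    and dn_triangle: "\<And>u v w. u < n \<Longrightarrow> v < n \<Longrightarrow> w < n \<Longrightarrow> dm ds u w \<le> dm ds u v + dm ds v w"
    and coarse: "\<And>u v. u < n \<Longrightarrow> v < n \<Longrightarrow> 8 * n dvd dm ds u v"
    and ws: "\<And>v. v < n \<Longrightarrow> nthd 0 ws v \<le> Q" and Q: "0 < Q"
begin

definition I :: inst where "I = ([0..<n], r, ds, ws, Q)"

lemma I_simps [simp]: "i_vs I = [0..<n]" "i_r I = r" "i_ds I = ds" "i_ws I = ws" "i_Q I = Q"
  by (simp_all add: I_def)

abbreviation w :: "nat \<Rightarrow> nat" where "w v \<equiv> nthd 0 ws v"
abbreviation dn :: "nat \<Rightarrow> nat \<Rightarrow> nat" where "dn u v \<equiv> dm ds u v"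

lemma mass_eq: "mass I v t = (\<Sum>x\<in>{x. x < n \<and> dn v x \<le> t}. if x = r then Q else w x)"
  unfolding mass_def I_simps by (rule sum_list_upt_if)

lemma mass_mono: "finite A \<Longrightarrow> A \<subseteq> {x. x < n \<and> dn v x \<le> t} \<Longrightarrow> (\<Sum>x\<in>A. if x = r then Q else w x) \<le> mass I v t"
  unfolding mass_eq by (rule sum_mono2) auto

lemma rad_props:
  assumes v: "v < n"
  shows "Q \<le> 2 * mass I v (rad I v)" "rad I v \<le> dn v r"
    "u < n \<Longrightarrow> dn v u < rad I v \<Longrightarrow> 2 * mass I v (dn v u) < Q"
proof -
  let ?ts = "filter (\<lambda>t. Q \<le> 2 * mass I v t) (map (\<lambda>u. dn v u) [0..<n])"
  have rad: "rad I v = argmin 0 (\<lambda>t. t) ?ts" by (simp add: rad_def)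
  have "Q \<le> mass I v (dn v r)" using mass_mono[of "{r}" v "dn v r"] r by simp
  then have rt: "dn v r \<in> set ?ts" using r by auto
  then have "?ts \<noteq> []" by (metis empty_iff empty_set)
  then have "rad I v \<in> set ?ts" unfolding rad by (rule argmin_in)
  then show "Q \<le> 2 * mass I v (rad I v)" by simp
  show "rad I v \<le> dn v r" unfolding rad using argmin_le[OF rt, of "\<lambda>t. t"] by simp
  assume u: "u < n" "dn v u < rad I v"
  show "2 * mass I v (dn v u) < Q"
  proof (rule ccontr)
    assume "\<not> ?thesis"
    then have "dn v u \<in> set ?ts" using u by auto
    from argmin_le[OF this, of "\<lambda>t. t" 0] show False using u(2) unfolding rad by simp
  qed
qed

text \<open>The open ball lies in the closed ball up to its farthest vertex, whose smaller radius
  was rejected. The root is outside, since the radius is at most its distance, so the weight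
  \<open>Q\<close> that \<open>mass\<close> gives it does not occur.\<close>

lemma light_ball:
  assumes v: "v < n"
  shows "2 * (\<Sum>u\<in>{u. u < n \<and> u \<noteq> v \<and> dn u v < rad I v}. w u) \<le> Q"
proof (cases "{u. u < n \<and> u \<noteq> v \<and> dn u v < rad I v} = {}")
  case False
  let ?S = "{u. u < n \<and> u \<noteq> v \<and> dn u v < rad I v}"
  have "Max (dn v ` ?S) \<in> dn v ` ?S" using False by (intro Max_in) auto
  then obtain u where u: "u \<in> ?S" "Max (dn v ` ?S) = dn v u" by auto
  have "x \<in> ?S \<Longrightarrow> dn v x \<le> dn v u" for x using Max_ge[of "dn v ` ?S" "dn v x"] u(2) by auto
  then have "(\<Sum>x\<in>?S. if x = r then Q else w x) \<le> mass I v (dn v u)" by (intro mass_mono) auto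
  moreover have "(\<Sum>x\<in>?S. if x = r then Q else w x) = (\<Sum>x\<in>?S. w x)"
    using rad_props(2)[OF v] dn_sym[OF v r] by (intro sum.cong) auto
  moreover have "2 * mass I v (dn v u) < Q" using rad_props(3)[OF v, of u] u(1) dn_sym[OF v, of u] by simp
  ultimately show ?thesis by linarith
next
  case True
  show ?thesis unfolding True by simp
qed

text \<open>The last condition says that centres are chosen in the order of their radii. With it, a
  new centre \<open>a\<close> is farther than \<open>2 * rad I a\<close>, hence farther than
  \<open>2 * rad I b\<close>, from every earlier centre \<open>b\<close> other than the
  root.\<close>

definition separated :: "nat list \<Rightarrow> bool" where
  "separated C \<longleftrightarrow> set C \<subseteq> {..<n} \<and> r \<in> set C \<and>
     (\<forall>a\<in>set C. \<forall>b\<in>set C. a \<noteq> r \<longrightarrow> a \<noteq> b \<longrightarrow> 2 * rad I a < dn a b) \<and>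
     (\<forall>a\<in>set C. \<forall>v\<in>set (uncovered I C). a \<noteq> r \<longrightarrow> rad I a \<le> rad I v)"

lemma set_uncovered: "v \<in> set (uncovered I C) \<longleftrightarrow> v < n \<and> (\<forall>a\<in>set C. 2 * rad I v < dn v a)"
  by (auto simp: uncovered_def not_le)

lemma add_centre_step:
  assumes "separated C"
  shows "separated (add_centre I C)" "card (set (uncovered I (add_centre I C))) \<le> card (set (uncovered I C)) - 1"
proof -
  have "separated (add_centre I C) \<and> card (set (uncovered I (add_centre I C))) \<le> card (set (uncovered I C)) - 1"
  proof (cases "uncovered I C = []")
    case True
    then show ?thesis using assms by (simp add: add_centre_def)
  next
    case False
    define a where "a = argmin 0 (\<lambda>v. rad I v) (uncovered I C)"
    have ac: "add_centre I C = a # C" using False by (simp add: add_centre_def a_def)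
    have a: "a \<in> set (uncovered I C)" unfolding a_def by (rule argmin_in[OF False])
    have amin: "v \<in> set (uncovered I C) \<Longrightarrow> rad I a \<le> rad I v" for v
      unfolding a_def using argmin_le[of v "uncovered I C" "\<lambda>v. rad I v" 0] by simp
    have an: "a < n" "b \<in> set C \<Longrightarrow> 2 * rad I a < dn a b" for b using a by (auto simp: set_uncovered)
    have sub: "set (uncovered I (a # C)) \<subseteq> set (uncovered I C) - {a}" using dn_zero[OF an(1)] by (auto simp: set_uncovered)
    have 1: "2 * rad I b < dn b a" if "b \<in> set C" "b \<noteq> r" for b
    proof -
      have "rad I b \<le> rad I a" using assms a that by (auto simp: separated_def)
      moreover have "dn b a = dn a b" using assms that an(1) by (intro dn_sym) (auto simp: separated_def)
      ultimately show ?thesis using an(2)[OF that(1)] by linarith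
    qed
    have "separated (a # C)" unfolding separated_def
    proof (intro conjI ballI impI)
      show "set (a # C) \<subseteq> {..<n}" "r \<in> set (a # C)" using assms an by (auto simp: separated_def)
      show "2 * rad I x < dn x b" if "x \<in> set (a # C)" "b \<in> set (a # C)" "x \<noteq> r" "x \<noteq> b" for x b
        using that 1 an(2) assms by (auto simp: separated_def)
      show "rad I x \<le> rad I v" if "x \<in> set (a # C)" "v \<in> set (uncovered I (a # C))" "x \<noteq> r" for x v
        using that sub amin assms by (auto simp: separated_def)
    qed
    moreover have "card (set (uncovered I (a # C))) \<le> card (set (uncovered I C) - {a})" by (rule card_mono[OF _ sub]) simp
    ultimately show ?thesis using a by (simp add: ac)
  qed
  then show "separated (add_centre I C)" "card (set (uncovered I (add_centre I C))) \<le> card (set (uncovered I C)) - 1" by auto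
qed

text \<open>Every round covers at least the chosen vertex, so \<open>n\<close> rounds leave nothing
  uncovered.\<close>

lemma centres_props: "separated (centres I)" "uncovered I (centres I) = []"
proof -
  have s: "separated [r]" using r by (auto simp: separated_def)
  have it: "separated C \<Longrightarrow> separated (foldl (\<lambda>C _. add_centre I C) C ks) \<and>
      card (set (uncovered I (foldl (\<lambda>C _. add_centre I C) C ks))) \<le> card (set (uncovered I C)) - length ks" for C and ks :: "nat list"
  proof (induction ks arbitrary: C)
    case (Cons k ks)
    then show ?case using Cons.IH[of "add_centre I C"] add_centre_step[of C] by fastforce
  qed simp
  have "set (uncovered I [r]) \<subseteq> {..<n}" using uncovered_subset[of I "[r]"] by auto
  then have "card (set (uncovered I [r])) \<le> n" using card_mono[of "{..<n}"] by fastforce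
  then show "separated (centres I)" "uncovered I (centres I) = []"
    using it[OF s, of "[0..<n]"] by (auto simp: centres_def)
qed

definition c :: "nat \<Rightarrow> nat" where "c v = nthd 0 (cells I) v"

lemma c_props:
  assumes v: "v < n"
  shows "c v \<in> set (centres I)" "a \<in> set (centres I) \<Longrightarrow> dn v (c v) \<le> dn v a" "c v < n"
proof -
  have c: "c v = argmin 0 (\<lambda>u. dn v u) (centres I)" using v by (simp add: c_def cells_def)
  have "r \<in> set (centres I)" using centres_props(1) by (simp add: separated_def)
  then show 1: "c v \<in> set (centres I)" unfolding c by (intro argmin_in) auto
  then show "c v < n" using centres_props(1) by (auto simp: separated_def)
  show "a \<in> set (centres I) \<Longrightarrow> dn v (c v) \<le> dn v a" unfolding c by (rule argmin_le)
qed

lemma c_r: "c r = r"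
proof (rule ccontr)
  assume "c r \<noteq> r"
  then have "2 * rad I (c r) < dn (c r) r" using centres_props(1) c_props(1)[OF r] by (auto simp: separated_def)
  moreover have "dn r (c r) \<le> dn r r" using centres_props(1) by (intro c_props r) (simp add: separated_def)
  ultimately show False using dn_zero[OF r] dn_sym[OF r c_props(3)[OF r]] by simp
qed

lemma c_near: assumes v: "v < n" shows "dn v (c v) \<le> 2 * rad I v"
proof -
  have "v \<notin> set (uncovered I (centres I))" using centres_props(2) by simp
  then obtain a where a: "a \<in> set (centres I)" "dn v a \<le> 2 * rad I v" using v by (auto simp: set_uncovered not_less)
  then show ?thesis using c_props(2)[OF v a(1)] by linarith
qed

text \<open>Other centres are more than twice the radius away, so the closed ball around a centre
  belongs to its cell, and its mass is at least \<open>Q / 2\<close> by the choice of the radius.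
  The root, being its own centre, is not in it.\<close>

lemma heavy_cell: assumes v: "v < n" and ne: "c v \<noteq> r" shows "Q \<le> 2 * (\<Sum>u\<in>{u. u < n \<and> c u = c v}. w u)"
proof -
  let ?a = "c v"
  have a: "?a \<in> set (centres I)" "?a < n" using c_props[OF v] by auto
  have sub: "c x = ?a" if x: "x < n" "dn ?a x \<le> rad I ?a" for x
  proof (rule ccontr)
    assume n: "c x \<noteq> ?a"
    have cx: "c x \<in> set (centres I)" "c x < n" using c_props[OF x(1)] by auto
    have "2 * rad I ?a < dn ?a (c x)" using centres_props(1) cx a ne n by (auto simp: separated_def)
    also have "\<dots> \<le> dn ?a x + dn x (c x)" by (rule dn_triangle[OF a(2) x(1) cx(2)])
    also have "dn x (c x) \<le> dn x ?a" by (rule c_props(2)[OF x(1) a(1)])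
    also have "dn x ?a = dn ?a x" by (rule dn_sym[OF x(1) a(2)])
    finally show False using x(2) by linarith
  qed
  have "mass I ?a (rad I ?a) = (\<Sum>x\<in>{x. x < n \<and> dn ?a x \<le> rad I ?a}. w x)"
    unfolding mass_eq using sub[OF r] c_r ne by (intro sum.cong) auto
  also have "\<dots> \<le> (\<Sum>u\<in>{u. u < n \<and> c u = ?a}. w u)" using sub by (intro sum_mono2) auto
  finally show ?thesis using rad_props(1)[OF a(2)] by linarith
qed

section \<open>The analysis applied to the integral instance\<close>

definition d :: "nat \<Rightarrow> nat \<Rightarrow> real" where "d u v = real (dn u v)"
definition p :: "nat \<Rightarrow> real" where "p v = real (w v) / real Q"

sublocale apriori n r d p
proof
  show "r < n" by (rule r)
  show "d i j = d j i" if "i < n" "j < n" for i j using dn_sym[OF that] by (simp add: d_def)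
  show "d i i = 0" if "i < n" for i using dn_zero[OF that] by (simp add: d_def)
  show "d i k \<le> d i j + d j k" if "i < n" "j < n" "k < n" for i j k
    using dn_triangle[OF that] unfolding d_def by (simp flip: of_nat_add)
  show "0 \<le> p i \<and> p i \<le> 1" if "i < n" for i using ws[OF that] Q by (simp add: p_def)
qed (simp add: d_def)

definition z :: "nat \<Rightarrow> nat \<Rightarrow> real" where
  "z t u = (if u = r then 0 else \<Sum>v\<in>{v. v < n \<and> c v = u}. p v * max 0 (real t - d v u))"

definition Tr :: "nat \<Rightarrow> nat list" where "Tr t = tour_at I (cells I) t"

lemma prizes_eq: assumes u: "u < n" shows "real (nthd 0 (prizes I (cells I) t) u) = real Q * z t u"
proof (cases "u = r")
  case False
  have e: "real (t - dn v u) = max 0 (real t - d v u)" for v by (cases "dn v u \<le> t") (auto simp: d_def of_nat_diff)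
  have "nthd 0 (prizes I (cells I) t) u = (\<Sum>v\<in>{v. v < n \<and> c v = u}. w v * (t - dn v u))"
    using u False by (simp add: prizes_def sum_list_upt_if c_def)
  then have "real (nthd 0 (prizes I (cells I) t) u) = (\<Sum>v\<in>{v. v < n \<and> c v = u}. real (w v) * max 0 (real t - d v u))"
    by (simp add: e)
  also have "\<dots> = (\<Sum>v\<in>{v. v < n \<and> c v = u}. real Q * (p v * max 0 (real t - d v u)))"
    using Q by (intro sum.cong) (auto simp: p_def)
  also have "\<dots> = real Q * z t u" using False by (simp add: z_def sum_distrib_left)
  finally show ?thesis .
qed (use u in \<open>simp add: prizes_def z_def\<close>)

text \<open>What the analysis uses of the dual at scale \<open>t\<close>. The edge list is kept
  because the argument for scale 1 looks at single edges.\<close>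

definition is_dual :: "nat \<Rightarrow> (nat set \<Rightarrow> real) \<Rightarrow> bool" where
  "is_dual t y \<longleftrightarrow> (\<forall>X. 0 \<le> y X) \<and> (\<forall>X. 0 < y X \<longrightarrow> r \<notin> X) \<and>
     (\<forall>a<n. \<forall>b<n. (\<Sum>X\<in>Pow {..<n}. of_bool ((a \<in> X) \<noteq> (b \<in> X)) * y X) \<le> d a b) \<and>
     (\<forall>U\<subseteq>{..<n}. (\<Sum>X\<in>Pow {..<n}. of_bool (X \<subseteq> U) * y X) \<le> (\<Sum>u\<in>U. z t u)) \<and>
     (\<exists>T. (\<forall>e\<in>set T. fst e < n \<and> snd e < n) \<and> plen d (Tr t @ [r]) \<le> 2 * (\<Sum>e\<leftarrow>T. d (fst e) (snd e)) \<and>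
       (\<Sum>e\<leftarrow>T. d (fst e) (snd e)) \<le> 4 * (\<Sum>X\<in>Pow {..<n}. y X)) \<and>
     (\<Sum>u\<in>{..<n} - set (Tr t). z t u) \<le> 2 * (\<Sum>X\<in>Pow {..<n}. y X)"

text \<open>The primal-dual theorem is applied to distances and prizes multiplied by
  \<open>Q\<close>; dividing its dual solution by \<open>Q\<close> undoes the scaling.\<close>

lemma dual_exists: "\<exists>y. is_dual t y" and Tr_root: "set (Tr t) \<subseteq> {..<n} \<and> (\<exists>xs. Tr t = r # xs)"
proof -
  define ps where "ps = prizes I (cells I) t"
  define pz where "pz u = nthd 0 ps u" for u
  have lps: "length ps = n" by (simp add: ps_def prizes_def)
  have pz: "real (pz u) = real Q * z t u" if "u < n" for u using prizes_eq[OF that] by (simp add: pz_def ps_def)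
  interpret m: moats n r "\<lambda>u v. Q * dn u v" pz "map (\<lambda>row. map (\<lambda>a. Q * a) row) ds" "sum_list ps"
  proof
    show "r < n" by (rule r)
    show "dm (map (\<lambda>row. map (\<lambda>a. Q * a) row) ds) u v = Q * dn u v" for u v by (rule dm_map)
    show "Q * dn u v = Q * dn v u" if "u < n" "v < n" for u v using dn_sym[OF that] by simp
    show "even (Q * dn u v)" if "u < n" "v < n" for u v
      using dvd_trans[OF _ coarse[OF that], of 2] by (simp add: dvd_mult)
    show "pz r = 0" using r by (simp add: pz_def ps_def prizes_def)
    show "sum_list ps = (\<Sum>v<n. pz v)" by (simp add: sum_list_sum_nth lps pz_def nthd_def atLeast0LessThan)
  qed
  have mg: "m.g = env_of I ps" by (simp add: m.g_def env_of_def)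
  define T where "T = g_edges (env_of I ps) ps"
  have pzv: "ps ! v = pz v" if "v < n" for v using that by (simp add: pz_def nthd_def lps)
  note pd = m.primal_dual[of ps, unfolded mg, folded T_def]
  have Tn: "\<forall>e\<in>set T. fst e < n \<and> snd e < n" by (rule pd(2)[OF lps]) (rule pzv)
  have conn: "insert r (fst ` set T \<union> snd ` set T) \<subseteq> P"
    if "P \<subseteq> {..<n}" "r \<in> P" "\<And>e. e \<in> set T \<Longrightarrow> fst e \<in> P \<longleftrightarrow> snd e \<in> P" for P
    using pd(3)[OF lps pzv that] unfolding m.verts_def by blast
  have TrT: "Tr t = g_tour [0..<n] r T" by (simp add: Tr_def tour_at_def T_def ps_def)
  have gt1: "\<exists>xs. Tr t = r # xs" unfolding TrT by (rule g_tour_correct(1)[OF Tn]) (rule conn)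
  have gt3: "set (Tr t) = insert r (fst ` set T \<union> snd ` set T)" unfolding TrT by (rule g_tour_correct(3)[OF Tn]) (rule conn)
  have gt4: "plen d (Tr t @ [r]) \<le> 2 * (\<Sum>e\<leftarrow>T. d (fst e) (snd e))" unfolding TrT by (rule g_tour_correct(4)[OF Tn]) (rule conn)
  obtain y where yy: "(\<forall>a<n. \<forall>b<n. m.wsum (\<lambda>X. of_bool ((a \<in> X) \<noteq> (b \<in> X))) y \<le> Q * dn a b) \<and>
     (\<forall>X. 0 < y X \<longrightarrow> X \<subseteq> {..<n} - {r}) \<and>
     (\<forall>U\<subseteq>{..<n}. m.wsum (\<lambda>X. of_bool (X \<subseteq> U)) y \<le> (\<Sum>u\<in>U. pz u)) \<and>
     (\<Sum>e\<leftarrow>T. Q * dn (fst e) (snd e)) + 2 * (\<Sum>v\<in>{..<n} - m.verts T. pz v) \<le> 4 * m.wsum (\<lambda>_. 1) y"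
    using pd(1)[OF lps pzv] by (auto elim: exE)
  note y = yy[THEN conjunct1, rule_format] yy[THEN conjunct2, THEN conjunct1, rule_format]
    yy[THEN conjunct2, THEN conjunct2, THEN conjunct1, rule_format] yy[THEN conjunct2, THEN conjunct2, THEN conjunct2]
  define yr where "yr X = real (y X) / real Q" for X
  have ws: "(\<Sum>X\<in>Pow {..<n}. of_bool (h X) * yr X) = real (m.wsum (\<lambda>X. of_bool (h X)) y) / real Q" for h
    unfolding m.wsum_def yr_def of_nat_sum of_nat_mult of_nat_of_bool sum_divide_distrib times_divide_eq_right by (rule HOL.refl)
  have w1: "real (m.wsum (\<lambda>_. 1) y) = real Q * (\<Sum>X\<in>Pow {..<n}. yr X)"
    using Q by (simp add: m.wsum_def yr_def sum_divide_distrib[symmetric])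
  have sum_pz: "real (\<Sum>u\<in>U. pz u) = real Q * (\<Sum>u\<in>U. z t u)" if "U \<subseteq> {..<n}" for U
    using that by (simp add: sum_distrib_left) (intro sum.cong, auto intro!: pz)
  have sT: "real (\<Sum>e\<leftarrow>T. Q * dn (fst e) (snd e)) = real Q * (\<Sum>e\<leftarrow>T. d (fst e) (snd e))"
    by (simp add: d_def sum_list_const_mult flip: sum_list_of_nat) (induction T; simp add: algebra_simps)
  have vT: "set (Tr t) = m.verts T" by (simp add: gt3 m.verts_def)
  have sub: "set (Tr t) \<subseteq> {..<n}" using Tn r by (auto simp: gt3)
  have znn: "0 \<le> z t u" for u unfolding z_def using prob by (auto intro!: sum_nonneg)
  have dnn: "0 \<le> (\<Sum>e\<leftarrow>T. d (fst e) (snd e))" by (rule sum_list_nonneg) (auto simp: d_def)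
  have "real ((\<Sum>e\<leftarrow>T. Q * dn (fst e) (snd e)) + 2 * (\<Sum>v\<in>{..<n} - m.verts T. pz v)) \<le> real (4 * m.wsum (\<lambda>_. 1) y)"
    using y(4) by (rule of_nat_mono)
  then have "real Q * (\<Sum>e\<leftarrow>T. d (fst e) (snd e)) + 2 * (real Q * (\<Sum>u\<in>{..<n} - set (Tr t). z t u)) \<le> 4 * (real Q * (\<Sum>X\<in>Pow {..<n}. yr X))"
    using sT w1 sum_pz[of "{..<n} - m.verts T"] unfolding vT by simp
  then have "real Q * ((\<Sum>e\<leftarrow>T. d (fst e) (snd e)) + 2 * (\<Sum>u\<in>{..<n} - set (Tr t). z t u)) \<le> real Q * (4 * (\<Sum>X\<in>Pow {..<n}. yr X))"
    by (simp only: distrib_left mult.left_commute[of 2] mult.left_commute[of 4])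
  then have main: "(\<Sum>e\<leftarrow>T. d (fst e) (snd e)) + 2 * (\<Sum>u\<in>{..<n} - set (Tr t). z t u) \<le> 4 * (\<Sum>X\<in>Pow {..<n}. yr X)"
    using Q by (simp del: sum_distrib_left)
  have zs: "0 \<le> (\<Sum>u\<in>{..<n} - set (Tr t). z t u)" by (rule sum_nonneg) (rule znn)
  show "set (Tr t) \<subseteq> {..<n} \<and> (\<exists>xs. Tr t = r # xs)" using sub gt1 by blast
  show "\<exists>y. is_dual t y" unfolding is_dual_def
  proof (intro exI[of _ yr] conjI allI impI)
    show "0 \<le> yr X" for X by (simp add: yr_def)
    show "r \<notin> X" if "0 < yr X" for X using y(2)[of X] that by (auto simp: yr_def zero_less_divide_iff)
    show "(\<Sum>X\<in>Pow {..<n}. of_bool ((a \<in> X) \<noteq> (b \<in> X)) * yr X) \<le> d a b" if "a < n" "b < n" for a b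
      using of_nat_mono[OF y(1)[OF that], where 'a = real] Q unfolding ws by (simp add: d_def divide_le_eq mult.commute)
    show "(\<Sum>X\<in>Pow {..<n}. of_bool (X \<subseteq> U) * yr X) \<le> (\<Sum>u\<in>U. z t u)" if "U \<subseteq> {..<n}" for U
      using of_nat_mono[OF y(3)[OF that], where 'a = real] Q unfolding ws sum_pz[OF that] by (simp add: divide_le_eq mult.commute)
    show "\<exists>T. (\<forall>e\<in>set T. fst e < n \<and> snd e < n) \<and> plen d (Tr t @ [r]) \<le> 2 * (\<Sum>e\<leftarrow>T. d (fst e) (snd e)) \<and>
       (\<Sum>e\<leftarrow>T. d (fst e) (snd e)) \<le> 4 * (\<Sum>X\<in>Pow {..<n}. yr X)"
      using Tn gt4 main zs by (intro exI[of _ T] conjI) linarith+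
    show "(\<Sum>u\<in>{..<n} - set (Tr t). z t u) \<le> 2 * (\<Sum>X\<in>Pow {..<n}. yr X)" using main dnn by linarith
  qed
qed

theorem solve_correct:
  assumes xo: "set xo = {..<n} - {r}" "distinct xo"
  shows "\<exists>xs. solve I = r # xs \<and> set xs = {..<n} - {r} \<and> distinct xs \<and> elat n r d p xs \<le> 30000000 * elat n r d p xo"
proof -
  define S where "S = sum_list (map (\<lambda>row. sum_list row) ds)"
  define J where "J = length (bits (horizon I))"
  have hz: "horizon I = 5 * n * S" by (simp add: horizon_def S_def sum_list_triv)
  have dS: "d u v \<le> real S" for u v unfolding d_def S_def using dm_le_sum[of ds u v] by simp
  have "5 * n * S < 2 ^ J" using less_power_length_bits[of "horizon I"] unfolding hz J_def .
  also have "(2::nat) ^ J \<le> 16 ^ J" by (rule power_mono) auto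
  finally have "real (5 * n * S) < real (16 ^ J)" by (simp only: of_nat_less_iff)
  then have J5: "5 * (real n * real S) < 16 ^ J" by simp
  have nS: "real S \<le> real n * real S" using mult_right_mono[of 1 "real n" "real S"] r by simp
  have "\<forall>j. \<exists>y. is_dual (16 ^ j) y" using dual_exists by blast
  from choice[OF this] obtain y where "\<forall>j. is_dual (16 ^ j) (y j)" by (rule exE)
  then have dual: "is_dual (16 ^ j) (y j)" for j by (rule spec)
  note yc = dual[unfolded is_dual_def]
  note yd = yc[THEN conjunct2]
  note ye = yd[THEN conjunct2]
  note yf = ye[THEN conjunct2]
  note yg = yf[THEN conjunct2]
  note y = yc[THEN conjunct1, rule_format] yd[THEN conjunct1, rule_format] ye[THEN conjunct1, rule_format] yf[THEN conjunct1, rule_format]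
    and T = yg[THEN conjunct1] and un = yg[THEN conjunct2]
  note TrV = Tr_root[of "16 ^ j" for j]
  have pn: "0 \<le> p v" for v by (simp add: p_def)
  have dn0: "0 \<le> d u v" for u v by (simp add: d_def)
  have znn: "0 \<le> z t u" for t u unfolding z_def using pn by (auto intro!: sum_nonneg)
  \<comment> \<open>A moat of positive width is nonempty and avoids the root, so it separates some
    vertex from the root; summing the distance constraint over all pairs of a vertex and the root
    counts it at least once.\<close>
  have Yd: "(\<Sum>X\<in>Pow {..<n}. y j X) \<le> real n * real S" for j
  proof -
    have "(\<Sum>X\<in>Pow {..<n}. of_bool (X \<subseteq> {}) * y j X) \<le> 0" using y(4)[of "{}" j] by simp
    moreover have "y j {} \<le> (\<Sum>X\<in>Pow {..<n}. of_bool (X \<subseteq> {}) * y j X)"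
      using member_le_sum[of "{}" "Pow {..<n}" "\<lambda>X. of_bool (X \<subseteq> {}) * y j X"] y(1)[of j] by simp
    ultimately have y0: "y j {} = 0" using y(1)[of j "{}"] by linarith
    have "y j X \<le> (\<Sum>v<n. of_bool ((v \<in> X) \<noteq> (r \<in> X)) * y j X)" if X: "X \<in> Pow {..<n}" for X
    proof (cases "y j X = 0")
      case False
      then have pos: "0 < y j X" using y(1)[of j X] by linarith
      then have "r \<notin> X" by (rule y(2))
      moreover have "X \<noteq> {}" using pos y0 by auto
      then obtain v where "v \<in> X" by blast
      moreover have "v < n" using \<open>v \<in> X\<close> X by auto
      ultimately show ?thesis
        using member_le_sum[of v "{..<n}" "\<lambda>v. of_bool ((v \<in> X) \<noteq> (r \<in> X)) * y j X"] y(1)[of j X] by simp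
    qed simp
    then have "(\<Sum>X\<in>Pow {..<n}. y j X) \<le> (\<Sum>X\<in>Pow {..<n}. \<Sum>v<n. of_bool ((v \<in> X) \<noteq> (r \<in> X)) * y j X)"
      by (rule sum_mono)
    also have "\<dots> = (\<Sum>v<n. \<Sum>X\<in>Pow {..<n}. of_bool ((v \<in> X) \<noteq> (r \<in> X)) * y j X)" by (rule sum.swap)
    also have "\<dots> \<le> (\<Sum>v<n. real S)" by (rule sum_mono) (use y(3)[OF _ r] dS order_trans in blast)
    finally show ?thesis by simp
  qed
  \<comment> \<open>If the centre of \<open>v\<close> were missed, a prize of at least
    \<open>(16 ^ J - S) / 2\<close> would be lost, while lost prizes are at most twice the dual
    value and so at most \<open>2 * n * S\<close>. The choice of the horizon excludes this.\<close>
  have served: "c v \<in> set (Tr (16 ^ J)) \<and> d v (c v) \<le> 16 ^ J" if v: "v < n" for v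
  proof
    show "d v (c v) \<le> 16 ^ J" using dS[of v "c v"] nS J5 by linarith
    show "c v \<in> set (Tr (16 ^ J))"
    proof (rule ccontr)
      assume nt: "c v \<notin> set (Tr (16 ^ J))"
      then have ne: "c v \<noteq> r" using TrV[of J] by auto
      let ?C = "{u. u < n \<and> c u = c v}"
      have "real Q \<le> real (2 * (\<Sum>u\<in>?C. w u))" using heavy_cell[OF v ne] by (rule of_nat_mono)
      then have half: "1 / 2 \<le> (\<Sum>u\<in>?C. p u)" using Q by (simp add: p_def sum_divide_distrib[symmetric] field_simps)
      have gap: "0 \<le> 16 ^ J - real S" using nS J5 by linarith
      have "1 / 2 * (16 ^ J - real S) \<le> (\<Sum>u\<in>?C. p u) * (16 ^ J - real S)" by (rule mult_right_mono[OF half gap])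
      also have "\<dots> = (\<Sum>u\<in>?C. p u * (16 ^ J - real S))" by (rule sum_distrib_right)
      also have "\<dots> \<le> (\<Sum>u\<in>?C. p u * max 0 (real (16 ^ J) - d u (c v)))"
      proof (intro sum_mono mult_left_mono pn)
        fix u show "16 ^ J - real S \<le> max 0 (real (16 ^ J) - d u (c v))" using dS[of u "c v"] by simp
      qed
      also have "\<dots> = z (16 ^ J) (c v)" using ne by (simp add: z_def)
      also have "\<dots> \<le> (\<Sum>u\<in>{..<n} - set (Tr (16 ^ J)). z (16 ^ J) u)"
        using nt c_props(3)[OF v] by (intro member_le_sum znn) auto
      also have "\<dots> \<le> 2 * (real n * real S)" using un[of J] Yd[of J] by linarith
      finally have "16 ^ J - real S \<le> 4 * (real n * real S)" by simp
      then show False using nS J5 by linarith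
    qed
  qed
  have small: "d u v = 0 \<or> 8 * real n \<le> d u v" if "u < n" "v < n" for u v
  proof -
    have "dn u v = 0 \<or> 8 * n \<le> dn u v" using coarse[OF that] by (auto dest: dvd_imp_le)
    then show ?thesis using of_nat_mono[of "8 * n" "dn u v", where 'a = real] unfolding d_def by auto
  qed
  have n1: "1 \<le> real n" using r by simp
  \<comment> \<open>At scale 1 the dual is worth at most the sum of the prizes, hence at most
    \<open>n\<close>, so the tree costs at most \<open>4 * n\<close>; an edge of nonzero length
    would alone cost at least \<open>8 * n\<close>.\<close>
  have first: "plen d (Tr (16 ^ 0) @ [r]) \<le> 0"
  proof -
    obtain T where T: "\<And>e. e \<in> set T \<Longrightarrow> fst e < n \<and> snd e < n" "plen d (Tr (16 ^ 0) @ [r]) \<le> 2 * (\<Sum>e\<leftarrow>T. d (fst e) (snd e))"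
       "(\<Sum>e\<leftarrow>T. d (fst e) (snd e)) \<le> 4 * (\<Sum>X\<in>Pow {..<n}. y 0 X)" using T[of 0] by blast
    have "(\<Sum>X\<in>Pow {..<n}. y 0 X) = (\<Sum>X\<in>Pow {..<n}. of_bool (X \<subseteq> {..<n}) * y 0 X)" by (rule sum.cong) auto
    also have "\<dots> \<le> (\<Sum>u<n. z (16 ^ 0) u)" by (rule y(4)) simp
    also have "\<dots> \<le> (\<Sum>u<n. \<Sum>v\<in>{v. v < n \<and> c v = u}. p v * max 0 (real 1 - d v u))"
      using pn by (intro sum_mono) (auto simp: z_def intro!: sum_nonneg)
    also have "\<dots> \<le> (\<Sum>u<n. \<Sum>v\<in>{v. v < n \<and> c v = u}. 1)"
    proof (intro sum_mono)
      fix u v assume "v \<in> {v. v < n \<and> c v = u}"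
      then have "p v * max 0 (real 1 - d v u) \<le> 1 * 1" using prob[of v] dn0[of v u] by (intro mult_mono) auto
      then show "p v * max 0 (real 1 - d v u) \<le> 1" by simp
    qed
    also have "\<dots> = (\<Sum>u<n. \<Sum>v\<in>{v\<in>{..<n}. c v = u}. 1)" by simp
    also have "\<dots> = (\<Sum>v<n. 1)" by (rule sum.group) (use c_props(3) in auto)
    finally have Y0: "(\<Sum>X\<in>Pow {..<n}. y 0 X) \<le> real n" by simp
    have "d (fst e) (snd e) = 0" if e: "e \<in> set T" for e
    proof (rule ccontr)
      assume "d (fst e) (snd e) \<noteq> 0"
      then have "8 * real n \<le> d (fst e) (snd e)" using small T(1)[OF e] by blast
      also have "\<dots> \<le> (\<Sum>e\<leftarrow>T. d (fst e) (snd e))" using e dn0 by (intro member_le_sum_list) auto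
      finally show False using T(3) Y0 n1 by linarith
    qed
    then have "(\<Sum>e\<leftarrow>T. d (fst e) (snd e)) = 0" by (simp cong: map_cong)
    then show ?thesis using T(2) by simp
  qed
  obtain xs where xs: "solve I = r # xs"
  proof -
    have "\<exists>zs. foldl rd [r] ys = r # zs" for ys using foldl_rd_prefix[of "[r]" ys] by auto
    then show ?thesis using that unfolding solve_def I_simps by blast
  qed
  have "solve I = foldl rd [r] (concat (map (\<lambda>j. stage [0..<n] (\<lambda>v a. c v = a \<and> d v a \<le> 16 ^ j) (Tr (16 ^ j))) [0..<Suc J]) @ [0..<n])"
    unfolding solve_def powers16_eq stage_at_def J_def
    by (simp add: o_def c_def d_def Tr_def del: upt_Suc)
  then have eq: "r # xs = foldl rd [r] (concat (map (\<lambda>j. stage [0..<n] (\<lambda>v a. c v = a \<and> d v a \<le> 16 ^ j) (Tr (16 ^ j))) [0..<Suc J]) @ [0..<n])"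
    using xs by simp
  note A = approximation[where c = c and R = "\<lambda>v. real (rad I v)" and J = J and z = "\<lambda>j. z (16 ^ j)" and Tr = "\<lambda>j. Tr (16 ^ j)" and y = y,
      OF c_props(3) c_r _ _ _ _ _ TrV y(1) y(2) y(3) y(4) _ _ un served first _ eq xo]
  have h1: "0 \<le> real (rad I v)" for v by simp
  have h2: "real (rad I v) \<le> d r v" if "v < n" for v using rad_props(2)[OF that] dn_sym[OF that r] by (simp add: d_def)
  have h3: "(\<Sum>u\<in>{u. u < n \<and> u \<noteq> v \<and> d u v < real (rad I v)}. p u) \<le> 1 / 2" if "v < n" "v \<noteq> r" for v
      using of_nat_mono[OF light_ball[OF that(1)], where 'a = real] Q
      by (simp add: p_def d_def sum_divide_distrib[symmetric] field_simps)
  have h4: "d v (c v) \<le> 2 * real (rad I v)" if "v < n" for v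
      using of_nat_mono[OF c_near[OF that], where 'a = real] by (simp add: d_def)
  have h5: "1 / 2 \<le> (\<Sum>u\<in>{u. u < n \<and> c u = c v}. p u)" if "v < n" "c v \<noteq> r" for v
      using of_nat_mono[OF heavy_cell[OF that], where 'a = real] Q
      by (simp add: p_def sum_divide_distrib[symmetric] field_simps)
  have h6: "z (16 ^ j) u = (if u = r then 0 else \<Sum>v\<in>{v. v < n \<and> c v = u}. p v * max 0 (16 ^ j - d v u))" for j u
      by (simp add: z_def)
  have h7: "plen d (Tr (16 ^ j) @ [r]) \<le> 8 * (\<Sum>X\<in>Pow {..<n}. y j X)" for j using T[of j] by fastforce
  have h8: "d v (c v) = 0" if "v < n" "d v (c v) \<le> 1" for v using small[OF that(1) c_props(3)[OF that(1)]] that(2) n1 by linarith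
  have "set xs = {..<n} - {r} \<and> distinct xs \<and> elat n r d p xs \<le> 30000000 * elat n r d p xo"
    by (intro conjI; rule A; use h1 h2 h3 h4 h5 h6 h7 h8 in blast)
  then show ?thesis using xs by blast
qed

end

section \<open>The tokens of an encoded instance\<close>

lemma rval_rev_bits: "rval (rev (bits m)) = m"
proof (induction m rule: bits.induct)
  case (2 m)
  have "rval (rev (bits (Suc m))) = nat_cons (rval (rev (bits (Suc m div 2)))) (odd (Suc m))" by (simp add: rval_def)
  then show ?case using 2 half_bit[of "Suc m"] by (simp only: nat_cons_def add.commute)
qed (simp add: rval_def)

text \<open>Requiring that no bits are pending before and after makes the property compose under
  concatenation.\<close>

definition reads :: "nat list \<Rightarrow> nat list \<Rightarrow> bool" where
  "reads w us \<longleftrightarrow> (\<forall>ts. foldl tok_step (ts, []) (map uns w) = (ts @ us, []))"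

lemma reads_Nil: "reads [] []" by (simp add: reads_def)

lemma reads_append: "reads w us \<Longrightarrow> reads w' us' \<Longrightarrow> reads (w @ w') (us @ us')" by (simp add: reads_def)

lemma reads_concat: "(\<And>i. i \<in> set js \<Longrightarrow> reads (f i) (g i)) \<Longrightarrow> reads (concat (map f js)) (concat (map g js))"
  by (induction js) (auto intro!: reads_append reads_Nil)

text \<open>The encoding lists the lowest bit first and the tokenizer stacks the bits, so they end
  up in the order that \<open>rval\<close> expects.\<close>

lemma reads_nat: assumes "2 < k" shows "reads (nat_enc m @ [k]) [m]"
proof -
  have u: "uns (Suc 0) = [()]" "uns 2 = [(), ()]" by (simp_all add: uns_def numeral_2_eq_2)
  have b: "foldl tok_step (ts, cur) (map uns (map (\<lambda>b. if b then 2 else 1) bs)) = (ts, rev bs @ cur)" for ts cur bs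
    by (induction bs arbitrary: cur) (auto simp: tok_step_def u)
  have "length (tl (tl (uns k))) = k - 2" by (simp add: uns_def)
  then have "tl (tl (uns k)) \<noteq> []" using assms by force
  then show ?thesis by (simp add: reads_def nat_enc_def b tok_step_def rval_rev_bits del: map_map)
qed

definition rat_toks :: "rat \<Rightarrow> nat list" where
  "rat_toks q = [nat (fst (quotient_of q)), nat (snd (quotient_of q))]"

lemma reads_rat: "reads (rat_enc q) (rat_toks q)"
proof -
  have "rat_enc q = (nat_enc (nat (fst (quotient_of q))) @ [3]) @ (nat_enc (nat (snd (quotient_of q))) @ [4])"
    by (simp add: rat_enc_def split: prod.split)
  then show ?thesis using reads_append[OF reads_nat[of 3] reads_nat[of 4]] by (simp add: rat_toks_def)
qed

lemma rat_toks_value: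
  assumes "0 \<le> q"
  shows "0 < nat (snd (quotient_of q))" "real (nat (fst (quotient_of q))) = real_of_rat q * real (nat (snd (quotient_of q)))"
proof -
  obtain a b where ab: "quotient_of q = (a, b)" by fastforce
  have b: "0 < b" using quotient_of_denom_pos[OF ab] .
  have q: "q = of_int a / of_int b" by (rule quotient_of_div[OF ab])
  then have "0 \<le> a" using assms b by (simp add: zero_le_divide_iff)
  moreover have real: "real_of_rat q = real_of_int a / real_of_int b" by (simp add: q of_rat_divide)
  ultimately show "0 < nat (snd (quotient_of q))" "real (nat (fst (quotient_of q))) = real_of_rat q * real (nat (snd (quotient_of q)))"
    using b real by (simp_all add: ab)
qed

lemma inst_tokens:
  "tokens (map uns (inst_enc n r d p)) = n # r # concat (map (\<lambda>i. concat (map (\<lambda>j. rat_toks (d i j)) [0..<n])) [0..<n]) @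
     0 # concat (map (\<lambda>i. rat_toks (p i)) [0..<n])"
proof -
  \<comment> \<open>\<open>nat_enc 0\<close> is empty, so the separator in front of the
    probabilities can be regarded as the encoding of a number 0.\<close>
  have "reads ((nat_enc n @ [5]) @ (nat_enc r @ [5]) @ concat (map (\<lambda>i. concat (map (\<lambda>j. rat_enc (d i j)) [0..<n])) [0..<n]) @
      (nat_enc 0 @ [5]) @ concat (map (\<lambda>i. rat_enc (p i)) [0..<n]))
    ([n] @ [r] @ concat (map (\<lambda>i. concat (map (\<lambda>j. rat_toks (d i j)) [0..<n])) [0..<n]) @ [0] @ concat (map (\<lambda>i. rat_toks (p i)) [0..<n]))"
    by (intro reads_append reads_concat reads_nat reads_rat) simp_all
  then show ?thesis by (simp add: reads_def tokens_def inst_enc_def nat_enc_def)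
qed

lemma concat_grid:
  assumes "\<And>u. length (f u) = k"
  shows "length (concat (map f [0..<m])) = m * k" "u < m \<Longrightarrow> v < k \<Longrightarrow> concat (map f [0..<m]) ! (u * k + v) = f u ! v"
proof -
  show l: "length (concat (map f [0..<m])) = m * k" for m by (induction m) (simp_all add: assms)
  show "u < m \<Longrightarrow> v < k \<Longrightarrow> concat (map f [0..<m]) ! (u * k + v) = f u ! v"
  proof (induction m)
    case (Suc m)
    show ?case
    proof (cases "u = m")
      case True
      then show ?thesis by (simp add: nth_append l)
    next
      case False
      then have "u * k + v < m * k" using Suc.prems mult_le_mono1[of "Suc u" m k] by simp
      then show ?thesis using Suc False by (simp add: nth_append l)
    qed
  qed simp
qed

text \<open>Cross-multiplication keeps the equality of fractions within the natural numbers.\<close>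

lemma common_den_value:
  assumes "\<forall>q\<in>set qs. 0 < snd q"
  shows "0 < snd (common_den qs) \<and> (\<forall>i<length qs. fst (common_den qs) ! i * snd (qs ! i) = fst (qs ! i) * snd (common_den qs))"
  using assms
proof (induction qs)
  case (Cons q qs)
  have l: "length (fst (common_den qs)) = length qs" using common_den_bits by blast
  show ?case
  proof (intro conjI allI impI)
    show "0 < snd (common_den (q # qs))" using Cons by (simp add: common_den_simps to_common_def)
    fix i assume "i < length (q # qs)"
    then show "fst (common_den (q # qs)) ! i * snd ((q # qs) ! i) = fst ((q # qs) ! i) * snd (common_den (q # qs))"
      using Cons l by (cases i) (auto simp: common_den_simps to_common_def algebra_simps)
  qed
qed (simp add: common_den_simps)

lemma common_den_ratio:
  assumes "\<forall>q\<in>set qs. 0 < snd q" "i < length qs" "real (fst (qs ! i)) = x * real (snd (qs ! i))"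
  shows "real (nthd 0 (fst (common_den qs)) i) = x * real (snd (common_den qs))"
proof -
  have l: "length (fst (common_den qs)) = length qs" using common_den_bits by blast
  have "real (fst (common_den qs) ! i) * real (snd (qs ! i)) = x * real (snd (qs ! i)) * real (snd (common_den qs))"
    using common_den_value[OF assms(1)] assms(2,3) by (metis of_nat_mult)
  moreover have "0 < snd (qs ! i)" using assms(1,2) by simp
  ultimately show ?thesis using assms(2) l by (simp add: nthd_def)
qed

lemma filter_upt: "n \<le> m \<Longrightarrow> filter (\<lambda>v. v < n) [0..<m] = [0..<n]"
  using upt_add_eq_append[of 0 n "m - n"] by simp

section \<open>The parsed instance and the final comparison\<close>

context
  fixes n r :: nat and d :: "nat \<Rightarrow> nat \<Rightarrow> rat" and p :: "nat \<Rightarrow> rat"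
  assumes valid: "valid_instance n r d p"
begin

definition toks :: "nat list" where "toks = tokens (map uns (inst_enc n r d p))"
definition den :: nat where "den = snd (dist_fracs toks)"
definition scale :: real where "scale = 8 * real n * real den"

lemma toks_eq: "toks = n # r # concat (map (\<lambda>i. concat (map (\<lambda>j. rat_toks (d i j)) [0..<n])) [0..<n]) @
     0 # concat (map (\<lambda>i. rat_toks (p i)) [0..<n])" by (simp add: toks_def inst_tokens)

lemma row_tokens:
  "length (concat (map (\<lambda>j. rat_toks (f j)) [0..<n])) = n * 2"
  "v < n \<Longrightarrow> concat (map (\<lambda>j. rat_toks (f j)) [0..<n]) ! (v * 2) = nat (fst (quotient_of (f v)))"
  "v < n \<Longrightarrow> concat (map (\<lambda>j. rat_toks (f j)) [0..<n]) ! (v * 2 + 1) = nat (snd (quotient_of (f v)))"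
proof -
  have len: "length (rat_toks (f j)) = 2" for j by (simp add: rat_toks_def)
  have nth: "rat_toks (f v) ! 0 = nat (fst (quotient_of (f v)))" "rat_toks (f v) ! 1 = nat (snd (quotient_of (f v)))"
    by (simp_all add: rat_toks_def)
  show "length (concat (map (\<lambda>j. rat_toks (f j)) [0..<n])) = n * 2" by (rule concat_grid(1)[OF len])
  assume v: "v < n"
  show "concat (map (\<lambda>j. rat_toks (f j)) [0..<n]) ! (v * 2) = nat (fst (quotient_of (f v)))"
    using concat_grid(2)[OF len v, of 0] nth by simp
  show "concat (map (\<lambda>j. rat_toks (f j)) [0..<n]) ! (v * 2 + 1) = nat (snd (quotient_of (f v)))"
    using concat_grid(2)[OF len v, of 1] nth by simp
qed

lemma dist_tokens:
  "length (concat (map (\<lambda>i. concat (map (\<lambda>j. rat_toks (d i j)) [0..<n])) [0..<n])) = n * (n * 2)"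
  "u < n \<Longrightarrow> x < n * 2 \<Longrightarrow> concat (map (\<lambda>i. concat (map (\<lambda>j. rat_toks (d i j)) [0..<n])) [0..<n]) ! (u * (n * 2) + x) =
     concat (map (\<lambda>j. rat_toks (d u j)) [0..<n]) ! x"
  by (rule concat_grid[OF row_tokens(1)], assumption?)+

lemma length_toks: "length toks = 3 + n * (n * 2) + n * 2"
  by (simp add: toks_eq dist_tokens(1) row_tokens(1))

lemma toks_0: "nthd 0 toks 0 = n" and toks_1: "nthd 0 toks 1 = r"
  by (simp_all add: toks_eq nthd_def)

lemma toks_dist:
  assumes "u < n" "v < n"
  shows "nthd 0 toks (2 + 2 * (u * n + v)) = nat (fst (quotient_of (d u v)))"
    "nthd 0 toks (3 + 2 * (u * n + v)) = nat (snd (quotient_of (d u v)))"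
proof -
  have b: "u * (n * 2) + x < n * (n * 2)" if "x < n * 2" for x
    using that mult_le_mono1[of "Suc u" n "n * 2"] assms by simp
  have g: "nthd 0 toks (2 + (u * (n * 2) + x)) = concat (map (\<lambda>j. rat_toks (d u j)) [0..<n]) ! x" if x: "x < n * 2" for x
  proof -
    have "nthd 0 toks (2 + (u * (n * 2) + x)) = toks ! Suc (Suc (u * (n * 2) + x))"
      using b[OF x] length_toks by (simp add: nthd_def)
    also have "\<dots> = concat (map (\<lambda>i. concat (map (\<lambda>j. rat_toks (d i j)) [0..<n])) [0..<n]) ! (u * (n * 2) + x)"
      unfolding toks_eq using b[OF x] dist_tokens(1) by (simp add: nth_append)
    finally show ?thesis using dist_tokens(2)[OF assms(1) x] by simp
  qed
  have e: "2 + 2 * (u * n + v) = 2 + (u * (n * 2) + v * 2)" "3 + 2 * (u * n + v) = 2 + (u * (n * 2) + (v * 2 + 1))" by simp_all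
  show "nthd 0 toks (2 + 2 * (u * n + v)) = nat (fst (quotient_of (d u v)))"
    unfolding e using g[of "v * 2"] row_tokens(2)[OF assms(2)] assms by simp
  show "nthd 0 toks (3 + 2 * (u * n + v)) = nat (snd (quotient_of (d u v)))"
    unfolding e using g[of "v * 2 + 1"] row_tokens(3)[OF assms(2)] assms by simp
qed

lemma toks_prob:
  assumes "v < n"
  shows "nthd 0 toks (3 + 2 * (n * n) + 2 * v) = nat (fst (quotient_of (p v)))"
    "nthd 0 toks (4 + 2 * (n * n) + 2 * v) = nat (snd (quotient_of (p v)))"
proof -
  have g: "nthd 0 toks (3 + n * (n * 2) + x) = concat (map (\<lambda>i. rat_toks (p i)) [0..<n]) ! x" if x: "x < n * 2" for x
  proof -
    have "nthd 0 toks (3 + n * (n * 2) + x) = toks ! Suc (Suc (n * (n * 2) + Suc x))"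
      using x length_toks by (simp add: nthd_def numeral_3_eq_3)
    also have "\<dots> = concat (map (\<lambda>i. rat_toks (p i)) [0..<n]) ! x"
      unfolding toks_eq using dist_tokens(1) by (simp add: nth_append)
    finally show ?thesis .
  qed
  have e: "3 + 2 * (n * n) + 2 * v = 3 + n * (n * 2) + v * 2" "4 + 2 * (n * n) + 2 * v = 3 + n * (n * 2) + (v * 2 + 1)" by simp_all
  show "nthd 0 toks (3 + 2 * (n * n) + 2 * v) = nat (fst (quotient_of (p v)))"
    unfolding e using g[of "v * 2"] row_tokens(2)[OF assms] assms by simp
  show "nthd 0 toks (4 + 2 * (n * n) + 2 * v) = nat (snd (quotient_of (p v)))"
    unfolding e using g[of "v * 2 + 1"] row_tokens(3)[OF assms] assms by simp
qed

lemma verts_toks: "verts_of toks = [0..<n]"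
  unfolding verts_of_def toks_0 by (rule filter_upt) (simp add: length_toks)

lemma grid_toks: "length (grid toks) = n * n" "u < n \<Longrightarrow> v < n \<Longrightarrow> grid toks ! (u * n + v) = u * n + v"
  "k \<in> set (grid toks) \<Longrightarrow> \<exists>u<n. \<exists>v<n. k = u * n + v"
proof -
  have g: "grid toks = concat (map (\<lambda>u. map (\<lambda>v. u * n + v) [0..<n]) [0..<n])" by (simp add: grid_def verts_toks toks_0)
  show l: "length (grid toks) = n * n" unfolding g by (rule concat_grid(1)) simp
  show e: "u < n \<Longrightarrow> v < n \<Longrightarrow> grid toks ! (u * n + v) = u * n + v" for u v
    unfolding g using concat_grid(2)[of "\<lambda>u. map (\<lambda>v. u * n + v) [0..<n]" n u n v] by simp
  assume "k \<in> set (grid toks)"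
  then obtain i where i: "i < n * n" "k = grid toks ! i" by (auto simp: in_set_conv_nth l)
  have "0 < n" using i(1) by (cases n) auto
  then have "i div n < n" "i mod n < n" using i(1) by (auto intro: less_mult_imp_div_less)
  moreover from this have "k = i div n * n + i mod n" using e[of "i div n" "i mod n"] i(2) by simp
  ultimately show "\<exists>u<n. \<exists>v<n. k = u * n + v" by blast
qed

lemma dist_scaled:
  assumes "u < n" "v < n"
  shows "real (dm (matrix_of toks (fst (dist_fracs toks))) u v) = scale * real_of_rat (d u v)"
    "8 * n dvd dm (matrix_of toks (fst (dist_fracs toks))) u v" "0 < scale"
proof -
  let ?qs = "map (\<lambda>k. (nthd 0 toks (2 + 2 * k), nthd 0 toks (3 + 2 * k))) (grid toks)"
  have dnn: "u < n \<Longrightarrow> v < n \<Longrightarrow> 0 \<le> d u v" for u v using valid by (auto simp: valid_instance_def)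
  have pos: "\<forall>q\<in>set ?qs. 0 < snd q" 
  proof
    fix q assume "q \<in> set ?qs"
    then obtain k where k: "k \<in> set (grid toks)" "snd q = nthd 0 toks (3 + 2 * k)" by auto
    then obtain a b where "a < n" "b < n" "k = a * n + b" using grid_toks(3) by blast
    then show "0 < snd q" using k(2) toks_dist(2)[of a b] rat_toks_value(1)[OF dnn[of a b]] by simp
  qed
  have i: "u * n + v < n * n" using mult_le_mono1[of "Suc u" n n] assms by simp
  have l: "u * n + v < length ?qs" using i by (simp add: grid_toks(1))
  have "?qs ! (u * n + v) = (nthd 0 toks (2 + 2 * (u * n + v)), nthd 0 toks (3 + 2 * (u * n + v)))"
    using l grid_toks(2)[OF assms] by (simp only: nth_map length_map)
  then have "?qs ! (u * n + v) = (nat (fst (quotient_of (d u v))), nat (snd (quotient_of (d u v))))"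
    unfolding toks_dist[OF assms] .
  then have "real (nthd 0 (fst (common_den ?qs)) (u * n + v)) = real_of_rat (d u v) * real (snd (common_den ?qs))"
    using rat_toks_value(2)[OF dnn[OF assms]] by (intro common_den_ratio[OF pos l]) (simp only: fst_conv snd_conv)
  then have e: "real (nthd 0 (fst (dist_fracs toks)) (u * n + v)) = real_of_rat (d u v) * real den"
    by (simp add: dist_fracs_def den_def)
  have m: "dm (matrix_of toks (fst (dist_fracs toks))) u v = 8 * n * nthd 0 (fst (dist_fracs toks)) (u * n + v)"
    using assms by (simp add: dm_def matrix_of_def verts_toks toks_0)
  show "real (dm (matrix_of toks (fst (dist_fracs toks))) u v) = scale * real_of_rat (d u v)"
    unfolding m scale_def using e by simp
  show "8 * n dvd dm (matrix_of toks (fst (dist_fracs toks))) u v" unfolding m by simp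
  have "0 < den" using common_den_value[OF pos] by (simp add: den_def dist_fracs_def)
  then show "0 < scale" using assms by (simp add: scale_def)
qed

lemma prob_scaled:
  assumes "v < n"
  shows "real (nthd 0 (fst (prob_fracs toks)) v) = real_of_rat (p v) * real (snd (prob_fracs toks))" "0 < snd (prob_fracs toks)"
proof -
  let ?qs = "map (\<lambda>v. (nthd 0 toks (3 + 2 * (n * n) + 2 * v), nthd 0 toks (4 + 2 * (n * n) + 2 * v))) [0..<n]"
  have e: "prob_fracs toks = common_den ?qs" by (simp add: prob_fracs_def toks_0 verts_toks)
  have pnn: "v < n \<Longrightarrow> 0 \<le> p v" for v using valid by (auto simp: valid_instance_def)
  have pos: "\<forall>q\<in>set ?qs. 0 < snd q" using rat_toks_value(1)[OF pnn] by (auto simp: toks_prob)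
  show "real (nthd 0 (fst (prob_fracs toks)) v) = real_of_rat (p v) * real (snd (prob_fracs toks))" unfolding e
    by (rule common_den_ratio[OF pos]) (use assms rat_toks_value(2)[OF pnn[OF assms]] in \<open>simp_all add: toks_prob\<close>)
  show "0 < snd (prob_fracs toks)" unfolding e using common_den_value[OF pos] by blast
qed

text \<open>The parsed instance is the given one with all distances multiplied by
  \<open>scale\<close> and unchanged probabilities, so both sides of the comparison scale alike. The
  optimum is attained because there are finitely many master tours.\<close>

lemma algorithm_correct:
  "\<exists>xs. solve (parse toks) = r # xs \<and> master_tour n r (r # xs) \<and>
     exp_latency n d p (r # xs) \<le> 30000000 * opt_latency n r d p"
proof -
  have rn: "r < n" using valid by (simp add: valid_instance_def)
  let ?ds = "matrix_of toks (fst (dist_fracs toks))" and ?ws = "fst (prob_fracs toks)" and ?Q = "snd (prob_fracs toks)"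
  let ?d = "\<lambda>u v. real_of_rat (d u v)" and ?p = "\<lambda>v. real_of_rat (p v)"
  have sc: "0 < scale" by (rule dist_scaled(3)[OF rn rn])
  interpret S: integral_instance n r ?ds ?ws ?Q
  proof
    show "r < n" by (rule rn)
    show "dm ?ds u v = dm ?ds v u" if "u < n" "v < n" for u v
    proof -
      have "d u v = d v u" using valid that by (auto simp: valid_instance_def)
      then have "real (dm ?ds u v) = real (dm ?ds v u)" using dist_scaled(1) that by simp
      then show ?thesis by simp
    qed
    show "dm ?ds u u = 0" if "u < n" for u
    proof -
      have "d u u = 0" using valid that by (auto simp: valid_instance_def)
      then show ?thesis using dist_scaled(1)[OF that that] by simp
    qed
    show "dm ?ds u w \<le> dm ?ds u v + dm ?ds v w" if "u < n" "v < n" "w < n" for u v w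
    proof -
      have "d u w \<le> d u v + d v w" using valid that unfolding valid_instance_def by blast
      then have "?d u w \<le> ?d u v + ?d v w" by (simp flip: of_rat_add add: of_rat_less_eq)
      then have "scale * ?d u w \<le> scale * (?d u v + ?d v w)" using sc by (intro mult_left_mono) auto
      then have "real (dm ?ds u w) \<le> real (dm ?ds u v + dm ?ds v w)" using dist_scaled(1) that by (simp add: distrib_left)
      then show ?thesis by (simp only: of_nat_le_iff)
    qed
    show "8 * n dvd dm ?ds u v" if "u < n" "v < n" for u v by (rule dist_scaled(2)[OF that])
    show "0 < ?Q" by (rule prob_scaled(2)[OF rn])
    show "nthd 0 ?ws v \<le> ?Q" if v: "v < n" for v
    proof -
      have "p v \<le> 1" using valid v by (auto simp: valid_instance_def)
      then have "?p v \<le> 1" by simp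
      then have "?p v * real ?Q \<le> 1 * real ?Q" by (rule mult_right_mono) simp
      then show ?thesis using prob_scaled(1)[OF v] by simp
    qed
  qed
  have I: "parse toks = S.I" unfolding parse_def S.I_def verts_toks toks_1 by (rule HOL.refl)
  have el: "elat n r S.d S.p xs = scale * elat n r ?d ?p xs" if "set xs \<subseteq> {..<n}" for xs
  proof (rule elat_scale[OF that rn])
    show "S.d i j = scale * ?d i j" if "i < n" "j < n" for i j using dist_scaled(1)[OF that] by (simp add: S.d_def)
    show "S.p i = ?p i" if "i < n" for i using prob_scaled[OF that] by (simp add: S.p_def)
  qed
  let ?M = "{\<tau>. master_tour n r \<tau>}"
  have "?M \<subseteq> {\<tau>. set \<tau> \<subseteq> {..<n} \<and> length \<tau> \<le> n}" 
  proof
    fix \<tau> assume "\<tau> \<in> ?M"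
    then have "set \<tau> = {..<n}" "distinct \<tau>" by (simp_all add: master_tour_def)
    moreover from this have "length \<tau> = n" using distinct_card[of \<tau>] by simp
    ultimately show "\<tau> \<in> {\<tau>. set \<tau> \<subseteq> {..<n} \<and> length \<tau> \<le> n}" by simp
  qed
  then have fin: "finite ?M" by (rule finite_subset) (rule finite_lists_length_le, simp)
  have tour: "master_tour n r (r # xs) \<longleftrightarrow> set xs = {..<n} - {r} \<and> distinct xs" for xs
    using rn by (auto simp: master_tour_def)
  have "master_tour n r (r # remove1 r [0..<n])" unfolding tour by (auto simp: set_remove1_eq)
  then have "?M \<noteq> {}" by blast
  then have "opt_latency n r d p \<in> exp_latency n d p ` ?M" unfolding opt_latency_def using fin by (intro Min_in) auto
  then obtain \<tau> where \<tau>: "master_tour n r \<tau>" "opt_latency n r d p = exp_latency n d p \<tau>" by blast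
  moreover obtain xo where "\<tau> = r # xo" using \<tau>(1) by (cases \<tau>) (auto simp: master_tour_def)
  ultimately have "master_tour n r (r # xo)" and opt: "opt_latency n r d p = exp_latency n d p (r # xo)" by simp_all
  then have xo: "set xo = {..<n} - {r}" "distinct xo" by (simp_all add: tour)
  obtain xs where xs: "solve S.I = r # xs" "set xs = {..<n} - {r}" "distinct xs"
      "elat n r S.d S.p xs \<le> 30000000 * elat n r S.d S.p xo"
    using S.solve_correct[OF xo] by blast
  have sub: "set xs \<subseteq> {..<n}" "set xo \<subseteq> {..<n}" using xs(2) xo(1) by auto
  have "scale * elat n r ?d ?p xs \<le> scale * (30000000 * elat n r ?d ?p xo)" using xs(4) el[OF sub(1)] el[OF sub(2)] by simp
  then have "elat n r ?d ?p xs \<le> 30000000 * elat n r ?d ?p xo" using sc by simp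
  then have "exp_latency n d p (r # xs) \<le> 30000000 * opt_latency n r d p"
    unfolding opt exp_latency_eq[OF sub(1)] exp_latency_eq[OF sub(2)] .
  then show ?thesis using xs by (intro exI[of _ xs]) (simp add: I tour)
qed

end

lemma set_nat_enc: "set (nat_enc m) \<subseteq> {1, 2}" by (auto simp: nat_enc_def)

lemma set_inst_enc: "\<forall>a\<in>set (inst_enc n r d p). 0 < a \<and> a < 6"
proof -
  have n: "a \<in> set (nat_enc m) \<Longrightarrow> 0 < a \<and> a < 6" for a m using set_nat_enc[of m] by auto
  have q: "a \<in> set (rat_enc q) \<Longrightarrow> 0 < a \<and> a < 6" for a q using n by (auto simp: rat_enc_def split: prod.splits)
  show ?thesis using n q by (auto simp: inst_enc_def)
qed

lemma set_tour_enc: "set (tour_enc xs) \<subseteq> {1, 2, 3}"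
proof (induction xs)
  case (Cons x xs)
  then show ?case using set_nat_enc[of x] by (auto simp: tour_enc_def)
qed (simp add: tour_enc_def)

lemma print_tour_eq: "print_tour xs = map uns (tour_enc xs)"
  by (induction xs) (auto simp: print_tour_def tour_enc_def nat_enc_def)

theorem theorem1:
  shows "\<exists>(\<alpha>::real) (M::tm) (c::nat) (k::nat). wf_tm M \<and>
     (\<forall>n r d p. valid_instance n r d p \<longrightarrow>
        (\<exists>\<tau>. master_tour n r \<tau> \<and>
              computes_within M (inst_enc n r d p) (c * (length (inst_enc n r d p) + 2) ^ k) (tour_enc \<tau>) \<and>
              exp_latency n d p \<tau> \<le> \<alpha> * opt_latency n r d p))"
proof -
  obtain M c k where M: "wf_tm M" "\<And>w ys. (\<forall>a\<in>set w. 0 < a \<and> a < 6) \<Longrightarrow> algorithm (map uns w) = map uns ys \<Longrightarrow> set ys \<subseteq> {1, 2, 3} \<Longrightarrow>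
     computes_within M w (c * (length w + 2) ^ k) ys"
    using PT_computes_within[OF PT_algorithm] by blast
  have "\<exists>\<tau>. master_tour n r \<tau> \<and> computes_within M (inst_enc n r d p) (c * (length (inst_enc n r d p) + 2) ^ k) (tour_enc \<tau>) \<and>
      exp_latency n d p \<tau> \<le> 30000000 * opt_latency n r d p" if valid: "valid_instance n r d p" for n r d p
  proof -
    obtain xs where xs: "solve (parse (tokens (map uns (inst_enc n r d p)))) = r # xs" "master_tour n r (r # xs)"
      "exp_latency n d p (r # xs) \<le> 30000000 * opt_latency n r d p"
      using algorithm_correct[OF valid] unfolding toks_def[OF valid] by blast
    have "algorithm (map uns (inst_enc n r d p)) = map uns (tour_enc (r # xs))"
      by (simp only: algorithm_def xs(1) print_tour_eq)
    from M(2)[OF set_inst_enc this set_tour_enc] show ?thesis using xs by blast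
  qed
  then show ?thesis using M(1) by blast
qed

end
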